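(* Let $\Omega\subset\mathbf{R}^N$ be a bounded smooth domain, let $1<\gamma<N$ and $\gamma^*=N\gamma/(N-\gamma)$. Let $f:\Omega\times\mathbf{R}\to\mathbf{R}$ be a Carath\'eodory function, $F(x,t)=\int_0^t f(x,s)\,ds$ and $A_\infty(x)=\limsup_{|s|\to\infty}\frac{F(x,s)}{|s|^\gamma}$. Suppose: (i) there are a constant $a\ge0$ and a nonnegative $b\in L^1(\Omega)$ such that $|f(x,s)|\le a|s|^{\gamma^*}+b(x)$ for all $s\in\mathbf{R}$ and a.e. $x\in\Omega$; (ii) there are a constant $A\ge0$ and a nonnegative $B\in L^1(\Omega)$ such that $F(x,s)\le A|s|^\gamma+B(x)$ for all $s\in\mathbf{R}$ and a.e. $x\in\Omega$; (iii) $$\inf_{v\in W_0^{1,\gamma}(\Omega),\ |v|_{L^\gamma}=1}\left\{\int_\Omega\left(\sqrt{1+|\nabla v|^2}-1\right)^\gamma dx-\int_{\{v\ne0\}}A_\infty(x)|v(x)|^\gamma\,dx\right\}>0.$$ Then for each $h\in L^{\frac{\gamma}{\gamma-1}}(\Omega)$ the problem $$-\mathrm{div}\left(\gamma\frac{(\sqrt{1+|\nabla u|^2}-1)^{\gamma-1}}{\sqrt{1+|\nabla u|^2}}\nabla u\right)=f(x,u)+h\ \text{ in }\Omega,\qquad u=0\ \text{ on }\partial\Omega,$$ admits a solution $u\in W_0^{1,\gamma}(\Omega)$ in the sense of distributions.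
   Context: $|v|_{L^\gamma}$ is the norm of $L^\gamma(\Omega)$. By (ii), $A_\infty\le A$ a.e., so the integral of $A_\infty|v|^\gamma$ is well defined in $[-\infty,\infty)$. A solution in the sense of distributions is a $u\in W_0^{1,\gamma}(\Omega)$ such that $\int_\Omega\gamma\frac{(\sqrt{1+|\nabla u|^2}-1)^{\gamma-1}}{\sqrt{1+|\nabla u|^2}}\nabla u\cdot\nabla v\,dx=\int_\Omega f(x,u)v\,dx+\int_\Omega hv\,dx$ for all $v\in C_0^\infty(\Omega)$. *)

theory Defs
  imports "HOL-Analysis.Analysis"
begin

section \<open>Smooth functions, smooth domains, test functions\<close>

primrec times_cont_diff :: "nat \<Rightarrow> ('a::euclidean_space \<Rightarrow> real) \<Rightarrow> bool" where
  "times_cont_diff 0 f \<longleftrightarrow> continuous_on UNIV f"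
| "times_cont_diff (Suc k) f \<longleftrightarrow>
     (\<forall>x. f differentiable (at x)) \<and>
     (\<forall>e. times_cont_diff k (\<lambda>x. frechet_derivative f (at x) e))"

definition smooth :: "('a::euclidean_space \<Rightarrow> real) \<Rightarrow> bool" where
  "smooth f \<longleftrightarrow> (\<forall>k. times_cont_diff k f)"

text \<open>The boundary is smooth if near each of its points, in suitable orthonormal coordinates
  with last coordinate direction \<open>e\<close>, the set is the strict epigraph of a smooth function of the
  remaining coordinates. A function of these is applied to \<open>y - (y \<bullet> e) *\<^sub>R e\<close>, the orthogonal
  projection of \<open>y\<close> to the hyperplane orthogonal to \<open>e\<close>.\<close>

definition smooth_boundary :: "'a::euclidean_space set \<Rightarrow> bool" where
  "smooth_boundary \<Omega> \<longleftrightarrow>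
     (\<forall>x\<in>frontier \<Omega>. \<exists>r>0. \<exists>e g. norm e = 1 \<and> smooth g \<and>
        \<Omega> \<inter> ball x r = {y \<in> ball x r. g (y - (y \<bullet> e) *\<^sub>R e) < y \<bullet> e})"

definition bounded_smooth_domain :: "'a::euclidean_space set \<Rightarrow> bool" where
  "bounded_smooth_domain \<Omega> \<longleftrightarrow>
     open \<Omega> \<and> connected \<Omega> \<and> \<Omega> \<noteq> {} \<and> bounded \<Omega> \<and> smooth_boundary \<Omega>"

text \<open>\<open>C\<^sub>0\<^sup>\<infinity>(\<Omega>)\<close>; its elements are extended by zero to the whole space.\<close>

definition test_functions :: "'a::euclidean_space set \<Rightarrow> ('a \<Rightarrow> real) set" where
  "test_functions \<Omega> =
     {\<phi>. smooth \<phi> \<and> compact (closure {x. \<phi> x \<noteq> 0}) \<and> closure {x. \<phi> x \<noteq> 0} \<subseteq> \<Omega>}"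

definition grad :: "('a::euclidean_space \<Rightarrow> real) \<Rightarrow> 'a \<Rightarrow> 'a" where
  "grad \<phi> x = (THE D. GDERIV \<phi> x :> D)"


section \<open>Lebesgue and Sobolev spaces\<close>

text \<open>Elements of \<open>L\<^sup>p(\<Omega>)\<close> and of the Sobolev spaces are represented by functions on the whole
  space, of which only the values on \<open>\<Omega>\<close>, up to null sets, are relevant.\<close>

definition Lp :: "'a::euclidean_space set \<Rightarrow> real \<Rightarrow> ('a \<Rightarrow> 'b::euclidean_space) set" where
  "Lp \<Omega> p = {u. u \<in> borel_measurable (lebesgue_on \<Omega>) \<and>
                 integrable (lebesgue_on \<Omega>) (\<lambda>x. norm (u x) powr p)}"

definition Lp_norm :: "'a::euclidean_space set \<Rightarrow> real \<Rightarrow> ('a \<Rightarrow> 'b::euclidean_space) \<Rightarrow> real" where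
  "Lp_norm \<Omega> p u = (\<integral>x. norm (u x) powr p \<partial>lebesgue_on \<Omega>) powr (1 / p)"

definition locally_integrable ::
    "'a::euclidean_space set \<Rightarrow> ('a \<Rightarrow> 'b::euclidean_space) \<Rightarrow> bool" where
  "locally_integrable \<Omega> u \<longleftrightarrow> (\<forall>K. compact K \<and> K \<subseteq> \<Omega> \<longrightarrow> integrable (lebesgue_on K) u)"

definition is_weak_grad :: "'a::euclidean_space set \<Rightarrow> ('a \<Rightarrow> real) \<Rightarrow> ('a \<Rightarrow> 'a) \<Rightarrow> bool" where
  "is_weak_grad \<Omega> u G \<longleftrightarrow> locally_integrable \<Omega> u \<and> locally_integrable \<Omega> G \<and>
     (\<forall>\<phi>\<in>test_functions \<Omega>.
        (\<integral>x. u x *\<^sub>R grad \<phi> x \<partial>lebesgue_on \<Omega>) = - (\<integral>x. \<phi> x *\<^sub>R G x \<partial>lebesgue_on \<Omega>))"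

text \<open>Weak gradients are unique almost everywhere in \<open>\<Omega>\<close>; a representative is chosen.\<close>

definition weak_grad :: "'a::euclidean_space set \<Rightarrow> ('a \<Rightarrow> real) \<Rightarrow> 'a \<Rightarrow> 'a" where
  "weak_grad \<Omega> u = (SOME G. is_weak_grad \<Omega> u G)"

definition W1p :: "'a::euclidean_space set \<Rightarrow> real \<Rightarrow> ('a \<Rightarrow> real) set" where
  "W1p \<Omega> p = {u \<in> Lp \<Omega> p. \<exists>G\<in>Lp \<Omega> p. is_weak_grad \<Omega> u G}"

definition W1p_norm :: "'a::euclidean_space set \<Rightarrow> real \<Rightarrow> ('a \<Rightarrow> real) \<Rightarrow> real" where
  "W1p_norm \<Omega> p u = (Lp_norm \<Omega> p u powr p + Lp_norm \<Omega> p (weak_grad \<Omega> u) powr p) powr (1 / p)"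

definition W01p :: "'a::euclidean_space set \<Rightarrow> real \<Rightarrow> ('a \<Rightarrow> real) set" where
  "W01p \<Omega> p =
     {u \<in> W1p \<Omega> p. \<forall>\<epsilon>>0. \<exists>\<phi>\<in>test_functions \<Omega>. W1p_norm \<Omega> p (\<lambda>x. u x - \<phi> x) < \<epsilon>}"


section \<open>The nonlinearity\<close>

definition caratheodory :: "'a::euclidean_space set \<Rightarrow> ('a \<Rightarrow> real \<Rightarrow> real) \<Rightarrow> bool" where
  "caratheodory \<Omega> f \<longleftrightarrow>
     (\<forall>s. (\<lambda>x. f x s) \<in> borel_measurable (lebesgue_on \<Omega>)) \<and>
     (AE x in lebesgue_on \<Omega>. continuous_on UNIV (f x))"

text \<open>The interval integral is oriented, as needed for \<open>t < 0\<close>.\<close>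

definition primitive :: "('a \<Rightarrow> real \<Rightarrow> real) \<Rightarrow> 'a \<Rightarrow> real \<Rightarrow> real" where
  "primitive f x t = (LBINT s=0..t. f x s)"

definition A_infinity :: "('a \<Rightarrow> real \<Rightarrow> real) \<Rightarrow> real \<Rightarrow> 'a \<Rightarrow> ereal" where
  "A_infinity f \<gamma> x = Limsup at_infinity (\<lambda>s::real. ereal (primitive f x s / \<bar>s\<bar> powr \<gamma>))"

text \<open>Integral of an extended real-valued function as the difference of the integrals of its
  positive and negative parts (\<open>e2ennreal\<close> maps negative numbers to \<open>0\<close>); meaningful when at least
  one of these is finite.\<close>

definition ereal_integral :: "'a measure \<Rightarrow> ('a \<Rightarrow> ereal) \<Rightarrow> ereal" where
  "ereal_integral M g =
     enn2ereal (\<integral>\<^sup>+x. e2ennreal (g x) \<partial>M) - enn2ereal (\<integral>\<^sup>+x. e2ennreal (- g x) \<partial>M)"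

definition asymptotic_functional ::
    "'a::euclidean_space set \<Rightarrow> real \<Rightarrow> ('a \<Rightarrow> real \<Rightarrow> real) \<Rightarrow> ('a \<Rightarrow> real) \<Rightarrow> ereal" where
  "asymptotic_functional \<Omega> \<gamma> f v =
     ereal (\<integral>x. (sqrt (1 + (norm (weak_grad \<Omega> v x))\<^sup>2) - 1) powr \<gamma> \<partial>lebesgue_on \<Omega>)
     - ereal_integral (lebesgue_on {x \<in> \<Omega>. v x \<noteq> 0})
         (\<lambda>x. A_infinity f \<gamma> x * ereal (\<bar>v x\<bar> powr \<gamma>))"

text \<open>Integrability of \<open>f(\<cdot>,u) v\<close> is part of the notion, since the Bochner integral of a
  non-integrable function is \<open>0\<close> by convention. The other two integrands are integrable
  by Hoelder's inequality when \<open>u\<close> is in \<open>W\<^sup>1\<^sup>,\<^sup>\<gamma>(\<Omega>)\<close> and \<open>h\<close> in the dual Lebesgue space.\<close>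

definition distributional_solution ::
    "'a::euclidean_space set \<Rightarrow> real \<Rightarrow> ('a \<Rightarrow> real \<Rightarrow> real) \<Rightarrow> ('a \<Rightarrow> real) \<Rightarrow> ('a \<Rightarrow> real) \<Rightarrow> bool" where
  "distributional_solution \<Omega> \<gamma> f h u \<longleftrightarrow> u \<in> W01p \<Omega> \<gamma> \<and>
     (\<forall>v\<in>test_functions \<Omega>.
        integrable (lebesgue_on \<Omega>) (\<lambda>x. f x (u x) * v x) \<and>
        (\<integral>x. \<gamma> * ((sqrt (1 + (norm (weak_grad \<Omega> u x))\<^sup>2) - 1) powr (\<gamma> - 1)
                    / sqrt (1 + (norm (weak_grad \<Omega> u x))\<^sup>2))
                * (weak_grad \<Omega> u x \<bullet> grad v x) \<partial>lebesgue_on \<Omega>)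
        = (\<integral>x. f x (u x) * v x \<partial>lebesgue_on \<Omega>) + (\<integral>x. h x * v x \<partial>lebesgue_on \<Omega>))"

end

theory Submission
  imports Defs "HOL-Computational_Algebra.Polynomial" "HOL-Library.Diagonal_Subsequence"
begin

text \<open>
  The equation is the Euler equation of \<open>J(u) = \<integral>\<Phi>(\<nabla> u) - \<integral> F(x, u) - \<integral> h u\<close>, where
  \<open>\<Phi>(\<xi>) = (\<surd>(1 + |\<xi>|\<^sup>2) - 1)\<^sup>\<gamma>\<close> is convex, and the solution is a minimiser of \<open>J\<close>. In the
  formal text \<open>\<gamma>\<close> is called \<open>p\<close> and its critical exponent \<open>q\<close>. Hypothesis (i) controls \<open>F\<close>
  only by \<open>|u|\<close> to the power \<open>q + 1\<close>, which need not be integrable, so \<open>\<integral> F(x, u)\<close> may be \<open>-\<infinity>\<close>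
  and \<open>J\<close> may be \<open>+\<infinity>\<close>. The functional is therefore minimised over the set of admissible \<open>u\<close>,
  those with integrable \<open>F(x, u)\<close>; it contains \<open>0\<close>.

  Compactness. A sequence that is bounded in the Sobolev space has a subsequence that converges
  almost everywhere with a majorant in \<open>L\<^sup>p\<close> (\<open>Rellich_W01p\<close> and \<open>Lp_complete_dominated\<close>), and
  \<open>\<integral>\<Phi>(\<nabla> u)\<close> is lower semicontinuous along it (\<open>W01p_lower_semicontinuous\<close>); the two are
  combined in \<open>W01p_compactness\<close>. Lower semicontinuity does not go through reflexivity: among
  the functions \<open>v\<close> that are close to the limit in \<open>L\<^sup>p\<close> and whose \<open>\<integral>\<Phi>(\<nabla> v)\<close> hardly exceeds
  the limit of the values along the sequence, those that nearly minimise \<open>\<integral>|\<nabla> v|\<^sup>p\<close> have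
  gradients that form a Cauchy sequence, by the uniform convexity of \<open>|\<xi>|\<^sup>p\<close>, exactly as in
  the construction of nearest points in closed convex sets.

  Coercivity (\<open>coercive\<close>). Let \<open>J(u\<^sub>n)\<close> be bounded above, let the norms \<open>t\<^sub>n\<close> of \<open>u\<^sub>n\<close> in \<open>L\<^sup>p\<close>
  tend to infinity, and put \<open>v\<^sub>n = u\<^sub>n / t\<^sub>n\<close>. Since \<open>\<Phi>(t \<xi>) \<ge> t\<^sup>p \<Phi>(\<xi>)\<close> for \<open>t \<ge> 1\<close>, dividing
  by \<open>t\<^sub>n\<^sup>p\<close> gives \<open>\<integral>\<Phi>(\<nabla> v\<^sub>n) \<le> \<integral> F(x, t\<^sub>n v\<^sub>n) / t\<^sub>n\<^sup>p + o(1)\<close>. The right side is bounded by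
  (ii), so the compactness theorem yields a limit \<open>v\<close> of norm 1. By (ii) the integrands on the
  right have a common integrable majorant, and Fatou's lemma for the upper limit
  (\<open>Fatou_upper\<close>) gives \<open>\<integral>\<Phi>(\<nabla> v) \<le> \<integral> A\<^sub>\<infinity> |v|\<^sup>p\<close> over the set where \<open>v\<close> is not zero, which
  contradicts (iii).

  Existence (\<open>minimiser_exists\<close>). A minimising sequence is thus bounded in \<open>L\<^sup>p\<close>, and (ii) then
  bounds its gradients. In the limit, \<open>\<integral>\<Phi>(\<nabla> u)\<close> is lower semicontinuous, the term with \<open>h\<close>
  converges, and \<open>\<integral> F(x, u)\<close> is upper semicontinuous, again by (ii) and Fatou's lemma; the
  same lemma shows that the limit is admissible.

  Euler equation (\<open>J_directional_derivative\<close>, \<open>Euler_equation\<close>). For a test function \<open>v\<close> with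
  \<open>|v| \<le> C\<close>, hypothesis (i) and the mean value theorem bound \<open>F(x, u + t v) - F(x, u)\<close> by
  \<open>|t| C (a (|u| + C)\<^sup>q + b(x))\<close>. This is integrable since \<open>u\<close> lies in \<open>L\<^sup>q\<close> by the Sobolev
  inequality (\<open>Sobolev_integrable\<close>). Hence \<open>u + t v\<close> is admissible together with \<open>u\<close>, and \<open>J\<close>
  can be differentiated at \<open>t = 0\<close> under the integral sign.

  The underlying facts on Sobolev spaces are the uniqueness of weak gradients, the inequalities
  of Gagliardo, Nirenberg and Sobolev for test functions, obtained by induction on the
  coordinates, and Rellich's theorem, obtained by averaging over the cells of fine grids.
\<close>

section \<open>Lebesgue spaces through integrals of powers\<close>

text \<open>The \<open>p\<close>-th power of the norm of \<open>L\<^sup>p\<close>. Without the root, limit theorems for integrals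
  apply to it directly; it is bounded, or tends to \<open>0\<close>, together with the norm.\<close>

definition energy :: "'a measure \<Rightarrow> real \<Rightarrow> ('a \<Rightarrow> 'b::euclidean_space) \<Rightarrow> real" where
  "energy M p u = (\<integral>x. norm (u x) powr p \<partial>M)"

definition p_integrable :: "'a measure \<Rightarrow> real \<Rightarrow> ('a \<Rightarrow> 'b::euclidean_space) \<Rightarrow> bool" where
  "p_integrable M p u \<longleftrightarrow> u \<in> borel_measurable M \<and> integrable M (\<lambda>x. norm (u x) powr p)"

lemma Lp_iff_p_integrable: "u \<in> Lp \<Omega> p \<longleftrightarrow> p_integrable (lebesgue_on \<Omega>) p u"
  by (simp add: Lp_def p_integrable_def)

text \<open>Without the \<open>p\<close>-th root there is no triangle inequality, but \<open>a + b \<le> 2 max(a, b)\<close> gives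
  one up to the factor \<open>2\<^sup>p\<close>, which replaces Minkowski's inequality throughout.\<close>

lemma powr_add_le:
  fixes a b p :: real
  assumes "0 \<le> a" "0 \<le> b" "0 \<le> p"
  shows "(a + b) powr p \<le> 2 powr p * (a powr p + b powr p)"
proof -
  have "(a + b) powr p \<le> (2 * max a b) powr p"
    using assms by (intro powr_mono2) auto
  also have "\<dots> = 2 powr p * max a b powr p"
    using assms by (simp add: powr_mult)
  also have "\<dots> \<le> 2 powr p * (a powr p + b powr p)"
    by (intro mult_left_mono) (auto simp: max_def)
  finally show ?thesis .
qed

lemma norm_add_powr_le:
  fixes a b :: "'a::real_normed_vector"
  assumes "0 \<le> p"
  shows "norm (a + b) powr p \<le> 2 powr p * (norm a powr p + norm b powr p)"
  using powr_add_le[of "norm a" "norm b" p] assms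
    powr_mono2[of p "norm (a+b)" "norm a + norm b"] norm_triangle_ineq[of a b] by fastforce

lemma norm_diff_powr_le:
  fixes a b :: "'a::real_normed_vector"
  assumes "0 \<le> p"
  shows "norm (a - b) powr p \<le> 2 powr p * (norm a powr p + norm b powr p)"
  using norm_add_powr_le[OF assms, of a "-b"] by simp

lemma p_integrable_dominated:
  assumes "p_integrable M p g" "u \<in> borel_measurable M" "0 \<le> p"
    and "AE x in M. norm (u x) \<le> norm (g x)"
  shows "p_integrable M p u"
proof -
  have "integrable M (\<lambda>x. norm (u x) powr p)"
  proof (rule Bochner_Integration.integrable_bound)
    show "integrable M (\<lambda>x. norm (g x) powr p)"
      using assms(1) by (simp add: p_integrable_def)
    show "(\<lambda>x. norm (u x) powr p) \<in> borel_measurable M"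
      using assms(2) by measurable
    show "AE x in M. norm (norm (u x) powr p) \<le> norm (norm (g x) powr p)"
      using assms(4) by eventually_elim (use \<open>0 \<le> p\<close> in \<open>auto intro!: powr_mono2\<close>)
  qed
  with assms show ?thesis by (simp add: p_integrable_def)
qed

lemma p_integrable_add:
  assumes "p_integrable M p u" "p_integrable M p v" "0 \<le> p"
  shows "p_integrable M p (\<lambda>x. u x + v x)"
proof -
  have [measurable]: "u \<in> borel_measurable M" "v \<in> borel_measurable M"
    using assms by (auto simp: p_integrable_def)
  have "integrable M (\<lambda>x. norm (u x + v x) powr p)"
  proof (rule Bochner_Integration.integrable_bound)
    show "integrable M (\<lambda>x. 2 powr p * (norm (u x) powr p + norm (v x) powr p))"
      using assms by (simp add: p_integrable_def)
    show "(\<lambda>x. norm (u x + v x) powr p) \<in> borel_measurable M" by measurable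
    show "AE x in M. norm (norm (u x + v x) powr p) \<le> norm (2 powr p * (norm (u x) powr p + norm (v x) powr p))"
      using norm_add_powr_le[OF \<open>0 \<le> p\<close>] by (intro AE_I2) fastforce
  qed
  then show ?thesis by (simp add: p_integrable_def)
qed

lemma p_integrable_scaleR:
  assumes "p_integrable M p u"
  shows "p_integrable M p (\<lambda>x. c *\<^sub>R u x)"
  using assms by (auto simp: p_integrable_def powr_mult)

lemma p_integrable_diff:
  assumes "p_integrable M p u" "p_integrable M p v" "0 \<le> p"
  shows "p_integrable M p (\<lambda>x. u x - v x)"
  using p_integrable_add[OF assms(1) p_integrable_scaleR[OF assms(2), of "-1"] assms(3)] by simp

lemma energy_nonneg: "0 \<le> energy M p u"
  by (simp add: energy_def)

lemma energy_scaleR: "energy M p (\<lambda>x. c *\<^sub>R u x) = \<bar>c\<bar> powr p * energy M p u"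
  by (simp add: energy_def powr_mult)

lemma energy_minus_commute: "energy M p (\<lambda>x. u x - v x) = energy M p (\<lambda>x. v x - u x)"
  by (simp add: energy_def norm_minus_commute)

lemma energy_add_le:
  assumes "p_integrable M p u" "p_integrable M p v" "0 \<le> p"
  shows "energy M p (\<lambda>x. u x + v x) \<le> 2 powr p * (energy M p u + energy M p v)"
proof -
  have "energy M p (\<lambda>x. u x + v x) \<le> (\<integral>x. 2 powr p * (norm (u x) powr p + norm (v x) powr p) \<partial>M)"
    unfolding energy_def
    using assms p_integrable_add[OF assms] norm_add_powr_le[OF \<open>0 \<le> p\<close>]
    by (intro integral_mono) (auto simp: p_integrable_def)
  also have "\<dots> = 2 powr p * (energy M p u + energy M p v)"
    using assms by (simp add: energy_def p_integrable_def)
  finally show ?thesis .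
qed

lemma energy_diff_le:
  assumes "p_integrable M p u" "p_integrable M p v" "0 \<le> p"
  shows "energy M p (\<lambda>x. u x - v x) \<le> 2 powr p * (energy M p u + energy M p v)"
  using energy_add_le[OF assms(1) p_integrable_scaleR[OF assms(2), of "-1"] assms(3)]
  by (simp add: energy_scaleR[of M p "-1", simplified])

lemma energy_triangle:
  assumes "p_integrable M p u" "p_integrable M p v" "p_integrable M p w" "0 \<le> p"
  shows "energy M p (\<lambda>x. u x - w x)
    \<le> 2 powr p * (energy M p (\<lambda>x. u x - v x) + energy M p (\<lambda>x. v x - w x))"
  using energy_add_le[OF p_integrable_diff[OF assms(1,2,4)] p_integrable_diff[OF assms(2,3,4)] assms(4)]
  by simp

lemma energy_cong_AE:
  assumes "u \<in> borel_measurable M" "v \<in> borel_measurable M" "AE x in M. u x = v x"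
  shows "energy M p u = energy M p v"
  unfolding energy_def
proof (rule integral_cong_AE)
  show "AE x in M. norm (u x) powr p = norm (v x) powr p"
    using assms(3) by eventually_elim simp
qed (use assms(1,2) in measurable)

lemma energy_linear_combination_le:
  assumes "p_integrable M p u" "p_integrable M p v" "0 \<le> p"
  shows "energy M p (\<lambda>x. c *\<^sub>R u x + d *\<^sub>R v x) \<le> 2 powr p * (\<bar>c\<bar> powr p * energy M p u + \<bar>d\<bar> powr p * energy M p v)"
  using energy_add_le[OF p_integrable_scaleR[OF assms(1), of c] p_integrable_scaleR[OF assms(2), of d] assms(3)]
  by (simp only: energy_scaleR)

lemma energy_eq_0_AE:
  assumes "p_integrable M p u" "energy M p u = 0"
  shows "AE x in M. u x = 0"
proof -
  have "AE x in M. norm (u x) powr p = 0"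
    using assms by (subst (asm) energy_def, subst (asm) integral_nonneg_eq_0_iff_AE) (auto simp: p_integrable_def)
  then show ?thesis by eventually_elim simp
qed

lemma energy_tendsto_dominated:
  fixes u :: "nat \<Rightarrow> 'a \<Rightarrow> 'b::euclidean_space" and g :: "'a \<Rightarrow> real"
  assumes "\<And>n. u n \<in> borel_measurable M" "p_integrable M p g" "0 < p"
    and "AE x in M. (\<lambda>n. u n x) \<longlonglongrightarrow> U x" "U \<in> borel_measurable M"
    and "\<And>n. AE x in M. norm (u n x) \<le> g x"
  shows "(\<lambda>n. energy M p (u n)) \<longlonglongrightarrow> energy M p U"
  unfolding energy_def
proof (rule integral_dominated_convergence)
  show "integrable M (\<lambda>x. norm (g x) powr p)"
    using assms by (simp add: p_integrable_def)
  show "AE x in M. (\<lambda>n. norm (u n x) powr p) \<longlonglongrightarrow> norm (U x) powr p"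
    using assms(4)
  proof eventually_elim
    case (elim x)
    show ?case by (rule tendsto_powr'[OF tendsto_norm[OF elim] tendsto_const]) (use \<open>0 < p\<close> in auto)
  qed
  show "AE x in M. norm (norm (u n x) powr p) \<le> norm (g x) powr p" for n
    using assms(6)[of n] by eventually_elim (use \<open>0 < p\<close> in \<open>auto intro!: powr_mono2\<close>)
qed (use assms(1,5) in measurable)

text \<open>Completeness of \<open>L\<^sup>p\<close>, in the form in which it is used: a subsequence also converges
  almost everywhere and has a majorant \<open>g\<close> in \<open>L\<^sup>p\<close>. Choose the subsequence so that the
  differences \<open>d\<^sub>n\<close> of its consecutive terms satisfy \<open>\<integral> d\<^sub>n\<^sup>p < 2\<^sup>-\<^sup>n\<^sup>p 2\<^sup>-\<^sup>n\<close>. Then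
  \<open>S = \<Sum> 2\<^sup>n\<^sup>p d\<^sub>n\<^sup>p\<close> is integrable, and \<open>d\<^sub>n \<le> 2\<^sup>-\<^sup>n S\<^sup>1\<^sup>/\<^sup>p\<close> wherever \<open>S\<close> is finite. Hence the
  telescoping series converges there, and its partial sums are at most \<open>|u\<^sub>r\<^sub>0| + 2 S\<^sup>1\<^sup>/\<^sup>p\<close>.\<close>

lemma Lp_complete_dominated:
  fixes u :: "nat \<Rightarrow> 'a \<Rightarrow> 'b::euclidean_space"
  assumes p: "0 < p" and u: "\<And>n. p_integrable M p (u n)"
    and Cauchy: "\<And>e. 0 < e \<Longrightarrow> \<exists>N. \<forall>m\<ge>N. \<forall>n\<ge>N. energy M p (\<lambda>x. u m x - u n x) < e"
  obtains r U g where "strict_mono (r :: nat \<Rightarrow> nat)" "p_integrable M p U"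
    "p_integrable M p (g :: 'a \<Rightarrow> real)"
    "AE x in M. (\<lambda>n. u (r n) x) \<longlonglongrightarrow> U x"
    "AE x in M. \<forall>n. norm (u (r n) x) \<le> g x"
    "(\<lambda>n. energy M p (\<lambda>x. u n x - U x)) \<longlonglongrightarrow> 0"
proof -
  have [measurable]: "u n \<in> borel_measurable M" for n
    using u by (simp add: p_integrable_def)
  \<comment> \<open>The energy of the \<open>n\<close>-th difference is kept below \<open>1 / c n\<close>: one factor makes the weighted
    series \<open>S\<close> converge, the other is the weight.\<close>
  define c where "c n = (2 powr (real n * p) * 2 ^ n :: real)" for n
  have c: "0 < c n" for n by (simp add: c_def)
  have "\<exists>N. \<forall>m\<ge>N. \<forall>n\<ge>N. energy M p (\<lambda>x. u m x - u n x) < 1 / c k" for k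
    using Cauchy[of "1 / c k"] c by simp
  then obtain N where N: "\<And>k m n. N k \<le> m \<Longrightarrow> N k \<le> n \<Longrightarrow> energy M p (\<lambda>x. u m x - u n x) < 1 / c k"
    by metis
  define r where "r = rec_nat (N 0) (\<lambda>n rn. max (Suc rn) (N (Suc n)))"
  have r_Suc: "r (Suc n) = max (Suc (r n)) (N (Suc n))" for n by (simp add: r_def)
  have r: "strict_mono r" by (simp add: strict_mono_Suc_iff r_Suc less_max_iff_disj)
  have rN: "N n \<le> r n" for n by (cases n) (auto simp: r_Suc, simp add: r_def)
  define d where "d n x = norm (u (r (Suc n)) x - u (r n) x)" for n x
  have [measurable]: "d n \<in> borel_measurable M" for n unfolding d_def by measurable
  have d_int: "integrable M (\<lambda>x. d n x powr p)" for n
    using p_integrable_diff[OF u[of "r (Suc n)"] u[of "r n"]] p by (simp add: p_integrable_def d_def)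
  have d_en: "(\<integral>x. d n x powr p \<partial>M) < 1 / c n" for n
  proof -
    have "N n \<le> r (Suc n)" using rN[of n] r[unfolded strict_mono_Suc_iff] by (meson le_trans less_imp_le)
    from N[OF this rN[of n]] show ?thesis by (simp add: energy_def d_def)
  qed
  define s where "s n x = 2 powr (real n * p) * d n x powr p" for n x
  have s_nonneg: "0 \<le> s n x" for n x by (simp add: s_def)
  have [measurable]: "s n \<in> borel_measurable M" for n unfolding s_def by measurable
  have s_int: "integrable M (s n)" for n unfolding s_def using d_int by simp
  have s_le: "(\<integral>x. s n x \<partial>M) \<le> (1/2) ^ n" for n
  proof -
    have "(\<integral>x. s n x \<partial>M) = 2 powr (real n * p) * (\<integral>x. d n x powr p \<partial>M)" by (simp add: s_def)
    also have "\<dots> \<le> 2 powr (real n * p) * (1 / c n)"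
      using d_en[of n] by (intro mult_left_mono) auto
    also have "\<dots> = (1/2) ^ n" by (simp add: c_def power_one_over)
    finally show ?thesis .
  qed
  have nn: "(\<integral>\<^sup>+x. (\<Sum>n. ennreal (s n x)) \<partial>M) \<le> 2"
  proof -
    have "(\<integral>\<^sup>+x. (\<Sum>n. ennreal (s n x)) \<partial>M) = (\<Sum>n. \<integral>\<^sup>+x. ennreal (s n x) \<partial>M)"
      by (rule nn_integral_suminf) measurable
    also have "\<dots> = (\<Sum>n. ennreal (\<integral>x. s n x \<partial>M))"
      using s_int s_nonneg by (simp add: nn_integral_eq_integral)
    also have "\<dots> \<le> (\<Sum>n. ennreal ((1/2) ^ n))"
      using s_le by (intro suminf_le) (auto intro: ennreal_leI)
    also have "\<dots> = ennreal (\<Sum>n. (1/2) ^ n)"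
      by (rule suminf_ennreal2) (auto intro: summable_geometric)
    also have "(\<Sum>n. (1/2) ^ n) = (2::real)" by (simp add: suminf_geometric)
    finally show ?thesis by simp
  qed
  then have fin: "(\<integral>\<^sup>+x. (\<Sum>n. ennreal (s n x)) \<partial>M) < \<infinity>"
    using ennreal_numeral_less_top order.strict_trans1 by (metis infinity_ennreal_def)
  have "AE x in M. (\<Sum>n. ennreal (s n x)) \<noteq> \<infinity>"
    by (rule nn_integral_noteq_infinite) (use fin in auto)
  then have AE_sum: "AE x in M. summable (\<lambda>n. s n x)"
    by eventually_elim (use s_nonneg in \<open>auto intro!: summable_suminf_not_top\<close>)
  define S where "S x = (\<Sum>n. s n x)" for x
  have [measurable]: "S \<in> borel_measurable M" unfolding S_def by measurable
  have S_int: "integrable M S"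
  proof (rule integrableI_bounded)
    have "(\<integral>\<^sup>+x. ennreal (norm (S x)) \<partial>M) = (\<integral>\<^sup>+x. (\<Sum>n. ennreal (s n x)) \<partial>M)"
    proof (rule nn_integral_cong_AE)
      show "AE x in M. ennreal (norm (S x)) = (\<Sum>n. ennreal (s n x))"
        using AE_sum
      proof eventually_elim
        case (elim x)
        then show ?case unfolding S_def using s_nonneg
          by (simp add: suminf_nonneg suminf_ennreal2)
      qed
    qed
    then show "(\<integral>\<^sup>+x. ennreal (norm (S x)) \<partial>M) < \<infinity>" using fin by simp
  qed measurable
  \<comment> \<open>The absolute value only matters on the null set where the series diverges.\<close>
  define g where "g x = norm (u (r 0) x) + 2 * \<bar>S x\<bar> powr (1/p)" for x
  have "p_integrable M p (\<lambda>x. 2 * \<bar>S x\<bar> powr (1/p))"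
    using S_int p by (auto simp: p_integrable_def powr_mult powr_powr)
  moreover have "p_integrable M p (\<lambda>x. norm (u (r 0) x))"
    using u[of "r 0"] by (auto simp: p_integrable_def)
  ultimately have g: "p_integrable M p g" unfolding g_def
    using p by (intro p_integrable_add) auto
  have key: "AE x in M. (\<forall>n. norm (u (r n) x) \<le> g x) \<and> convergent (\<lambda>n. u (r n) x)"
    using AE_sum
  proof eventually_elim
    case (elim x)
    have S0: "0 \<le> S x" unfolding S_def using elim s_nonneg by (intro suminf_nonneg)
    have d_le: "d n x \<le> (1/2) ^ n * S x powr (1/p)" for n
    proof -
      have "s n x \<le> S x" unfolding S_def
        using elim s_nonneg by (intro sum_le_suminf[of _ "{n}", simplified]) auto
      then have "s n x powr (1/p) \<le> S x powr (1/p)"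
        using p s_nonneg by (intro powr_mono2) auto
      moreover have "s n x powr (1/p) = 2 ^ n * d n x"
        using p by (simp add: s_def powr_mult powr_powr powr_realpow d_def)
      ultimately show ?thesis by (simp add: field_simps power_one_over)
    qed
    have sd: "summable (\<lambda>n. d n x)"
    proof (rule summable_comparison_test')
      show "summable (\<lambda>n. (1/2) ^ n * S x powr (1/p))"
        by (intro summable_mult2 summable_geometric) auto
      show "norm (d n x) \<le> (1/2) ^ n * S x powr (1/p)" for n
        using d_le[of n] by (simp add: d_def)
    qed
    have tele: "u (r n) x = u (r 0) x + (\<Sum>k<n. u (r (Suc k)) x - u (r k) x)" for n
      using sum_lessThan_telescope[of "\<lambda>k. u (r k) x" n] by simp
    have "(\<Sum>n. d n x) \<le> (\<Sum>n. (1/2) ^ n * S x powr (1/p))"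
      using d_le sd by (intro suminf_le summable_mult2 summable_geometric) auto
    also have "\<dots> = 2 * S x powr (1/p)"
      by (subst suminf_mult2[symmetric]) (auto simp: suminf_geometric)
    finally have sum_le: "(\<Sum>n. d n x) \<le> 2 * S x powr (1/p)" .
    have "norm (u (r n) x) \<le> g x" for n
    proof -
      have "norm (u (r n) x) \<le> norm (u (r 0) x) + (\<Sum>k<n. d k x)"
        unfolding tele[of n] d_def by (intro norm_triangle_le add_left_mono norm_sum)
      also have "(\<Sum>k<n. d k x) \<le> (\<Sum>n. d n x)"
        using sd by (intro sum_le_suminf) (auto simp: d_def)
      finally show ?thesis using sum_le S0 by (simp add: g_def)
    qed
    moreover have "summable (\<lambda>k. u (r (Suc k)) x - u (r k) x)"
      using sd unfolding d_def by (rule summable_norm_cancel)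
    then have "convergent (\<lambda>n. u (r 0) x + (\<Sum>k<n. u (r (Suc k)) x - u (r k) x))"
      by (intro convergent_add convergent_const) (simp add: summable_iff_convergent)
    then have "convergent (\<lambda>n. u (r n) x)" by (simp only: tele[symmetric])
    ultimately show ?case by blast
  qed
  define U where "U x = lim (\<lambda>n. u (r n) x)" for x
  have U_meas [measurable]: "U \<in> borel_measurable M"
    unfolding U_def by (intro borel_measurable_lim_metric) measurable
  have conv: "AE x in M. (\<lambda>n. u (r n) x) \<longlonglongrightarrow> U x"
    using key by eventually_elim (simp add: U_def convergent_LIMSEQ_iff)
  have dom: "AE x in M. \<forall>n. norm (u (r n) x) \<le> g x"
    using key by eventually_elim simp
  have U_le: "AE x in M. norm (U x) \<le> g x"
    using conv dom
  proof eventually_elim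
    case (elim x)
    then show ?case by (intro LIMSEQ_le_const2[OF tendsto_norm[OF elim(1)]]) auto
  qed
  have U: "p_integrable M p U"
    by (rule p_integrable_dominated[OF g]) (use U_le p in \<open>auto elim: eventually_mono\<close>)
  have sub0: "(\<lambda>n. energy M p (\<lambda>x. u (r n) x - U x)) \<longlonglongrightarrow> energy M p (\<lambda>x. 0 :: 'b)"
  proof (rule energy_tendsto_dominated)
    show "p_integrable M p (\<lambda>x. 2 *\<^sub>R g x)" by (rule p_integrable_scaleR[OF g])
    show "AE x in M. (\<lambda>n. u (r n) x - U x) \<longlonglongrightarrow> 0"
      using conv by eventually_elim (simp add: LIM_zero)
    show "AE x in M. norm (u (r n) x - U x) \<le> 2 *\<^sub>R g x" for n
      using dom U_le
    proof eventually_elim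
      case (elim x)
      have "norm (u (r n) x - U x) \<le> norm (u (r n) x) + norm (U x)" by (rule norm_triangle_ineq4)
      also have "\<dots> \<le> g x + g x" using elim by (intro add_mono) auto
      finally show ?case by simp
    qed
  qed (use p in auto)
  have "(\<lambda>n. energy M p (\<lambda>x. u n x - U x)) \<longlonglongrightarrow> 0"
  proof (rule LIMSEQ_I)
    fix e :: real assume e: "0 < e"
    define e' where "e' = e / (2 * 2 powr p)"
    have e': "0 < e'" using e by (simp add: e'_def)
    obtain N1 where N1: "\<And>m n. N1 \<le> m \<Longrightarrow> N1 \<le> n \<Longrightarrow> energy M p (\<lambda>x. u m x - u n x) < e'"
      using Cauchy[OF e'] by blast
    have "\<forall>\<^sub>F k in sequentially. energy M p (\<lambda>x. u (r k) x - U x) < e'"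
      using sub0 e' by (intro order_tendstoD(2)) (auto simp: energy_def)
    then obtain k where k: "N1 \<le> k" "energy M p (\<lambda>x. u (r k) x - U x) < e'"
      unfolding eventually_sequentially by (metis le_cases)
    have rk: "N1 \<le> r k" using k(1) seq_suble[OF r, of k] by linarith
    show "\<exists>no. \<forall>n\<ge>no. norm (energy M p (\<lambda>x. u n x - U x) - 0) < e"
    proof (intro exI allI impI)
      fix n assume n: "N1 \<le> n"
      have "energy M p (\<lambda>x. u n x - U x)
        \<le> 2 powr p * (energy M p (\<lambda>x. u n x - u (r k) x) + energy M p (\<lambda>x. u (r k) x - U x))"
        by (rule energy_triangle[OF u u U]) (use p in auto)
      also have "\<dots> < 2 powr p * (e' + e')"
        using N1[OF n rk] k(2) by (intro mult_strict_left_mono) auto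
      also have "\<dots> = e" by (simp add: e'_def)
      finally show "norm (energy M p (\<lambda>x. u n x - U x) - 0) < e"
        using energy_nonneg[of M p "\<lambda>x. u n x - U x"] by simp
    qed
  qed
  with r U g conv dom that show thesis by blast
qed

lemma energy_Cauchy_of_tendsto:
  fixes u :: "nat \<Rightarrow> 'a \<Rightarrow> 'b::euclidean_space"
  assumes p: "0 < p" and u: "\<And>n. p_integrable M p (u n)" and U: "p_integrable M p U"
    and lim: "(\<lambda>n. energy M p (\<lambda>x. u n x - U x)) \<longlonglongrightarrow> 0" and e: "0 < e"
  shows "\<exists>N. \<forall>m\<ge>N. \<forall>n\<ge>N. energy M p (\<lambda>x. u m x - u n x) < e"
proof -
  define e' where "e' = e / (2 * 2 powr p)"
  have "0 < e'" using e by (simp add: e'_def)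
  then obtain N where N: "\<And>n. N \<le> n \<Longrightarrow> energy M p (\<lambda>x. u n x - U x) < e'"
    using order_tendstoD(2)[OF lim] unfolding eventually_sequentially by blast
  have "energy M p (\<lambda>x. u m x - u n x) < e" if "N \<le> m" "N \<le> n" for m n
  proof -
    have "energy M p (\<lambda>x. u m x - u n x)
      \<le> 2 powr p * (energy M p (\<lambda>x. u m x - U x) + energy M p (\<lambda>x. U x - u n x))"
      by (rule energy_triangle[OF u U u]) (use p in auto)
    also have "\<dots> < 2 powr p * (e' + e')"
      using N[OF that(1)] N[OF that(2)] energy_minus_commute[of M p U "u n"]
      by (intro mult_strict_left_mono) auto
    also have "\<dots> = e" by (simp add: e'_def)
    finally show ?thesis .
  qed
  then show ?thesis by blast
qed

text \<open>A sequence is Cauchy if Cauchy sequences come arbitrarily close to it. Both steps of the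
  proof of Rellich's theorem, from grid averages to test functions and from test functions to
  Sobolev functions, use this.\<close>

lemma energy_Cauchy_of_approx:
  fixes u :: "nat \<Rightarrow> 'a \<Rightarrow> 'b::euclidean_space"
  assumes p: "0 \<le> p" and u: "\<And>n. p_integrable M p (u n)"
    and approx: "\<And>e. 0 < e \<Longrightarrow> \<exists>T N. (\<forall>n. p_integrable M p (T n)) \<and> (\<forall>n\<ge>N. energy M p (\<lambda>x. u n x - T n x) < e) \<and>
      (\<forall>m\<ge>N. \<forall>n\<ge>N. energy M p (\<lambda>x. T m x - T n x) < e)"
    and e: "0 < e"
  shows "\<exists>N. \<forall>m\<ge>N. \<forall>n\<ge>N. energy M p (\<lambda>x. u m x - u n x) < e"
proof -
  let ?q = "2 powr p"
  define e' where "e' = e / (?q * (1 + ?q * 2))"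
  have q: "0 < ?q * (1 + ?q * 2)" by (intro mult_pos_pos add_pos_nonneg) auto
  then have e': "0 < e'" using e by (simp add: e'_def)
  obtain T N where T: "\<And>n. p_integrable M p (T n)"
    and uT: "\<And>n. N \<le> n \<Longrightarrow> energy M p (\<lambda>x. u n x - T n x) < e'"
    and TT: "\<And>m n. N \<le> m \<Longrightarrow> N \<le> n \<Longrightarrow> energy M p (\<lambda>x. T m x - T n x) < e'"
    using approx[OF e'] by blast
  have "energy M p (\<lambda>x. u m x - u n x) < e" if mn: "N \<le> m" "N \<le> n" for m n
  proof -
    have "energy M p (\<lambda>x. T m x - u n x) \<le> ?q * (energy M p (\<lambda>x. T m x - T n x) + energy M p (\<lambda>x. T n x - u n x))"
      by (rule energy_triangle[OF T T u p])
    also have "\<dots> \<le> ?q * (e' + e')"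
      using TT[OF mn] uT[OF mn(2)] energy_minus_commute[of M p "T n" "u n"] by (intro mult_left_mono add_mono) auto
    finally have Tu: "energy M p (\<lambda>x. T m x - u n x) \<le> ?q * (e' + e')" .
    have "energy M p (\<lambda>x. u m x - u n x) \<le> ?q * (energy M p (\<lambda>x. u m x - T m x) + energy M p (\<lambda>x. T m x - u n x))"
      by (rule energy_triangle[OF u T u p])
    also have "\<dots> < ?q * (e' + ?q * (e' + e'))"
      using uT[OF mn(1)] Tu by (intro mult_strict_left_mono add_less_le_mono) auto
    also have "\<dots> = ?q * (1 + ?q * 2) * e'" by (simp add: algebra_simps)
    also have "\<dots> = e" using less_imp_neq[OF q] unfolding e'_def by (metis nonzero_mult_div_cancel_left times_divide_eq_right)
    finally show ?thesis .
  qed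
  then show ?thesis by blast
qed

text \<open>The subsequence that completeness provides has a limit \<open>V\<close> of its own; it agrees with \<open>U\<close>
  almost everywhere because the whole sequence converges to both.\<close>

lemma Lp_tendsto_dominated_subseq:
  fixes u :: "nat \<Rightarrow> 'a \<Rightarrow> 'b::euclidean_space"
  assumes p: "0 < p" and u: "\<And>n. p_integrable M p (u n)" and U: "p_integrable M p U"
    and lim: "(\<lambda>n. energy M p (\<lambda>x. u n x - U x)) \<longlonglongrightarrow> 0"
  obtains r g where "strict_mono (r :: nat \<Rightarrow> nat)"
    "p_integrable M p (g :: 'a \<Rightarrow> real)"
    "AE x in M. (\<lambda>n. u (r n) x) \<longlonglongrightarrow> U x"
    "AE x in M. \<forall>n. norm (u (r n) x) \<le> g x"
proof -
  obtain r V g where r: "strict_mono (r :: nat \<Rightarrow> nat)" and V: "p_integrable M p V" and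
    g: "p_integrable M p (g :: 'a \<Rightarrow> real)"
    and conv: "AE x in M. (\<lambda>n. u (r n) x) \<longlonglongrightarrow> V x"
    and dom: "AE x in M. \<forall>n. norm (u (r n) x) \<le> g x"
    and lim2: "(\<lambda>n. energy M p (\<lambda>x. u n x - V x)) \<longlonglongrightarrow> 0"
    using Lp_complete_dominated[OF p u energy_Cauchy_of_tendsto[OF p u U lim]] by blast
  have "energy M p (\<lambda>x. U x - V x) \<le> 0"
  proof (rule LIMSEQ_le_const)
    show "(\<lambda>n. 2 powr p * (energy M p (\<lambda>x. u n x - U x) + energy M p (\<lambda>x. u n x - V x))) \<longlonglongrightarrow> 0"
      using tendsto_mult[OF tendsto_const[of "2 powr p"] tendsto_add[OF lim lim2]] by simp
    show "\<exists>N. \<forall>n\<ge>N. energy M p (\<lambda>x. U x - V x) \<le> 2 powr p * (energy M p (\<lambda>x. u n x - U x) + energy M p (\<lambda>x. u n x - V x))"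
      using energy_triangle[OF U u V] p energy_minus_commute[of M p U] by auto
  qed
  then have "energy M p (\<lambda>x. U x - V x) = 0" using energy_nonneg[of M p "\<lambda>x. U x - V x"] by linarith
  then have "AE x in M. U x - V x = 0"
    using energy_eq_0_AE[OF p_integrable_diff[OF U V]] p by simp
  with conv have "AE x in M. (\<lambda>n. u (r n) x) \<longlonglongrightarrow> U x"
    by eventually_elim simp
  with r g dom that show thesis by blast
qed

section \<open>Test functions\<close>

text \<open>The Sobolev spaces are defined with the completed measure on \<open>\<Omega>\<close>, whereas the calculus of
  test functions takes place on the whole space with the Borel measure, where Fubini's theorem
  and translation invariance are available. For Borel functions that vanish outside \<open>\<Omega>\<close> the
  integrals agree.\<close>

lemma integrable_lebesgue_on_iff_lborel:
  fixes f :: "'a::euclidean_space \<Rightarrow> 'b::euclidean_space"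
  assumes "S \<in> sets lebesgue" "f \<in> borel_measurable borel" "\<And>x. x \<notin> S \<Longrightarrow> f x = 0"
  shows "integrable (lebesgue_on S) f \<longleftrightarrow> integrable lborel f"
proof -
  have "(\<lambda>x. if x \<in> S then f x else 0) = f" using assms(3) by auto
  then show ?thesis
    using Lebesgue_Measure.integrable_restrict_UNIV[OF assms(1), of f] integrable_completion[of f lborel] assms(2) by simp
qed

lemma integral_lebesgue_on_eq_lborel:
  fixes f :: "'a::euclidean_space \<Rightarrow> 'b::euclidean_space"
  assumes "S \<in> sets lebesgue" "f \<in> borel_measurable borel" "\<And>x. x \<notin> S \<Longrightarrow> f x = 0"
  shows "integral\<^sup>L (lebesgue_on S) f = integral\<^sup>L lborel f"
proof -
  have "(\<lambda>x. if x \<in> S then f x else 0) = f" using assms(3) by auto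
  then show ?thesis
    using Lebesgue_Measure.integral_restrict_UNIV[OF assms(1), of f] integral_completion[of f lborel] assms(2) by simp
qed

lemma borel_measurable_lebesgueI:
  fixes f :: "'a::euclidean_space \<Rightarrow> 'b::euclidean_space"
  shows "f \<in> borel_measurable borel \<Longrightarrow> f \<in> borel_measurable lebesgue"
  by (rule measurable_completion) simp

lemma integrable_lborel_continuous_bounded_support:
  fixes f :: "'a::euclidean_space \<Rightarrow> 'b::euclidean_space"
  assumes "continuous_on UNIV f" "\<And>x. f x \<noteq> 0 \<Longrightarrow> norm x \<le> R"
  shows "integrable lborel f"
proof -
  have "integrable lborel (\<lambda>x. indicator (cball 0 R) x *\<^sub>R f x)"
    using assms(1) by (intro borel_integrable_compact) (auto intro: continuous_on_subset)
  also have "(\<lambda>x. indicator (cball 0 R) x *\<^sub>R f x) = f"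
    using assms(2) by (auto simp: indicator_def fun_eq_iff)
  finally show ?thesis .
qed

lemma times_cont_diff_Suc_D: "times_cont_diff (Suc k) f \<Longrightarrow> times_cont_diff k f"
proof (induction k arbitrary: f)
  case 0
  then show ?case
    by (auto intro!: continuous_at_imp_continuous_on differentiable_imp_continuous_within)
next
  case (Suc k)
  then show ?case unfolding times_cont_diff.simps(2)[of "Suc k"] times_cont_diff.simps(2)[of k] by blast
qed

lemma times_cont_diff_add:
  "times_cont_diff k f \<Longrightarrow> times_cont_diff k g \<Longrightarrow> times_cont_diff k (\<lambda>x. f x + g x)"
proof (induction k arbitrary: f g)
  case 0
  then show ?case by (auto intro: continuous_intros)
next
  case (Suc k)
  have d: "f differentiable (at x)" "g differentiable (at x)" for x using Suc.prems by auto
  have fr: "frechet_derivative (\<lambda>x. f x + g x) (at x) e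
    = frechet_derivative f (at x) e + frechet_derivative g (at x) e" for x e
    using frechet_derivative_at[OF has_derivative_add[OF d(1)[unfolded frechet_derivative_works] d(2)[unfolded frechet_derivative_works]], symmetric]
    by (rule fun_cong)
  show ?case using Suc by (auto simp: fr)
qed

lemma times_cont_diff_mult:
  "times_cont_diff k f \<Longrightarrow> times_cont_diff k g \<Longrightarrow> times_cont_diff k (\<lambda>x. f x * g x)"
proof (induction k arbitrary: f g)
  case 0
  then show ?case by (auto intro: continuous_intros)
next
  case (Suc k)
  have d: "f differentiable (at x)" "g differentiable (at x)" for x using Suc.prems by auto
  have fr: "frechet_derivative (\<lambda>x. f x * g x) (at x) e
    = f x * frechet_derivative g (at x) e + frechet_derivative f (at x) e * g x" for x e
    using frechet_derivative_at[OF has_derivative_mult[OF d(1)[unfolded frechet_derivative_works] d(2)[unfolded frechet_derivative_works]], symmetric]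
    by (rule fun_cong)
  show ?case
    using Suc.prems times_cont_diff_Suc_D[OF Suc.prems(1)] times_cont_diff_Suc_D[OF Suc.prems(2)]
    by (auto simp: fr intro!: times_cont_diff_add Suc.IH)
qed

lemma times_cont_diff_const: "times_cont_diff k (\<lambda>x. c)"
  by (induction k arbitrary: c) (auto simp: frechet_derivative_const)

lemma smooth_add: "smooth f \<Longrightarrow> smooth g \<Longrightarrow> smooth (\<lambda>x. f x + g x)"
  by (simp add: smooth_def times_cont_diff_add)

lemma smooth_mult: "smooth f \<Longrightarrow> smooth g \<Longrightarrow> smooth (\<lambda>x. f x * g x)"
  by (simp add: smooth_def times_cont_diff_mult)

lemma smooth_const: "smooth (\<lambda>x. c)"
  by (simp add: smooth_def times_cont_diff_const)

lemma smooth_prod: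
  assumes "finite I" "\<And>i. i \<in> I \<Longrightarrow> smooth (f i)"
  shows "smooth (\<lambda>x. \<Prod>i\<in>I. f i x)"
  using assms by (induction I rule: finite_induct) (auto intro: smooth_const smooth_mult)

lemma smooth_differentiable: "smooth f \<Longrightarrow> f differentiable (at x)"
  unfolding smooth_def by (metis times_cont_diff.simps(2))

lemma smooth_continuous: "smooth f \<Longrightarrow> continuous_on UNIV f"
  unfolding smooth_def by (metis times_cont_diff.simps(1))

lemma grad_eqI: "GDERIV f x :> D \<Longrightarrow> grad f x = D"
proof -
  assume D: "GDERIV f x :> D"
  have "D' = D" if "GDERIV f x :> D'" for D'
  proof -
    have "(\<lambda>h. h \<bullet> D') = (\<lambda>h. h \<bullet> D)"
      using that D unfolding gderiv_def by (rule has_derivative_unique)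
    then have "(D' - D) \<bullet> D' = (D' - D) \<bullet> D" by metis
    then have "(D' - D) \<bullet> (D' - D) = 0" by (simp add: inner_diff_right)
    then show ?thesis by simp
  qed
  then show ?thesis unfolding grad_def using D by (intro the_equality)
qed

lemma GDERIV_frechet:
  assumes "f differentiable (at x)"
  shows "GDERIV f x :> (\<Sum>b\<in>Basis. frechet_derivative f (at x) b *\<^sub>R b)"
proof -
  have d: "(f has_derivative frechet_derivative f (at x)) (at x)"
    using assms by (simp add: frechet_derivative_works)
  have "frechet_derivative f (at x) = (\<lambda>h. h \<bullet> (\<Sum>b\<in>Basis. frechet_derivative f (at x) b *\<^sub>R b))"
  proof
    fix h
    have "frechet_derivative f (at x) h = frechet_derivative f (at x) (\<Sum>b\<in>Basis. (h \<bullet> b) *\<^sub>R b)"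
      by (simp add: euclidean_representation)
    also have "\<dots> = (\<Sum>b\<in>Basis. (h \<bullet> b) * frechet_derivative f (at x) b)"
      using has_derivative_linear[OF d] by (simp add: linear_sum linear_scale)
    finally show "frechet_derivative f (at x) h = h \<bullet> (\<Sum>b\<in>Basis. frechet_derivative f (at x) b *\<^sub>R b)"
      by (simp add: inner_sum_right mult.commute)
  qed
  with d show ?thesis unfolding gderiv_def by simp
qed

lemma grad_frechet:
  "f differentiable (at x) \<Longrightarrow> grad f x = (\<Sum>b\<in>Basis. frechet_derivative f (at x) b *\<^sub>R b)"
  by (rule grad_eqI[OF GDERIV_frechet])

lemma GDERIV_grad: "f differentiable (at x) \<Longrightarrow> GDERIV f x :> grad f x"
  by (simp add: grad_frechet GDERIV_frechet)

lemma smooth_GDERIV: "smooth f \<Longrightarrow> GDERIV f x :> grad f x"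
  by (intro GDERIV_grad smooth_differentiable)

lemma smooth_grad_continuous:
  assumes "smooth f"
  shows "continuous_on UNIV (grad f)"
proof -
  have "times_cont_diff (Suc 0) f" using assms by (simp add: smooth_def)
  then have c: "continuous_on UNIV (\<lambda>x. frechet_derivative f (at x) e)" for e by simp
  have "grad f = (\<lambda>x. \<Sum>b\<in>Basis. frechet_derivative f (at x) b *\<^sub>R b)"
    using smooth_differentiable[OF assms] by (auto simp: grad_frechet)
  then show ?thesis using c by (auto intro!: continuous_intros)
qed

lemma grad_linear_combination:
  assumes "smooth f" "smooth g"
  shows "grad (\<lambda>x. c * f x + d * g x) x = c *\<^sub>R grad f x + d *\<^sub>R grad g x"
proof (rule grad_eqI)
  have "GDERIV (\<lambda>x. c * f x) x :> c *\<^sub>R grad f x" "GDERIV (\<lambda>x. d * g x) x :> d *\<^sub>R grad g x"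
    using GDERIV_mult[OF GDERIV_const[of c] smooth_GDERIV[OF assms(1)]]
      GDERIV_mult[OF GDERIV_const[of d] smooth_GDERIV[OF assms(2)]] by auto
  then show "GDERIV (\<lambda>x. c * f x + d * g x) x :> c *\<^sub>R grad f x + d *\<^sub>R grad g x"
    by (rule GDERIV_add)
qed

lemma grad_eq_0_outside:
  assumes "x \<notin> closure {x. f x \<noteq> 0}"
  shows "f x = 0" "grad f x = 0"
proof -
  have out: "f y = 0" if "y \<notin> closure {x. f x \<noteq> 0}" for y
    using that closure_subset[of "{x. f x \<noteq> 0}"] by blast
  show "f x = 0" using out[OF assms] .
  have "GDERIV f x :> 0" unfolding gderiv_def
  proof (rule has_derivative_transform_within_open)
    show "((\<lambda>x. 0) has_derivative (\<lambda>h. h \<bullet> 0)) (at x)" by simp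
    show "open (- closure {x. f x \<noteq> 0})" by auto
    show "x \<in> - closure {x. f x \<noteq> 0}" using assms by simp
    show "0 = f y" if "y \<in> - closure {x. f x \<noteq> 0}" for y
      using out[of y] that by simp
  qed
  then show "grad f x = 0" by (rule grad_eqI)
qed

lemma test_functions_linear_combination:
  assumes "\<phi> \<in> test_functions \<Omega>" "\<psi> \<in> test_functions \<Omega>"
  shows "(\<lambda>x. c * \<phi> x + d * \<psi> x) \<in> test_functions \<Omega>"
proof -
  let ?K = "closure {x. \<phi> x \<noteq> 0} \<union> closure {x. \<psi> x \<noteq> 0}"
  have "closure {x. c * \<phi> x + d * \<psi> x \<noteq> 0} \<subseteq> closure ({x. \<phi> x \<noteq> 0} \<union> {x. \<psi> x \<noteq> 0})"
    by (rule closure_mono) auto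
  then have sub: "closure {x. c * \<phi> x + d * \<psi> x \<noteq> 0} \<subseteq> ?K" by simp
  moreover have "compact ?K" using assms by (auto simp: test_functions_def)
  ultimately have "compact (closure {x. c * \<phi> x + d * \<psi> x \<noteq> 0})"
    by (meson closed_closure compact_Int_closed compact_closure bounded_subset compact_imp_bounded closure_subset)
  with sub assms show ?thesis
    by (auto simp: test_functions_def intro!: smooth_add smooth_mult smooth_const)
qed

lemma test_functions_zero: "(\<lambda>x. 0) \<in> test_functions \<Omega>"
  by (simp add: test_functions_def smooth_const)

lemma test_functionsD:
  assumes "\<phi> \<in> test_functions \<Omega>"
  shows "smooth \<phi>" "continuous_on UNIV \<phi>" "continuous_on UNIV (grad \<phi>)"
    "\<And>x. x \<notin> \<Omega> \<Longrightarrow> \<phi> x = 0" "\<And>x. x \<notin> \<Omega> \<Longrightarrow> grad \<phi> x = 0"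
    "\<And>x. GDERIV \<phi> x :> grad \<phi> x"
proof -
  show s: "smooth \<phi>" using assms by (simp add: test_functions_def)
  have sub: "closure {x. \<phi> x \<noteq> 0} \<subseteq> \<Omega>" using assms by (simp add: test_functions_def)
  show "continuous_on UNIV \<phi>" "continuous_on UNIV (grad \<phi>)" "GDERIV \<phi> x :> grad \<phi> x" for x
    using s by (auto intro: smooth_continuous smooth_grad_continuous smooth_GDERIV)
  show "\<phi> x = 0" "grad \<phi> x = 0" if "x \<notin> \<Omega>" for x
    using grad_eq_0_outside[of x \<phi>] sub that by blast+
qed

lemma test_function_support:
  assumes "\<phi> \<in> test_functions \<Omega>"
  shows "\<exists>R>0. \<forall>x. R < norm x \<longrightarrow> \<phi> x = 0 \<and> grad \<phi> x = 0"
proof -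
  have "bounded (closure {x. \<phi> x \<noteq> 0})"
    using assms by (intro compact_imp_bounded) (simp add: test_functions_def)
  then obtain R where R: "0 < R" "\<forall>x\<in>closure {x. \<phi> x \<noteq> 0}. norm x \<le> R"
    by (auto simp only: bounded_pos)
  have "\<phi> x = 0 \<and> grad \<phi> x = 0" if "R < norm x" for x
    using grad_eq_0_outside[of x \<phi>] R(2) that by force
  with R(1) show ?thesis by blast
qed

lemma continuous_bounded_support_bounded:
  fixes f :: "'a::euclidean_space \<Rightarrow> 'b::euclidean_space"
  assumes "continuous_on UNIV f" "\<And>x. R < norm x \<Longrightarrow> f x = 0"
  obtains C where "0 < C" "\<And>x. norm (f x) \<le> C"
proof -
  have "bounded (f ` cball 0 R)"
    using assms(1) by (intro compact_imp_bounded compact_continuous_image) (auto intro: continuous_on_subset)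
  then obtain C where C: "0 < C" "\<And>x. x \<in> cball 0 R \<Longrightarrow> norm (f x) \<le> C"
    by (auto simp: bounded_pos)
  have "norm (f x) \<le> C" for x
    using C assms(2)[of x] by (cases "norm x \<le> R") auto
  with C(1) that show thesis by blast
qed

lemma test_function_bounded:
  assumes "\<phi> \<in> test_functions \<Omega>"
  shows "\<exists>C>0. \<forall>x. \<bar>\<phi> x\<bar> \<le> C \<and> norm (grad \<phi> x) \<le> C"
proof -
  obtain R where "0 < R" and R: "\<And>x. R < norm x \<Longrightarrow> \<phi> x = 0" "\<And>x. R < norm x \<Longrightarrow> grad \<phi> x = 0"
    using test_function_support[OF assms] by auto
  obtain C1 where C1: "0 < C1" "\<And>x. norm (\<phi> x) \<le> C1"
    using continuous_bounded_support_bounded[OF test_functionsD(2)[OF assms] R(1)] by blast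
  obtain C2 where C2: "0 < C2" "\<And>x. norm (grad \<phi> x) \<le> C2"
    using continuous_bounded_support_bounded[OF test_functionsD(3)[OF assms] R(2)] by blast
  have "\<bar>\<phi> x\<bar> \<le> C1 + C2" "norm (grad \<phi> x) \<le> C1 + C2" for x
    using C1(2)[of x] C2(2)[of x] C1(1) C2(1) by auto
  then show ?thesis using C1(1) C2(1) by (intro exI[of _ "C1 + C2"]) auto
qed

lemma test_function_powr_integrable:
  fixes \<phi> :: "'a::euclidean_space \<Rightarrow> real"
  assumes \<phi>: "\<phi> \<in> test_functions \<Omega>" and r: "0 < r"
  shows "integrable lborel (\<lambda>x. \<bar>\<phi> x\<bar> powr r)" "integrable lborel (\<lambda>x. norm (grad \<phi> x) powr r)"
proof -
  obtain R where R: "\<And>x. R < norm x \<Longrightarrow> \<phi> x = 0" "\<And>x. R < norm x \<Longrightarrow> grad \<phi> x = 0"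
    using test_function_support[OF \<phi>] by auto
  have "continuous_on UNIV (\<lambda>x. \<bar>\<phi> x\<bar> powr r)" "continuous_on UNIV (\<lambda>x. norm (grad \<phi> x) powr r)"
    using test_functionsD(2,3)[OF \<phi>] r
    by (intro continuous_on_powr' continuous_on_rabs continuous_on_norm continuous_on_const ballI conjI impI; simp)+
  then show "integrable lborel (\<lambda>x. \<bar>\<phi> x\<bar> powr r)" "integrable lborel (\<lambda>x. norm (grad \<phi> x) powr r)"
    using R by (force intro!: integrable_lborel_continuous_bounded_support[where R = R])+
qed

lemma integral_translate:
  fixes f :: "'a::euclidean_space \<Rightarrow> 'b::euclidean_space"
  assumes [measurable]: "f \<in> borel_measurable borel"
  shows "(\<integral>x. f (x + c) \<partial>lborel) = (\<integral>x. f x \<partial>lborel)"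
proof -
  have "(\<integral>x. f x \<partial>lborel) = (\<integral>x. f x \<partial>distr lborel borel ((+) c))"
    by (simp add: lborel_distr_plus)
  also have "\<dots> = (\<integral>x. f (c + x) \<partial>lborel)" by (subst integral_distr) auto
  finally show ?thesis by (simp add: add.commute)
qed

lemma GDERIV_lipschitz:
  fixes F :: "'a::euclidean_space \<Rightarrow> real"
  assumes "\<And>x. GDERIV F x :> D x" "\<And>x. norm (D x) \<le> C"
  shows "\<bar>F x - F y\<bar> \<le> C * norm (x - y)"
proof -
  have "norm (F x - F y) \<le> C * norm (x - y)"
  proof (rule differentiable_bound[of UNIV F "\<lambda>x h. h \<bullet> D x"])
    show "(F has_derivative (\<lambda>h. h \<bullet> D x)) (at x within UNIV)" for x
      using assms(1)[of x] by (simp add: gderiv_def)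
    show "onorm (\<lambda>h. h \<bullet> D x) \<le> C" for x
    proof (rule onorm_le)
      fix h
      have "norm (h \<bullet> D x) \<le> norm h * norm (D x)" by (simp add: Cauchy_Schwarz_ineq2)
      also have "\<dots> \<le> norm h * C" by (intro mult_left_mono assms(2)) auto
      finally show "norm (h \<bullet> D x) \<le> C * norm h" by (simp add: mult.commute)
    qed
  qed auto
  then show ?thesis by simp
qed

lemma GDERIV_difference_quotient_tendsto:
  fixes F :: "'a::euclidean_space \<Rightarrow> real"
  assumes "GDERIV F x :> D"
  shows "((\<lambda>t. (F (x + t *\<^sub>R e) - F x) / t) \<longlongrightarrow> D \<bullet> e) (at 0)"
proof -
  have "((\<lambda>t. F (x + t *\<^sub>R e)) has_derivative (\<lambda>t. (t *\<^sub>R e) \<bullet> D)) (at 0)"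
  proof (rule has_derivative_compose[where g = F and f = "\<lambda>t. x + t *\<^sub>R e" and g' = "\<lambda>h. h \<bullet> D"])
    show "((\<lambda>t. x + t *\<^sub>R e) has_derivative (\<lambda>t. t *\<^sub>R e)) (at 0)"
      by (auto intro!: derivative_eq_intros)
    show "(F has_derivative (\<lambda>h. h \<bullet> D)) (at (x + 0 *\<^sub>R e))"
      using assms by (simp add: gderiv_def)
  qed
  then have "((\<lambda>t. F (x + t *\<^sub>R e)) has_field_derivative (D \<bullet> e)) (at 0)"
    by (simp add: has_field_derivative_def inner_commute mult.commute[of _ "D \<bullet> e"])
  then show ?thesis by (simp add: has_field_derivative_iff)
qed

text \<open>Since the Lebesgue measure is invariant under translations, every difference quotient of
  \<open>F\<close> has integral \<open>0\<close>. These quotients converge boundedly, and on a bounded set, to the partial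
  derivatives.\<close>

lemma integral_GDERIV_eq_0:
  fixes F :: "'a::euclidean_space \<Rightarrow> real"
  assumes F: "\<And>x. GDERIV F x :> D x" and D: "continuous_on UNIV D"
    and supp: "\<And>x. R < norm x \<Longrightarrow> F x = 0" "\<And>x. R < norm x \<Longrightarrow> D x = 0"
  shows "(\<integral>x. D x \<partial>lborel) = 0"
proof -
  have Fc: "continuous_on UNIV F"
    using F unfolding gderiv_def by (meson has_derivative_continuous continuous_at_imp_continuous_on)
  have [measurable]: "F \<in> borel_measurable borel" "D \<in> borel_measurable borel"
    using Fc D by (auto intro: borel_measurable_continuous_onI)
  obtain C where C: "0 < C" "\<And>x. norm (D x) \<le> C"
    using continuous_bounded_support_bounded[OF D supp(2)] by blast
  have Fint: "integrable lborel F"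
    by (rule integrable_lborel_continuous_bounded_support[OF Fc, of R]) (use supp in force)
  have Dint: "integrable lborel D"
    by (rule integrable_lborel_continuous_bounded_support[OF D, of R]) (use supp in force)
  have "(\<integral>x. D x \<partial>lborel) \<bullet> e = 0" if e: "e \<in> Basis" for e
  proof -
    define G where "G n x = (F (x + (1 / real (Suc n)) *\<^sub>R e) - F x) / (1 / real (Suc n))" for n x
    have G0: "(\<integral>x. G n x \<partial>lborel) = 0" for n
    proof -
      have "integrable lborel (\<lambda>x. F (x + (1 / real (Suc n)) *\<^sub>R e))"
      proof -
        have "integrable (distr lborel borel ((+) ((1 / real (Suc n)) *\<^sub>R e))) F"
          using Fint by (simp add: lborel_distr_plus)
        then show ?thesis by (subst (asm) integrable_distr_eq) (auto simp: add.commute)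
      qed
      then show ?thesis unfolding G_def using Fint
        by (simp add: integral_translate)
    qed
    have "(\<lambda>n. \<integral>x. G n x \<partial>lborel) \<longlonglongrightarrow> (\<integral>x. D x \<bullet> e \<partial>lborel)"
    proof (rule integral_dominated_convergence)
      \<comment> \<open>The majorant lives on a ball enlarged by 1, the largest step of the difference
        quotients.\<close>
      have "emeasure lborel (cball (0::'a) (R + 1)) < \<infinity>"
        using emeasure_bounded_finite bounded_cball by blast
      then show "integrable lborel (\<lambda>x. C * indicator (cball (0::'a) (R + 1)) x)"
        by (intro integrable_mult_right integrable_real_indicator) auto
      show "AE x in lborel. (\<lambda>n. G n x) \<longlonglongrightarrow> D x \<bullet> e"
      proof (rule AE_I2)
        fix x
        have "filterlim (\<lambda>n. 1 / real (Suc n)) (at 0) sequentially"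
          using LIMSEQ_inverse_real_of_nat by (auto simp: filterlim_at inverse_eq_divide)
        from filterlim_compose[OF GDERIV_difference_quotient_tendsto[OF F] this]
        show "(\<lambda>n. G n x) \<longlonglongrightarrow> D x \<bullet> e" unfolding G_def .
      qed
      show "AE x in lborel. norm (G n x) \<le> C * indicator (cball 0 (R + 1)) x" for n
      proof (rule AE_I2)
        fix x
        let ?t = "1 / real (Suc n)"
        have t: "0 < ?t" "?t \<le> 1" by auto
        have *: "norm (?t *\<^sub>R e) = ?t" using e by simp
        show "norm (G n x) \<le> C * indicator (cball 0 (R + 1)) x"
        proof (cases "x \<in> cball 0 (R + 1)")
          case True
          have "\<bar>F (x + ?t *\<^sub>R e) - F x\<bar> \<le> C * norm (x + ?t *\<^sub>R e - x)"
            by (rule GDERIV_lipschitz[OF F C(2)])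
          then have "\<bar>F (x + ?t *\<^sub>R e) - F x\<bar> \<le> C * ?t" using * by simp
          then have "\<bar>F (x + ?t *\<^sub>R e) - F x\<bar> / ?t \<le> C" using t(1) by (simp only: pos_divide_le_eq)
          then show ?thesis using True t(1) unfolding G_def abs_divide real_norm_def by simp
        next
          case False
          then have "R + 1 < norm x" by simp
          moreover have "norm x \<le> norm (x + ?t *\<^sub>R e) + norm (?t *\<^sub>R e)"
            using norm_triangle_ineq4[of "x + ?t *\<^sub>R e" "?t *\<^sub>R e"] by simp
          ultimately have "R < norm x" "R < norm (x + ?t *\<^sub>R e)" using * t(2) by linarith+
          then show ?thesis using supp(1) C(1) by (simp add: G_def)
        qed
      qed
    qed (auto simp: G_def)
    then have "(\<integral>x. D x \<bullet> e \<partial>lborel) = 0"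
      using G0 LIMSEQ_unique by (simp add: LIMSEQ_const_iff)
    then show ?thesis using Dint by simp
  qed
  then show ?thesis by (metis euclidean_all_zero_iff)
qed

text \<open>The integral of the gradient of the product vanishes, since the product has compact
  support.\<close>

lemma test_functions_integration_by_parts:
  assumes \<phi>: "\<phi> \<in> test_functions \<Omega>" and \<psi>: "\<psi> \<in> test_functions \<Omega>" and \<Omega>: "\<Omega> \<in> sets lebesgue"
  shows "(\<integral>x. \<phi> x *\<^sub>R grad \<psi> x \<partial>lebesgue_on \<Omega>) = - (\<integral>x. \<psi> x *\<^sub>R grad \<phi> x \<partial>lebesgue_on \<Omega>)"
proof -
  note \<phi>D = test_functionsD[OF \<phi>] and \<psi>D = test_functionsD[OF \<psi>]
  obtain R where "0 < R" and R: "\<And>x. R < norm x \<Longrightarrow> \<phi> x = 0" "\<And>x. R < norm x \<Longrightarrow> grad \<phi> x = 0"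
    using test_function_support[OF \<phi>] by auto
  have c1: "continuous_on UNIV (\<lambda>x. \<phi> x *\<^sub>R grad \<psi> x)" and c2: "continuous_on UNIV (\<lambda>x. \<psi> x *\<^sub>R grad \<phi> x)"
    using \<phi>D(2,3) \<psi>D(2,3) by (auto intro!: continuous_intros)
  have i1: "integrable lborel (\<lambda>x. \<phi> x *\<^sub>R grad \<psi> x)"
    by (rule integrable_lborel_continuous_bounded_support[OF c1, of R]) (use R in force)
  have i2: "integrable lborel (\<lambda>x. \<psi> x *\<^sub>R grad \<phi> x)"
    by (rule integrable_lborel_continuous_bounded_support[OF c2, of R]) (use R in force)
  have "(\<integral>x. \<phi> x *\<^sub>R grad \<psi> x + \<psi> x *\<^sub>R grad \<phi> x \<partial>lborel) = 0"
  proof (rule integral_GDERIV_eq_0[where F = "\<lambda>x. \<phi> x * \<psi> x" and R = R])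
    show "GDERIV (\<lambda>x. \<phi> x * \<psi> x) x :> \<phi> x *\<^sub>R grad \<psi> x + \<psi> x *\<^sub>R grad \<phi> x" for x
      by (rule GDERIV_mult[OF \<phi>D(6) \<psi>D(6)])
  qed (use c1 c2 R in \<open>auto intro!: continuous_intros\<close>)
  then have "(\<integral>x. \<phi> x *\<^sub>R grad \<psi> x \<partial>lborel) = - (\<integral>x. \<psi> x *\<^sub>R grad \<phi> x \<partial>lborel)"
    using i1 i2 by (simp add: eq_neg_iff_add_eq_0)
  then show ?thesis
    using \<phi>D(4) \<psi>D(4) \<Omega>
    by (subst (1 2) integral_lebesgue_on_eq_lborel)
      (auto intro!: borel_measurable_continuous_onI c1 c2)
qed

text \<open>For \<open>P = 1\<close> this is the standard smooth function that vanishes to all orders at \<open>0\<close>. The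
  polynomial factor makes the family closed under differentiation, so that smoothness of all
  members follows by one induction. As \<open>c\<close> decreases to \<open>0\<close>, \<open>flat 1 c\<close> increases to the
  indicator of the positive half-line.\<close>

definition flat :: "real poly \<Rightarrow> real \<Rightarrow> real \<Rightarrow> real" where
  "flat P c t = (if 0 < t then poly P (1 / t) * exp (- c / t) else 0)"

lemma poly_times_exp_tendsto_0:
  assumes c: "0 < (c::real)"
  shows "((\<lambda>s. poly P s * exp (- c * s)) \<longlongrightarrow> 0) at_top"
proof -
  have "((\<lambda>s. s ^ i * exp (- c * s)) \<longlongrightarrow> 0) at_top" for i
  proof -
    have "filterlim (\<lambda>s. c * s) at_top at_top"
      using c by (intro filterlim_tendsto_pos_mult_at_top[OF tendsto_const]) (auto simp: filterlim_ident)
    then have "((\<lambda>s. (c * s) ^ i / exp (c * s)) \<longlongrightarrow> 0) at_top"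
      by (rule filterlim_compose[OF tendsto_power_div_exp_0])
    then have "((\<lambda>s. (1 / c ^ i) * ((c * s) ^ i / exp (c * s))) \<longlongrightarrow> (1 / c ^ i) * 0) at_top"
      by (intro tendsto_mult tendsto_const)
    then show ?thesis using c by (simp add: power_mult_distrib exp_minus field_simps)
  qed
  then have "((\<lambda>s. \<Sum>i\<le>degree P. coeff P i * (s ^ i * exp (- c * s))) \<longlongrightarrow> (\<Sum>i\<le>degree P. coeff P i * 0)) at_top"
    by (intro tendsto_sum tendsto_mult tendsto_const)
  then show ?thesis by (simp add: poly_altdef sum_distrib_right mult.assoc)
qed

text \<open>At \<open>t = 0\<close> the difference quotient is again of the form \<open>P(1/t) exp(-c/t)\<close>, which tends to
  \<open>0\<close> because the exponential beats every power.\<close>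

lemma flat_has_derivative:
  assumes c: "0 < c"
  shows "(flat P c has_real_derivative flat ([:0, 0, 1:] * (smult c P - pderiv P)) c t) (at t)"
proof -
  let ?Q = "[:0, 0, 1:] * (smult c P - pderiv P)"
  consider "0 < t" | "t < 0" | "t = 0" by linarith
  then show ?thesis
  proof cases
    case 1
    have "((\<lambda>t. poly P (1 / t) * exp (- c / t)) has_real_derivative flat ?Q c t) (at t)"
      using 1 by (auto intro!: derivative_eq_intros DERIV_chain2[OF poly_DERIV] simp: flat_def field_simps power2_eq_square)
    then show ?thesis
      by (rule has_field_derivative_transform_within_open[of _ _ _ "{0<..}"]) (use 1 in \<open>auto simp: flat_def\<close>)
  next
    case 2
    have "((\<lambda>t. 0) has_real_derivative flat ?Q c t) (at t)" using 2 by (simp add: flat_def)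
    then show ?thesis
      by (rule has_field_derivative_transform_within_open[of _ _ _ "{..<0}"]) (use 2 in \<open>auto simp: flat_def\<close>)
  next
    case 3
    have "((\<lambda>h. flat P c h / h) \<longlongrightarrow> 0) (at_right 0)"
    proof -
      have "((\<lambda>h. poly (pCons 0 P) (inverse h) * exp (- c * inverse h)) \<longlongrightarrow> 0) (at_right 0)"
        by (rule filterlim_compose[OF poly_times_exp_tendsto_0[OF c] filterlim_inverse_at_top_right])
      then show ?thesis
        by (rule Lim_transform_eventually)
          (auto simp: eventually_at_right_field flat_def divide_inverse intro!: exI[of _ 1])
    qed
    moreover have "((\<lambda>h. flat P c h / h) \<longlongrightarrow> 0) (at_left 0)"
      by (rule Lim_transform_eventually[OF tendsto_const])
        (auto simp: eventually_at_left_field flat_def intro!: exI[of _ "-1"])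
    ultimately have "((\<lambda>h. flat P c h / h) \<longlongrightarrow> 0) (at 0)"
      by (simp add: filterlim_split_at)
    then show ?thesis using 3 by (simp add: has_field_derivative_iff flat_def)
  qed
qed

lemma smooth_flat_inner:
  fixes e :: "'a::euclidean_space"
  assumes c: "0 < c"
  shows "smooth (\<lambda>x. flat P c (x \<bullet> e + a))"
proof -
  have d: "((\<lambda>x. flat P c (x \<bullet> e + a)) has_derivative
      (\<lambda>h. flat ([:0, 0, 1:] * (smult c P - pderiv P)) c (x \<bullet> e + a) * (h \<bullet> e))) (at x)" for P x
  proof (rule has_derivative_compose[where g = "flat P c" and f = "\<lambda>x. x \<bullet> e + a"
      and g' = "(*) (flat ([:0, 0, 1:] * (smult c P - pderiv P)) c (x \<bullet> e + a))"])
    show "((\<lambda>x. x \<bullet> e + a) has_derivative (\<lambda>h. h \<bullet> e)) (at x)"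
      by (auto intro!: derivative_eq_intros)
    show "(flat P c has_derivative (*) (flat ([:0, 0, 1:] * (smult c P - pderiv P)) c (x \<bullet> e + a))) (at (x \<bullet> e + a))"
      using flat_has_derivative[OF c, of P "x \<bullet> e + a"] by (simp add: has_field_derivative_def)
  qed
  have fr: "frechet_derivative (\<lambda>x. flat P c (x \<bullet> e + a)) (at x) h
    = flat (smult (h \<bullet> e) ([:0, 0, 1:] * (smult c P - pderiv P))) c (x \<bullet> e + a)" for P x h
    using frechet_derivative_at[OF d[of P x], symmetric] by (simp add: flat_def)
  have "times_cont_diff k (\<lambda>x. flat P c (x \<bullet> e + a))" for k
  proof (induction k arbitrary: P)
    case 0
    show ?case using d[THEN has_derivative_continuous]
      by (auto intro!: continuous_at_imp_continuous_on)
  next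
    case (Suc k)
    show ?case unfolding times_cont_diff.simps fr
      using Suc.IH d[THEN differentiableI] by blast
  qed
  then show ?thesis by (simp add: smooth_def)
qed

text \<open>Smooth functions that are positive exactly on the open box and converge boundedly to its
  indicator.\<close>

definition box_bump :: "'a::euclidean_space \<Rightarrow> 'a \<Rightarrow> nat \<Rightarrow> 'a \<Rightarrow> real" where
  "box_bump a b n x = (\<Prod>i\<in>Basis. flat 1 (1 / real (Suc n)) (x \<bullet> i + - (a \<bullet> i)) *
     flat 1 (1 / real (Suc n)) (x \<bullet> (- i) + b \<bullet> i))"

lemma flat_one_bounds: "0 < c \<Longrightarrow> 0 \<le> flat 1 c t \<and> flat 1 c t \<le> 1"
  by (auto simp: flat_def)

lemma flat_one_tendsto: "(\<lambda>n. flat 1 (1 / real (Suc n)) t) \<longlonglongrightarrow> (if 0 < t then 1 else 0)"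
proof (cases "0 < t")
  case True
  have "(\<lambda>n. exp (- (1 / real (Suc n)) / t)) \<longlonglongrightarrow> exp (- 0 / t)"
    using LIMSEQ_inverse_real_of_nat True
    by (intro tendsto_exp tendsto_divide tendsto_minus tendsto_const) (auto simp: inverse_eq_divide)
  then show ?thesis using True by (simp add: flat_def)
qed (simp add: flat_def)

lemma box_bump_test_function:
  assumes "cbox a b \<subseteq> \<Omega>"
  shows "box_bump a b n \<in> test_functions \<Omega>"
proof -
  have "x \<in> box a b" if "box_bump a b n x \<noteq> 0" for x
    using that by (auto simp: box_bump_def flat_def mem_box split: if_splits)
  then have sub: "{x. box_bump a b n x \<noteq> 0} \<subseteq> cbox a b"
    using box_subset_cbox by blast
  then have cl: "closure {x. box_bump a b n x \<noteq> 0} \<subseteq> cbox a b"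
    by (simp add: closure_minimal closed_cbox)
  moreover have "compact (closure {x. box_bump a b n x \<noteq> 0})"
    using sub bounded_cbox bounded_subset compact_closure by blast
  moreover have "smooth (box_bump a b n)"
    unfolding box_bump_def by (intro smooth_prod smooth_mult smooth_flat_inner) auto
  ultimately show ?thesis using assms by (auto simp: test_functions_def)
qed

lemma box_bump_bounds: "0 \<le> box_bump a b n x" "box_bump a b n x \<le> 1"
proof -
  have f: "0 \<le> flat 1 (1 / real (Suc n)) t" "flat 1 (1 / real (Suc n)) t \<le> 1" for t
    using flat_one_bounds[of "1 / real (Suc n)" t] by simp_all
  show "0 \<le> box_bump a b n x" unfolding box_bump_def
    by (intro prod_nonneg mult_nonneg_nonneg ballI f)
  show "box_bump a b n x \<le> 1" unfolding box_bump_def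
    by (intro prod_le_1 conjI mult_nonneg_nonneg mult_le_one f)
qed

lemma box_bump_tendsto: "(\<lambda>n. box_bump a b n x) \<longlonglongrightarrow> indicator (box a b) x"
proof -
  have "(\<lambda>n. box_bump a b n x) \<longlonglongrightarrow> (\<Prod>i\<in>Basis. (if 0 < x \<bullet> i + - (a \<bullet> i) then 1 else 0) *
      (if 0 < x \<bullet> (- i) + b \<bullet> i then 1 else 0))"
    unfolding box_bump_def by (intro tendsto_prod tendsto_mult flat_one_tendsto)
  also have "(\<Prod>i\<in>Basis. (if 0 < x \<bullet> i + - (a \<bullet> i) then 1 else 0) *
      (if 0 < x \<bullet> (- i) + b \<bullet> i then 1 else 0)) = (indicator (box a b) x :: real)"
    by (auto simp: indicator_def mem_box intro!: prod_zero)
  finally show ?thesis .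
qed

lemma box_bump_zero: "x \<notin> box a b \<Longrightarrow> box_bump a b n x = 0"
  by (auto simp: box_bump_def flat_def mem_box intro!: prod_zero)

section \<open>Weak gradients and Sobolev spaces\<close>

text \<open>Completeness is what makes the weak gradient measurable: it is an arbitrary
  representative, known only to agree almost everywhere with a measurable function.\<close>

lemma complete_measure_lebesgue_on:
  assumes "S \<in> sets lebesgue"
  shows "complete_measure (lebesgue_on S)"
proof
  fix A B assume B: "B \<subseteq> A" "A \<in> null_sets (lebesgue_on S)"
  then have A: "A \<subseteq> S" "A \<in> null_sets lebesgue"
    using null_sets_restrict_space[OF assms, of A] by auto
  then have "B \<in> null_sets lebesgue" using B(1) null_sets_completion_subset by blast
  then show "B \<in> sets (lebesgue_on S)" using assms A(1) B(1)
    by (auto simp: sets_restrict_space_iff)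
qed

lemma borel_measurable_lebesgue_on_AE_cong:
  fixes f g :: "'a::euclidean_space \<Rightarrow> 'b::euclidean_space"
  assumes S: "S \<in> sets lebesgue" and f: "f \<in> borel_measurable (lebesgue_on S)"
    and eq: "AE x in lebesgue_on S. f x = g x"
  shows "g \<in> borel_measurable (lebesgue_on S)"
proof (rule borel_measurableI)
  fix U :: "'b set" assume U: "open U"
  interpret complete_measure "lebesgue_on S" by (rule complete_measure_lebesgue_on[OF S])
  show "g -` U \<inter> space (lebesgue_on S) \<in> sets (lebesgue_on S)"
  proof (rule in_sets_AE)
    show "f -` U \<inter> space (lebesgue_on S) \<in> sets (lebesgue_on S)"
      using measurable_sets[OF f borel_open[OF U]] .
    show "AE x in lebesgue_on S. x \<in> f -` U \<inter> space (lebesgue_on S) \<longleftrightarrow> x \<in> g -` U \<inter> space (lebesgue_on S)"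
      using eq by eventually_elim auto
  qed auto
qed

text \<open>The sets over which the integral of \<open>g\<close> vanishes form a Dynkin system, which contains the
  boxes, and these are stable under intersection and generate the Borel sets. The system
  contains the whole space because the integral of \<open>g\<close> over the whole space is the integral over
  a box that contains its support.\<close>

lemma integral_zero_on_boxes_imp_AE_zero:
  fixes g :: "'a::euclidean_space \<Rightarrow> real"
  assumes g: "integrable lebesgue g"
    and boxes: "\<And>a b. (\<integral>x. indicator (box a b) x *\<^sub>R g x \<partial>lebesgue) = 0"
    and supp: "\<And>x. R < norm x \<Longrightarrow> g x = 0"
  shows "AE x in lebesgue. g x = 0"
proof -
  \<comment> \<open>A Borel representative of \<open>g\<close>, so that Borel sets suffice.\<close>
  obtain h where h [measurable]: "h \<in> borel_measurable lborel" and gh: "AE x in lborel. g x = h x"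
    using completion_ex_borel_measurable_real[of g lborel] borel_measurable_integrable[OF g] by blast
  have gh': "AE x in lebesgue. g x = h x" using gh by (rule AE_completion)
  have h_leb: "h \<in> borel_measurable lebesgue" using h by (rule measurable_completion)
  have g_leb: "g \<in> borel_measurable lebesgue" using g by auto
  have "integrable lebesgue h"
    using g integrable_cong_AE[OF g_leb h_leb gh'] by simp
  then have h_int: "integrable lborel h" using integrable_completion[OF h] by simp
  have eq: "(\<integral>x. indicator A x *\<^sub>R h x \<partial>lborel) = (\<integral>x. indicator A x *\<^sub>R g x \<partial>lebesgue)"
    if A [measurable]: "A \<in> sets borel" for A
  proof -
    have "(\<integral>x. indicator A x *\<^sub>R h x \<partial>lborel) = (\<integral>x. indicator A x *\<^sub>R h x \<partial>lebesgue)"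
      by (rule integral_completion[symmetric]) measurable
    also have "\<dots> = (\<integral>x. indicator A x *\<^sub>R g x \<partial>lebesgue)"
    proof (rule integral_cong_AE)
      show "AE x in lebesgue. indicator A x *\<^sub>R h x = indicator A x *\<^sub>R g x"
        using gh' by eventually_elim simp
      have "indicator A \<in> borel_measurable lebesgue"
        using A by (intro borel_measurable_indicator) auto
      then show "(\<lambda>x. indicator A x *\<^sub>R h x) \<in> borel_measurable lebesgue"
        "(\<lambda>x. indicator A x *\<^sub>R g x) \<in> borel_measurable lebesgue"
        using h_leb g_leb by (auto intro: borel_measurable_times)
    qed
    finally show ?thesis .
  qed
  have h_boxes: "set_lebesgue_integral lborel (box a b) h = 0" for a b
    unfolding set_lebesgue_integral_def using eq[of "box a b"] boxes by simp
  have total: "(\<integral>x. h x \<partial>lborel) = 0"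
  proof -
    obtain c :: 'a where c: "cball 0 R \<subseteq> box (-c) c"
      using bounded_subset_box_symmetric[OF bounded_cball] by blast
    have "indicator (box (-c) c) x *\<^sub>R g x = g x" for x
      using supp[of x] c by (cases "norm x \<le> R") (auto simp: indicator_def)
    then have "(\<integral>x. indicator (box (-c) c) x *\<^sub>R g x \<partial>lebesgue) = (\<integral>x. g x \<partial>lebesgue)" by (simp only:)
    moreover have "(\<integral>x. indicator UNIV x *\<^sub>R h x \<partial>lborel) = (\<integral>x. indicator UNIV x *\<^sub>R g x \<partial>lebesgue)"
      by (rule eq) auto
    ultimately show ?thesis using boxes[of "-c" c] by simp
  qed
  let ?E = "range (\<lambda>(a, b). box a b :: 'a set)"
  have sint: "set_integrable lborel A h" if "A \<in> sets borel" for A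
    unfolding set_integrable_def using integrable_mult_indicator[of A lborel h] that h_int by simp
  have sig: "A \<in> sigma_sets UNIV ?E \<longleftrightarrow> A \<in> sets borel" for A
    by (subst borel_eq_box) (auto simp: case_prod_beta)
  have "set_lebesgue_integral lborel A h = 0" if "A \<in> sigma_sets UNIV ?E" for A
  proof (rule sigma_sets_induct_disjoint[OF _ _ that])
    show "Int_stable ?E" by (auto simp: Int_stable_def box_Int_box)
    show "set_lebesgue_integral lborel A h = 0" if "A \<in> ?E" for A using that h_boxes by auto
    show "set_lebesgue_integral lborel (UNIV - A) h = 0"
      if A: "A \<in> sigma_sets UNIV ?E" and z: "set_lebesgue_integral lborel A h = 0" for A
    proof -
      have A': "A \<in> sets borel" using A sig by blast
      have "set_lebesgue_integral lborel (A \<union> (UNIV - A)) h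
        = set_lebesgue_integral lborel A h + set_lebesgue_integral lborel (UNIV - A) h"
        using A' by (intro set_integral_Un sint) auto
      moreover have "set_lebesgue_integral lborel (A \<union> (UNIV - A)) h = 0"
        using total by (simp add: set_lebesgue_integral_def)
      ultimately show ?thesis using z by simp
    qed
    show "set_lebesgue_integral lborel (\<Union>i::nat. A i) h = 0"
      if "disjoint_family A" and r: "range A \<subseteq> sigma_sets UNIV ?E"
        and z: "\<And>i. set_lebesgue_integral lborel (A i) h = 0" for A
    proof -
      have A': "A i \<in> sets borel" for i using r sig by blast
      have "set_lebesgue_integral lborel (\<Union>i. A i) h = (\<Sum>i. set_lebesgue_integral lborel (A i) h)"
        using A' \<open>disjoint_family A\<close>
        by (intro lebesgue_integral_countable_add sint) (auto simp: disjoint_family_on_def)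
      then show ?thesis using z by simp
    qed
  qed (auto simp: set_lebesgue_integral_def)
  then have "AE x in lborel. h x = 0"
    by (intro sigma_finite_measure.density_zero[OF lborel.sigma_finite_measure_axioms] h_int) (use sig in auto)
  then have "AE x in lebesgue. h x = 0" by (rule AE_completion)
  with gh' show ?thesis by eventually_elim simp
qed

text \<open>On a closed box in \<open>\<Omega>\<close> the function is integrable, and testing with bumps that converge to
  the indicators of smaller boxes shows that its integral over each of these vanishes. Countably
  many closed boxes cover \<open>\<Omega>\<close>.\<close>

theorem fundamental_lemma_calculus_of_variations:
  fixes G :: "'a::euclidean_space \<Rightarrow> 'b::euclidean_space"
  assumes \<Omega>: "open \<Omega>" and G: "locally_integrable \<Omega> G"
    and zero: "\<And>\<phi>. \<phi> \<in> test_functions \<Omega> \<Longrightarrow> (\<integral>x. \<phi> x *\<^sub>R G x \<partial>lebesgue_on \<Omega>) = 0"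
  shows "AE x in lebesgue_on \<Omega>. G x = 0"
proof -
  have \<Omega>_sets: "\<Omega> \<in> sets lebesgue" using \<Omega> by auto
  obtain \<D> where \<D>: "countable \<D>" "\<D> \<subseteq> Pow \<Omega>" "\<And>X. X \<in> \<D> \<Longrightarrow> \<exists>a b. X = cbox a b" "\<Union>\<D> = \<Omega>"
    using open_countable_Union_open_cbox[OF \<Omega>] by blast
  have box: "AE x in lebesgue. x \<in> cbox a b \<longrightarrow> G x = 0" if ab: "cbox a b \<subseteq> \<Omega>" for a b
  proof -
    define H where "H x = (if x \<in> cbox a b then G x else 0)" for x
    have "integrable (lebesgue_on (cbox a b)) G"
      using G ab compact_cbox by (auto simp: locally_integrable_def)
    then have H: "integrable lebesgue H" unfolding H_def
      by (subst Lebesgue_Measure.integrable_restrict_UNIV) auto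
    have Hbox: "(\<integral>x. indicator (box c d) x *\<^sub>R H x \<partial>lebesgue) = 0"
      if cd: "cbox c d \<subseteq> cbox a b" for c d
    proof -
      have sub: "cbox c d \<subseteq> \<Omega>" using cd ab by blast
      have "(\<lambda>n. \<integral>x. box_bump c d n x *\<^sub>R H x \<partial>lebesgue) \<longlonglongrightarrow> (\<integral>x. indicator (box c d) x *\<^sub>R H x \<partial>lebesgue)"
      proof (rule integral_dominated_convergence)
        show "integrable lebesgue (\<lambda>x. norm (H x))" using H by auto
        show "AE x in lebesgue. (\<lambda>n. box_bump c d n x *\<^sub>R H x) \<longlonglongrightarrow> indicator (box c d) x *\<^sub>R H x"
          by (intro AE_I2 tendsto_scaleR box_bump_tendsto tendsto_const)
        show "AE x in lebesgue. norm (box_bump c d n x *\<^sub>R H x) \<le> norm (H x)" for n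
          using box_bump_bounds[of c d n] by (intro AE_I2) (simp add: mult_left_le_one_le)
        have [measurable]: "H \<in> borel_measurable lebesgue" using H by auto
        show "(\<lambda>x. indicator (box c d) x *\<^sub>R H x) \<in> borel_measurable lebesgue"
          by (intro borel_measurable_scaleR borel_measurable_indicator) (auto)
        have "box_bump c d n \<in> borel_measurable borel" for n
          using test_functionsD(2)[OF box_bump_test_function[OF sub, of n]]
          by (rule borel_measurable_continuous_onI)
        then have "box_bump c d n \<in> borel_measurable lebesgue" for n
          by (rule borel_measurable_lebesgueI)
        then show "(\<lambda>x. box_bump c d n x *\<^sub>R H x) \<in> borel_measurable lebesgue" for n
          by (intro borel_measurable_scaleR) auto
      qed
      moreover have "(\<integral>x. box_bump c d n x *\<^sub>R H x \<partial>lebesgue) = 0" for n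
      proof -
        have "(\<lambda>x. if x \<in> \<Omega> then box_bump c d n x *\<^sub>R G x else 0) = (\<lambda>x. box_bump c d n x *\<^sub>R H x)"
          using box_bump_zero[of _ c d n] box_subset_cbox[of c d] cd ab by (fastforce simp: H_def)
        then show ?thesis
          using zero[OF box_bump_test_function[OF sub, of n]]
            Lebesgue_Measure.integral_restrict_UNIV[OF \<Omega>_sets, of "\<lambda>x. box_bump c d n x *\<^sub>R G x"] by simp
      qed
      ultimately show ?thesis by (simp add: LIMSEQ_const_iff)
    qed
    obtain R where R: "\<forall>x\<in>box a b. norm x \<le> R"
      using bounded_box[of a b] unfolding bounded_iff by blast
    have comp: "AE x in lebesgue. indicator (box a b) x * (H x \<bullet> i) = 0" for i
    proof (rule integral_zero_on_boxes_imp_AE_zero[where R = R])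
      have "integrable lebesgue (\<lambda>x. indicator (box a b) x *\<^sub>R (H x \<bullet> i))"
        using H by (intro integrable_mult_indicator integrable_inner_left) auto
      then show "integrable lebesgue (\<lambda>x. indicator (box a b) x * (H x \<bullet> i))" by simp
      show "indicator (box a b) x * (H x \<bullet> i) = 0" if "R < norm x" for x
        using R that by (auto simp: indicator_def)
      show "(\<integral>x. indicator (box c d) x *\<^sub>R (indicator (box a b) x * (H x \<bullet> i)) \<partial>lebesgue) = 0" for c d
      proof -
        obtain c' d' where c'd': "box c d \<inter> box a b = box c' d'" "cbox c' d' \<subseteq> cbox a b"
          using box_Int_box[of c d a b] Int_interval[of c d a b] by blast
        have "indicator (box c d) x *\<^sub>R (indicator (box a b) x * (H x \<bullet> i))
          = (indicator (box c' d') x *\<^sub>R H x) \<bullet> i" for x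
          using c'd'(1) by (auto simp: indicator_def)
        moreover have "integrable lebesgue (\<lambda>x. indicator (box c' d') x *\<^sub>R H x)"
          using H by (intro integrable_mult_indicator) auto
        ultimately show ?thesis
          using Hbox[OF c'd'(2)] by (simp only: integral_inner_left inner_zero_left)
      qed
    qed
    have "AE x in lebesgue. \<forall>i\<in>Basis. indicator (box a b) x * (H x \<bullet> i) = 0"
      by (rule AE_finite_allI[OF finite_Basis]) (rule comp)
    moreover have "AE x in lebesgue. x \<notin> cbox a b - box a b"
      using negligible_frontier_interval[of a b] unfolding negligible_iff_null_sets by (rule AE_not_in)
    ultimately show ?thesis
    proof eventually_elim
      case (elim x)
      show ?case
      proof
        assume x: "x \<in> cbox a b"
        then have "\<forall>i\<in>Basis. G x \<bullet> i = 0" using elim by (auto simp: H_def)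
        then show "G x = 0" by (simp add: euclidean_all_zero_iff)
      qed
    qed
  qed
  have "AE x in lebesgue. \<forall>X\<in>\<D>. x \<in> X \<longrightarrow> G x = 0"
    using \<D>(2,3) box by (subst AE_ball_countable[OF \<D>(1)]) blast
  then have "AE x in lebesgue. x \<in> \<Omega> \<longrightarrow> G x = 0"
    by eventually_elim (use \<D>(4) in blast)
  then show ?thesis using \<Omega>_sets by (simp add: AE_restrict_space_iff)
qed

lemma integrable_test_function_mult:
  fixes G :: "'a::euclidean_space \<Rightarrow> 'b::euclidean_space"
  assumes \<Omega>: "\<Omega> \<in> sets lebesgue" and G: "locally_integrable \<Omega> G" and \<phi>: "\<phi> \<in> test_functions \<Omega>"
  shows "integrable (lebesgue_on \<Omega>) (\<lambda>x. \<phi> x *\<^sub>R G x)"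
proof -
  define K where "K = closure {x. \<phi> x \<noteq> 0}"
  have K: "compact K" "K \<subseteq> \<Omega>" using \<phi> by (auto simp: test_functions_def K_def)
  then have K_sets: "K \<in> sets lebesgue" by (meson lmeasurable_compact fmeasurableD)
  have \<phi>0: "\<phi> x = 0" if "x \<notin> K" for x using grad_eq_0_outside(1)[of x \<phi>] that by (simp add: K_def)
  have "integrable (lebesgue_on K) G" using G K by (simp add: locally_integrable_def)
  then have GK: "integrable lebesgue (\<lambda>x. if x \<in> K then G x else 0)"
    by (subst Lebesgue_Measure.integrable_restrict_UNIV[OF K_sets])
  obtain C where C: "0 < C" "\<And>x. \<bar>\<phi> x\<bar> \<le> C" using test_function_bounded[OF \<phi>] by auto
  have [measurable]: "\<phi> \<in> borel_measurable lebesgue"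
    by (intro borel_measurable_lebesgueI borel_measurable_continuous_onI test_functionsD(2)[OF \<phi>])
  have "integrable lebesgue (\<lambda>x. \<phi> x *\<^sub>R (if x \<in> K then G x else 0))"
  proof (rule Bochner_Integration.integrable_bound)
    show "integrable lebesgue (\<lambda>x. C *\<^sub>R norm (if x \<in> K then G x else 0))" using GK by auto
    show "(\<lambda>x. \<phi> x *\<^sub>R (if x \<in> K then G x else 0)) \<in> borel_measurable lebesgue"
      using borel_measurable_integrable[OF GK] by (intro borel_measurable_scaleR) auto
    show "AE x in lebesgue. norm (\<phi> x *\<^sub>R (if x \<in> K then G x else 0)) \<le> norm (C *\<^sub>R norm (if x \<in> K then G x else 0))"
      using C by (intro AE_I2) (auto intro!: mult_mono)
  qed
  moreover have "(\<lambda>x. \<phi> x *\<^sub>R (if x \<in> K then G x else 0)) = (\<lambda>x. if x \<in> \<Omega> then \<phi> x *\<^sub>R G x else 0)"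
    using K(2) \<phi>0 by fastforce
  ultimately show ?thesis
    using Lebesgue_Measure.integrable_restrict_UNIV[OF \<Omega>, of "\<lambda>x. \<phi> x *\<^sub>R G x"] by (simp only:)
qed

lemma integrable_lebesgue_on_subset:
  fixes G :: "'a::euclidean_space \<Rightarrow> 'b::euclidean_space"
  assumes "integrable (lebesgue_on \<Omega>) G" "K \<subseteq> \<Omega>" "K \<in> sets lebesgue" "\<Omega> \<in> sets lebesgue"
  shows "integrable (lebesgue_on K) G"
proof -
  have "integrable lebesgue (\<lambda>x. indicator K x *\<^sub>R (if x \<in> \<Omega> then G x else 0))"
    using assms Lebesgue_Measure.integrable_restrict_UNIV[OF assms(4), of G]
    by (intro integrable_mult_indicator) auto
  moreover have "(\<lambda>x. indicator K x *\<^sub>R (if x \<in> \<Omega> then G x else 0)) = (\<lambda>x. if x \<in> K then G x else 0)"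
    using assms(2) by (auto simp: indicator_def fun_eq_iff)
  ultimately show ?thesis
    using Lebesgue_Measure.integrable_restrict_UNIV[OF assms(3), of G] by (simp only:)
qed

text \<open>On a finite measure space this bounds the integral of \<open>|v|\<close> by that of \<open>|v|\<^sup>p\<close>. The factor
  \<open>e\<^sup>1\<^sup>-\<^sup>p\<close> is the price for an additive error \<open>e\<close> as small as desired, so that convergence to
  \<open>0\<close> is inherited too.\<close>

lemma le_add_powr:
  fixes t e p :: real
  assumes "0 \<le> t" "0 < e" "1 \<le> p"
  shows "t \<le> e + e powr (1 - p) * t powr p"
proof (cases "t \<le> e")
  case True
  then show ?thesis using assms by (simp add: add_increasing2)
next
  case False
  then have "1 \<le> t / e" using assms by simp
  then have "(t / e) powr 1 \<le> (t / e) powr p" using assms by (intro powr_mono) auto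
  then have "t / e \<le> (t / e) powr p" using assms by (simp add: powr_one)
  also have "\<dots> = t powr p / e powr p" using assms by (simp add: powr_divide)
  finally have "t \<le> e * (t powr p / e powr p)" using assms by (simp add: field_simps)
  also have "\<dots> = e powr (1 - p) * t powr p" using assms by (simp add: powr_diff)
  finally show ?thesis using assms by simp
qed

lemma p_integrable_integrable:
  fixes v :: "'a \<Rightarrow> 'b::euclidean_space"
  assumes M: "finite_measure M" and p: "1 \<le> p" and v: "p_integrable M p v"
  shows "integrable M v"
proof -
  interpret finite_measure M by fact
  show ?thesis
  proof (rule Bochner_Integration.integrable_bound)
    show "integrable M (\<lambda>x. 1 + norm (v x) powr p)" using v by (auto simp: p_integrable_def)
    show "v \<in> borel_measurable M" using v by (simp add: p_integrable_def)
    show "AE x in M. norm (v x) \<le> norm (1 + norm (v x) powr p)"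
    proof (intro AE_I2)
      fix x show "norm (v x) \<le> norm (1 + norm (v x) powr p)" using le_add_powr[of "norm (v x)" 1 p] p by simp
    qed
  qed
qed

text \<open>Convergence in \<open>L\<^sup>p\<close> implies convergence in \<open>L\<^sup>1\<close> when the measure is finite: integrate
  \<open>le_add_powr\<close>, with \<open>e\<close> chosen first and the index afterwards.\<close>

lemma integral_norm_tendsto_0_of_energy:
  fixes v :: "nat \<Rightarrow> 'a \<Rightarrow> 'b::euclidean_space"
  assumes M: "finite_measure M" and p: "1 \<le> p" and v: "\<And>n. p_integrable M p (v n)"
    and lim: "(\<lambda>n. energy M p (v n)) \<longlonglongrightarrow> 0"
  shows "(\<lambda>n. \<integral>x. norm (v n x) \<partial>M) \<longlonglongrightarrow> 0"
proof -
  interpret finite_measure M by fact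
  note int = p_integrable_integrable[OF M p v]
  show "(\<lambda>n. \<integral>x. norm (v n x) \<partial>M) \<longlonglongrightarrow> 0"
  proof (rule LIMSEQ_I)
    fix r :: real assume r: "0 < r"
    define m where "m = measure M (space M) + 1"
    have m: "0 < m" by (simp add: m_def add_nonneg_pos)
    define e where "e = r / (2 * m)"
    have e: "0 < e" using r m by (simp add: e_def)
    define c where "c = e powr (1 - p)"
    have c: "0 < c" using e by (simp add: c_def)
    obtain N where N: "\<And>n. N \<le> n \<Longrightarrow> energy M p (v n) < r / (2 * c)"
      using order_tendstoD(2)[OF lim, of "r / (2 * c)"] r c unfolding eventually_sequentially by auto
    show "\<exists>N. \<forall>n\<ge>N. norm ((\<integral>x. norm (v n x) \<partial>M) - 0) < r"
    proof (intro exI allI impI)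
      fix n assume n: "N \<le> n"
      have "(\<integral>x. norm (v n x) \<partial>M) \<le> (\<integral>x. e + c * norm (v n x) powr p \<partial>M)"
        using v[of n] int[of n] le_add_powr[OF norm_ge_zero e p] by (intro integral_mono) (auto simp: p_integrable_def c_def)
      also have "\<dots> = e * measure M (space M) + c * energy M p (v n)"
        using v[of n] by (simp add: p_integrable_def energy_def)
      also have "\<dots> < e * m + c * (r / (2 * c))"
        using N[OF n] c e by (intro add_strict_mono mult_strict_left_mono) (auto simp: m_def)
      also have "\<dots> = r" using c m by (simp add: e_def)
      finally show "norm ((\<integral>x. norm (v n x) \<partial>M) - 0) < r" by simp
    qed
  qed
qed

lemma integral_tendsto_of_energy:
  fixes v :: "nat \<Rightarrow> 'a \<Rightarrow> 'b::euclidean_space" and s :: "nat \<Rightarrow> 'a \<Rightarrow> 'c::euclidean_space"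
  assumes M: "finite_measure M" and p: "1 \<le> p" and v: "\<And>n. p_integrable M p (v n)"
    and lim: "(\<lambda>n. energy M p (v n)) \<longlonglongrightarrow> 0"
    and s: "\<And>n. integrable M (s n)" and S: "integrable M S"
    and le: "\<And>n x. norm (s n x - S x) \<le> C * norm (v n x)"
  shows "(\<lambda>n. \<integral>x. s n x \<partial>M) \<longlonglongrightarrow> (\<integral>x. S x \<partial>M)"
proof (rule Lim_null_comparison[THEN LIM_zero_cancel])
  show "(\<lambda>n. C * (\<integral>x. norm (v n x) \<partial>M)) \<longlonglongrightarrow> 0"
    using integral_norm_tendsto_0_of_energy[OF M p v lim] by (rule tendsto_mult_right_zero)
  have "norm ((\<integral>x. s n x \<partial>M) - (\<integral>x. S x \<partial>M)) \<le> C * (\<integral>x. norm (v n x) \<partial>M)" for n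
  proof -
    have "norm ((\<integral>x. s n x \<partial>M) - (\<integral>x. S x \<partial>M)) = norm (\<integral>x. s n x - S x \<partial>M)" using s S by simp
    also have "\<dots> \<le> (\<integral>x. norm (s n x - S x) \<partial>M)" by (rule integral_norm_bound)
    also have "\<dots> \<le> (\<integral>x. C * norm (v n x) \<partial>M)"
      using s S le p_integrable_integrable[OF M p v] by (intro integral_mono) auto
    finally show ?thesis by simp
  qed
  then show "\<forall>\<^sub>F n in sequentially. norm ((\<integral>x. s n x \<partial>M) - (\<integral>x. S x \<partial>M)) \<le> C * (\<integral>x. norm (v n x) \<partial>M)"
    by (intro always_eventually allI)
qed

locale sobolev_domain =
  fixes \<Omega> :: "'a::euclidean_space set" and p :: real
  assumes open_\<Omega>: "open \<Omega>" and bounded_\<Omega>: "bounded \<Omega>" and p: "1 < p"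
begin

abbreviation "M \<equiv> lebesgue_on \<Omega>"
abbreviation "in_Lp \<equiv> p_integrable M p"
abbreviation "en \<equiv> energy M p"
abbreviation "dist_en u v \<equiv> en (\<lambda>x. u x - v x)"
abbreviation weak_gradient (\<open>\<nabla>\<close>) where "\<nabla> \<equiv> weak_grad \<Omega>"
abbreviation "tests \<equiv> test_functions \<Omega>"
abbreviation "W0 \<equiv> W01p \<Omega> p"

lemma \<Omega>_sets: "\<Omega> \<in> sets lebesgue" using open_\<Omega> by auto

lemma finite_M: "finite_measure M"
  using open_\<Omega> bounded_\<Omega> by (intro finite_measure_lebesgue_on bounded_set_imp_lmeasurable) auto

lemma integrable_M_bounded:
  fixes u :: "'a \<Rightarrow> 'b::euclidean_space"
  assumes "u \<in> borel_measurable M" "\<And>x. norm (u x) \<le> C"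
  shows "integrable M u"
proof -
  interpret finite_measure M by (rule finite_M)
  show ?thesis by (rule integrable_const_bound[where B = C]) (use assms in auto)
qed

lemma borel_measurable_M:
  fixes u :: "'a \<Rightarrow> 'b::euclidean_space"
  shows "u \<in> borel_measurable borel \<Longrightarrow> u \<in> borel_measurable M"
  by (intro measurable_restrict_space1 borel_measurable_lebesgueI)

lemma p_integrable_M_bounded:
  fixes u :: "'a \<Rightarrow> 'b::euclidean_space"
  assumes [measurable]: "u \<in> borel_measurable M" and "\<And>x. norm (u x) \<le> C"
  shows "in_Lp u"
proof -
  have "integrable M (\<lambda>x. norm (u x) powr p)"
    by (rule integrable_M_bounded[where C = "C powr p"]) (use assms(2) p in \<open>auto intro!: powr_mono2\<close>)
  then show ?thesis using assms by (simp add: p_integrable_def)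
qed

lemma p_integrable_imp_integrable:
  fixes u :: "'a \<Rightarrow> 'b::euclidean_space"
  assumes "in_Lp u"
  shows "integrable M u"
  using p_integrable_integrable[OF finite_M _ assms] p by simp

lemma integrable_imp_locally_integrable:
  fixes u :: "'a \<Rightarrow> 'b::euclidean_space"
  assumes "integrable M u"
  shows "locally_integrable \<Omega> u"
  unfolding locally_integrable_def
  using integrable_lebesgue_on_subset[OF assms _ _ \<Omega>_sets] by (meson lmeasurable_compact fmeasurableD)

lemma p_integrable_imp_locally_integrable:
  fixes u :: "'a \<Rightarrow> 'b::euclidean_space"
  assumes "in_Lp u"
  shows "locally_integrable \<Omega> u"
  using assms by (intro integrable_imp_locally_integrable p_integrable_imp_integrable)

lemma test_function_p_integrable:
  assumes "\<phi> \<in> tests"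
  shows "in_Lp \<phi>" "in_Lp (grad \<phi>)"
proof -
  obtain C where C: "\<And>x. norm (\<phi> x) \<le> C" "\<And>x. norm (grad \<phi> x) \<le> C"
    using test_function_bounded[OF assms] by auto
  show "in_Lp \<phi>" "in_Lp (grad \<phi>)"
    using test_functionsD[OF assms] C
    by (auto intro!: p_integrable_M_bounded borel_measurable_M borel_measurable_continuous_onI)
qed

lemma integrable_scaleR_grad_test:
  fixes u :: "'a \<Rightarrow> real"
  assumes u: "integrable M u" and \<phi>: "\<phi> \<in> tests"
  shows "integrable M (\<lambda>x. u x *\<^sub>R grad \<phi> x)"
proof -
  obtain C where C: "0 < C" "\<And>x. norm (grad \<phi> x) \<le> C"
    using test_function_bounded[OF \<phi>] by auto
  show ?thesis
  proof (rule Bochner_Integration.integrable_bound)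
    show "integrable M (\<lambda>x. C * norm (u x))" using u by auto
    show "(\<lambda>x. u x *\<^sub>R grad \<phi> x) \<in> borel_measurable M"
      using borel_measurable_M[OF borel_measurable_continuous_onI[OF test_functionsD(3)[OF \<phi>]]] u
      by (intro borel_measurable_scaleR) auto
    show "AE x in M. norm (u x *\<^sub>R grad \<phi> x) \<le> norm (C * norm (u x))"
    proof (rule AE_I2)
      fix x
      have "\<bar>u x\<bar> * norm (grad \<phi> x) \<le> \<bar>u x\<bar> * C" by (intro mult_left_mono C) auto
      then show "norm (u x *\<^sub>R grad \<phi> x) \<le> norm (C * norm (u x))" using C(1) by (simp add: abs_mult mult.commute)
    qed
  qed
qed

text \<open>The difference of two weak gradients integrates to \<open>0\<close> against every test function.\<close>

lemma weak_grad_unique: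
  assumes "is_weak_grad \<Omega> u G" "is_weak_grad \<Omega> v H" "AE x in M. u x = v x"
    and "integrable M u" "integrable M v"
  shows "AE x in M. G x = H x"
proof -
  have loc: "locally_integrable \<Omega> G" "locally_integrable \<Omega> H"
    using assms by (auto simp: is_weak_grad_def)
  have "AE x in M. G x - H x = 0"
  proof (rule fundamental_lemma_calculus_of_variations[OF open_\<Omega>])
    show "locally_integrable \<Omega> (\<lambda>x. G x - H x)" using loc by (auto simp: locally_integrable_def)
    fix \<phi> assume \<phi>: "\<phi> \<in> tests"
    have "(\<integral>x. u x *\<^sub>R grad \<phi> x \<partial>M) = (\<integral>x. v x *\<^sub>R grad \<phi> x \<partial>M)"
    proof (rule integral_cong_AE)
      show "AE x in M. u x *\<^sub>R grad \<phi> x = v x *\<^sub>R grad \<phi> x" using assms(3) by eventually_elim simp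
    qed (use integrable_scaleR_grad_test[OF _ \<phi>] assms in auto)
    then have "(\<integral>x. \<phi> x *\<^sub>R G x \<partial>M) = (\<integral>x. \<phi> x *\<^sub>R H x \<partial>M)"
      using assms(1,2) \<phi> by (simp add: is_weak_grad_def)
    then show "(\<integral>x. \<phi> x *\<^sub>R (G x - H x) \<partial>M) = 0"
      using integrable_test_function_mult[OF \<Omega>_sets loc(1) \<phi>] integrable_test_function_mult[OF \<Omega>_sets loc(2) \<phi>]
      by (simp add: scaleR_diff_right)
  qed
  then show ?thesis by eventually_elim simp
qed

text \<open>The defined weak gradient is a choice among functions that agree almost everywhere, so it
  inherits the integrability of any one of them.\<close>

lemma W1pI:
  assumes "in_Lp u" "in_Lp G" "is_weak_grad \<Omega> u G"
  shows "u \<in> W1p \<Omega> p" "AE x in M. \<nabla> u x = G x"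
    "is_weak_grad \<Omega> u (\<nabla> u)" "in_Lp (\<nabla> u)"
proof -
  show "u \<in> W1p \<Omega> p" using assms by (auto simp: W1p_def Lp_iff_p_integrable)
  show wg: "is_weak_grad \<Omega> u (\<nabla> u)"
    unfolding weak_grad_def using assms(3) by (rule someI[of "is_weak_grad \<Omega> u"])
  show ae: "AE x in M. \<nabla> u x = G x"
    using p_integrable_imp_integrable[OF assms(1)] by (intro weak_grad_unique[OF wg assms(3)]) auto
  have "\<nabla> u \<in> borel_measurable M"
  proof (rule borel_measurable_lebesgue_on_AE_cong[OF \<Omega>_sets])
    show "G \<in> borel_measurable M" using assms(2) by (simp add: p_integrable_def)
    show "AE x in M. G x = \<nabla> u x" using ae by eventually_elim simp
  qed
  then show "in_Lp (\<nabla> u)"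
    by (rule p_integrable_dominated[OF assms(2)]) (use ae p in \<open>auto elim: eventually_mono\<close>)
qed

lemma W1pD:
  assumes "u \<in> W1p \<Omega> p"
  shows "in_Lp u" "is_weak_grad \<Omega> u (\<nabla> u)" "in_Lp (\<nabla> u)"
proof -
  obtain G where G: "in_Lp u" "in_Lp G" "is_weak_grad \<Omega> u G"
    using assms by (auto simp: W1p_def Lp_iff_p_integrable)
  with W1pI[OF G] show "in_Lp u" "is_weak_grad \<Omega> u (\<nabla> u)"
    "in_Lp (\<nabla> u)" by auto
qed

lemma W1p_linear_combination:
  assumes u: "u \<in> W1p \<Omega> p" and v: "v \<in> W1p \<Omega> p"
  shows "(\<lambda>x. c * u x + d * v x) \<in> W1p \<Omega> p"
    "AE x in M. \<nabla> (\<lambda>x. c * u x + d * v x) x = c *\<^sub>R \<nabla> u x + d *\<^sub>R \<nabla> v x"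
proof -
  note uD = W1pD[OF u] and vD = W1pD[OF v]
  let ?w = "\<lambda>x. c * u x + d * v x" and ?G = "\<lambda>x. c *\<^sub>R \<nabla> u x + d *\<^sub>R \<nabla> v x"
  have w: "in_Lp ?w"
    using p_integrable_add[OF p_integrable_scaleR[OF uD(1), of c] p_integrable_scaleR[OF vD(1), of d]] p by simp
  have G: "in_Lp ?G"
    using p by (intro p_integrable_add p_integrable_scaleR uD vD) auto
  have "is_weak_grad \<Omega> ?w ?G"
    unfolding is_weak_grad_def
  proof (intro conjI ballI)
    fix \<phi> assume \<phi>: "\<phi> \<in> tests"
    note i1 = integrable_scaleR_grad_test[OF p_integrable_imp_integrable[OF uD(1)] \<phi>]
      integrable_scaleR_grad_test[OF p_integrable_imp_integrable[OF vD(1)] \<phi>]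
    note i2 = integrable_test_function_mult[OF \<Omega>_sets p_integrable_imp_locally_integrable[OF uD(3)] \<phi>]
      integrable_test_function_mult[OF \<Omega>_sets p_integrable_imp_locally_integrable[OF vD(3)] \<phi>]
    have "(\<integral>x. ?w x *\<^sub>R grad \<phi> x \<partial>M) = (\<integral>x. c *\<^sub>R (u x *\<^sub>R grad \<phi> x) + d *\<^sub>R (v x *\<^sub>R grad \<phi> x) \<partial>M)"
      by (simp add: scaleR_add_left)
    also have "\<dots> = c *\<^sub>R (\<integral>x. u x *\<^sub>R grad \<phi> x \<partial>M) + d *\<^sub>R (\<integral>x. v x *\<^sub>R grad \<phi> x \<partial>M)"
      using i1 by (simp only: Bochner_Integration.integral_add integrable_scaleR_right integral_scaleR_right)
    also have "\<dots> = - (c *\<^sub>R (\<integral>x. \<phi> x *\<^sub>R \<nabla> u x \<partial>M) + d *\<^sub>R (\<integral>x. \<phi> x *\<^sub>R \<nabla> v x \<partial>M))"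
      using uD(2) vD(2) \<phi> by (simp add: is_weak_grad_def)
    also have "\<dots> = - (\<integral>x. c *\<^sub>R (\<phi> x *\<^sub>R \<nabla> u x) + d *\<^sub>R (\<phi> x *\<^sub>R \<nabla> v x) \<partial>M)"
      using i2 by (simp only: Bochner_Integration.integral_add integrable_scaleR_right integral_scaleR_right)
    also have "(\<lambda>x. c *\<^sub>R (\<phi> x *\<^sub>R \<nabla> u x) + d *\<^sub>R (\<phi> x *\<^sub>R \<nabla> v x)) = (\<lambda>x. \<phi> x *\<^sub>R ?G x)"
      by (simp add: scaleR_add_right mult.commute)
    finally show "(\<integral>x. ?w x *\<^sub>R grad \<phi> x \<partial>M) = - (\<integral>x. \<phi> x *\<^sub>R ?G x \<partial>M)" .
  qed (use w G in \<open>auto intro: p_integrable_imp_locally_integrable\<close>)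
  from W1pI[OF w G this] show "?w \<in> W1p \<Omega> p" "AE x in M. \<nabla> ?w x = ?G x" by auto
qed

lemma test_function_W1p:
  assumes \<phi>: "\<phi> \<in> tests"
  shows "\<phi> \<in> W1p \<Omega> p" "AE x in M. \<nabla> \<phi> x = grad \<phi> x"
proof -
  have "is_weak_grad \<Omega> \<phi> (grad \<phi>)"
    unfolding is_weak_grad_def
    using test_function_p_integrable[OF \<phi>] test_functions_integration_by_parts[OF \<phi> _ \<Omega>_sets]
    by (auto intro: p_integrable_imp_locally_integrable)
  from W1pI[OF test_function_p_integrable[OF \<phi>] this]
  show "\<phi> \<in> W1p \<Omega> p" "AE x in M. \<nabla> \<phi> x = grad \<phi> x" by auto
qed

lemma W1p_norm_eq_energy:
  "W1p_norm \<Omega> p u = (en u + en (\<nabla> u)) powr (1 / p)"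
proof -
  have "Lp_norm \<Omega> p u powr p = en u"
    using p energy_nonneg[of M p u] unfolding Lp_norm_def energy_def[symmetric] by (simp add: powr_powr)
  moreover have "Lp_norm \<Omega> p (\<nabla> u) powr p = en (\<nabla> u)"
    using p energy_nonneg[of M p "\<nabla> u"] by (simp add: Lp_norm_def energy_def[symmetric] powr_powr)
  ultimately show ?thesis by (simp add: W1p_norm_def)
qed

text \<open>The weak gradient of a difference is only almost everywhere the difference of the
  gradients, and the classical gradient of a test function only almost everywhere its weak
  gradient; integrals do not see this.\<close>

lemma energy_weak_grad_diff_test:
  assumes u: "u \<in> W1p \<Omega> p" and \<phi>: "\<phi> \<in> tests"
  shows "en (\<nabla> (\<lambda>x. u x - \<phi> x)) = dist_en (\<nabla> u) (grad \<phi>)"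
proof (rule energy_cong_AE)
  note l = W1p_linear_combination[OF u test_function_W1p(1)[OF \<phi>], of 1 "-1"]
  then show "\<nabla> (\<lambda>x. u x - \<phi> x) \<in> borel_measurable M"
    using W1pD(3) by (auto simp: p_integrable_def)
  show "AE x in M. \<nabla> (\<lambda>x. u x - \<phi> x) x = \<nabla> u x - grad \<phi> x"
    using l(2) test_function_W1p(2)[OF \<phi>] by eventually_elim simp
  show "(\<lambda>x. \<nabla> u x - grad \<phi> x) \<in> borel_measurable M"
    using W1pD(3)[OF u] test_function_p_integrable(2)[OF \<phi>] by (auto simp: p_integrable_def)
qed

text \<open>All estimates are made with \<open>energy\<close>. The norm in the definition of the space is the
  \<open>p\<close>-th root of the sum of two energies, so a bound \<open>e\<close> for one corresponds to a bound \<open>e\<^sup>p\<close>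
  for the other.\<close>

lemma W01p_iff:
  "u \<in> W0 \<longleftrightarrow> u \<in> W1p \<Omega> p \<and> (\<forall>e>0. \<exists>\<phi>\<in>tests.
     dist_en u \<phi> + dist_en (\<nabla> u) (grad \<phi>) < e)"
proof -
  have *: "W1p_norm \<Omega> p (\<lambda>x. u x - \<phi> x) < e \<longleftrightarrow>
     dist_en u \<phi> + dist_en (\<nabla> u) (grad \<phi>) < e powr p"
    if "u \<in> W1p \<Omega> p" "\<phi> \<in> tests" "0 < e" for \<phi> e
  proof -
    let ?E = "dist_en u \<phi> + dist_en (\<nabla> u) (grad \<phi>)"
    have E: "0 \<le> ?E" by (simp add: energy_nonneg)
    have "W1p_norm \<Omega> p (\<lambda>x. u x - \<phi> x) = ?E powr (1 / p)"
      using that by (simp add: W1p_norm_eq_energy energy_weak_grad_diff_test)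
    moreover have "?E powr (1 / p) < e \<longleftrightarrow> ?E < e powr p"
    proof
      assume "?E powr (1 / p) < e"
      then have "(?E powr (1 / p)) powr p < e powr p" using p by (intro powr_less_mono2) auto
      then show "?E < e powr p" using p E by (simp add: powr_powr)
    next
      assume "?E < e powr p"
      then have "?E powr (1 / p) < (e powr p) powr (1 / p)" using p E by (intro powr_less_mono2) auto
      then show "?E powr (1 / p) < e" using p \<open>0 < e\<close> by (simp add: powr_powr)
    qed
    ultimately show ?thesis by simp
  qed
  show ?thesis
  proof
    assume u: "u \<in> W0"
    then have u1: "u \<in> W1p \<Omega> p" by (simp add: W01p_def)
    show "u \<in> W1p \<Omega> p \<and> (\<forall>e>0. \<exists>\<phi>\<in>tests.
     dist_en u \<phi> + dist_en (\<nabla> u) (grad \<phi>) < e)"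
    proof (intro conjI allI impI u1)
      fix e :: real assume e: "0 < e"
      then have "0 < e powr (1 / p)" by simp
      then obtain \<phi> where \<phi>: "\<phi> \<in> tests" "W1p_norm \<Omega> p (\<lambda>x. u x - \<phi> x) < e powr (1 / p)"
        using u unfolding W01p_def by blast
      have "(e powr (1 / p)) powr p = e" using p e by (simp add: powr_powr)
      with *[OF u1 \<phi>(1) \<open>0 < e powr (1 / p)\<close>] \<phi>
      show "\<exists>\<phi>\<in>tests. dist_en u \<phi> + dist_en (\<nabla> u) (grad \<phi>) < e"
        by auto
    qed
  next
    assume R: "u \<in> W1p \<Omega> p \<and> (\<forall>e>0. \<exists>\<phi>\<in>tests.
     dist_en u \<phi> + dist_en (\<nabla> u) (grad \<phi>) < e)"
    show "u \<in> W0" unfolding W01p_def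
    proof (intro CollectI conjI allI impI)
      show "u \<in> W1p \<Omega> p" using R by simp
      fix e :: real assume e: "0 < e"
      then have "0 < e powr p" by simp
      with R obtain \<phi> where "\<phi> \<in> tests"
        "dist_en u \<phi> + dist_en (\<nabla> u) (grad \<phi>) < e powr p" by blast
      with *[OF _ _ e] R show "\<exists>\<phi>\<in>tests. W1p_norm \<Omega> p (\<lambda>x. u x - \<phi> x) < e" by blast
    qed
  qed
qed

lemma W01pD:
  assumes "u \<in> W0"
  shows "u \<in> W1p \<Omega> p" "in_Lp u" "is_weak_grad \<Omega> u (\<nabla> u)" "in_Lp (\<nabla> u)"
  using assms W1pD by (auto simp: W01p_def)

lemma test_function_W01p:
  assumes "\<phi> \<in> tests"
  shows "\<phi> \<in> W0"
  unfolding W01p_iff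
proof (intro conjI allI impI test_function_W1p assms)
  fix e :: real assume "0 < e"
  moreover have "dist_en (\<nabla> \<phi>) (grad \<phi>) = en (\<lambda>x. 0 :: 'a)"
  proof (rule energy_cong_AE)
    show "AE x in M. \<nabla> \<phi> x - grad \<phi> x = 0"
      using test_function_W1p(2)[OF assms] by eventually_elim simp
    show "(\<lambda>x. \<nabla> \<phi> x - grad \<phi> x) \<in> borel_measurable M"
      using W1pD(3)[OF test_function_W1p(1)[OF assms]] test_function_p_integrable(2)[OF assms] by (auto simp: p_integrable_def)
  qed auto
  ultimately show "\<exists>\<psi>\<in>tests. dist_en \<phi> \<psi> + dist_en (\<nabla> \<phi>) (grad \<psi>) < e"
    using assms by (intro bexI[of _ \<phi>]) (auto simp: energy_def)
qed

lemma W01p_linear_combination: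
  assumes u: "u \<in> W0" and v: "v \<in> W0"
  shows "(\<lambda>x. c * u x + d * v x) \<in> W0"
    "AE x in M. \<nabla> (\<lambda>x. c * u x + d * v x) x = c *\<^sub>R \<nabla> u x + d *\<^sub>R \<nabla> v x"
proof -
  note uD = W01pD[OF u] and vD = W01pD[OF v]
  note l = W1p_linear_combination[OF uD(1) vD(1), of c d]
  show "AE x in M. \<nabla> (\<lambda>x. c * u x + d * v x) x = c *\<^sub>R \<nabla> u x + d *\<^sub>R \<nabla> v x" by fact
  show "(\<lambda>x. c * u x + d * v x) \<in> W0"
    unfolding W01p_iff
  proof (intro conjI allI impI l(1))
    fix e :: real assume e: "0 < e"
    define k where "k = 2 powr p * (\<bar>c\<bar> powr p + \<bar>d\<bar> powr p + 1)"
    have k: "0 < k" unfolding k_def by (intro mult_pos_pos add_nonneg_pos) auto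
    define e' where "e' = e / k"
    have e': "0 < e'" using e k by (simp add: e'_def)
    obtain \<phi> where \<phi>: "\<phi> \<in> tests"
      "dist_en u \<phi> + dist_en (\<nabla> u) (grad \<phi>) < e'"
      using u e' unfolding W01p_iff by blast
    obtain \<psi> where \<psi>: "\<psi> \<in> tests"
      "dist_en v \<psi> + dist_en (\<nabla> v) (grad \<psi>) < e'"
      using v e' unfolding W01p_iff by blast
    let ?\<theta> = "\<lambda>x. c * \<phi> x + d * \<psi> x"
    have p0: "0 \<le> p" using p by simp
    note pi = test_function_p_integrable[OF \<phi>(1)] test_function_p_integrable[OF \<psi>(1)]
    have A: "en (\<lambda>x. c * u x + d * v x - ?\<theta> x)
      \<le> 2 powr p * (\<bar>c\<bar> powr p * dist_en u \<phi> + \<bar>d\<bar> powr p * dist_en v \<psi>)"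
    proof -
      have "(\<lambda>x. c * u x + d * v x - ?\<theta> x) = (\<lambda>x. c *\<^sub>R (u x - \<phi> x) + d *\<^sub>R (v x - \<psi> x))"
        by (simp add: fun_eq_iff algebra_simps)
      then show ?thesis
        using energy_linear_combination_le[OF p_integrable_diff[OF uD(2) pi(1) p0] p_integrable_diff[OF vD(2) pi(3) p0] p0, of c d]
        by (simp only:)
    qed
    have B: "dist_en (\<nabla> (\<lambda>x. c * u x + d * v x)) (grad ?\<theta>)
      \<le> 2 powr p * (\<bar>c\<bar> powr p * dist_en (\<nabla> u) (grad \<phi>) + \<bar>d\<bar> powr p * dist_en (\<nabla> v) (grad \<psi>))"
    proof -
      let ?R = "\<lambda>x. c *\<^sub>R (\<nabla> u x - grad \<phi> x) + d *\<^sub>R (\<nabla> v x - grad \<psi> x)"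
      have R: "in_Lp ?R"
        using p0 by (intro p_integrable_add p_integrable_scaleR p_integrable_diff uD vD pi)
      have th: "?\<theta> \<in> tests" by (rule test_functions_linear_combination[OF \<phi>(1) \<psi>(1)])
      have "dist_en (\<nabla> (\<lambda>x. c * u x + d * v x)) (grad ?\<theta>) = en ?R"
      proof (rule energy_cong_AE)
        show "AE x in M. \<nabla> (\<lambda>x. c * u x + d * v x) x - grad ?\<theta> x = ?R x"
          using l(2) by eventually_elim
            (simp add: grad_linear_combination test_functionsD(1)[OF \<phi>(1)] test_functionsD(1)[OF \<psi>(1)] algebra_simps)
        show "(\<lambda>x. \<nabla> (\<lambda>x. c * u x + d * v x) x - grad ?\<theta> x) \<in> borel_measurable M"
          using W1pD(3)[OF l(1)] test_function_p_integrable(2)[OF th] by (auto simp: p_integrable_def)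
        show "?R \<in> borel_measurable M" using R by (simp add: p_integrable_def)
      qed
      then show ?thesis
        using energy_linear_combination_le[OF p_integrable_diff[OF uD(4) pi(2) p0] p_integrable_diff[OF vD(4) pi(4) p0] p0, of c d]
        by (simp only:)
    qed
    let ?a = "dist_en u \<phi> + dist_en (\<nabla> u) (grad \<phi>)"
    let ?b = "dist_en v \<psi> + dist_en (\<nabla> v) (grad \<psi>)"
    have "en (\<lambda>x. c * u x + d * v x - ?\<theta> x) + dist_en (\<nabla> (\<lambda>x. c * u x + d * v x)) (grad ?\<theta>)
      \<le> 2 powr p * (\<bar>c\<bar> powr p * ?a + \<bar>d\<bar> powr p * ?b)"
      using A B by (simp add: algebra_simps)
    also have "\<dots> \<le> 2 powr p * (\<bar>c\<bar> powr p * e' + \<bar>d\<bar> powr p * e')"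
      using \<phi>(2) \<psi>(2) by (intro mult_left_mono add_mono) auto
    also have "\<dots> < k * e'" using e' by (simp add: k_def algebra_simps)
    also have "\<dots> = e" using k by (simp add: e'_def)
    finally show "\<exists>\<theta>\<in>tests. en (\<lambda>x. c * u x + d * v x - \<theta> x)
        + dist_en (\<nabla> (\<lambda>x. c * u x + d * v x)) (grad \<theta>) < e"
      by (intro bexI[of _ ?\<theta>] test_functions_linear_combination[OF \<phi>(1) \<psi>(1)])
  qed
qed

text \<open>Convergence in \<open>L\<^sup>p\<close> implies convergence in \<open>L\<^sup>1\<close> on the bounded set \<open>\<Omega>\<close>, so both sides of
  the identity that defines weak gradients pass to the limit; a diagonal choice then gives
  approximation by test functions.\<close>

lemma W01p_closed:
  assumes w: "\<And>n. w n \<in> W0" and u: "in_Lp u" and H: "in_Lp H"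
    and wu: "(\<lambda>n. dist_en (w n) u) \<longlonglongrightarrow> 0"
    and wH: "(\<lambda>n. dist_en (\<nabla> (w n)) H) \<longlonglongrightarrow> 0"
  shows "u \<in> W0" "AE x in M. \<nabla> u x = H x"
proof -
  note wD = W01pD[OF w]
  have p0: "0 \<le> p" "1 \<le> p" using p by auto
  have d1: "in_Lp (\<lambda>x. w n x - u x)" for n by (rule p_integrable_diff[OF wD(2) u p0(1)])
  have d2: "in_Lp (\<lambda>x. \<nabla> (w n) x - H x)" for n by (rule p_integrable_diff[OF wD(4) H p0(1)])
  have "is_weak_grad \<Omega> u H"
    unfolding is_weak_grad_def
  proof (intro conjI ballI p_integrable_imp_locally_integrable u H)
    fix \<phi> assume \<phi>: "\<phi> \<in> tests"
    obtain C where C: "0 < C" "\<And>x. \<bar>\<phi> x\<bar> \<le> C" "\<And>x. norm (grad \<phi> x) \<le> C"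
      using test_function_bounded[OF \<phi>] by auto
    note iu = integrable_scaleR_grad_test[OF p_integrable_imp_integrable[OF u] \<phi>]
    note iw = integrable_scaleR_grad_test[OF p_integrable_imp_integrable[OF wD(2)] \<phi>]
    note iH = integrable_test_function_mult[OF \<Omega>_sets p_integrable_imp_locally_integrable[OF H] \<phi>]
    note ig = integrable_test_function_mult[OF \<Omega>_sets p_integrable_imp_locally_integrable[OF wD(4)] \<phi>]
    have l1: "(\<lambda>n. \<integral>x. w n x *\<^sub>R grad \<phi> x \<partial>M) \<longlonglongrightarrow> (\<integral>x. u x *\<^sub>R grad \<phi> x \<partial>M)"
    proof (rule integral_tendsto_of_energy[OF finite_M p0(2) d1 wu iw iu])
      show "norm (w n x *\<^sub>R grad \<phi> x - u x *\<^sub>R grad \<phi> x) \<le> C * norm (w n x - u x)" for n x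
        using mult_right_mono[OF C(3)[of x], of "\<bar>w n x - u x\<bar>"]
        by (simp add: scaleR_diff_left[symmetric] mult.commute)
    qed
    have l2: "(\<lambda>n. \<integral>x. \<phi> x *\<^sub>R \<nabla> (w n) x \<partial>M) \<longlonglongrightarrow> (\<integral>x. \<phi> x *\<^sub>R H x \<partial>M)"
    proof (rule integral_tendsto_of_energy[OF finite_M p0(2) d2 wH ig iH])
      show "norm (\<phi> x *\<^sub>R \<nabla> (w n) x - \<phi> x *\<^sub>R H x) \<le> C * norm (\<nabla> (w n) x - H x)" for n x
        using C(2)[of x] by (auto simp: scaleR_diff_right[symmetric] intro: mult_right_mono)
    qed
    have "(\<integral>x. w n x *\<^sub>R grad \<phi> x \<partial>M) = - (\<integral>x. \<phi> x *\<^sub>R \<nabla> (w n) x \<partial>M)" for n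
      using wD(3)[of n] \<phi> by (simp add: is_weak_grad_def)
    then show "(\<integral>x. u x *\<^sub>R grad \<phi> x \<partial>M) = - (\<integral>x. \<phi> x *\<^sub>R H x \<partial>M)"
      using LIMSEQ_unique[OF l1] tendsto_minus[OF l2] by simp
  qed
  note I = W1pI[OF u H this]
  show ae: "AE x in M. \<nabla> u x = H x" by (rule I(2))
  show "u \<in> W0"
    unfolding W01p_iff
  proof (intro conjI allI impI I(1))
    fix e :: real assume e: "0 < e"
    define e' where "e' = e / (4 * 2 powr p)"
    have e': "0 < e'" using e by (simp add: e'_def)
    have "\<forall>\<^sub>F n in sequentially. dist_en (w n) u < e' \<and> dist_en (\<nabla> (w n)) H < e'"
      using order_tendstoD(2)[OF wu e'] order_tendstoD(2)[OF wH e'] by eventually_elim simp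
    then obtain n where n: "dist_en (w n) u < e'" "dist_en (\<nabla> (w n)) H < e'"
      using eventually_happens'[OF sequentially_bot] by blast
    obtain \<phi> where \<phi>: "\<phi> \<in> tests"
      "dist_en (w n) \<phi> + dist_en (\<nabla> (w n)) (grad \<phi>) < e'"
      using w[of n] e' unfolding W01p_iff by blast
    note pi = test_function_p_integrable[OF \<phi>(1)]
    have "dist_en (\<nabla> u) (grad \<phi>) = dist_en H (grad \<phi>)"
    proof (rule energy_cong_AE)
      show "AE x in M. \<nabla> u x - grad \<phi> x = H x - grad \<phi> x" using ae by eventually_elim simp
    qed (use I(4) H pi in \<open>auto simp: p_integrable_def\<close>)
    also have "\<dots> \<le> 2 powr p * (dist_en H (\<nabla> (w n)) + dist_en (\<nabla> (w n)) (grad \<phi>))"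
      by (rule energy_triangle[OF H wD(4) pi(2) p0(1)])
    finally have a: "dist_en (\<nabla> u) (grad \<phi>) \<le> 2 powr p * (dist_en (\<nabla> (w n)) H + dist_en (\<nabla> (w n)) (grad \<phi>))"
      by (simp only: energy_minus_commute[of M p H])
    have b: "dist_en u \<phi> \<le> 2 powr p * (dist_en (w n) u + dist_en (w n) \<phi>)"
      using energy_triangle[OF u wD(2) pi(1) p0(1), of n] by (simp only: energy_minus_commute[of M p u])
    have "dist_en u \<phi> + dist_en (\<nabla> u) (grad \<phi>)
      \<le> 2 powr p * (dist_en (w n) u + dist_en (\<nabla> (w n)) H +
         (dist_en (w n) \<phi> + dist_en (\<nabla> (w n)) (grad \<phi>)))"
      using a b by (simp add: algebra_simps)
    also have "\<dots> < 2 powr p * (e' + e' + e')"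
      using n \<phi>(2) by (intro mult_strict_left_mono) auto
    also have "\<dots> < e" using e by (simp add: e'_def)
    finally show "\<exists>\<phi>\<in>tests. dist_en u \<phi> + dist_en (\<nabla> u) (grad \<phi>) < e"
      using \<phi>(1) by blast
  qed
qed

end

section \<open>The Sobolev inequality\<close>

text \<open>Concavity of the logarithm, when no factor vanishes.\<close>

lemma weighted_geometric_le_arithmetic_mean:
  fixes a w :: "'i \<Rightarrow> real"
  assumes S: "finite S" and w: "\<And>j. j \<in> S \<Longrightarrow> 0 < w j" "sum w S = 1"
    and a: "\<And>j. j \<in> S \<Longrightarrow> 0 \<le> a j"
  shows "(\<Prod>j\<in>S. a j powr w j) \<le> (\<Sum>j\<in>S. w j * a j)"
proof (cases "\<exists>j\<in>S. a j = 0")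
  case True
  then have "(\<Prod>j\<in>S. a j powr w j) = 0" using S by (intro prod_zero) auto
  also have "\<dots> \<le> (\<Sum>j\<in>S. w j * a j)"
    using w(1) a by (intro sum_nonneg mult_nonneg_nonneg) (auto simp: less_imp_le)
  finally show ?thesis .
next
  case False
  then have pos: "0 < a j" if "j \<in> S" for j using a that by (metis order_le_imp_less_or_eq)
  have S0: "S \<noteq> {}" using w(2) by auto
  have "(\<Sum>j\<in>S. w j * ln (a j)) \<le> ln (\<Sum>j\<in>S. w j *\<^sub>R a j)"
    using concave_on_sum[OF S S0 ln_concave w(2), of a] pos w(1) by (auto simp: less_imp_le)
  moreover have "0 < (\<Sum>j\<in>S. w j * a j)"
    using S S0 pos w(1) by (intro sum_pos) auto
  ultimately have "exp (\<Sum>j\<in>S. w j * ln (a j)) \<le> (\<Sum>j\<in>S. w j * a j)"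
    by (simp add: ln_ge_iff)
  moreover have "exp (\<Sum>j\<in>S. w j * ln (a j)) = (\<Prod>j\<in>S. a j powr w j)"
    using S pos by (subst exp_sum) (auto intro!: prod.cong simp: powr_def less_imp_neq[symmetric])
  ultimately show ?thesis by simp
qed

text \<open>Hoelder's inequality for finitely many factors with exponents \<open>1 / w\<^sub>j\<close>. Normalise each
  \<open>h\<^sub>j\<close> to have integral 1 and integrate the pointwise inequality of the weighted means. The
  left side is a nonnegative integral since integrability of the product is part of the
  conclusion.\<close>

lemma Hoelder_prod:
  fixes h :: "'i \<Rightarrow> 'a \<Rightarrow> real" and w :: "'i \<Rightarrow> real"
  assumes S: "finite S" and w: "\<And>j. j \<in> S \<Longrightarrow> 0 < w j" "sum w S = 1"
    and h: "\<And>j. j \<in> S \<Longrightarrow> integrable M (h j)" "\<And>j x. j \<in> S \<Longrightarrow> 0 \<le> h j x"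
  shows "(\<integral>\<^sup>+x. ennreal (\<Prod>j\<in>S. h j x powr w j) \<partial>M) \<le> ennreal (\<Prod>j\<in>S. (\<integral>x. h j x \<partial>M) powr w j)"
proof (cases "\<exists>j\<in>S. (\<integral>x. h j x \<partial>M) = 0")
  case True
  then obtain j where j: "j \<in> S" "(\<integral>x. h j x \<partial>M) = 0" by blast
  have "AE x in M. h j x = 0"
    using j h by (subst (asm) integral_nonneg_eq_0_iff_AE) auto
  then have "AE x in M. ennreal (\<Prod>j\<in>S. h j x powr w j) = 0"
  proof eventually_elim
    case (elim x)
    then have "(\<Prod>j\<in>S. h j x powr w j) = 0" using S j(1) by (intro prod_zero) auto
    then show ?case by simp
  qed
  then have "(\<integral>\<^sup>+x. ennreal (\<Prod>j\<in>S. h j x powr w j) \<partial>M) = (\<integral>\<^sup>+x. 0 \<partial>M)" by (rule nn_integral_cong_AE)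
  then show ?thesis by simp
next
  case False
  define c where "c j = (\<integral>x. h j x \<partial>M)" for j
  have c: "0 < c j" if "j \<in> S" for j
  proof -
    have "0 \<le> c j" unfolding c_def using h(2)[OF that] by (intro Bochner_Integration.integral_nonneg) auto
    with False that show ?thesis by (auto simp: c_def order_le_less)
  qed
  have cne: "c j \<noteq> 0" if "j \<in> S" for j using c[OF that] by simp
  define P where "P = (\<Prod>j\<in>S. c j powr w j)"
  have P: "0 < P" unfolding P_def using cne by (intro prod_pos) auto
  have le: "(\<Prod>j\<in>S. h j x powr w j) \<le> P * (\<Sum>j\<in>S. w j * (h j x / c j))" for x
  proof -
    have "(\<Prod>j\<in>S. (h j x / c j) powr w j) \<le> (\<Sum>j\<in>S. w j * (h j x / c j))"
      using S w h(2) c by (intro weighted_geometric_le_arithmetic_mean) (auto intro: divide_nonneg_pos)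
    moreover have "(\<Prod>j\<in>S. (h j x / c j) powr w j) = (\<Prod>j\<in>S. h j x powr w j) / P"
      unfolding P_def prod_dividef[symmetric] using h(2) c by (intro prod.cong) (auto simp: powr_divide less_imp_le)
    ultimately have "(\<Prod>j\<in>S. h j x powr w j) / P \<le> (\<Sum>j\<in>S. w j * (h j x / c j))" by simp
    then show ?thesis using P by (simp only: pos_divide_le_eq mult.commute)
  qed
  have int: "integrable M (\<lambda>x. P * (\<Sum>j\<in>S. w j * (h j x / c j)))"
    using h(1) by (intro integrable_mult_right integrable_sum integrable_divide) auto
  have "(\<integral>\<^sup>+x. ennreal (\<Prod>j\<in>S. h j x powr w j) \<partial>M) \<le> (\<integral>\<^sup>+x. ennreal (P * (\<Sum>j\<in>S. w j * (h j x / c j))) \<partial>M)"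
    using le by (intro nn_integral_mono ennreal_leI)
  also have "\<dots> = ennreal (\<integral>x. P * (\<Sum>j\<in>S. w j * (h j x / c j)) \<partial>M)"
    using P w(1) h(2) c
    by (intro nn_integral_eq_integral int AE_I2 mult_nonneg_nonneg sum_nonneg divide_nonneg_pos) (auto simp: less_imp_le)
  also have "(\<integral>x. P * (\<Sum>j\<in>S. w j * (h j x / c j)) \<partial>M) = P * (\<Sum>j\<in>S. \<integral>x. w j * (h j x / c j) \<partial>M)"
    using h(1) by (subst integral_mult_right_zero, subst Bochner_Integration.integral_sum) auto
  also have "(\<Sum>j\<in>S. \<integral>x. w j * (h j x / c j) \<partial>M) = (\<Sum>j\<in>S. w j * (c j / c j))"
    unfolding c_def by (intro sum.cong refl) (simp only: integral_mult_right_zero integral_divide_zero)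
  also have "(\<Sum>j\<in>S. w j * (c j / c j)) = sum w S"
    using c by (intro sum.cong refl) (metis divide_self less_irrefl mult.right_neutral)
  finally show ?thesis using w(2) by (simp add: P_def c_def)
qed

text \<open>A power with the convention \<open>0\<^sup>0 = 1\<close>, which \<open>powr\<close> does not follow. It is needed because
  the exponent of \<open>f\<close> in \<open>grid_lines_inequality\<close> vanishes in the case of interest, where the
  factor must disappear.\<close>

definition wpow :: "real \<Rightarrow> real \<Rightarrow> real" where
  "wpow y a = (if a = 0 then 1 else y powr a)"

text \<open>Functions on a product of lines that are measurable, bounded and supported in a cube. The
  class is closed under integrating out a coordinate, and for its members all iterated integrals
  exist.\<close>

definition boxed :: "'i set \<Rightarrow> real \<Rightarrow> real \<Rightarrow> (('i \<Rightarrow> real) \<Rightarrow> real) \<Rightarrow> bool" where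
  "boxed I R C f \<longleftrightarrow> f \<in> borel_measurable (Pi\<^sub>M I (\<lambda>_. lborel)) \<and>
     (\<forall>x\<in>space (Pi\<^sub>M I (\<lambda>_. lborel)). 0 \<le> f x \<and> f x \<le> C \<and> ((\<exists>i\<in>I. R < \<bar>x i\<bar>) \<longrightarrow> f x = 0))"

interpretation lborel_product: product_sigma_finite "\<lambda>_. lborel :: real measure"
  by standard

lemma integrable_lborel_bounded_support:
  fixes F :: "real \<Rightarrow> real"
  assumes "F \<in> borel_measurable borel" "\<And>y. 0 \<le> F y" "\<And>y. F y \<le> C" "\<And>y. R < \<bar>y\<bar> \<Longrightarrow> F y = 0" "0 \<le> R"
  shows "integrable lborel F" "(\<integral>y. F y \<partial>lborel) \<le> 2 * R * C"
proof -
  have C: "0 \<le> C" using assms(2,3) order_trans by blast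
  have i: "integrable lborel (\<lambda>y. C * indicator {-R..R} y :: real)"
    using \<open>0 \<le> R\<close> by (intro integrable_mult_right integrable_real_indicator) auto
  have le: "F y \<le> C * indicator {-R..R} y" for y
    using assms(3)[of y] assms(4)[of y] C by (cases "\<bar>y\<bar> \<le> R") (auto simp: indicator_def abs_le_iff)
  show int: "integrable lborel F"
    by (rule Bochner_Integration.integrable_bound[OF i]) (use assms le C in \<open>auto simp: abs_mult\<close>)
  have "(\<integral>y. F y \<partial>lborel) \<le> (\<integral>y. C * indicator {-R..R} y \<partial>lborel)"
    by (rule integral_mono[OF int i le])
  then show "(\<integral>y. F y \<partial>lborel) \<le> 2 * R * C" using \<open>0 \<le> R\<close> by (simp add: mult.commute mult.left_commute)
qed

lemma boxed_integrable:
  assumes I: "finite I" and f: "boxed I R C f" and R: "0 \<le> R"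
  shows "integrable (Pi\<^sub>M I (\<lambda>_. lborel)) f"
proof -
  let ?B = "Pi\<^sub>E I (\<lambda>_. {-R..R})"
  have B: "?B \<in> sets (Pi\<^sub>M I (\<lambda>_. lborel))" by (intro sets_PiM_I_finite I) auto
  have eB: "emeasure (Pi\<^sub>M I (\<lambda>_. lborel)) ?B < \<infinity>"
    using I R by (subst lborel_product.emeasure_PiM) (auto simp: ennreal_power less_top[symmetric] ennreal_mult_eq_top_iff)
  show ?thesis
  proof (rule Bochner_Integration.integrable_bound)
    show "integrable (Pi\<^sub>M I (\<lambda>_. lborel)) (\<lambda>x. C * indicator ?B x :: real)"
      using B eB by (intro integrable_mult_right integrable_real_indicator) auto
    show "f \<in> borel_measurable (Pi\<^sub>M I (\<lambda>_. lborel))" using f by (simp add: boxed_def)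
    show "AE x in Pi\<^sub>M I (\<lambda>_. lborel). norm (f x) \<le> norm (C * indicator ?B x)"
    proof (rule AE_I2)
      fix x assume x: "x \<in> space (Pi\<^sub>M I (\<lambda>_. lborel :: real measure))"
      then have fx: "0 \<le> f x" "f x \<le> C" "(\<exists>i\<in>I. R < \<bar>x i\<bar>) \<Longrightarrow> f x = 0"
        using f by (auto simp: boxed_def)
      show "norm (f x) \<le> norm (C * indicator ?B x)"
      proof (cases "x \<in> ?B")
        case False
        then have "\<exists>i\<in>I. \<not> (- R \<le> x i \<and> x i \<le> R)" using x by (auto simp: space_PiM PiE_def Pi_def)
        then have "\<exists>i\<in>I. R < \<bar>x i\<bar>" by (metis abs_le_iff minus_le_iff not_less)
        then show ?thesis using fx by simp
      qed (use fx in auto)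
    qed
  qed
qed

lemma fun_upd_in_space_PiM:
  "x \<in> space (Pi\<^sub>M I (\<lambda>_. lborel :: real measure)) \<Longrightarrow> x(i := y) \<in> space (Pi\<^sub>M (insert i I) (\<lambda>_. lborel :: real measure))"
  by (auto simp: space_PiM PiE_def extensional_def)

lemma boxed_partial_integral:
  assumes I: "finite I" "i \<notin> I" and f: "boxed (insert i I) R C f" and R: "0 \<le> R"
  shows "boxed I R (2 * R * C) (\<lambda>x. \<integral>y. f (x(i := y)) \<partial>lborel)"
    and "\<And>x. x \<in> space (Pi\<^sub>M I (\<lambda>_. lborel)) \<Longrightarrow> integrable lborel (\<lambda>y. f (x(i := y)))"
proof -
  have [measurable]: "f \<in> borel_measurable (Pi\<^sub>M (insert i I) (\<lambda>_. lborel))" using f by (simp add: boxed_def)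
  have m: "(\<lambda>y. f (x(i := y))) \<in> borel_measurable borel" if "x \<in> space (Pi\<^sub>M I (\<lambda>_. lborel))" for x
  proof -
    have "(\<lambda>y. x(i := y)) \<in> lborel \<rightarrow>\<^sub>M Pi\<^sub>M (insert i I) (\<lambda>_. lborel)"
      using that by (intro measurable_fun_upd[where J = I]) auto
    then show ?thesis by measurable
  qed
  have *: "integrable lborel (\<lambda>y. f (x(i := y)))" "(\<integral>y. f (x(i := y)) \<partial>lborel) \<le> 2 * R * C"
    if "x \<in> space (Pi\<^sub>M I (\<lambda>_. lborel))" for x
    using integrable_lborel_bounded_support[OF m[OF that], of C R] R f fun_upd_in_space_PiM[OF that, of i]
    by (auto simp: boxed_def)
  show "boxed I R (2 * R * C) (\<lambda>x. \<integral>y. f (x(i := y)) \<partial>lborel)"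
    unfolding boxed_def
  proof (intro conjI ballI impI)
    have "(\<lambda>(x, y). x(i := y)) \<in> Pi\<^sub>M I (\<lambda>_. lborel) \<Otimes>\<^sub>M lborel \<rightarrow>\<^sub>M Pi\<^sub>M (insert i I) (\<lambda>_. lborel :: real measure)"
      by (rule measurable_add_dim)
    then have "(\<lambda>(x, y). f (x(i := y))) \<in> borel_measurable (Pi\<^sub>M I (\<lambda>_. lborel) \<Otimes>\<^sub>M lborel)"
      by (simp add: case_prod_beta')
    then show "(\<lambda>x. \<integral>y. f (x(i := y)) \<partial>lborel) \<in> borel_measurable (Pi\<^sub>M I (\<lambda>_. lborel))"
      by (rule lborel.borel_measurable_lebesgue_integral)
    fix x assume x: "x \<in> space (Pi\<^sub>M I (\<lambda>_. lborel :: real measure))"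
    note xs = fun_upd_in_space_PiM[OF x, of i]
    show "0 \<le> (\<integral>y. f (x(i := y)) \<partial>lborel)"
      using f xs by (intro Bochner_Integration.integral_nonneg) (auto simp: boxed_def)
    show "(\<integral>y. f (x(i := y)) \<partial>lborel) \<le> 2 * R * C" using *[OF x] by simp
    assume "\<exists>j\<in>I. R < \<bar>x j\<bar>"
    then obtain j where j: "j \<in> I" "R < \<bar>x j\<bar>" by blast
    then have "j \<noteq> i" using I by auto
    have "f (x(i := y)) = 0" for y
      using f xs[of y] j \<open>j \<noteq> i\<close> unfolding boxed_def by (metis fun_upd_other insertCI)
    then show "(\<integral>y. f (x(i := y)) \<partial>lborel) = 0" by simp
  qed
  show "\<And>x. x \<in> space (Pi\<^sub>M I (\<lambda>_. lborel)) \<Longrightarrow> integrable lborel (\<lambda>y. f (x(i := y)))" using * by blast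
qed

lemma boxed_two_integrals_swap:
  assumes I: "i \<notin> I" "j \<in> I" and f: "boxed (insert i I) R C f" and R: "0 \<le> R"
    and x: "x \<in> space (Pi\<^sub>M I (\<lambda>_. lborel))"
  shows "integrable lborel (\<lambda>y. \<integral>t. f (x(i := y, j := t)) \<partial>lborel)"
    "(\<integral>y. (\<integral>t. f (x(i := y, j := t)) \<partial>lborel) \<partial>lborel) = (\<integral>t. (\<integral>y. f (x(j := t, i := y)) \<partial>lborel) \<partial>lborel)"
proof -
  let ?F = "\<lambda>(y, t). f (x(i := y, j := t))"
  have [measurable]: "f \<in> borel_measurable (Pi\<^sub>M (insert i I) (\<lambda>_. lborel))" using f by (simp add: boxed_def)
  have ij: "i \<noteq> j" "insert j (insert i I) = insert i I" using I by auto
  have "(\<lambda>z. x(i := fst z)) \<in> lborel \<Otimes>\<^sub>M lborel \<rightarrow>\<^sub>M Pi\<^sub>M (insert i I) (\<lambda>_. lborel :: real measure)"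
    using x by (intro measurable_fun_upd[where J = I]) auto
  then have "(\<lambda>z. x(i := fst z, j := snd z)) \<in> lborel \<Otimes>\<^sub>M lborel \<rightarrow>\<^sub>M Pi\<^sub>M (insert i I) (\<lambda>_. lborel :: real measure)"
    using I by (intro measurable_fun_upd[where J = "insert i I" and f = "\<lambda>z. x(i := fst z)"]) auto
  then have m: "?F \<in> borel_measurable (lborel \<Otimes>\<^sub>M lborel)" by (simp add: case_prod_beta')
  have s: "x(i := y, j := t) \<in> space (Pi\<^sub>M (insert i I) (\<lambda>_. lborel))" for y t
    using fun_upd_in_space_PiM[OF fun_upd_in_space_PiM[OF x, of i y], of j t] ij by simp
  have v: "0 \<le> f (x(i := y, j := t))" "f (x(i := y, j := t)) \<le> C"
    "R < \<bar>y\<bar> \<or> R < \<bar>t\<bar> \<Longrightarrow> f (x(i := y, j := t)) = 0" for y t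
  proof -
    show "0 \<le> f (x(i := y, j := t))" "f (x(i := y, j := t)) \<le> C" using f s[of y t] by (auto simp: boxed_def)
    assume "R < \<bar>y\<bar> \<or> R < \<bar>t\<bar>"
    then have "\<exists>k\<in>insert i I. R < \<bar>(x(i := y, j := t)) k\<bar>" using ij I by auto
    then show "f (x(i := y, j := t)) = 0" using f s[of y t] unfolding boxed_def by blast
  qed
  have C: "0 \<le> C" using v(1,2) order_trans by blast
  have int: "integrable (lborel \<Otimes>\<^sub>M lborel) ?F"
  proof (rule Bochner_Integration.integrable_bound[OF _ m])
    have "emeasure (lborel \<Otimes>\<^sub>M lborel) ({-R..R} \<times> {-R..R}) < \<infinity>"
      using R by (subst lborel.emeasure_pair_measure_Times) (auto simp: ennreal_mult_less_top)
    then show "integrable (lborel \<Otimes>\<^sub>M lborel) (\<lambda>z. C * indicator ({-R..R} \<times> {-R..R}) z :: real)"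
      by (intro integrable_mult_right integrable_real_indicator) auto
    show "AE z in lborel \<Otimes>\<^sub>M lborel. norm (?F z) \<le> norm (C * indicator ({-R..R} \<times> {-R..R}) z)"
    proof (rule AE_I2)
      fix z :: "real \<times> real"
      obtain y t where z: "z = (y, t)" by (cases z)
      show "norm (?F z) \<le> norm (C * indicator ({-R..R} \<times> {-R..R}) z)"
      proof (cases "R < \<bar>y\<bar> \<or> R < \<bar>t\<bar>")
        case True
        then show ?thesis using v(3)[OF True] by (simp add: z)
      next
        case False
        then have "z \<in> {-R..R} \<times> {-R..R}" by (auto simp: z abs_le_iff not_less)
        then show ?thesis using v(1,2)[of y t] C by (simp add: z)
      qed
    qed
  qed
  show "integrable lborel (\<lambda>y. \<integral>t. f (x(i := y, j := t)) \<partial>lborel)"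
    using lborel_pair.integrable_fst[OF int] by simp
  have "(\<integral>y. (\<integral>t. f (x(i := y, j := t)) \<partial>lborel) \<partial>lborel) = (\<integral>t. (\<integral>y. f (x(i := y, j := t)) \<partial>lborel) \<partial>lborel)"
    using lborel_pair.Fubini_integral[OF int] by simp
  then show "(\<integral>y. (\<integral>t. f (x(i := y, j := t)) \<partial>lborel) \<partial>lborel) = (\<integral>t. (\<integral>y. f (x(j := t, i := y)) \<partial>lborel) \<partial>lborel)"
    using ij(1) by (simp add: fun_upd_twist)
qed

text \<open>For \<open>p = 1 / (n - 1)\<close>, where \<open>n\<close> is the number of coordinates, the first factor disappears
  and this is Gagliardo's inequality \<open>\<integral> \<Prod>\<^sub>i (\<integral> f dx\<^sub>i)\<^sup>p \<le> (\<integral> f)\<^sup>1\<^sup>+\<^sup>p\<close>. The additional power of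
  \<open>f\<close> makes an induction on the coordinates possible. Integrate out the coordinate \<open>i\<close> and let
  \<open>g\<close> be the integral of \<open>f\<close> over it. The line integral in direction \<open>i\<close> is \<open>g\<close>, which does not
  depend on that coordinate; to the remaining factors apply Hoelder's inequality with weight
  \<open>1 - m p\<close> on \<open>f\<close> and \<open>p\<close> on each of the \<open>m\<close> other line integrals, whose integrals are the line
  integrals of \<open>g\<close>. The powers of \<open>g\<close> add up to \<open>1 - (m - 1) p\<close>, which is the claim for \<open>g\<close> on
  the remaining \<open>m\<close> coordinates.\<close>

lemma grid_lines_inequality:
  fixes f :: "('i \<Rightarrow> real) \<Rightarrow> real"
  assumes "finite I" "0 < p" "(real (card I) - 1) * p \<le> 1" "boxed I R C f" "0 \<le> R"
  shows "(\<integral>\<^sup>+x. ennreal (wpow (f x) (1 - (real (card I) - 1) * p) *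
      (\<Prod>i\<in>I. (\<integral>t. f (x(i := t)) \<partial>lborel) powr p)) \<partial>Pi\<^sub>M I (\<lambda>_. lborel))
    \<le> ennreal ((\<integral>x. f x \<partial>Pi\<^sub>M I (\<lambda>_. lborel)) powr (1 + p))"
  using assms
proof (induction I arbitrary: f C rule: finite_induct)
  case empty
  then have "wpow (f x) (1 + p) = f x powr (1 + p)" for x by (simp add: wpow_def)
  then show ?case
    by (simp add: PiM_empty nn_integral_count_space_finite lebesgue_integral_count_space_finite)
next
  case (insert i I)
  note f = \<open>boxed (insert i I) R C f\<close> and R = \<open>0 \<le> R\<close>
  define m where "m = real (card I)"
  have card: "real (card (insert i I)) - 1 = m" using insert.hyps by (simp add: m_def)
  have mp: "m * p \<le> 1" using insert.prems(2) card by simp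
  define g where "g x = (\<integral>y. f (x(i := y)) \<partial>lborel)" for x
  have g: "boxed I R (2 * R * C) g" unfolding g_def
    by (rule boxed_partial_integral(1)[OF insert.hyps f R])
  have [measurable]: "f \<in> borel_measurable (Pi\<^sub>M (insert i I) (\<lambda>_. lborel))" using f by (simp add: boxed_def)
  let ?h = "\<lambda>z. wpow (f z) (1 - m * p) * (\<Prod>j\<in>insert i I. (\<integral>t. f (z(j := t)) \<partial>lborel) powr p)"
  have h_meas: "?h \<in> borel_measurable (Pi\<^sub>M (insert i I) (\<lambda>_. lborel))"
  proof -
    have "(\<lambda>z. \<integral>t. f (z(j := t)) \<partial>lborel) \<in> borel_measurable (Pi\<^sub>M (insert i I) (\<lambda>_. lborel))"
      if j: "j \<in> insert i I" for j
    proof (rule lborel.borel_measurable_lebesgue_integral)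
      have "(\<lambda>z. (fst z)(j := snd z)) \<in> Pi\<^sub>M (insert i I) (\<lambda>_. lborel) \<Otimes>\<^sub>M lborel \<rightarrow>\<^sub>M Pi\<^sub>M (insert i I) (\<lambda>_. lborel :: real measure)"
        using j by (intro measurable_fun_upd[where J = "insert i I"]) auto
      then show "(\<lambda>(z, t). f (z(j := t))) \<in> borel_measurable (Pi\<^sub>M (insert i I) (\<lambda>_. lborel) \<Otimes>\<^sub>M lborel)"
        by (simp add: case_prod_beta')
    qed
    moreover have "(\<lambda>z. wpow (f z) (1 - m * p)) \<in> borel_measurable (Pi\<^sub>M (insert i I) (\<lambda>_. lborel))"
      unfolding wpow_def by simp
    ultimately show ?thesis by (intro borel_measurable_times borel_measurable_prod powr_real_measurable) auto
  qed
  have inner: "(\<integral>\<^sup>+y. ennreal (?h (x(i := y))) \<partial>lborel)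
    \<le> ennreal (wpow (g x) (1 - (m - 1) * p) * (\<Prod>j\<in>I. (\<integral>t. g (x(j := t)) \<partial>lborel) powr p))"
    if x: "x \<in> space (Pi\<^sub>M I (\<lambda>_. lborel))" for x
  proof -
    define k where "k j y = (\<integral>t. f (x(i := y, j := t)) \<partial>lborel)" for j y
    have xs: "x(i := y) \<in> space (Pi\<^sub>M (insert i I) (\<lambda>_. lborel))" for y by (rule fun_upd_in_space_PiM[OF x])
    have f0: "0 \<le> f (x(i := y))" for y using f xs[of y] by (auto simp: boxed_def)
    have k0: "0 \<le> k j y" if "j \<in> I" for j y
    proof -
      have "x(i := y, j := t) \<in> space (Pi\<^sub>M (insert i I) (\<lambda>_. lborel))" for t
        using fun_upd_in_space_PiM[OF xs[of y], of j t] that by (simp add: insert_absorb)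
      then show ?thesis unfolding k_def using f by (intro Bochner_Integration.integral_nonneg) (auto simp: boxed_def)
    qed
    have kint: "integrable lborel (k j)" "(\<integral>y. k j y \<partial>lborel) = (\<integral>t. g (x(j := t)) \<partial>lborel)" if "j \<in> I" for j
      using boxed_two_integrals_swap[OF insert.hyps(2) that f R x] unfolding k_def g_def by auto
    have fint: "integrable lborel (\<lambda>y. f (x(i := y)))" by (rule boxed_partial_integral(2)[OF insert.hyps f R x])
    have g0: "0 \<le> g x" using g x by (auto simp: boxed_def)
    have h_eq: "?h (x(i := y)) = g x powr p * (wpow (f (x(i := y))) (1 - m * p) * (\<Prod>j\<in>I. k j y powr p))" for y
    proof -
      have "(\<Prod>j\<in>insert i I. (\<integral>t. f ((x(i := y))(j := t)) \<partial>lborel) powr p)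
        = g x powr p * (\<Prod>j\<in>I. k j y powr p)"
        using insert.hyps by (simp add: g_def k_def)
      then show ?thesis by simp
    qed
    have H: "(\<integral>\<^sup>+y. ennreal (wpow (f (x(i := y))) (1 - m * p) * (\<Prod>j\<in>I. k j y powr p)) \<partial>lborel)
      \<le> ennreal (wpow (g x) (1 - m * p) * (\<Prod>j\<in>I. (\<integral>y. k j y \<partial>lborel) powr p))"
    proof (cases "1 - m * p = 0")
      case True
      then have "(\<Sum>j\<in>I. p) = 1" by (simp add: m_def)
      from Hoelder_prod[OF insert.hyps(1) _ this kint(1) k0] True
      show ?thesis using \<open>0 < p\<close> by (simp add: wpow_def)
    next
      case False
      \<comment> \<open>The index set of the factors is the coordinates with one extra index for the power of
        \<open>f\<close>.\<close>
      let ?H = "\<lambda>j y. case j of None \<Rightarrow> f (x(i := y)) | Some j \<Rightarrow> k j y"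
      let ?w = "\<lambda>j. case j of None \<Rightarrow> 1 - m * p | Some j \<Rightarrow> p"
      have "sum ?w (insert None (Some ` I)) = 1"
        using insert.hyps(1) by (simp add: sum.reindex m_def)
      moreover have "finite (insert None (Some ` I))" using insert.hyps(1) by simp
      moreover have "0 < ?w j" if "j \<in> insert None (Some ` I)" for j
        using that False mp \<open>0 < p\<close> by auto
      moreover have "integrable lborel (?H j)" if "j \<in> insert None (Some ` I)" for j
        using that fint kint(1) by auto
      moreover have "0 \<le> ?H j y" if "j \<in> insert None (Some ` I)" for j y
        using that f0 k0 by auto
      ultimately have "(\<integral>\<^sup>+y. ennreal (\<Prod>j\<in>insert None (Some ` I). ?H j y powr ?w j) \<partial>lborel)
        \<le> ennreal (\<Prod>j\<in>insert None (Some ` I). (\<integral>y. ?H j y \<partial>lborel) powr ?w j)"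
        by (intro Hoelder_prod) blast+
      then show ?thesis using insert.hyps(1) False
        by (simp add: prod.reindex wpow_def g_def)
    qed
    have "(\<integral>\<^sup>+y. ennreal (?h (x(i := y))) \<partial>lborel)
      = (\<integral>\<^sup>+y. ennreal (g x powr p) * ennreal (wpow (f (x(i := y))) (1 - m * p) * (\<Prod>j\<in>I. k j y powr p)) \<partial>lborel)"
      unfolding h_eq by (subst ennreal_mult') auto
    also have "\<dots> = ennreal (g x powr p) * (\<integral>\<^sup>+y. ennreal (wpow (f (x(i := y))) (1 - m * p) * (\<Prod>j\<in>I. k j y powr p)) \<partial>lborel)"
    proof (rule nn_integral_cmult)
      have "(\<lambda>y. wpow (f (x(i := y))) (1 - m * p)) \<in> borel_measurable lborel"
        unfolding wpow_def using fint by auto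
      moreover have "(\<lambda>y. \<Prod>j\<in>I. k j y powr p) \<in> borel_measurable lborel"
        using kint(1) by (intro borel_measurable_prod powr_real_measurable) auto
      ultimately show "(\<lambda>y. ennreal (wpow (f (x(i := y))) (1 - m * p) * (\<Prod>j\<in>I. k j y powr p))) \<in> borel_measurable lborel"
        by auto
    qed
    also have "\<dots> \<le> ennreal (g x powr p) * ennreal (wpow (g x) (1 - m * p) * (\<Prod>j\<in>I. (\<integral>y. k j y \<partial>lborel) powr p))"
      by (intro mult_left_mono H) auto
    also have "\<dots> = ennreal (g x powr p * wpow (g x) (1 - m * p) * (\<Prod>j\<in>I. (\<integral>y. k j y \<partial>lborel) powr p))"
      by (subst ennreal_mult'[symmetric]) (auto simp: mult.assoc)
    also have "(\<Prod>j\<in>I. (\<integral>y. k j y \<partial>lborel) powr p) = (\<Prod>j\<in>I. (\<integral>t. g (x(j := t)) \<partial>lborel) powr p)"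
      using kint(2) by (intro prod.cong) auto
    also have "g x powr p * wpow (g x) (1 - m * p) = wpow (g x) (1 - (m - 1) * p)"
      using \<open>0 < p\<close> mp by (auto simp: wpow_def powr_add[symmetric] algebra_simps)
    finally show ?thesis .
  qed
  have "(\<integral>\<^sup>+z. ennreal (?h z) \<partial>Pi\<^sub>M (insert i I) (\<lambda>_. lborel))
    = (\<integral>\<^sup>+x. (\<integral>\<^sup>+y. ennreal (?h (x(i := y))) \<partial>lborel) \<partial>Pi\<^sub>M I (\<lambda>_. lborel))"
    using h_meas insert.hyps by (intro lborel_product.product_nn_integral_insert) auto
  also have "\<dots> \<le> (\<integral>\<^sup>+x. ennreal (wpow (g x) (1 - (m - 1) * p) * (\<Prod>j\<in>I. (\<integral>t. g (x(j := t)) \<partial>lborel) powr p)) \<partial>Pi\<^sub>M I (\<lambda>_. lborel))"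
    using inner by (rule nn_integral_mono)
  also have "\<dots> \<le> ennreal ((\<integral>x. g x \<partial>Pi\<^sub>M I (\<lambda>_. lborel)) powr (1 + p))"
    unfolding m_def
  proof (rule insert.IH[OF _ _ g R])
    show "(real (card I) - 1) * p \<le> 1" using mp \<open>0 < p\<close> by (simp add: m_def algebra_simps)
  qed (use \<open>0 < p\<close> in auto)
  also have "(\<integral>x. g x \<partial>Pi\<^sub>M I (\<lambda>_. lborel)) = (\<integral>x. f x \<partial>Pi\<^sub>M (insert i I) (\<lambda>_. lborel))"
    unfolding g_def using insert.hyps boxed_integrable[OF _ f R]
    by (subst lborel_product.product_integral_insert) auto
  finally show ?case by (simp add: card)
qed

lemma abs_powr_has_derivative:
  fixes s y :: real
  assumes s: "1 < s"
  shows "((\<lambda>y. \<bar>y\<bar> powr s) has_real_derivative s * \<bar>y\<bar> powr (s - 1) * sgn y) (at y)"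
proof -
  consider "0 < y" | "y < 0" | "y = 0" by linarith
  then show ?thesis
  proof cases
    case 1
    have "((\<lambda>y. y powr s) has_real_derivative s * y powr (s - 1)) (at y)"
      using 1 by (auto intro!: derivative_eq_intros)
    then have "((\<lambda>y. \<bar>y\<bar> powr s) has_real_derivative s * y powr (s - 1)) (at y)"
      by (rule has_field_derivative_transform_within_open[of _ _ _ "{0<..}"]) (use 1 in auto)
    then show ?thesis using 1 by simp
  next
    case 2
    have "((\<lambda>y. (- y) powr s) has_real_derivative - (s * (- y) powr (s - 1))) (at y)"
      using 2 by (auto intro!: derivative_eq_intros)
    then have "((\<lambda>y. \<bar>y\<bar> powr s) has_real_derivative - (s * (- y) powr (s - 1))) (at y)"
      by (rule has_field_derivative_transform_within_open[of _ _ _ "{..<0}"]) (use 2 in auto)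
    then show ?thesis using 2 by simp
  next
    case 3
    have "((\<lambda>h. \<bar>h\<bar> powr (s - 1)) \<longlongrightarrow> 0) (at 0)"
    proof -
      have "((\<lambda>h::real. \<bar>h\<bar> powr (s - 1)) \<longlongrightarrow> \<bar>0\<bar> powr (s - 1)) (at 0)"
        using s by (intro tendsto_powr' tendsto_rabs tendsto_ident_at tendsto_const) auto
      then show ?thesis by simp
    qed
    then have "((\<lambda>h. norm (\<bar>h\<bar> powr s / h)) \<longlongrightarrow> 0) (at 0)"
    proof (rule Lim_transform_eventually)
      show "\<forall>\<^sub>F h::real in at 0. \<bar>h\<bar> powr (s - 1) = norm (\<bar>h\<bar> powr s / h)"
        by (auto simp: eventually_at_filter powr_diff abs_divide)
    qed
    then have "((\<lambda>h. \<bar>h\<bar> powr s / h) \<longlongrightarrow> 0) (at 0)" by (rule tendsto_norm_zero_cancel)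
    then show ?thesis using 3 by (simp add: has_field_derivative_iff)
  qed
qed

lemma line_in_direction:
  fixes z e :: "'a::euclidean_space"
  assumes "e \<in> Basis"
  shows "norm (z + (t - z \<bullet> e) *\<^sub>R e) \<ge> \<bar>t\<bar>"
proof -
  have "(z + (t - z \<bullet> e) *\<^sub>R e) \<bullet> e = t" using assms by (simp add: inner_left_distrib)
  then show ?thesis using Basis_le_norm[OF assms, of "z + (t - z \<bullet> e) *\<^sub>R e"] by simp
qed

text \<open>Along the line through \<open>z\<close> in direction \<open>e\<close> the function \<open>|\<phi>|\<^sup>s\<close> starts from \<open>0\<close> far away,
  so its value at \<open>z\<close> is at most the integral of its derivative's absolute value. The power
  \<open>s > 1\<close> makes it differentiable also at zeros of \<open>\<phi>\<close>.\<close>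

lemma test_function_le_line_integral:
  fixes \<phi> :: "'a::euclidean_space \<Rightarrow> real"
  assumes \<phi>: "\<phi> \<in> test_functions \<Omega>" and s: "1 < s" and e: "e \<in> Basis"
  shows "\<bar>\<phi> z\<bar> powr s \<le> (\<integral>t. s * \<bar>\<phi> (z + (t - z \<bullet> e) *\<^sub>R e)\<bar> powr (s - 1) * norm (grad \<phi> (z + (t - z \<bullet> e) *\<^sub>R e)) \<partial>lborel)"
proof -
  note \<phi>D = test_functionsD[OF \<phi>]
  obtain R where R: "0 < R" "\<And>x. R < norm x \<Longrightarrow> \<phi> x = 0" "\<And>x. R < norm x \<Longrightarrow> grad \<phi> x = 0"
    using test_function_support[OF \<phi>] by auto
  define l where "l t = z + (t - z \<bullet> e) *\<^sub>R e" for t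
  have l_cont: "continuous_on UNIV l" unfolding l_def by (intro continuous_intros)
  define F where "F t = s * \<bar>\<phi> (l t)\<bar> powr (s - 1) * norm (grad \<phi> (l t))" for t
  have F0: "0 \<le> F t" for t using s by (simp add: F_def)
  have c1: "continuous_on UNIV (\<lambda>t. \<phi> (l t))" "continuous_on UNIV (\<lambda>t. grad \<phi> (l t))"
    using continuous_on_compose2[OF \<phi>D(2) l_cont] continuous_on_compose2[OF \<phi>D(3) l_cont] by auto
  have F_cont: "continuous_on UNIV F" unfolding F_def
    using s c1 by (intro continuous_intros continuous_on_powr') auto
  have far: "\<phi> (l t) = 0" if "R < \<bar>t\<bar>" for t
    using R(2)[of "l t"] line_in_direction[OF e, of t z] that by (simp add: l_def)
  have F_supp: "F t = 0" if "R < \<bar>t\<bar>" for t using far[OF that] s by (simp add: F_def)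
  have F_int: "integrable lborel F"
    by (rule integrable_lborel_continuous_bounded_support[OF F_cont, of R]) (use F_supp in force)
  let ?t0 = "z \<bullet> e"
  \<comment> \<open>A parameter before \<open>z\<close> on the line at which the line has not yet entered the support.\<close>
  let ?T = "min (- R - 1) (?t0 - 1)"
  let ?k = "\<lambda>t. \<bar>\<phi> (l t)\<bar> powr s"
  let ?k' = "\<lambda>t. (s * \<bar>\<phi> (l t)\<bar> powr (s - 1) * sgn (\<phi> (l t))) * (e \<bullet> grad \<phi> (l t))"
  have T: "?T \<le> ?t0" by simp
  have dk: "(?k has_real_derivative ?k' t) (at t)" for t
  proof (rule DERIV_chain2[OF abs_powr_has_derivative[OF s]])
    have "((\<lambda>t. \<phi> (l t)) has_derivative (\<lambda>h. (h *\<^sub>R e) \<bullet> grad \<phi> (l t))) (at t)"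
    proof (rule has_derivative_compose[where g = \<phi> and f = l and g' = "\<lambda>h. h \<bullet> grad \<phi> (l t)"])
      show "(l has_derivative (\<lambda>h. h *\<^sub>R e)) (at t)" unfolding l_def
        by (auto intro!: derivative_eq_intros)
      show "(\<phi> has_derivative (\<lambda>h. h \<bullet> grad \<phi> (l t))) (at (l t))"
        using \<phi>D(6)[of "l t"] by (simp add: gderiv_def)
    qed
    then show "((\<lambda>t. \<phi> (l t)) has_real_derivative e \<bullet> grad \<phi> (l t)) (at t)"
      by (simp add: has_field_derivative_def mult_commute_abs)
  qed
  have I1: "(?k' has_integral (?k ?t0 - ?k ?T)) {?T..?t0}"
    using dk by (intro fundamental_theorem_of_calculus T)
      (auto simp: has_real_derivative_iff_has_vector_derivative[symmetric] intro: has_field_derivative_at_within)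
  have I2: "(F has_integral (integral {?T..?t0} F)) {?T..?t0}"
    by (intro integrable_integral integrable_continuous_real continuous_on_subset[OF F_cont]) auto
  have le: "?k' t \<le> F t" for t
  proof -
    have "\<bar>e \<bullet> grad \<phi> (l t)\<bar> \<le> norm (grad \<phi> (l t))"
      using Cauchy_Schwarz_ineq2[of e "grad \<phi> (l t)"] e by simp
    then have "sgn (\<phi> (l t)) * (e \<bullet> grad \<phi> (l t)) \<le> norm (grad \<phi> (l t))"
      by (auto simp: sgn_if)
    then show ?thesis using s unfolding F_def
      by (simp add: mult.assoc mult_left_mono)
  qed
  have "?k ?t0 - ?k ?T \<le> integral {?T..?t0} F"
    by (rule has_integral_le[OF I1 I2 le])
  moreover have "?k ?T = 0" using far[of ?T] R(1) s by simp
  moreover have "integral {?T..?t0} F \<le> integral UNIV F"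
    using F_int F0 by (intro integral_subset_le) (auto intro: integrable_on_lborel integrable_continuous_real continuous_on_subset[OF F_cont])
  moreover have "integral UNIV F = (\<integral>t. F t \<partial>lborel)"
    using F_int by (intro integral_lborel)
  moreover have "l ?t0 = z" by (simp add: l_def)
  ultimately show ?thesis by (simp add: F_def l_def)
qed

lemma sum_update_Basis:
  fixes f :: "'a::euclidean_space \<Rightarrow> real"
  assumes "i \<in> Basis"
  defines "z \<equiv> \<Sum>b\<in>Basis. f b *\<^sub>R b"
  shows "(\<Sum>b\<in>Basis. (f(i := t)) b *\<^sub>R b) = z + (t - z \<bullet> i) *\<^sub>R i"
proof (rule euclidean_eqI)
  fix b :: 'a assume b: "b \<in> Basis"
  show "(\<Sum>b\<in>Basis. (f(i := t)) b *\<^sub>R b) \<bullet> b = (z + (t - z \<bullet> i) *\<^sub>R i) \<bullet> b"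
    using b assms(1) by (simp add: z_def inner_sum_left_Basis inner_left_distrib inner_Basis)
qed

text \<open>Multiply the bounds of \<open>|\<phi>|\<^sup>s\<close> by line integrals, one for each coordinate direction and
  each raised to the power \<open>1 / (n - 1)\<close>, and integrate the product with
  \<open>grid_lines_inequality\<close>.\<close>

lemma Gagliardo_Nirenberg_test_function:
  fixes \<phi> :: "'a::euclidean_space \<Rightarrow> real"
  assumes \<phi>: "\<phi> \<in> test_functions \<Omega>" and s: "1 < s" and dim: "2 \<le> DIM('a)"
  defines "n \<equiv> real DIM('a)"
  shows "(\<integral>x. \<bar>\<phi> x\<bar> powr (s * n / (n - 1)) \<partial>lborel)
    \<le> (\<integral>x. s * \<bar>\<phi> x\<bar> powr (s - 1) * norm (grad \<phi> x) \<partial>lborel) powr (n / (n - 1))"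
proof -
  note \<phi>D = test_functionsD[OF \<phi>]
  obtain R where R: "0 < R" "\<And>x. R < norm x \<Longrightarrow> \<phi> x = 0" "\<And>x. R < norm x \<Longrightarrow> grad \<phi> x = 0"
    using test_function_support[OF \<phi>] by auto
  have n: "2 \<le> n" using dim by (simp add: n_def)
  define f where "f x = s * \<bar>\<phi> x\<bar> powr (s - 1) * norm (grad \<phi> x)" for x
  have f_cont: "continuous_on UNIV f" unfolding f_def
    using s \<phi>D(2,3) by (intro continuous_intros continuous_on_powr') auto
  then have f_meas: "f \<in> borel_measurable borel" by (rule borel_measurable_continuous_onI)
  have f0: "0 \<le> f x" for x using s by (simp add: f_def)
  have f_supp: "f x = 0" if "R < norm x" for x using R(3)[OF that] by (simp add: f_def)
  obtain C where C: "\<And>x. norm (f x) \<le> C"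
    using continuous_bounded_support_bounded[OF f_cont f_supp] by blast
  \<comment> \<open>The Lebesgue measure is the image of the product measure on coordinates under \<open>L\<close>.\<close>
  define L where "L y = (\<Sum>b\<in>Basis. y b *\<^sub>R (b::'a))" for y
  let ?P = "Pi\<^sub>M Basis (\<lambda>_::'a. lborel :: real measure)"
  have L_meas [measurable]: "L \<in> ?P \<rightarrow>\<^sub>M borel" unfolding L_def by measurable
  have lb: "lborel = distr ?P borel L" unfolding L_def by (rule lborel_eq)
  have L_upd: "L (y(i := t)) = L y + (t - L y \<bullet> i) *\<^sub>R i" if "i \<in> Basis" for y i t
    unfolding L_def by (rule sum_update_Basis[OF that])
  have bx: "boxed Basis R C (\<lambda>y. f (L y))"
    unfolding boxed_def
  proof (intro conjI ballI impI)
    show "(\<lambda>y. f (L y)) \<in> borel_measurable ?P" using f_meas by measurable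
    fix y :: "'a \<Rightarrow> real"
    show "0 \<le> f (L y)" "f (L y) \<le> C" using f0 C[of "L y"] by auto
    assume "\<exists>i\<in>Basis. R < \<bar>y i\<bar>"
    then obtain i :: 'a where i: "i \<in> Basis" "R < \<bar>y i\<bar>" by blast
    then have "R < norm (L y)" using Basis_le_norm[OF i(1), of "L y"] by (simp add: L_def)
    then show "f (L y) = 0" by (rule f_supp)
  qed
  define p where "p = 1 / (n - 1)"
  have p: "0 < p" "(n - 1) * p = 1" using n by (auto simp: p_def)
  let ?q = "s * n / (n - 1)"
  have pt: "\<bar>\<phi> (L y)\<bar> powr ?q \<le> (\<Prod>i\<in>Basis. (\<integral>t. f (L (y(i := t))) \<partial>lborel) powr p)" for y
  proof -
    have le: "\<bar>\<phi> (L y)\<bar> powr s \<le> (\<integral>t. f (L (y(i := t))) \<partial>lborel)" if "i \<in> Basis" for i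
      using test_function_le_line_integral[OF \<phi> s that, of "L y"] by (simp only: L_upd[OF that] f_def)
    have "\<bar>\<phi> (L y)\<bar> powr ?q = (\<Prod>i\<in>(Basis :: 'a set). (\<bar>\<phi> (L y)\<bar> powr s) powr p)"
    proof -
      have "(\<Prod>i\<in>(Basis :: 'a set). (\<bar>\<phi> (L y)\<bar> powr s) powr p) = ((\<bar>\<phi> (L y)\<bar> powr s) powr p) powr n"
        unfolding n_def prod_constant by (cases "\<phi> (L y) = 0") (auto simp: powr_realpow)
      also have "\<dots> = \<bar>\<phi> (L y)\<bar> powr ?q" by (simp add: powr_powr p_def)
      finally show ?thesis by simp
    qed
    also have "\<dots> \<le> (\<Prod>i\<in>Basis. (\<integral>t. f (L (y(i := t))) \<partial>lborel) powr p)"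
      using le p by (intro prod_mono conjI powr_mono2) auto
    finally show ?thesis .
  qed
  have grid: "(\<integral>\<^sup>+y. ennreal (\<Prod>i\<in>Basis. (\<integral>t. f (L (y(i := t))) \<partial>lborel) powr p) \<partial>?P)
    \<le> ennreal ((\<integral>y. f (L y) \<partial>?P) powr (1 + p))"
    using grid_lines_inequality[OF finite_Basis p(1) _ bx] R(1) p(2) by (simp add: wpow_def n_def)
  have "(\<integral>\<^sup>+x. ennreal (\<bar>\<phi> x\<bar> powr ?q) \<partial>lborel) = (\<integral>\<^sup>+y. ennreal (\<bar>\<phi> (L y)\<bar> powr ?q) \<partial>?P)"
    using borel_measurable_continuous_onI[OF \<phi>D(2)] by (subst lb, subst nn_integral_distr) auto
  also have "\<dots> \<le> (\<integral>\<^sup>+y. ennreal (\<Prod>i\<in>Basis. (\<integral>t. f (L (y(i := t))) \<partial>lborel) powr p) \<partial>?P)"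
    using pt by (intro nn_integral_mono ennreal_leI)
  also note grid
  also have "(\<integral>y. f (L y) \<partial>?P) = (\<integral>x. f x \<partial>lborel)"
    using f_meas by (subst lb, subst integral_distr) auto
  finally have main: "(\<integral>\<^sup>+x. ennreal (\<bar>\<phi> x\<bar> powr ?q) \<partial>lborel) \<le> ennreal ((\<integral>x. f x \<partial>lborel) powr (1 + p))" .
  have "1 + p = n / (n - 1)" using n by (simp add: p_def field_simps)
  moreover have "integrable lborel (\<lambda>x. \<bar>\<phi> x\<bar> powr ?q)"
    using s n by (intro test_function_powr_integrable(1)[OF \<phi>]) auto
  ultimately show ?thesis using main
    by (subst (asm) nn_integral_eq_integral) (auto simp: f_def[abs_def])
qed

text \<open>The exponent \<open>s = p (n - 1) / (n - p)\<close> is chosen so that \<open>s n / (n - 1) = q\<close> and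
  \<open>s - 1 = q (1 - 1/p)\<close>. Hoelder's inequality then bounds the right side of the inequality of
  Gagliardo and Nirenberg by a power of \<open>\<integral>|\<phi>|\<^sup>q\<close> smaller than the one on the left, which is
  divided out.\<close>

theorem Sobolev_inequality_test_function:
  fixes \<phi> :: "'a::euclidean_space \<Rightarrow> real"
  assumes \<phi>: "\<phi> \<in> test_functions \<Omega>" and p: "1 < p" "p < real DIM('a)"
  defines "n \<equiv> real DIM('a)"
  defines "q \<equiv> n * p / (n - p)"
  shows "(\<integral>x. \<bar>\<phi> x\<bar> powr q \<partial>lborel)
    \<le> (p * (n - 1) / (n - p)) powr q * (\<integral>x. norm (grad \<phi> x) powr p \<partial>lborel) powr (q / p)"
proof -
  note \<phi>D = test_functionsD[OF \<phi>]
  obtain R where R: "0 < R" "\<And>x. R < norm x \<Longrightarrow> \<phi> x = 0" "\<And>x. R < norm x \<Longrightarrow> grad \<phi> x = 0"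
    using test_function_support[OF \<phi>] by auto
  have np: "p < n" "1 < n" using p by (auto simp: n_def)
  have dim: "2 \<le> DIM('a)" using np by (simp add: n_def)
  define s where "s = p * (n - 1) / (n - p)"
  have s: "1 < s" using p(1) np by (simp add: s_def field_simps)
  have q: "0 < q" using p(1) np by (simp add: q_def)
  have sq: "s * n / (n - 1) = q" using np by (simp add: s_def q_def)
  have sq2: "q * (1 - 1 / p) = s - 1" using np p(1) by (simp add: s_def q_def field_simps)
  define X where "X = (\<integral>x. \<bar>\<phi> x\<bar> powr q \<partial>lborel)"
  define E where "E = (\<integral>x. norm (grad \<phi> x) powr p \<partial>lborel)"
  have X0: "0 \<le> X" and E0: "0 \<le> E" by (auto simp: X_def E_def)
  note i1 = test_function_powr_integrable(1)[OF \<phi> q]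
  have i2: "integrable lborel (\<lambda>x. norm (grad \<phi> x) powr p)"
    using p by (intro test_function_powr_integrable(2)[OF \<phi>]) simp
  have i3: "integrable lborel (\<lambda>x. \<bar>\<phi> x\<bar> powr (s - 1) * norm (grad \<phi> x))"
  proof (rule integrable_lborel_continuous_bounded_support)
    show "continuous_on UNIV (\<lambda>x. \<bar>\<phi> x\<bar> powr (s - 1) * norm (grad \<phi> x))"
      using \<phi>D(2,3) s by (intro continuous_on_powr' continuous_intros) auto
    show "norm x \<le> R" if "\<bar>\<phi> x\<bar> powr (s - 1) * norm (grad \<phi> x) \<noteq> 0" for x using R(3)[of x] that by force
  qed
  have hold: "(\<integral>x. \<bar>\<phi> x\<bar> powr (s - 1) * norm (grad \<phi> x) \<partial>lborel) \<le> X powr (1 - 1 / p) * E powr (1 / p)"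
  proof -
    let ?h = "\<lambda>b x. if b then \<bar>\<phi> x\<bar> powr q else norm (grad \<phi> x) powr p"
    let ?w = "\<lambda>b. if b then 1 - 1 / p else 1 / p"
    have "(\<integral>\<^sup>+x. ennreal (\<Prod>b\<in>UNIV. ?h b x powr ?w b) \<partial>lborel) \<le> ennreal (\<Prod>b\<in>UNIV. (\<integral>x. ?h b x \<partial>lborel) powr ?w b)"
    proof (rule Hoelder_prod)
      show "integrable lborel (?h b)" for b using i1 i2 by (cases b) auto
    qed (use p(1) in \<open>auto simp: UNIV_bool\<close>)
    then have "(\<integral>\<^sup>+x. ennreal (\<bar>\<phi> x\<bar> powr (s - 1) * norm (grad \<phi> x)) \<partial>lborel) \<le> ennreal (X powr (1 - 1 / p) * E powr (1 / p))"
      using p(1) by (simp add: UNIV_bool powr_powr sq2 X_def E_def mult.commute)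
    then show ?thesis using i3 by (subst (asm) nn_integral_eq_integral) auto
  qed
  have "X \<le> (\<integral>x. s * \<bar>\<phi> x\<bar> powr (s - 1) * norm (grad \<phi> x) \<partial>lborel) powr (n / (n - 1))"
    using Gagliardo_Nirenberg_test_function[OF \<phi> s dim] sq by (simp only: X_def n_def[symmetric])
  also have "(\<integral>x. s * \<bar>\<phi> x\<bar> powr (s - 1) * norm (grad \<phi> x) \<partial>lborel) = s * (\<integral>x. \<bar>\<phi> x\<bar> powr (s - 1) * norm (grad \<phi> x) \<partial>lborel)"
    by (simp add: mult.assoc)
  also have "\<dots> powr (n / (n - 1)) \<le> (s * (X powr (1 - 1 / p) * E powr (1 / p))) powr (n / (n - 1))"
    using hold s np by (intro powr_mono2 mult_left_mono mult_nonneg_nonneg Bochner_Integration.integral_nonneg) auto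
  finally have main: "X \<le> (s * (X powr (1 - 1 / p) * E powr (1 / p))) powr (n / (n - 1))" .
  have "X \<le> s powr q * E powr (q / p)"
  proof (cases "X = 0")
    case False
    then have X: "0 < X" using X0 by simp
    have "X powr ((n - 1) / n) \<le> ((s * (X powr (1 - 1 / p) * E powr (1 / p))) powr (n / (n - 1))) powr ((n - 1) / n)"
      using main X0 np by (intro powr_mono2) auto
    also have "\<dots> = s * (X powr (1 - 1 / p) * E powr (1 / p))" using np s by (simp add: powr_powr)
    finally have "X powr ((n - 1) / n) / X powr (1 - 1 / p) \<le> s * E powr (1 / p)"
      using X by (simp add: pos_divide_le_eq mult_ac)
    moreover have "X powr ((n - 1) / n) / X powr (1 - 1 / p) = X powr (1 / q)"
    proof -
      have "(n - 1) / n - (1 - 1 / p) = 1 / q" using np p(1) by (simp add: q_def field_simps)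
      then show ?thesis using X by (simp add: powr_diff[symmetric])
    qed
    ultimately have "(X powr (1 / q)) powr q \<le> (s * E powr (1 / p)) powr q"
      using q by (intro powr_mono2) auto
    then show ?thesis using q X s E0 by (simp add: powr_powr powr_mult)
  qed auto
  then show ?thesis by (simp only: X_def E_def s_def)
qed

section \<open>Compact embedding\<close>

text \<open>The graph of the convex function \<open>a\<^sup>p\<close> lies above its tangent at \<open>A\<close>. This is Young's
  inequality for \<open>a\<close> and \<open>A\<^sup>p\<^sup>-\<^sup>1\<close>, and so includes the boundary case \<open>A = 0\<close>.\<close>

lemma powr_tangent:
  fixes a A p :: real
  assumes "0 \<le> a" "0 \<le> A" "1 < p"
  shows "A powr p + p * A powr (p - 1) * (a - A) \<le> a powr p"
proof -
  define q where "q = p / (p - 1)"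
  have q: "1 < q" "1 / p + 1 / q = 1" "(p - 1) * q = p" using assms by (auto simp: q_def field_simps)
  have "a * A powr (p - 1) \<le> a powr p / p + (A powr (p - 1)) powr q / q"
    by (rule Youngs_inequality) (use assms q in auto)
  also have "(A powr (p - 1)) powr q = A powr p" using q(3) by (simp add: powr_powr)
  finally have "p * (a * A powr (p - 1)) \<le> p * (a powr p / p + A powr p / q)"
    using assms by (intro mult_left_mono) auto
  also have "\<dots> = a powr p + (p / q) * A powr p" using assms by (simp add: field_simps)
  also have "p / q = p - 1" using assms by (simp add: q_def)
  finally have "p * (a * A powr (p - 1)) \<le> a powr p + (p - 1) * A powr p" .
  moreover have "A powr (p - 1) * A = A powr p"
    using powr_mult_base[of A "p - 1"] assms by (simp add: mult.commute)
  ultimately show ?thesis by (simp add: algebra_simps)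
qed

text \<open>Integrate the tangent inequality at the average of \<open>h\<close> over \<open>S\<close>; the linear term drops
  out.\<close>

lemma Jensen_powr:
  fixes h :: "'a \<Rightarrow> real"
  assumes S: "S \<in> sets M" "emeasure M S < \<infinity>" and V: "V = measure M S" "0 < V" and p: "1 < p"
    and h: "h \<in> borel_measurable M" "\<And>x. 0 \<le> h x" "integrable M (\<lambda>x. indicator S x * h x)"
  shows "ennreal (((\<integral>x. indicator S x * h x \<partial>M) / V) powr p)
    \<le> ennreal (1 / V) * (\<integral>\<^sup>+x. indicator S x * ennreal (h x powr p) \<partial>M)"
proof (cases "(\<integral>\<^sup>+x. indicator S x * ennreal (h x powr p) \<partial>M) = \<infinity>")
  case True
  then show ?thesis using V by (simp add: ennreal_mult_top)
next
  case False
  note [measurable] = h(1) S(1)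
  have eq: "indicator S x * ennreal (h x powr p) = ennreal (indicator S x * h x powr p)" for x
    by (auto simp: indicator_def)
  have int: "integrable M (\<lambda>x. indicator S x * h x powr p)"
  proof (rule integrableI_bounded)
    show "(\<integral>\<^sup>+x. ennreal (norm (indicator S x * h x powr p)) \<partial>M) < \<infinity>"
      using False by (simp add: eq top.not_eq_extremum)
  qed measurable
  define A where "A = (\<integral>x. indicator S x * h x \<partial>M) / V"
  have A: "0 \<le> A" unfolding A_def using V h(2)
    by (intro divide_nonneg_pos Bochner_Integration.integral_nonneg) auto
  have iS: "integrable M (indicator S :: _ \<Rightarrow> real)" using S by (intro integrable_real_indicator) auto
  have i2: "integrable M (\<lambda>x. indicator S x * (A powr p - p * A powr (p - 1) * A) + (p * A powr (p - 1)) * (indicator S x * h x))"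
    using iS h(3) by auto
  have "(\<integral>x. indicator S x * (A powr p - p * A powr (p - 1) * A) + (p * A powr (p - 1)) * (indicator S x * h x) \<partial>M)
    \<le> (\<integral>x. indicator S x * h x powr p \<partial>M)"
  proof (rule integral_mono[OF i2 int])
    fix x show "indicator S x * (A powr p - p * A powr (p - 1) * A) + (p * A powr (p - 1)) * (indicator S x * h x) \<le> indicator S x * h x powr p"
      using powr_tangent[OF h(2)[of x] A p] by (auto simp: indicator_def algebra_simps)
  qed
  also have "(\<integral>x. indicator S x * (A powr p - p * A powr (p - 1) * A) + (p * A powr (p - 1)) * (indicator S x * h x) \<partial>M)
    = V * (A powr p - p * A powr (p - 1) * A) + (p * A powr (p - 1)) * (V * A)"
    using iS h(3) V S by (simp add: A_def)
  also have "\<dots> = V * A powr p" by (simp add: algebra_simps)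
  finally have "A powr p \<le> (1 / V) * (\<integral>x. indicator S x * h x powr p \<partial>M)" using V by (simp add: field_simps)
  then have "ennreal (A powr p) \<le> ennreal ((1 / V) * (\<integral>x. indicator S x * h x powr p \<partial>M))" by (rule ennreal_leI)
  also have "\<dots> = ennreal (1 / V) * ennreal (\<integral>x. indicator S x * h x powr p \<partial>M)"
    using V by (intro ennreal_mult') auto
  also have "ennreal (\<integral>x. indicator S x * h x powr p \<partial>M) = (\<integral>\<^sup>+x. indicator S x * ennreal (h x powr p) \<partial>M)"
    unfolding eq using int by (intro nn_integral_eq_integral[symmetric]) auto
  finally show ?thesis by (simp add: A_def)
qed

lemma nn_integral_translate:
  fixes f :: "'a::euclidean_space \<Rightarrow> ennreal"
  assumes [measurable]: "f \<in> borel_measurable borel"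
  shows "(\<integral>\<^sup>+x. f (x + c) \<partial>lborel) = (\<integral>\<^sup>+x. f x \<partial>lborel)"
proof -
  have "(\<integral>\<^sup>+x. f x \<partial>lborel) = (\<integral>\<^sup>+x. f x \<partial>distr lborel borel ((+) c))"
    by (simp add: lborel_distr_plus)
  also have "\<dots> = (\<integral>\<^sup>+x. f (c + x) \<partial>lborel)" by (subst nn_integral_distr) auto
  finally show ?thesis by (simp add: add.commute)
qed

lemma integrable_indicator_continuous:
  fixes f :: "'a::euclidean_space \<Rightarrow> real"
  assumes "compact S" "continuous_on S f"
  shows "integrable lborel (\<lambda>x. indicator S x * f x)"
  using borel_integrable_compact[OF assms] by simp

text \<open>The increment is the integral of the derivative along the segment from \<open>x\<close> to \<open>x + h\<close>.
  Apply Jensen's inequality on the segment, exchange the integrals and use translation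
  invariance.\<close>

lemma test_function_translation_estimate:
  fixes \<phi> :: "'a::euclidean_space \<Rightarrow> real"
  assumes \<phi>: "\<phi> \<in> test_functions \<Omega>" and p: "1 < p"
  defines "E \<equiv> (\<integral>x. norm (grad \<phi> x) powr p \<partial>lborel)"
  shows "(\<integral>\<^sup>+x. ennreal (\<bar>\<phi> x - \<phi> (x + h)\<bar> powr p) \<partial>lborel) \<le> ennreal (norm h powr p * E)"
proof -
  note \<phi>D = test_functionsD[OF \<phi>]
  obtain R where R: "0 < R" "\<And>x. R < norm x \<Longrightarrow> \<phi> x = 0" "\<And>x. R < norm x \<Longrightarrow> grad \<phi> x = 0"
    using test_function_support[OF \<phi>] by auto
  have [measurable]: "grad \<phi> \<in> borel_measurable borel" "\<phi> \<in> borel_measurable borel"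
    using \<phi>D(2,3) by (auto intro: borel_measurable_continuous_onI)
  define a where "a x t = norm (grad \<phi> (x + t *\<^sub>R h)) * norm h" for x t
  have a_cont: "continuous_on S (a x)" for x and S :: "real set" unfolding a_def
    by (intro continuous_intros continuous_on_compose2[OF \<phi>D(3)]) auto
  have a_int: "integrable lborel (\<lambda>t. indicator {0..1} t * a x t)" for x
    by (intro integrable_indicator_continuous a_cont) auto
  have ftc: "\<bar>\<phi> x - \<phi> (x + h)\<bar> \<le> (\<integral>t. indicator {0..1} t * a x t \<partial>lborel)" for x
  proof -
    have d: "((\<lambda>t. \<phi> (x + t *\<^sub>R h)) has_vector_derivative (h \<bullet> grad \<phi> (x + t *\<^sub>R h))) (at t within {0..1})" for t
    proof -
      have "((\<lambda>t. \<phi> (x + t *\<^sub>R h)) has_derivative (\<lambda>s. (s *\<^sub>R h) \<bullet> grad \<phi> (x + t *\<^sub>R h))) (at t within {0..1})"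
      proof (rule has_derivative_compose[where g = \<phi> and f = "\<lambda>t. x + t *\<^sub>R h" and g' = "\<lambda>h'. h' \<bullet> grad \<phi> (x + t *\<^sub>R h)"])
        show "((\<lambda>t. x + t *\<^sub>R h) has_derivative (\<lambda>s. s *\<^sub>R h)) (at t within {0..1})"
          by (auto intro!: derivative_eq_intros)
        show "(\<phi> has_derivative (\<lambda>h'. h' \<bullet> grad \<phi> (x + t *\<^sub>R h))) (at (x + t *\<^sub>R h))"
          using \<phi>D(6) by (simp add: gderiv_def)
      qed
      then show ?thesis by (simp add: has_vector_derivative_def)
    qed
    have I: "((\<lambda>t. h \<bullet> grad \<phi> (x + t *\<^sub>R h)) has_integral (\<phi> (x + 1 *\<^sub>R h) - \<phi> (x + 0 *\<^sub>R h))) {0..1}"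
      by (rule fundamental_theorem_of_calculus) (auto intro: d)
    have "norm (integral {0..1} (\<lambda>t. h \<bullet> grad \<phi> (x + t *\<^sub>R h))) \<le> integral {0..1} (a x)"
    proof (rule integral_norm_bound_integral)
      show "(\<lambda>t. h \<bullet> grad \<phi> (x + t *\<^sub>R h)) integrable_on {0..1}" using I by (rule has_integral_integrable)
      show "a x integrable_on {0..1}" by (intro integrable_continuous_real a_cont)
      show "norm (h \<bullet> grad \<phi> (x + t *\<^sub>R h)) \<le> a x t" for t
        using Cauchy_Schwarz_ineq2[of h "grad \<phi> (x + t *\<^sub>R h)"] by (simp add: a_def mult.commute)
    qed
    moreover have "integral {0..1} (\<lambda>t. h \<bullet> grad \<phi> (x + t *\<^sub>R h)) = \<phi> (x + h) - \<phi> x"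
      using integral_unique[OF I] by simp
    moreover have "integral {0..1} (a x) = (\<integral>t. indicator {0..1} t * a x t \<partial>lborel)"
      using set_borel_integral_eq_integral(2)[of "{0..1}" "a x"] a_int[of x]
      by (simp add: set_integrable_def set_lebesgue_integral_def)
    ultimately show ?thesis by simp
  qed
  have pt: "ennreal (\<bar>\<phi> x - \<phi> (x + h)\<bar> powr p) \<le> (\<integral>\<^sup>+t. indicator {0..1} t * ennreal (a x t powr p) \<partial>lborel)" for x
  proof -
    have "ennreal (\<bar>\<phi> x - \<phi> (x + h)\<bar> powr p) \<le> ennreal (((\<integral>t. indicator {0..1} t * a x t \<partial>lborel) / 1) powr p)"
      using ftc[of x] p by (intro ennreal_leI powr_mono2) auto
    also have "\<dots> \<le> ennreal (1 / 1) * (\<integral>\<^sup>+t. indicator {0..1} t * ennreal (a x t powr p) \<partial>lborel)"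
    proof (rule Jensen_powr)
      show "a x \<in> borel_measurable lborel" using a_cont[of UNIV x] by (simp add: borel_measurable_continuous_onI)
      show "0 \<le> a x t" for t by (simp add: a_def)
    qed (use p a_int in auto)
    finally show ?thesis by simp
  qed
  have "(\<integral>\<^sup>+x. ennreal (\<bar>\<phi> x - \<phi> (x + h)\<bar> powr p) \<partial>lborel)
    \<le> (\<integral>\<^sup>+x. (\<integral>\<^sup>+t. indicator {0..1} t * ennreal (a x t powr p) \<partial>lborel) \<partial>lborel)"
    by (intro nn_integral_mono pt)
  also have "\<dots> = (\<integral>\<^sup>+t. (\<integral>\<^sup>+x. indicator {0..1} t * ennreal (a x t powr p) \<partial>lborel) \<partial>lborel)"
    by (rule lborel_pair.Fubini') (simp add: a_def case_prod_beta')
  also have "\<dots> = (\<integral>\<^sup>+t. indicator {0..1::real} t * ennreal (norm h powr p * E) \<partial>lborel)"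
  proof (intro nn_integral_cong)
    fix t :: real
    have i: "integrable lborel (\<lambda>x. norm (grad \<phi> x) powr p)"
      using p by (intro test_function_powr_integrable(2)[OF \<phi>]) simp
    have "(\<integral>\<^sup>+x. ennreal (a x t powr p) \<partial>lborel) = (\<integral>\<^sup>+x. ennreal ((norm (grad \<phi> x) * norm h) powr p) \<partial>lborel)"
      unfolding a_def using nn_integral_translate[of "\<lambda>x. ennreal ((norm (grad \<phi> x) * norm h) powr p)" "t *\<^sub>R h"] by simp
    also have "\<dots> = (\<integral>\<^sup>+x. ennreal (norm h powr p * norm (grad \<phi> x) powr p) \<partial>lborel)"
      by (simp add: powr_mult mult.commute)
    also have "\<dots> = ennreal (norm h powr p * E)"
      using i by (subst nn_integral_eq_integral) (auto simp: E_def)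
    finally show "(\<integral>\<^sup>+x. indicator {0..1} t * ennreal (a x t powr p) \<partial>lborel) = indicator {0..1} t * ennreal (norm h powr p * E)"
      by (auto simp: indicator_def)
  qed
  also have "\<dots> = ennreal (norm h powr p * E)"
    by (subst nn_integral_multc) auto
  finally show ?thesis .
qed

text \<open>The lower corner of the cell that contains \<open>x\<close> in the cubic grid with mesh width \<open>l\<close>.\<close>

definition grid_corner :: "real \<Rightarrow> 'a::euclidean_space \<Rightarrow> 'a" where
  "grid_corner l x = (\<Sum>i\<in>Basis. (l * of_int \<lfloor>x \<bullet> i / l\<rfloor>) *\<^sub>R i)"

definition grid_cell :: "real \<Rightarrow> 'a::euclidean_space \<Rightarrow> 'a set" where
  "grid_cell l c = cbox c (c + l *\<^sub>R One)"

definition grid_average :: "real \<Rightarrow> ('a::euclidean_space \<Rightarrow> real) \<Rightarrow> 'a \<Rightarrow> real" where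
  "grid_average l \<phi> x = (\<integral>y. indicator (grid_cell l (grid_corner l x)) y * \<phi> y \<partial>lborel) / l ^ DIM('a)"

lemma countable_grid_corners: "countable (range (grid_corner l :: 'a::euclidean_space \<Rightarrow> 'a))"
proof -
  let ?F = "\<lambda>z. \<Sum>i\<in>Basis. (l * of_int (z i)) *\<^sub>R (i::'a)"
  have "range (grid_corner l :: 'a \<Rightarrow> 'a) \<subseteq> ?F ` (Pi\<^sub>E Basis (\<lambda>_. UNIV :: int set))"
  proof
    fix c assume "c \<in> range (grid_corner l :: 'a \<Rightarrow> 'a)"
    then obtain x where x: "c = grid_corner l x" by blast
    have "c = ?F (restrict (\<lambda>i. \<lfloor>x \<bullet> i / l\<rfloor>) Basis)" unfolding x grid_corner_def by (intro sum.cong) auto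
    moreover have "restrict (\<lambda>i. \<lfloor>x \<bullet> i / l\<rfloor>) Basis \<in> Pi\<^sub>E Basis (\<lambda>_. UNIV :: int set)" by auto
    ultimately show "c \<in> ?F ` (Pi\<^sub>E Basis (\<lambda>_. UNIV :: int set))" by (rule image_eqI)
  qed
  moreover have "countable (Pi\<^sub>E (Basis :: 'a set) (\<lambda>_. UNIV :: int set))" by (intro countable_PiE) auto
  ultimately show ?thesis by (intro countable_subset[OF _ countable_image[of _ ?F]])
qed

lemma grid_cell_diff:
  fixes x y :: "'a::euclidean_space"
  assumes l: "0 < l" and y: "y \<in> grid_cell l (grid_corner l x)"
  shows "y - x \<in> cbox (- l *\<^sub>R One) (l *\<^sub>R One)"
  unfolding mem_box
proof
  fix i :: 'a assume i: "i \<in> Basis"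
  have c: "grid_corner l x \<bullet> i = l * of_int \<lfloor>x \<bullet> i / l\<rfloor>"
    using i by (simp add: grid_corner_def inner_sum_left_Basis)
  have "of_int \<lfloor>x \<bullet> i / l\<rfloor> \<le> x \<bullet> i / l" "x \<bullet> i / l < of_int \<lfloor>x \<bullet> i / l\<rfloor> + 1" by linarith+
  then have "l * of_int \<lfloor>x \<bullet> i / l\<rfloor> \<le> x \<bullet> i" "x \<bullet> i < (of_int \<lfloor>x \<bullet> i / l\<rfloor> + 1) * l"
    by (simp_all only: pos_le_divide_eq[OF l] pos_divide_less_eq[OF l] mult.commute[of l])
  then have "l * of_int \<lfloor>x \<bullet> i / l\<rfloor> \<le> x \<bullet> i" "x \<bullet> i \<le> l * of_int \<lfloor>x \<bullet> i / l\<rfloor> + l"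
    by (simp_all add: algebra_simps)
  moreover have "grid_corner l x \<bullet> i \<le> y \<bullet> i" "y \<bullet> i \<le> grid_corner l x \<bullet> i + l"
    using y i by (auto simp: grid_cell_def mem_box inner_left_distrib)
  ultimately show "(- l *\<^sub>R One) \<bullet> i \<le> (y - x) \<bullet> i \<and> (y - x) \<bullet> i \<le> (l *\<^sub>R One) \<bullet> i"
    using i c by (auto simp: inner_diff_left)
qed

lemma measure_grid_cell:
  fixes c :: "'a::euclidean_space"
  assumes "0 \<le> l"
  shows "measure lborel (grid_cell l c) = l ^ DIM('a)" "emeasure lborel (grid_cell l c) < \<infinity>"
    "grid_cell l c \<in> sets borel" "compact (grid_cell l c)"
proof -
  have "c \<bullet> i \<le> (c + l *\<^sub>R One) \<bullet> i" if "i \<in> Basis" for i using assms that by (simp add: inner_left_distrib)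
  then show "measure lborel (grid_cell l c) = l ^ DIM('a)"
    using measure_lborel_cbox[of c "c + l *\<^sub>R One"] by (simp add: grid_cell_def inner_left_distrib)
  show "emeasure lborel (grid_cell l c) < \<infinity>"
    unfolding grid_cell_def using emeasure_bounded_finite[OF bounded_cbox] .
qed (auto simp: grid_cell_def)

text \<open>The integrand is rewritten as a jointly measurable function of the corner and the variable
  of integration.\<close>

lemma grid_average_measurable:
  assumes [measurable]: "\<phi> \<in> borel_measurable borel"
  shows "grid_average l \<phi> \<in> borel_measurable borel"
proof -
  have [measurable]: "grid_corner l \<in> borel_measurable borel"
    unfolding grid_corner_def by measurable
  have eq: "grid_average l \<phi> = (\<lambda>x. (\<integral>y. (if \<forall>i\<in>Basis. grid_corner l x \<bullet> i \<le> y \<bullet> i \<and> y \<bullet> i \<le> grid_corner l x \<bullet> i + l then \<phi> y else 0) \<partial>lborel) / l ^ DIM('a))"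
    unfolding grid_average_def
    by (intro ext arg_cong2[where f = "(/)"] Bochner_Integration.integral_cong refl)
      (auto simp: grid_cell_def mem_box indicator_def inner_left_distrib)
  have "(\<lambda>x. \<integral>y. (if \<forall>i\<in>Basis. grid_corner l x \<bullet> i \<le> y \<bullet> i \<and> y \<bullet> i \<le> grid_corner l x \<bullet> i + l then \<phi> y else 0) \<partial>lborel) \<in> borel_measurable borel"
    by (rule lborel.borel_measurable_lebesgue_integral) measurable
  then show ?thesis unfolding eq by measurable
qed

text \<open>The difference is the average of \<open>\<phi>(x) - \<phi>(y)\<close> over the cell of \<open>x\<close>. Every such \<open>y\<close> is
  \<open>x + h\<close> with \<open>h\<close> in the cube \<open>D\<close> of side \<open>2 l\<close>, which does not depend on \<open>x\<close>; replacing the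
  cell by \<open>x + D\<close> costs the ratio \<open>2\<^sup>n\<close> of the volumes and allows the integrals over \<open>x\<close> and \<open>h\<close>
  to be exchanged. The inner one is bounded by the translation estimate.\<close>

lemma grid_average_estimate:
  fixes \<phi> :: "'a::euclidean_space \<Rightarrow> real"
  assumes \<phi>: "\<phi> \<in> test_functions \<Omega>" and p: "1 < p" and l: "0 < l"
  defines "E \<equiv> (\<integral>x. norm (grad \<phi> x) powr p \<partial>lborel)" and "N \<equiv> real DIM('a)"
  shows "(\<integral>\<^sup>+x. ennreal (\<bar>\<phi> x - grid_average l \<phi> x\<bar> powr p) \<partial>lborel) \<le> ennreal (2 ^ DIM('a) * ((N * l) powr p * E))"
proof -
  note \<phi>D = test_functionsD[OF \<phi>]
  have [measurable]: "\<phi> \<in> borel_measurable borel"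
    using \<phi>D(2) by (rule borel_measurable_continuous_onI)
  define V where "V = l ^ DIM('a)"
  have V: "0 < V" using l by (simp add: V_def)
  define D where "D = cbox (- l *\<^sub>R One) (l *\<^sub>R One :: 'a)"
  have [measurable]: "D \<in> sets borel" by (simp add: D_def)
  have E0: "0 \<le> E" by (simp add: E_def)
  have pt: "ennreal (\<bar>\<phi> x - grid_average l \<phi> x\<bar> powr p)
    \<le> ennreal (1 / V) * (\<integral>\<^sup>+h. indicator D h * ennreal (\<bar>\<phi> x - \<phi> (x + h)\<bar> powr p) \<partial>lborel)" for x
  proof -
    let ?S = "grid_cell l (grid_corner l x)"
    have mS: "measure lborel ?S = V" "emeasure lborel ?S < \<infinity>" "?S \<in> sets lborel" "compact ?S"
      using measure_grid_cell[of l "grid_corner l x"] l by (auto simp: V_def)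
    have iS: "integrable lborel (indicator ?S :: 'a \<Rightarrow> real)" using mS by (intro integrable_real_indicator) auto
    have i1: "integrable lborel (\<lambda>y. indicator ?S y * \<phi> y)"
      using mS(4) \<phi>D(2) by (intro integrable_indicator_continuous) (auto intro: continuous_on_subset)
    have i2: "integrable lborel (\<lambda>y. indicator ?S y * \<bar>\<phi> x - \<phi> y\<bar>)"
      using mS(4) \<phi>D(2) by (intro integrable_indicator_continuous continuous_intros) (auto intro: continuous_on_subset)
    have "\<phi> x - grid_average l \<phi> x = (\<integral>y. indicator ?S y * (\<phi> x - \<phi> y) \<partial>lborel) / V"
    proof -
      have "(\<integral>y. indicator ?S y * (\<phi> x - \<phi> y) \<partial>lborel) = (\<integral>y. indicator ?S y * \<phi> x - indicator ?S y * \<phi> y \<partial>lborel)"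
        by (simp add: right_diff_distrib)
      also have "\<dots> = V * \<phi> x - (\<integral>y. indicator ?S y * \<phi> y \<partial>lborel)"
        using iS i1 mS by (subst Bochner_Integration.integral_diff) auto
      finally show ?thesis using V by (simp add: grid_average_def V_def[symmetric] diff_divide_distrib)
    qed
    then have "\<bar>\<phi> x - grid_average l \<phi> x\<bar> = \<bar>\<integral>y. indicator ?S y * (\<phi> x - \<phi> y) \<partial>lborel\<bar> / V"
      using V by (simp add: abs_divide)
    also have "\<dots> \<le> (\<integral>y. \<bar>indicator ?S y * (\<phi> x - \<phi> y)\<bar> \<partial>lborel) / V"
      using V by (intro divide_right_mono integral_abs_bound) auto
    also have "(\<integral>y. \<bar>indicator ?S y * (\<phi> x - \<phi> y)\<bar> \<partial>lborel) = (\<integral>y. indicator ?S y * \<bar>\<phi> x - \<phi> y\<bar> \<partial>lborel)"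
      by (intro Bochner_Integration.integral_cong) (auto simp: abs_mult)
    finally have "ennreal (\<bar>\<phi> x - grid_average l \<phi> x\<bar> powr p) \<le> ennreal (((\<integral>y. indicator ?S y * \<bar>\<phi> x - \<phi> y\<bar> \<partial>lborel) / V) powr p)"
      using p by (intro ennreal_leI powr_mono2) auto
    also have "\<dots> \<le> ennreal (1 / V) * (\<integral>\<^sup>+y. indicator ?S y * ennreal (\<bar>\<phi> x - \<phi> y\<bar> powr p) \<partial>lborel)"
      using mS V p i2 by (intro Jensen_powr) auto
    also have "\<dots> \<le> ennreal (1 / V) * (\<integral>\<^sup>+y. indicator D (y - x) * ennreal (\<bar>\<phi> x - \<phi> y\<bar> powr p) \<partial>lborel)"
      using grid_cell_diff[OF l] by (intro mult_left_mono nn_integral_mono mult_right_mono) (auto simp: D_def indicator_def)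
    also have "(\<integral>\<^sup>+y. indicator D (y - x) * ennreal (\<bar>\<phi> x - \<phi> y\<bar> powr p) \<partial>lborel)
      = (\<integral>\<^sup>+h. indicator D h * ennreal (\<bar>\<phi> x - \<phi> (x + h)\<bar> powr p) \<partial>lborel)"
      using nn_integral_translate[of "\<lambda>y. indicator D (y - x) * ennreal (\<bar>\<phi> x - \<phi> y\<bar> powr p)" x] by (simp add: add.commute)
    finally show ?thesis .
  qed
  have normD: "norm h \<le> N * l" if "h \<in> D" for h
  proof -
    have "norm h \<le> (\<Sum>i\<in>Basis. \<bar>h \<bullet> i\<bar>)" by (rule norm_le_l1)
    also have "\<dots> \<le> (\<Sum>i\<in>(Basis::'a set). l)"
      using that by (intro sum_mono) (auto simp: D_def mem_box abs_le_iff minus_le_iff)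
    finally show ?thesis by (simp add: N_def)
  qed
  have "(\<integral>\<^sup>+x. ennreal (\<bar>\<phi> x - grid_average l \<phi> x\<bar> powr p) \<partial>lborel)
    \<le> (\<integral>\<^sup>+x. ennreal (1 / V) * (\<integral>\<^sup>+h. indicator D h * ennreal (\<bar>\<phi> x - \<phi> (x + h)\<bar> powr p) \<partial>lborel) \<partial>lborel)"
    by (intro nn_integral_mono pt)
  also have "\<dots> = ennreal (1 / V) * (\<integral>\<^sup>+x. (\<integral>\<^sup>+h. indicator D h * ennreal (\<bar>\<phi> x - \<phi> (x + h)\<bar> powr p) \<partial>lborel) \<partial>lborel)"
    by (rule nn_integral_cmult) measurable
  also have "(\<integral>\<^sup>+x. (\<integral>\<^sup>+h. indicator D h * ennreal (\<bar>\<phi> x - \<phi> (x + h)\<bar> powr p) \<partial>lborel) \<partial>lborel)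
    = (\<integral>\<^sup>+h. (\<integral>\<^sup>+x. indicator D h * ennreal (\<bar>\<phi> x - \<phi> (x + h)\<bar> powr p) \<partial>lborel) \<partial>lborel)"
    by (rule lborel_pair.Fubini') measurable
  also have "\<dots> \<le> (\<integral>\<^sup>+h. indicator D h * ennreal ((N * l) powr p * E) \<partial>lborel)"
  proof (rule nn_integral_mono)
    fix h :: 'a
    show "(\<integral>\<^sup>+x. indicator D h * ennreal (\<bar>\<phi> x - \<phi> (x + h)\<bar> powr p) \<partial>lborel) \<le> indicator D h * ennreal ((N * l) powr p * E)"
    proof (cases "h \<in> D")
      case True
      have "(\<integral>\<^sup>+x. ennreal (\<bar>\<phi> x - \<phi> (x + h)\<bar> powr p) \<partial>lborel) \<le> ennreal (norm h powr p * E)"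
        unfolding E_def by (rule test_function_translation_estimate[OF \<phi> p])
      also have "\<dots> \<le> ennreal ((N * l) powr p * E)"
        using normD[OF True] p E0 by (intro ennreal_leI mult_right_mono powr_mono2) auto
      finally show ?thesis using True by simp
    qed simp
  qed
  also have "\<dots> = emeasure lborel D * ennreal ((N * l) powr p * E)"
    by (subst nn_integral_multc) auto
  also have "emeasure lborel D = ennreal ((2 * l) ^ DIM('a))"
  proof -
    have "(\<Prod>i\<in>Basis. (l *\<^sub>R One - (- l *\<^sub>R One)) \<bullet> (i::'a)) = (\<Prod>i\<in>(Basis :: 'a set). 2 * l)"
      by (intro prod.cong) (auto simp: inner_diff_left inner_add_left)
    moreover have "emeasure lborel D = ennreal (\<Prod>i\<in>Basis. (l *\<^sub>R One - (- l *\<^sub>R One)) \<bullet> (i::'a))"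
      unfolding D_def using l by (intro emeasure_lborel_cbox) auto
    ultimately show ?thesis by (simp only: prod_constant)
  qed
  also have "ennreal (1 / V) * (ennreal ((2 * l) ^ DIM('a)) * ennreal ((N * l) powr p * E))
    = ennreal (1 / V * ((2 * l) ^ DIM('a) * ((N * l) powr p * E)))"
    using V l E0 by (simp add: ennreal_mult[symmetric])
  also have "1 / V * ((2 * l) ^ DIM('a) * ((N * l) powr p * E)) = 2 ^ DIM('a) * ((N * l) powr p * E)"
    using V by (simp add: V_def power_mult_distrib)
  finally show ?thesis by (simp add: mult_left_mono)
qed

lemma countable_bounded_diagonal_subseq:
  fixes s :: "'i \<Rightarrow> nat \<Rightarrow> real"
  assumes I: "countable I" and bd: "\<And>i. i \<in> I \<Longrightarrow> bounded (range (s i))"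
  shows "\<exists>r. strict_mono (r :: nat \<Rightarrow> nat) \<and> (\<forall>i\<in>I. convergent (\<lambda>n. s i (r n)))"
proof (cases "I = {}")
  case True
  then show ?thesis using strict_mono_id by auto
next
  case False
  define t where "t n = s (from_nat_into I n)" for n
  have tb: "bounded (range (t n))" for n
    unfolding t_def using bd from_nat_into[OF False] by blast
  interpret subseqs "\<lambda>n r. convergent (\<lambda>k. t n (r k))"
  proof
    fix n and u :: "nat \<Rightarrow> nat" assume "strict_mono u"
    have "bounded (range (\<lambda>k. t n (u k)))" using tb[of n] by (rule bounded_subset) auto
    from bounded_imp_convergent_subsequence[OF this]
    obtain l r where "strict_mono r" "((\<lambda>k. t n (u k)) \<circ> r) \<longlonglongrightarrow> l" by blast
    then show "\<exists>r'. strict_mono r' \<and> convergent (\<lambda>k. t n ((u \<circ> r') k))"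
      by (auto simp: o_def convergent_def)
  qed
  have "convergent (\<lambda>k. t n (diagseq k))" for n
  proof -
    have "convergent (\<lambda>k. t n ((diagseq \<circ> ((+) (Suc n))) k))"
    proof (rule diagseq_holds)
      fix r s and m :: nat assume "strict_mono (r :: nat \<Rightarrow> nat)" "convergent (\<lambda>k. t m (s k))"
      then show "convergent (\<lambda>k. t m ((s \<circ> r) k))"
        using convergent_subseq_convergent[of "\<lambda>k. t m (s k)" r] by (simp add: o_def)
    qed
    then have "convergent (\<lambda>k. t n (diagseq (k + Suc n)))" by (simp add: o_def add.commute)
    then show ?thesis using convergent_ignore_initial_segment[of "\<lambda>k. t n (diagseq k)" "Suc n"] by simp
  qed
  moreover have "\<exists>n. s i = t n" if "i \<in> I" for i
    unfolding t_def using from_nat_into_surj[OF I that] by metis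
  ultimately show ?thesis using subseq_diagseq by metis
qed

context sobolev_domain begin

lemma energy_M_eq_lborel:
  fixes g :: "'a \<Rightarrow> 'b::euclidean_space"
  assumes "g \<in> borel_measurable borel" "\<And>x. x \<notin> \<Omega> \<Longrightarrow> g x = 0"
  shows "en g = (\<integral>x. norm (g x) powr p \<partial>lborel)"
  unfolding energy_def using assms p
  by (intro integral_lebesgue_on_eq_lborel[OF \<Omega>_sets]) auto

lemma test_function_energy:
  assumes "\<phi> \<in> tests"
  shows "en \<phi> = (\<integral>x. \<bar>\<phi> x\<bar> powr p \<partial>lborel)" "en (grad \<phi>) = (\<integral>x. norm (grad \<phi> x) powr p \<partial>lborel)"
  using energy_M_eq_lborel[of \<phi>] energy_M_eq_lborel[of "grad \<phi>"] test_functionsD[OF assms]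
  by (auto simp: borel_measurable_continuous_onI)

lemma energy_M_le:
  fixes g :: "'a \<Rightarrow> real"
  assumes [measurable]: "g \<in> borel_measurable borel" and C: "0 \<le> C"
    and le: "(\<integral>\<^sup>+x. ennreal (\<bar>g x\<bar> powr p) \<partial>lborel) \<le> ennreal C"
  shows "in_Lp g" "en g \<le> C"
proof -
  have eq: "(\<integral>\<^sup>+x. ennreal (\<bar>g x\<bar> powr p) \<partial>M) \<le> ennreal C"
  proof -
    have "(\<integral>\<^sup>+x. ennreal (\<bar>g x\<bar> powr p) \<partial>M) = (\<integral>\<^sup>+x. ennreal (\<bar>g x\<bar> powr p) * indicator \<Omega> x \<partial>lebesgue)"
      using \<Omega>_sets by (subst nn_integral_restrict_space) auto
    also have "\<dots> \<le> (\<integral>\<^sup>+x. ennreal (\<bar>g x\<bar> powr p) \<partial>lebesgue)"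
      by (intro nn_integral_mono) (auto simp: indicator_def)
    also have "\<dots> = (\<integral>\<^sup>+x. ennreal (\<bar>g x\<bar> powr p) \<partial>lborel)" by (rule nn_integral_completion)
    finally show ?thesis using le by simp
  qed
  have gM: "g \<in> borel_measurable M" by (rule borel_measurable_M) measurable
  then have int: "integrable M (\<lambda>x. \<bar>g x\<bar> powr p)"
    using eq by (intro integrableI_bounded) (auto simp: le_less_trans)
  then show "in_Lp g" using gM by (simp add: p_integrable_def)
  show "en g \<le> C"
    using eq int C unfolding energy_def by (subst (asm) nn_integral_eq_integral) auto
qed

text \<open>The averages over a fixed cell are bounded along the sequence, and there are countably
  many cells in the grids of mesh width \<open>1 / (k + 1)\<close>. By a diagonal choice all of them converge
  along one subsequence. For a fixed grid the averaged functions are then bounded and converge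
  pointwise, hence form a Cauchy sequence in \<open>L\<^sup>p\<close>; for a fine grid they are close to the test
  functions uniformly in \<open>n\<close>.\<close>

theorem Rellich_test_functions:
  assumes \<phi>: "\<And>n. \<phi> n \<in> tests" and K: "\<And>n. en (\<phi> n) \<le> K" "\<And>n. en (grad (\<phi> n)) \<le> K"
  shows "\<exists>r. strict_mono (r :: nat \<Rightarrow> nat) \<and>
    (\<forall>e>0. \<exists>N. \<forall>m\<ge>N. \<forall>n\<ge>N. dist_en (\<phi> (r m)) (\<phi> (r n)) < e)"
proof -
  note \<phi>D = test_functionsD[OF \<phi>]
  interpret finite_measure M by (rule finite_M)
  have p0: "0 \<le> p" "0 < p" using p by auto
  have \<phi>_meas [measurable]: "\<phi> n \<in> borel_measurable borel" for n
    by (rule borel_measurable_continuous_onI[OF \<phi>D(2)])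
  have \<phi>_int: "integrable lborel (\<phi> n)" for n
  proof -
    obtain R where "\<And>x. R < norm x \<Longrightarrow> \<phi> n x = 0" using test_function_support[OF \<phi>] by blast
    then show ?thesis by (intro integrable_lborel_continuous_bounded_support[OF \<phi>D(2), of _ R]) force
  qed
  define K1 where "K1 = measure M (space M) + K"
  have L1: "(\<integral>x. \<bar>\<phi> n x\<bar> \<partial>lborel) \<le> K1" for n
  proof -
    have "(\<integral>x. \<bar>\<phi> n x\<bar> \<partial>lborel) = (\<integral>x. \<bar>\<phi> n x\<bar> \<partial>M)"
      using \<phi>D(4) by (intro integral_lebesgue_on_eq_lborel[OF \<Omega>_sets, symmetric]) auto
    also have "\<dots> \<le> (\<integral>x. 1 + norm (\<phi> n x) powr p \<partial>M)"
    proof (rule integral_mono)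
      show "integrable M (\<lambda>x. \<bar>\<phi> n x\<bar>)"
        using p_integrable_imp_integrable[OF test_function_p_integrable(1)[OF \<phi>]] by (rule integrable_abs)
      show "integrable M (\<lambda>x. 1 + norm (\<phi> n x) powr p)"
        using test_function_p_integrable(1)[OF \<phi>[of n]] by (simp add: p_integrable_def)
      show "\<bar>\<phi> n x\<bar> \<le> 1 + norm (\<phi> n x) powr p" for x using le_add_powr[of "\<bar>\<phi> n x\<bar>" 1 p] p by simp
    qed
    also have "\<dots> = measure M (space M) + en (\<phi> n)"
      using test_function_p_integrable(1)[OF \<phi>[of n]] by (simp add: p_integrable_def energy_def)
    finally show ?thesis using K(1)[of n] by (simp add: K1_def)
  qed
  let ?I = "\<lambda>l c n. \<integral>y. indicator (grid_cell l c) y * \<phi> n y \<partial>lborel"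
  have I_bound: "\<bar>?I l c n\<bar> \<le> K1" if "0 < l" for l c n
  proof -
    have "\<bar>?I l c n\<bar> \<le> (\<integral>y. \<bar>indicator (grid_cell l c) y * \<phi> n y\<bar> \<partial>lborel)" by (rule integral_abs_bound)
    also have "\<dots> \<le> (\<integral>y. \<bar>\<phi> n y\<bar> \<partial>lborel)"
    proof (rule integral_mono)
      show "integrable lborel (\<lambda>y. \<bar>indicator (grid_cell l c) y * \<phi> n y\<bar>)"
        using measure_grid_cell[of l c] that \<phi>D(2)
        by (intro integrable_abs integrable_indicator_continuous) (auto intro: continuous_on_subset)
    qed (use \<phi>_int in \<open>auto simp: indicator_def\<close>)
    finally show ?thesis using L1[of n] by simp
  qed
  define J where "J = (SIGMA k : (UNIV :: nat set). range (grid_corner (1 / real (Suc k)) :: 'a \<Rightarrow> 'a))"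
  have "countable J" unfolding J_def by (intro countable_SIGMA countable_grid_corners) auto
  moreover have "bounded (range (\<lambda>n. ?I (1 / real (Suc (fst i))) (snd i) n))" for i
    using I_bound by (intro boundedI[of _ K1]) auto
  ultimately obtain r where r: "strict_mono (r :: nat \<Rightarrow> nat)"
    and conv: "\<And>i. i \<in> J \<Longrightarrow> convergent (\<lambda>n. ?I (1 / real (Suc (fst i))) (snd i) (r n))"
    using countable_bounded_diagonal_subseq[of J "\<lambda>i n. ?I (1 / real (Suc (fst i))) (snd i) n"] by blast
  have "\<exists>T N. (\<forall>n. in_Lp (T n)) \<and> (\<forall>n\<ge>N. dist_en (\<phi> (r n)) (T n) < e') \<and>
      (\<forall>m\<ge>N. \<forall>n\<ge>N. dist_en (T m) (T n) < e')" if e': "0 < e'" for e' :: real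
  proof -
    \<comment> \<open>The distance to the averages is at most \<open>c l\<^sup>p\<close> on the grid of mesh width \<open>l\<close>.\<close>
    define c where "c = 2 ^ DIM('a) * (real DIM('a) powr p * K)"
    have K0: "0 \<le> K" using K(1)[of 0] energy_nonneg[of M p "\<phi> 0"] by linarith
    have c0: "0 \<le> c" using K0 by (simp add: c_def)
    have "(\<lambda>k. c * (1 / real (Suc k)) powr p) \<longlonglongrightarrow> c * 0"
    proof (intro tendsto_mult tendsto_const)
      have "(\<lambda>k. (1 / real (Suc k)) powr p) \<longlonglongrightarrow> 0 powr p"
        using LIMSEQ_inverse_real_of_nat p by (intro tendsto_powr') (auto simp: inverse_eq_divide)
      then show "(\<lambda>k. (1 / real (Suc k)) powr p) \<longlonglongrightarrow> 0" by simp
    qed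
    then have "\<forall>\<^sub>F k in sequentially. c * (1 / real (Suc k)) powr p < e'"
      using e' by (intro order_tendstoD(2)) auto
    then obtain k where k: "c * (1 / real (Suc k)) powr p < e'"
      using eventually_happens'[OF sequentially_bot] by blast
    define l where "l = 1 / real (Suc k)"
    have l: "0 < l" by (simp add: l_def)
    define T where "T n = grid_average l (\<phi> (r n))" for n
    have T_meas [measurable]: "T n \<in> borel_measurable borel" for n
      unfolding T_def by (rule grid_average_measurable) measurable
    have est: "in_Lp (\<lambda>x. \<phi> (r n) x - T n x)" "dist_en (\<phi> (r n)) (T n) < e'" for n
    proof -
      let ?E = "\<integral>x. norm (grad (\<phi> (r n)) x) powr p \<partial>lborel"
      have "(\<integral>\<^sup>+x. ennreal (\<bar>\<phi> (r n) x - T n x\<bar> powr p) \<partial>lborel) \<le> ennreal (2 ^ DIM('a) * ((real DIM('a) * l) powr p * ?E))"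
        unfolding T_def by (rule grid_average_estimate[OF \<phi> p l])
      also have "\<dots> \<le> ennreal (2 ^ DIM('a) * ((real DIM('a) * l) powr p * K))"
        using K(2)[of "r n"] test_function_energy(2)[OF \<phi>] by (intro ennreal_leI mult_left_mono) auto
      also have "2 ^ DIM('a) * ((real DIM('a) * l) powr p * K) = c * l powr p"
        using l by (simp add: c_def powr_mult)
      finally have le: "(\<integral>\<^sup>+x. ennreal (\<bar>\<phi> (r n) x - T n x\<bar> powr p) \<partial>lborel) \<le> ennreal (c * l powr p)" .
      have "0 \<le> c * l powr p" using c0 by simp
      from energy_M_le[OF _ this le]
      show "in_Lp (\<lambda>x. \<phi> (r n) x - T n x)" "dist_en (\<phi> (r n)) (T n) < e'"
        using k by (auto simp: l_def)
    qed
    have T_bound: "norm (T n x) \<le> K1 / l ^ DIM('a)" for n x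
      using I_bound[OF l, of "grid_corner l x" "r n"] l
      by (simp add: T_def grid_average_def abs_divide divide_right_mono)
    have T_p: "in_Lp (T n)" for n
      by (rule p_integrable_M_bounded[OF borel_measurable_M[OF T_meas] T_bound])
    define L where "L x = lim (\<lambda>n. T n x)" for x
    have T_conv: "(\<lambda>n. T n x) \<longlonglongrightarrow> L x" for x
    proof -
      have "convergent (\<lambda>n. ?I l (grid_corner l x) (r n))"
        using conv[of "(k, grid_corner l x)"] by (auto simp: J_def l_def)
      then obtain L0 where "(\<lambda>n. ?I l (grid_corner l x) (r n)) \<longlonglongrightarrow> L0" by (auto simp: convergent_def)
      then have "(\<lambda>n. T n x) \<longlonglongrightarrow> L0 / l ^ DIM('a)"
        unfolding T_def grid_average_def using l by (intro tendsto_divide tendsto_const) auto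
      then have "convergent (\<lambda>n. T n x)" by (rule convergentI)
      then show ?thesis by (simp add: L_def convergent_LIMSEQ_iff)
    qed
    have L_meas [measurable]: "L \<in> borel_measurable borel"
      by (rule borel_measurable_LIMSEQ_metric[OF T_meas T_conv])
    have L_bound: "norm (L x) \<le> K1 / l ^ DIM('a)" for x
      by (rule LIMSEQ_le_const2[OF tendsto_norm[OF T_conv]]) (use T_bound in auto)
    have L_p: "in_Lp L"
      by (rule p_integrable_M_bounded[OF borel_measurable_M[OF L_meas] L_bound])
    have "(\<lambda>n. dist_en (T n) L) \<longlonglongrightarrow> en (\<lambda>x. 0::real)"
    proof (rule energy_tendsto_dominated)
      show "(\<lambda>x. T n x - L x) \<in> borel_measurable M" for n by (rule borel_measurable_M) measurable
      show "in_Lp (\<lambda>x. 2 * (K1 / l ^ DIM('a)))" by (rule p_integrable_M_bounded) auto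
      show "AE x in M. (\<lambda>n. T n x - L x) \<longlonglongrightarrow> 0" using T_conv by (intro AE_I2 LIM_zero)
      show "AE x in M. norm (T n x - L x) \<le> 2 * (K1 / l ^ DIM('a))" for n
      proof (rule AE_I2)
        fix x show "norm (T n x - L x) \<le> 2 * (K1 / l ^ DIM('a))"
          using norm_triangle_ineq4[of "T n x" "L x"] T_bound[of n x] L_bound[of x] by linarith
      qed
    qed (use p in auto)
    then have "(\<lambda>n. dist_en (T n) L) \<longlonglongrightarrow> 0" by (simp add: energy_def)
    from energy_Cauchy_of_tendsto[OF p0(2) T_p L_p this e']
    obtain N where "\<And>m n. N \<le> m \<Longrightarrow> N \<le> n \<Longrightarrow> dist_en (T m) (T n) < e'" by blast
    with T_p est(2) show ?thesis by blast
  qed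
  from energy_Cauchy_of_approx[OF p0(1) test_function_p_integrable(1)[OF \<phi>] this] r show ?thesis by blast
qed

text \<open>Approximating test functions can be taken with bounds that depend on \<open>u\<close> only, which makes
  the estimates for test functions applicable.\<close>

lemma W01p_test_approx:
  assumes "u \<in> W0" "0 < e"
  shows "\<exists>\<phi>\<in>tests. dist_en u \<phi> < e
    \<and> en \<phi> \<le> 2 powr p * (en u + e)
    \<and> en (grad \<phi>) \<le> 2 powr p * (en (\<nabla> u) + e)"
proof -
  obtain \<phi> where \<phi>: "\<phi> \<in> tests"
    "dist_en u \<phi> + dist_en (\<nabla> u) (grad \<phi>) < e"
    using assms unfolding W01p_iff by blast
  have p0: "0 \<le> p" using p by simp
  note uD = W01pD[OF assms(1)] and pi = test_function_p_integrable[OF \<phi>(1)]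
  have a: "dist_en u \<phi> < e" "dist_en (\<nabla> u) (grad \<phi>) < e"
    using \<phi>(2) energy_nonneg[of M p "\<lambda>x. u x - \<phi> x"] energy_nonneg[of M p "\<lambda>x. \<nabla> u x - grad \<phi> x"] by linarith+
  have "en \<phi> = en (\<lambda>x. u x - (u x - \<phi> x))" by simp
  also have "\<dots> \<le> 2 powr p * (en u + dist_en u \<phi>)"
    by (rule energy_diff_le[OF uD(2) p_integrable_diff[OF uD(2) pi(1) p0] p0])
  also have "\<dots> \<le> 2 powr p * (en u + e)" using a by (intro mult_left_mono) auto
  finally have b: "en \<phi> \<le> 2 powr p * (en u + e)" .
  have "en (grad \<phi>) = en (\<lambda>x. \<nabla> u x - (\<nabla> u x - grad \<phi> x))" by simp
  also have "\<dots> \<le> 2 powr p * (en (\<nabla> u) + dist_en (\<nabla> u) (grad \<phi>))"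
    by (rule energy_diff_le[OF uD(4) p_integrable_diff[OF uD(4) pi(2) p0] p0])
  also have "\<dots> \<le> 2 powr p * (en (\<nabla> u) + e)" using a by (intro mult_left_mono) auto
  finally show ?thesis using \<phi>(1) a b by blast
qed

theorem Rellich_W01p:
  assumes w: "\<And>n. w n \<in> W0" and K: "\<And>n. en (w n) \<le> K" "\<And>n. en (\<nabla> (w n)) \<le> K"
  shows "\<exists>r. strict_mono (r :: nat \<Rightarrow> nat) \<and>
    (\<forall>e>0. \<exists>N. \<forall>m\<ge>N. \<forall>n\<ge>N. dist_en (w (r m)) (w (r n)) < e)"
proof -
  have p0: "0 \<le> p" using p by simp
  have "\<exists>\<phi>. \<phi> \<in> tests \<and> dist_en (w n) \<phi> < 1 / real (Suc n) \<and>
    en \<phi> \<le> 2 powr p * (K + 1) \<and> en (grad \<phi>) \<le> 2 powr p * (K + 1)" for n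
  proof -
    have pos: "0 < 1 / real (Suc n)" by simp
    obtain \<phi> where \<phi>: "\<phi> \<in> tests" "dist_en (w n) \<phi> < 1 / real (Suc n)"
      "en \<phi> \<le> 2 powr p * (en (w n) + 1 / real (Suc n))"
      "en (grad \<phi>) \<le> 2 powr p * (en (\<nabla> (w n)) + 1 / real (Suc n))"
      using W01p_test_approx[OF w[of n] pos] by blast
    have "1 / real (Suc n) \<le> 1" by simp
    then have "2 powr p * (en (w n) + 1 / real (Suc n)) \<le> 2 powr p * (K + 1)"
      "2 powr p * (en (\<nabla> (w n)) + 1 / real (Suc n)) \<le> 2 powr p * (K + 1)"
      using K[of n] by (intro mult_left_mono add_mono; simp)+
    with \<phi> show ?thesis by (intro exI[of _ \<phi>] conjI) linarith+
  qed
  then have "\<exists>\<phi>. \<forall>n. \<phi> n \<in> tests \<and> dist_en (w n) (\<phi> n) < 1 / real (Suc n) \<and>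
    en (\<phi> n) \<le> 2 powr p * (K + 1) \<and> en (grad (\<phi> n)) \<le> 2 powr p * (K + 1)"
    by (intro choice allI)
  then obtain \<phi> where \<phi>': "\<forall>n. \<phi> n \<in> tests \<and> dist_en (w n) (\<phi> n) < 1 / real (Suc n) \<and>
    en (\<phi> n) \<le> 2 powr p * (K + 1) \<and> en (grad (\<phi> n)) \<le> 2 powr p * (K + 1)" ..
  have \<phi>: "\<phi> n \<in> tests" "dist_en (w n) (\<phi> n) < 1 / real (Suc n)"
    "en (\<phi> n) \<le> 2 powr p * (K + 1)" "en (grad (\<phi> n)) \<le> 2 powr p * (K + 1)" for n
    using \<phi>'[THEN spec, of n] by simp_all
  obtain r where rC: "strict_mono (r :: nat \<Rightarrow> nat) \<and>
    (\<forall>e>0. \<exists>N. \<forall>m\<ge>N. \<forall>n\<ge>N. dist_en (\<phi> (r m)) (\<phi> (r n)) < e)"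
    using Rellich_test_functions[of \<phi>, OF \<phi>(1,3,4)] ..
  note r = conjunct1[OF rC] and C = conjunct2[OF rC]
  have "\<exists>T N. (\<forall>n. in_Lp (T n)) \<and> (\<forall>n\<ge>N. dist_en (w (r n)) (T n) < e) \<and>
      (\<forall>m\<ge>N. \<forall>n\<ge>N. dist_en (T m) (T n) < e)" if e: "0 < e" for e :: real
  proof -
    obtain N1 where N1: "\<And>m n. N1 \<le> m \<Longrightarrow> N1 \<le> n \<Longrightarrow> dist_en (\<phi> (r m)) (\<phi> (r n)) < e"
      using C[rule_format, OF e] by blast
    obtain N2 where N2: "1 / real (Suc N2) < e" using e reals_Archimedean[of e] by (auto simp: inverse_eq_divide)
    have small: "dist_en (w (r n)) (\<phi> (r n)) < e" if "N2 \<le> n" for n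
    proof -
      have "N2 \<le> r n" using that seq_suble[OF r, of n] by simp
      then have "1 / real (Suc (r n)) \<le> 1 / real (Suc N2)" by (simp add: frac_le)
      then show ?thesis using \<phi>(2)[of "r n"] N2 by linarith
    qed
    show ?thesis
      using small N1 test_function_p_integrable(1)[OF \<phi>(1)]
      by (intro exI[of _ "\<lambda>n. \<phi> (r n)"] exI[of _ "max N1 N2"]) auto
  qed
  from energy_Cauchy_of_approx[OF p0 W01pD(2)[OF w] this] r show ?thesis by blast
qed

text \<open>The Sobolev inequality bounds the \<open>q\<close>-th powers of approximating test functions uniformly.
  A subsequence converges almost everywhere, so Fatou's lemma gives the bound for \<open>u\<close>.\<close>

theorem Sobolev_integrable:
  assumes u: "u \<in> W0" and dim: "p < real DIM('a)"
  shows "integrable M (\<lambda>x. \<bar>u x\<bar> powr (real DIM('a) * p / (real DIM('a) - p)))"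
proof -
  define q where "q = real DIM('a) * p / (real DIM('a) - p)"
  have q: "0 < q" using p dim by (simp add: q_def)
  have p0: "0 < p" using p by simp
  define K where "K = 2 powr p * (en (\<nabla> u) + 1)"
  have "\<exists>\<phi>. \<phi> \<in> tests \<and> dist_en \<phi> u < 1 / real (Suc n) \<and> en (grad \<phi>) \<le> K" for n
  proof -
    have pos: "0 < 1 / real (Suc n)" by simp
    obtain \<phi> where \<phi>: "\<phi> \<in> tests" "dist_en u \<phi> < 1 / real (Suc n)"
      "en (grad \<phi>) \<le> 2 powr p * (en (\<nabla> u) + 1 / real (Suc n))"
      using W01p_test_approx[OF u pos] by blast
    have "2 powr p * (en (\<nabla> u) + 1 / real (Suc n)) \<le> K"
      unfolding K_def by (intro mult_left_mono add_left_mono) auto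
    with \<phi> show ?thesis using energy_minus_commute[of M p u \<phi>] by (intro exI[of _ \<phi>] conjI) auto
  qed
  then obtain \<phi> where \<phi>: "\<And>n. \<phi> n \<in> tests" "\<And>n. dist_en (\<phi> n) u < 1 / real (Suc n)"
    "\<And>n. en (grad (\<phi> n)) \<le> K" by metis
  note pi = test_function_p_integrable(1)[OF \<phi>(1)]
  have "(\<lambda>n. dist_en (\<phi> n) u) \<longlonglongrightarrow> 0"
  proof (rule tendsto_sandwich[where f = "\<lambda>_. 0" and h = "\<lambda>n. 1 / real (Suc n)"])
    show "(\<lambda>n. 1 / real (Suc n)) \<longlonglongrightarrow> 0" using LIMSEQ_inverse_real_of_nat by (simp add: inverse_eq_divide)
    show "\<forall>\<^sub>F n in sequentially. dist_en (\<phi> n) u \<le> 1 / real (Suc n)"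
      using \<phi>(2) by (intro always_eventually allI less_imp_le)
  qed (auto simp: energy_nonneg)
  from Lp_tendsto_dominated_subseq[OF p0 pi W01pD(2)[OF u] this]
  obtain r and g :: "'a \<Rightarrow> real" where r: "strict_mono (r :: nat \<Rightarrow> nat)" and "in_Lp g"
    and conv: "AE x in M. (\<lambda>n. \<phi> (r n) x) \<longlonglongrightarrow> u x" and "AE x in M. \<forall>n. norm (\<phi> (r n) x) \<le> g x"
    by blast
  define C where "C = (p * (real DIM('a) - 1) / (real DIM('a) - p)) powr q * K powr (q / p)"
  have bound: "(\<integral>\<^sup>+x. ennreal (\<bar>\<phi> n x\<bar> powr q) \<partial>M) \<le> ennreal C" for n
  proof -
    note \<phi>D = test_functionsD[OF \<phi>(1)[of n]]
    have [measurable]: "\<phi> n \<in> borel_measurable borel" by (rule borel_measurable_continuous_onI[OF \<phi>D(2)])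
    note i = test_function_powr_integrable(1)[OF \<phi>(1)[of n] q]
    have "(\<integral>x. \<bar>\<phi> n x\<bar> powr q \<partial>lborel) \<le> (p * (real DIM('a) - 1) / (real DIM('a) - p)) powr q * en (grad (\<phi> n)) powr (q / p)"
      using Sobolev_inequality_test_function[OF \<phi>(1)[of n] p dim] test_function_energy(2)[OF \<phi>(1)] by (simp add: q_def)
    also have "\<dots> \<le> C" unfolding C_def using \<phi>(3)[of n] energy_nonneg q p
      by (intro mult_left_mono powr_mono2) auto
    finally have "(\<integral>x. \<bar>\<phi> n x\<bar> powr q \<partial>M) \<le> C"
      using \<phi>D(4) q by (subst integral_lebesgue_on_eq_lborel[OF \<Omega>_sets]) auto
    moreover have "integrable M (\<lambda>x. \<bar>\<phi> n x\<bar> powr q)"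
      using i \<phi>D(4) q by (subst integrable_lebesgue_on_iff_lborel[OF \<Omega>_sets]) auto
    ultimately show ?thesis by (subst nn_integral_eq_integral) (auto intro: ennreal_leI)
  qed
  have u_meas [measurable]: "u \<in> borel_measurable M" using W01pD(2)[OF u] by (simp add: p_integrable_def)
  have \<phi>_meas [measurable]: "\<phi> n \<in> borel_measurable M" for n using pi[of n] by (simp add: p_integrable_def)
  have "(\<integral>\<^sup>+x. ennreal (\<bar>u x\<bar> powr q) \<partial>M) \<le> (\<integral>\<^sup>+x. liminf (\<lambda>n. ennreal (\<bar>\<phi> (r n) x\<bar> powr q)) \<partial>M)"
  proof (rule nn_integral_mono_AE)
    show "AE x in M. ennreal (\<bar>u x\<bar> powr q) \<le> liminf (\<lambda>n. ennreal (\<bar>\<phi> (r n) x\<bar> powr q))"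
      using conv
    proof eventually_elim
      case (elim x)
      have "(\<lambda>n. ennreal (\<bar>\<phi> (r n) x\<bar> powr q)) \<longlonglongrightarrow> ennreal (\<bar>u x\<bar> powr q)"
        using elim q by (intro tendsto_ennrealI tendsto_powr' tendsto_rabs tendsto_const) auto
      then show ?case using lim_imp_Liminf[OF sequentially_bot] by fastforce
    qed
  qed
  also have "\<dots> \<le> liminf (\<lambda>n. \<integral>\<^sup>+x. ennreal (\<bar>\<phi> (r n) x\<bar> powr q) \<partial>M)"
    by (rule nn_integral_liminf) measurable
  also have "\<dots> \<le> ennreal C"
    using bound by (intro Liminf_le) (auto intro: always_eventually)
  finally have "(\<integral>\<^sup>+x. ennreal (\<bar>u x\<bar> powr q) \<partial>M) < \<infinity>" by (simp add: le_less_trans)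
  then show ?thesis unfolding q_def[symmetric] by (intro integrableI_bounded) auto
qed

end

section \<open>Convex integrals of the gradient and compactness\<close>

text \<open>Strictness comes from the mean value theorem: the derivative \<open>p c\<^sup>p\<^sup>-\<^sup>1\<close> at an
  intermediate point differs from the one at \<open>A\<close>.\<close>

lemma powr_tangent_strict:
  fixes a A p :: real
  assumes "0 \<le> a" "0 < A" "1 < p" "a \<noteq> A"
  shows "A powr p + p * A powr (p - 1) * (a - A) < a powr p"
proof (cases "A < a")
  case True
  obtain c where c: "A < c" "c < a" "\<bar>a\<bar> powr p - \<bar>A\<bar> powr p = (a - A) * (p * \<bar>c\<bar> powr (p - 1) * sgn c)"
    using MVT2[OF True, of "\<lambda>y. \<bar>y\<bar> powr p" "\<lambda>y. p * \<bar>y\<bar> powr (p - 1) * sgn y"] abs_powr_has_derivative[OF assms(3)] by blast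
  have "A powr (p - 1) < c powr (p - 1)" using c assms by (intro powr_less_mono2) auto
  then have "(a - A) * (p * A powr (p - 1)) < (a - A) * (p * c powr (p - 1))"
    using True assms by (intro mult_strict_left_mono) auto
  moreover have "a powr p - A powr p = (a - A) * (p * c powr (p - 1))" using c assms by simp
  ultimately show ?thesis by (simp add: algebra_simps)
next
  case False
  then have lt: "a < A" using assms by simp
  obtain c where c: "a < c" "c < A" "\<bar>A\<bar> powr p - \<bar>a\<bar> powr p = (A - a) * (p * \<bar>c\<bar> powr (p - 1) * sgn c)"
    using MVT2[OF lt, of "\<lambda>y. \<bar>y\<bar> powr p" "\<lambda>y. p * \<bar>y\<bar> powr (p - 1) * sgn y"] abs_powr_has_derivative[OF assms(3)] by blast
  have "c powr (p - 1) < A powr (p - 1)" using c assms by (intro powr_less_mono2) auto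
  then have "(A - a) * (p * c powr (p - 1)) < (A - a) * (p * A powr (p - 1))"
    using lt assms by (intro mult_strict_left_mono) auto
  moreover have "A powr p - a powr p = (A - a) * (p * c powr (p - 1))" using c assms by simp
  ultimately show ?thesis by (simp add: algebra_simps)
qed

lemma powr_midpoint_le:
  fixes a b p :: real
  assumes "0 \<le> a" "0 \<le> b" "1 < p"
  shows "((a + b) / 2) powr p \<le> (a powr p + b powr p) / 2"
  using powr_tangent[of a "(a + b) / 2" p] powr_tangent[of b "(a + b) / 2" p] assms
  by (simp add: field_simps)

lemma powr_midpoint_less:
  fixes a b p :: real
  assumes "0 \<le> a" "0 \<le> b" "1 < p" "a \<noteq> b"
  shows "((a + b) / 2) powr p < (a powr p + b powr p) / 2"
proof -
  define A where "A = (a + b) / 2"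
  have A: "0 < A" "a \<noteq> A" "b \<noteq> A" using assms by (auto simp: A_def)
  have "A powr p + p * A powr (p - 1) * (a - A) < a powr p"
    "A powr p + p * A powr (p - 1) * (b - A) < b powr p"
    using assms A by (auto intro!: powr_tangent_strict)
  moreover have "p * A powr (p - 1) * (a - A) + p * A powr (p - 1) * (b - A) = p * A powr (p - 1) * (a + b - 2 * A)"
    by (simp add: algebra_simps)
  moreover have "a + b - 2 * A = 0" by (simp add: A_def)
  ultimately have "2 * A powr p < a powr p + b powr p" by simp
  then show ?thesis by (simp add: A_def)
qed

definition convexity_defect :: "real \<Rightarrow> 'a::euclidean_space \<Rightarrow> 'a \<Rightarrow> real" where
  "convexity_defect p \<xi> \<eta> = (norm \<xi> powr p + norm \<eta> powr p) / 2 - norm ((1/2) *\<^sub>R \<xi> + (1/2) *\<^sub>R \<eta>) powr p"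

lemma norm_midpoint_le: "norm ((1/2) *\<^sub>R \<xi> + (1/2) *\<^sub>R \<eta>) \<le> (norm \<xi> + norm \<eta>) / 2"
  for \<xi> \<eta> :: "'a::real_normed_vector"
  using norm_triangle_ineq[of "(1/2) *\<^sub>R \<xi>" "(1/2) *\<^sub>R \<eta>"] by simp

lemma convexity_defect_nonneg:
  assumes "1 < p"
  shows "0 \<le> convexity_defect p \<xi> \<eta>"
proof -
  have "norm ((1/2) *\<^sub>R \<xi> + (1/2) *\<^sub>R \<eta>) powr p \<le> ((norm \<xi> + norm \<eta>) / 2) powr p"
    using assms norm_midpoint_le by (intro powr_mono2) auto
  also have "\<dots> \<le> (norm \<xi> powr p + norm \<eta> powr p) / 2" using assms by (intro powr_midpoint_le) auto
  finally show ?thesis by (simp add: convexity_defect_def)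
qed

text \<open>If the norms differ, the power is strictly convex; if they agree, the parallelogram
  identity makes the midpoint strictly shorter.\<close>

lemma convexity_defect_pos:
  assumes p: "1 < p" and ne: "\<xi> \<noteq> \<eta>"
  shows "0 < convexity_defect p \<xi> \<eta>"
proof (cases "norm \<xi> = norm \<eta>")
  case False
  have "norm ((1/2) *\<^sub>R \<xi> + (1/2) *\<^sub>R \<eta>) powr p \<le> ((norm \<xi> + norm \<eta>) / 2) powr p"
    using p norm_midpoint_le by (intro powr_mono2) auto
  also have "\<dots> < (norm \<xi> powr p + norm \<eta> powr p) / 2" using p False by (intro powr_midpoint_less) auto
  finally show ?thesis by (simp add: convexity_defect_def)
next
  case True
  let ?m = "(1/2) *\<^sub>R \<xi> + (1/2) *\<^sub>R \<eta>"
  have "(norm ?m)\<^sup>2 = ((norm \<xi>)\<^sup>2 + (norm \<eta>)\<^sup>2) / 2 - (norm (\<xi> - \<eta>))\<^sup>2 / 4"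
    by (simp add: power2_norm_eq_inner inner_add_left inner_add_right inner_diff_left inner_diff_right inner_commute field_simps)
  also have "\<dots> < (norm \<xi>)\<^sup>2" using True ne by simp
  finally have "norm ?m < norm \<xi>" using power_less_imp_less_base by fastforce
  then have "norm ?m powr p < norm \<xi> powr p" using p by (intro powr_less_mono2) auto
  then show ?thesis using True by (simp add: convexity_defect_def)
qed

text \<open>Both sides are homogeneous of degree \<open>p\<close>, so the pair may be normalised to have
  \<open>|\<xi>|\<^sup>p + |\<eta>|\<^sup>p = 1\<close>. The first term on the right suffices unless \<open>|\<xi> - \<eta>|\<^sup>p \<ge> e\<close>; on the
  compact set of normalised pairs with this property the defect has a positive minimum \<open>d\<close>, and
  the left side is at most \<open>2\<^sup>p\<close>.\<close>

lemma uniform_convexity_powr_norm: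
  fixes p e :: real
  assumes p: "1 < p" and e: "0 < e"
  shows "\<exists>C\<ge>0. \<forall>\<xi> \<eta> :: 'a::euclidean_space.
    norm (\<xi> - \<eta>) powr p \<le> e * (norm \<xi> powr p + norm \<eta> powr p) + C * convexity_defect p \<xi> \<eta>"
proof -
  define K :: "('a \<times> 'a) set" where
    "K = {z. norm (fst z) powr p + norm (snd z) powr p = 1 \<and> e \<le> norm (fst z - snd z) powr p}"
  have cont: "continuous_on UNIV (\<lambda>z::'a \<times> 'a. norm (f z) powr p)" if "continuous_on UNIV f" for f :: "'a \<times> 'a \<Rightarrow> 'a"
    using p that by (intro continuous_on_powr' continuous_intros) auto
  have c1: "continuous_on UNIV (\<lambda>z::'a \<times> 'a. norm (fst z) powr p + norm (snd z) powr p)"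
    by (intro continuous_on_add cont continuous_intros)
  have c2: "continuous_on UNIV (\<lambda>z::'a \<times> 'a. norm (fst z - snd z) powr p)"
    by (intro cont continuous_intros)
  have c3: "continuous_on UNIV (\<lambda>z::'a \<times> 'a. convexity_defect p (fst z) (snd z))"
    unfolding convexity_defect_def
    by (intro continuous_on_diff continuous_on_divide c1 cont continuous_intros) auto
  have "closed K"
    unfolding K_def using c1 c2 by (intro closed_Collect_conj closed_Collect_eq closed_Collect_le) (auto intro: continuous_intros)
  moreover have "bounded K"
  proof (rule boundedI)
    fix z assume z: "z \<in> K"
    have le: "norm v \<le> 1" if "norm v powr p \<le> 1" for v :: 'a
    proof (rule ccontr)
      assume "\<not> norm v \<le> 1"
      then have "1 powr p < norm v powr p" using p by (intro powr_less_mono2) auto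
      with that show False by simp
    qed
    have "norm (fst z) powr p + norm (snd z) powr p = 1" using z by (simp add: K_def)
    moreover have "0 \<le> norm (fst z) powr p" "0 \<le> norm (snd z) powr p" by simp_all
    ultimately have "norm (fst z) powr p \<le> 1" "norm (snd z) powr p \<le> 1" by linarith+
    then have "norm (fst z) \<le> 1" "norm (snd z) \<le> 1" using le by auto
    moreover have "norm z \<le> norm (fst z) + norm (snd z)"
      using norm_Pair_le[of "fst z" "snd z"] by simp
    ultimately show "norm z \<le> 2" by simp
  qed
  ultimately have K: "compact K" by (simp add: compact_eq_bounded_closed)
  have pos: "0 < convexity_defect p (fst z) (snd z)" if "z \<in> K" for z
  proof (rule convexity_defect_pos[OF p])
    show "fst z \<noteq> snd z" using that e p by (auto simp: K_def)
  qed
  obtain d where d: "0 < d" "\<And>z. z \<in> K \<Longrightarrow> d \<le> convexity_defect p (fst z) (snd z)"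
  proof (cases "K = {}")
    case True
    then show ?thesis using that[of 1] by simp
  next
    case False
    obtain z0 where "z0 \<in> K" "\<forall>z\<in>K. convexity_defect p (fst z0) (snd z0) \<le> convexity_defect p (fst z) (snd z)"
      using continuous_attains_inf[OF K False continuous_on_subset[OF c3]] by blast
    with pos that show ?thesis by blast
  qed
  show ?thesis
  proof (intro exI[of _ "2 powr p / d"] conjI allI)
    show "0 \<le> 2 powr p / d" using d by simp
    fix \<xi> \<eta> :: 'a
    let ?S = "norm \<xi> powr p + norm \<eta> powr p"
    have D0: "0 \<le> convexity_defect p \<xi> \<eta>" by (rule convexity_defect_nonneg[OF p])
    show "norm (\<xi> - \<eta>) powr p \<le> e * ?S + 2 powr p / d * convexity_defect p \<xi> \<eta>"
    proof (cases "norm (\<xi> - \<eta>) powr p \<le> e * ?S")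
      case True
      moreover have "0 \<le> 2 powr p / d * convexity_defect p \<xi> \<eta>" using d D0 by simp
      ultimately show ?thesis by linarith
    next
      case False
      have S0: "0 \<le> ?S" by simp
      have "?S \<noteq> 0"
      proof
        assume "?S = 0"
        then have "norm \<xi> powr p = 0 \<and> norm \<eta> powr p = 0"
          by (simp add: add_nonneg_eq_0_iff)
        then show False using False by simp
      qed
      with S0 have S: "0 < ?S" by linarith
      \<comment> \<open>Scaling by \<open>s\<close> normalises the pair.\<close>
      define s where "s = ?S powr (- 1 / p)"
      have s: "0 < s" using S by (simp add: s_def)
      have sp: "s powr p = 1 / ?S"
      proof -
        have "s powr p = ?S powr ((- 1 / p) * p)" by (simp only: s_def powr_powr)
        also have "(- 1 / p) * p = - 1" using p by simp
        finally show ?thesis using S by (simp only: powr_neg_one)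
      qed
      have sc: "norm (s *\<^sub>R v) powr p = norm v powr p / ?S" for v :: 'a
        using s sp by (simp add: powr_mult)
      have "(s *\<^sub>R \<xi>, s *\<^sub>R \<eta>) \<in> K"
      proof -
        have "norm (s *\<^sub>R \<xi>) powr p + norm (s *\<^sub>R \<eta>) powr p = ?S / ?S"
          unfolding sc by (rule add_divide_distrib[symmetric])
        moreover have "norm (s *\<^sub>R \<xi> - s *\<^sub>R \<eta>) powr p = norm (\<xi> - \<eta>) powr p / ?S"
          unfolding scaleR_diff_right[symmetric] sc ..
        moreover have "e \<le> norm (\<xi> - \<eta>) powr p / ?S" using False S by (simp add: pos_le_divide_eq)
        ultimately show ?thesis using S by (simp add: K_def)
      qed
      from d(2)[OF this] have "d \<le> convexity_defect p (s *\<^sub>R \<xi>) (s *\<^sub>R \<eta>)" by simp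
      also have "\<dots> = convexity_defect p \<xi> \<eta> / ?S"
      proof -
        have "(1/2) *\<^sub>R s *\<^sub>R \<xi> + (1/2) *\<^sub>R s *\<^sub>R \<eta> = s *\<^sub>R ((1/2) *\<^sub>R \<xi> + (1/2) *\<^sub>R \<eta>)"
          by (simp add: scaleR_add_right)
        moreover have "(x / S + y / S) / 2 - z / S = ((x + y) / 2 - z) / S" for x y z S :: real
          by (simp add: add_divide_distrib diff_divide_distrib)
        ultimately show ?thesis unfolding convexity_defect_def by (simp only: sc)
      qed
      finally have "d * ?S \<le> convexity_defect p \<xi> \<eta>" using S by (simp add: pos_le_divide_eq)
      then have "?S \<le> convexity_defect p \<xi> \<eta> / d" using d by (simp add: pos_le_divide_eq mult.commute)
      then have "2 powr p * ?S \<le> 2 powr p * (convexity_defect p \<xi> \<eta> / d)" by (intro mult_left_mono) auto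
      moreover have "norm (\<xi> - \<eta>) powr p \<le> 2 powr p * ?S" using p by (intro norm_diff_powr_le) auto
      moreover have "0 \<le> e * ?S" using e S by simp
      ultimately show ?thesis by simp
    qed
  qed
qed

text \<open>The energy density whose derivative is the nonlinear operator of the equation.\<close>

definition \<Phi> :: "real \<Rightarrow> 'a::euclidean_space \<Rightarrow> real" where
  "\<Phi> p \<xi> = (sqrt (1 + (norm \<xi>)\<^sup>2) - 1) powr p"

lemma \<Phi>_nonneg: "0 \<le> \<Phi> p \<xi>"
  by (simp add: \<Phi>_def)

lemma sqrt_one_plus_bounds:
  fixes s :: real
  assumes "0 \<le> s"
  shows "0 \<le> sqrt (1 + s\<^sup>2) - 1" "sqrt (1 + s\<^sup>2) - 1 \<le> s" "s \<le> (sqrt (1 + s\<^sup>2) - 1) + 1"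
proof -
  show "0 \<le> sqrt (1 + s\<^sup>2) - 1" by simp
  have "sqrt (1 + s\<^sup>2) \<le> 1 + s" using assms by (intro real_le_lsqrt) (auto simp: power2_eq_square algebra_simps)
  then show "sqrt (1 + s\<^sup>2) - 1 \<le> s" by simp
  have "s \<le> sqrt (1 + s\<^sup>2)" by (intro real_le_rsqrt) auto
  then show "s \<le> (sqrt (1 + s\<^sup>2) - 1) + 1" by simp
qed

lemma \<Phi>_le: "0 \<le> p \<Longrightarrow> \<Phi> p \<xi> \<le> norm \<xi> powr p"
  unfolding \<Phi>_def using sqrt_one_plus_bounds[of "norm \<xi>"] by (intro powr_mono2) auto

lemma norm_powr_le_\<Phi>:
  assumes "0 \<le> p"
  shows "norm \<xi> powr p \<le> 2 powr p * (\<Phi> p \<xi> + 1)"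
proof -
  have "norm \<xi> powr p \<le> ((sqrt (1 + (norm \<xi>)\<^sup>2) - 1) + 1) powr p"
    using assms sqrt_one_plus_bounds[of "norm \<xi>"] by (intro powr_mono2) auto
  also have "\<dots> \<le> 2 powr p * (\<Phi> p \<xi> + 1 powr p)"
    unfolding \<Phi>_def using assms by (intro powr_add_le) auto
  finally show ?thesis by simp
qed

lemma continuous_\<Phi>: "0 < p \<Longrightarrow> continuous_on UNIV (\<Phi> p)"
  unfolding \<Phi>_def by (intro continuous_on_powr' continuous_intros) auto

text \<open>\<open>\<surd>(1 + |\<xi>|\<^sup>2)\<close> is the norm of the pair \<open>(1, \<xi>)\<close>, hence convex in \<open>\<xi>\<close>; the power is convex
  and increasing.\<close>

lemma \<Phi>_midpoint_le:
  assumes "1 < p"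
  shows "\<Phi> p ((1/2) *\<^sub>R \<xi> + (1/2) *\<^sub>R \<eta>) \<le> (\<Phi> p \<xi> + \<Phi> p \<eta>) / 2"
proof -
  have n: "sqrt (1 + (norm v)\<^sup>2) = norm (1::real, v)" for v :: 'a by (simp add: norm_Pair)
  have "norm (1::real, (1/2) *\<^sub>R \<xi> + (1/2) *\<^sub>R \<eta>) \<le> (norm (1::real, \<xi>) + norm (1::real, \<eta>)) / 2"
  proof -
    have "(1::real, (1/2) *\<^sub>R \<xi> + (1/2) *\<^sub>R \<eta>) = (1/2) *\<^sub>R (1, \<xi>) + (1/2) *\<^sub>R (1, \<eta>)" by simp
    then show ?thesis using norm_midpoint_le by metis
  qed
  then have le: "sqrt (1 + (norm ((1/2) *\<^sub>R \<xi> + (1/2) *\<^sub>R \<eta>))\<^sup>2) - 1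
    \<le> ((sqrt (1 + (norm \<xi>)\<^sup>2) - 1) + (sqrt (1 + (norm \<eta>)\<^sup>2) - 1)) / 2"
    unfolding n by (simp add: field_simps)
  have "\<Phi> p ((1/2) *\<^sub>R \<xi> + (1/2) *\<^sub>R \<eta>) \<le> (((sqrt (1 + (norm \<xi>)\<^sup>2) - 1) + (sqrt (1 + (norm \<eta>)\<^sup>2) - 1)) / 2) powr p"
    unfolding \<Phi>_def using assms le by (intro powr_mono2) auto
  also have "\<dots> \<le> (\<Phi> p \<xi> + \<Phi> p \<eta>) / 2"
    unfolding \<Phi>_def using assms by (intro powr_midpoint_le) auto
  finally show ?thesis .
qed

text \<open>The function \<open>\<surd>(1 + s\<^sup>2) - 1\<close> of \<open>s\<close> is convex and vanishes at \<open>0\<close>, so it grows at least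
  linearly along rays. Since \<open>\<Phi>\<close> is not homogeneous, this replaces homogeneity when the
  functions are normalised in the proof of coercivity.\<close>

lemma \<Phi>_scale_le:
  assumes t: "1 \<le> t" and p: "0 \<le> p"
  shows "t powr p * \<Phi> p \<xi> \<le> \<Phi> p (t *\<^sub>R \<xi>)"
proof -
  let ?s = "norm \<xi>" and ?r = "sqrt (1 + (norm \<xi>)\<^sup>2)"
  have r: "1 \<le> ?r" "?r\<^sup>2 = 1 + ?s\<^sup>2" by auto
  have "(t * ?r - (t - 1))\<^sup>2 = 1 + t\<^sup>2 * ?s\<^sup>2 - 2 * (t * (t - 1)) * (?r - 1)"
  proof -
    have "(t * ?r - (t - 1))\<^sup>2 = t\<^sup>2 * ?r\<^sup>2 - 2 * t * (t - 1) * ?r + (t - 1)\<^sup>2"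
      by (simp add: power2_eq_square algebra_simps)
    then show ?thesis unfolding r(2) by (simp add: power2_eq_square algebra_simps)
  qed
  also have "\<dots> \<le> 1 + t\<^sup>2 * ?s\<^sup>2" using t r(1) by simp
  finally have "t * ?r - (t - 1) \<le> sqrt (1 + t\<^sup>2 * ?s\<^sup>2)" by (rule real_le_rsqrt)
  moreover have "sqrt (1 + t\<^sup>2 * ?s\<^sup>2) = sqrt (1 + (norm (t *\<^sub>R \<xi>))\<^sup>2)" by (simp add: power_mult_distrib)
  ultimately have "t * (?r - 1) \<le> sqrt (1 + (norm (t *\<^sub>R \<xi>))\<^sup>2) - 1"
    by (simp only: right_diff_distrib mult_1_right)
  then have "(t * (?r - 1)) powr p \<le> \<Phi> p (t *\<^sub>R \<xi>)"
    unfolding \<Phi>_def using t p r(1) by (intro powr_mono2) auto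
  then show ?thesis using t r(1) by (simp add: powr_mult \<Phi>_def)
qed

context sobolev_domain begin

definition I\<Phi> :: "('a \<Rightarrow> 'a) \<Rightarrow> real" where
  "I\<Phi> G = (\<integral>x. \<Phi> p (G x) \<partial>M)"

lemma \<Phi>_measurable:
  assumes "G \<in> borel_measurable M"
  shows "(\<lambda>x. \<Phi> p (G x)) \<in> borel_measurable M"
proof -
  have "\<Phi> p \<in> borel_measurable borel"
    using p by (intro borel_measurable_continuous_onI continuous_\<Phi>) simp
  from measurable_compose[OF assms this] show ?thesis .
qed

lemma integrable_\<Phi>:
  assumes "in_Lp G"
  shows "integrable M (\<lambda>x. \<Phi> p (G x))"
  by (rule Bochner_Integration.integrable_bound[of M "\<lambda>x. norm (G x) powr p"])
    (use assms p \<Phi>_le[of p] in \<open>auto simp: p_integrable_def \<Phi>_measurable \<Phi>_nonneg\<close>)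

lemma I\<Phi>_nonneg: "0 \<le> I\<Phi> G"
  unfolding I\<Phi>_def by (simp add: \<Phi>_nonneg)

lemma I\<Phi>_cong_AE:
  assumes "in_Lp G" "in_Lp H" "AE x in M. G x = H x"
  shows "I\<Phi> G = I\<Phi> H"
  unfolding I\<Phi>_def
  by (rule integral_cong_AE) (use assms in \<open>auto simp: p_integrable_def \<Phi>_measurable elim: eventually_mono\<close>)

lemma I\<Phi>_midpoint_le:
  assumes "in_Lp G" "in_Lp H"
  shows "I\<Phi> (\<lambda>x. (1/2) *\<^sub>R G x + (1/2) *\<^sub>R H x) \<le> (I\<Phi> G + I\<Phi> H) / 2"
proof -
  have i: "in_Lp (\<lambda>x. (1/2) *\<^sub>R G x + (1/2) *\<^sub>R H x)"
    using assms p by (intro p_integrable_add p_integrable_scaleR) auto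
  have "I\<Phi> (\<lambda>x. (1/2) *\<^sub>R G x + (1/2) *\<^sub>R H x) \<le> (\<integral>x. (\<Phi> p (G x) + \<Phi> p (H x)) / 2 \<partial>M)"
    unfolding I\<Phi>_def using integrable_\<Phi>[OF i] integrable_\<Phi>[OF assms(1)] integrable_\<Phi>[OF assms(2)] \<Phi>_midpoint_le[OF p]
    by (intro integral_mono) auto
  also have "\<dots> = (I\<Phi> G + I\<Phi> H) / 2"
    unfolding I\<Phi>_def using integrable_\<Phi>[OF assms(1)] integrable_\<Phi>[OF assms(2)] by simp
  finally show ?thesis .
qed

text \<open>How much the energy of a midpoint falls below the mean of the energies is measured by the
  integral of the pointwise defect; by uniform convexity, a small value forces \<open>G\<close> and \<open>H\<close> to be
  close.\<close>

lemma energy_defect: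
  fixes G H :: "'a \<Rightarrow> 'b::euclidean_space"
  assumes "in_Lp G" "in_Lp H"
  shows "integrable M (\<lambda>x. convexity_defect p (G x) (H x))"
    "(\<integral>x. convexity_defect p (G x) (H x) \<partial>M)
      = (en G + en H) / 2 - en (\<lambda>x. (1/2) *\<^sub>R G x + (1/2) *\<^sub>R H x)"
    "en (\<lambda>x. (1/2) *\<^sub>R G x + (1/2) *\<^sub>R H x) \<le> (en G + en H) / 2"
proof -
  have i: "in_Lp (\<lambda>x. (1/2) *\<^sub>R G x + (1/2) *\<^sub>R H x)"
    using assms p by (intro p_integrable_add p_integrable_scaleR) auto
  show "integrable M (\<lambda>x. convexity_defect p (G x) (H x))"
    using assms i unfolding convexity_defect_def by (auto simp: p_integrable_def)
  show eq: "(\<integral>x. convexity_defect p (G x) (H x) \<partial>M)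
      = (en G + en H) / 2 - en (\<lambda>x. (1/2) *\<^sub>R G x + (1/2) *\<^sub>R H x)"
    using assms i unfolding convexity_defect_def energy_def p_integrable_def by simp
  have "0 \<le> (\<integral>x. convexity_defect p (G x) (H x) \<partial>M)"
    using convexity_defect_nonneg[OF p] by (intro Bochner_Integration.integral_nonneg) auto
  then show "en (\<lambda>x. (1/2) *\<^sub>R G x + (1/2) *\<^sub>R H x) \<le> (en G + en H) / 2"
    using eq by linarith
qed

text \<open>The gradients of \<open>w\<^sub>n\<close> need not converge in \<open>L\<^sup>p\<close>, but suitable other functions have the
  same limit and strongly convergent gradients. Let \<open>C\<^sub>m\<close> be the set of all functions in the
  space within \<open>t\<^sub>m\<close> of \<open>u\<close>, with gradient energy at most \<open>K\<close> and \<open>\<integral>\<Phi>\<close> of the gradient at most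
  \<open>c + t\<^sub>m\<close>, where \<open>t\<^sub>m\<close> decreases to \<open>0\<close>. These sets decrease, contain midpoints, and contain
  \<open>w\<^sub>n\<close> for large \<open>n\<close>. Choose \<open>v\<^sub>m\<close> in \<open>C\<^sub>m\<close> whose gradient energy is within \<open>t\<^sub>m\<close> of the
  infimum \<open>d\<^sub>m\<close> over \<open>C\<^sub>m\<close>. The infima increase to a limit, so the midpoint of \<open>v\<^sub>m\<close> and \<open>v\<^sub>k\<close>
  cannot have much less energy than the mean of the two, and by uniform convexity the gradients
  of \<open>v\<^sub>m\<close> form a Cauchy sequence. The limit is the gradient of \<open>u\<close>, and \<open>\<integral>\<Phi>\<close> is continuous
  under this convergence.\<close>

theorem W01p_lower_semicontinuous:
  assumes w: "\<And>n. w n \<in> W0" and u: "in_Lp u"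
    and wu: "(\<lambda>n. dist_en (w n) u) \<longlonglongrightarrow> 0"
    and K: "\<And>n. en (\<nabla> (w n)) \<le> K"
    and c: "(\<lambda>n. I\<Phi> (\<nabla> (w n))) \<longlonglongrightarrow> c"
  shows "u \<in> W0" "I\<Phi> (\<nabla> u) \<le> c"
proof -
  have p0: "0 \<le> p" "0 < p" using p by auto
  define t where "t m = 1 / real (Suc m)" for m
  have t: "0 < t m" "m \<le> k \<Longrightarrow> t k \<le> t m" for m k by (auto simp: t_def frac_le)
  have t_lim: "t \<longlonglongrightarrow> 0" unfolding t_def using LIMSEQ_inverse_real_of_nat by (simp add: inverse_eq_divide)
  define E where "E v = en (\<nabla> v)" for v
  define C where "C m = {v \<in> W0. dist_en v u \<le> t m \<and> E v \<le> K \<and> I\<Phi> (\<nabla> v) \<le> c + t m}" for m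
  have C_mono: "C k \<subseteq> C m" if "m \<le> k" for m k
    using t(2)[OF that] unfolding C_def by auto
  have C_ne: "C m \<noteq> {}" for m
  proof -
    have "\<forall>\<^sub>F n in sequentially. dist_en (w n) u < t m \<and> I\<Phi> (\<nabla> (w n)) < c + t m"
      using order_tendstoD(2)[OF wu t(1)[of m]] order_tendstoD(2)[OF c, of "c + t m"] t(1)[of m]
      by (auto elim: eventually_elim2)
    then obtain n where "dist_en (w n) u < t m" "I\<Phi> (\<nabla> (w n)) < c + t m"
      using eventually_happens'[OF sequentially_bot] by blast
    then have "w n \<in> C m" using w[of n] K[of n] by (simp add: C_def E_def)
    then show ?thesis by blast
  qed
  have CD: "v \<in> W0" if "v \<in> C m" for v m using that by (simp add: C_def)
  let ?mid = "\<lambda>v v' x. (1/2) * v x + (1/2) * v' x"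
  have mid_grad: "E (?mid v v') = en (\<lambda>x. (1/2) *\<^sub>R \<nabla> v x + (1/2) *\<^sub>R \<nabla> v' x)"
    "I\<Phi> (\<nabla> (?mid v v')) = I\<Phi> (\<lambda>x. (1/2) *\<^sub>R \<nabla> v x + (1/2) *\<^sub>R \<nabla> v' x)"
    if v: "v \<in> W0" "v' \<in> W0" for v v'
  proof -
    note l = W01p_linear_combination[OF v, of "1/2" "1/2"]
    have i: "in_Lp (\<lambda>x. (1/2) *\<^sub>R \<nabla> v x + (1/2) *\<^sub>R \<nabla> v' x)"
      using W01pD(4)[OF v(1)] W01pD(4)[OF v(2)] p0 by (intro p_integrable_add p_integrable_scaleR)
    show "E (?mid v v') = en (\<lambda>x. (1/2) *\<^sub>R \<nabla> v x + (1/2) *\<^sub>R \<nabla> v' x)"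
      unfolding E_def using W01pD(4)[OF l(1)] i by (intro energy_cong_AE l(2)) (auto simp: p_integrable_def)
    show "I\<Phi> (\<nabla> (?mid v v')) = I\<Phi> (\<lambda>x. (1/2) *\<^sub>R \<nabla> v x + (1/2) *\<^sub>R \<nabla> v' x)"
      by (intro I\<Phi>_cong_AE W01pD(4)[OF l(1)] i l(2))
  qed
  have C_mid: "?mid v v' \<in> C m" if v: "v \<in> C m" "v' \<in> C m" for v v' m
  proof -
    note V = CD[OF v(1)] CD[OF v(2)]
    have "en (\<lambda>x. ?mid v v' x - u x) = en (\<lambda>x. (1/2) *\<^sub>R (v x - u x) + (1/2) *\<^sub>R (v' x - u x))"
      by (rule arg_cong[where f = "en"]) (simp add: fun_eq_iff field_simps)
    also have "\<dots> \<le> (dist_en v u + dist_en v' u) / 2"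
      by (rule energy_defect(3)) (intro p_integrable_diff W01pD(2) V u p0)+
    also have "\<dots> \<le> t m" using v by (simp add: C_def)
    finally have a: "en (\<lambda>x. ?mid v v' x - u x) \<le> t m" .
    have "E (?mid v v') \<le> (E v + E v') / 2"
      unfolding mid_grad(1)[OF V] E_def by (intro energy_defect(3) W01pD(4) V)
    also have "\<dots> \<le> K" using v by (simp add: C_def)
    finally have b: "E (?mid v v') \<le> K" .
    have "I\<Phi> (\<nabla> (?mid v v')) \<le> (I\<Phi> (\<nabla> v) + I\<Phi> (\<nabla> v')) / 2"
      unfolding mid_grad(2)[OF V] by (intro I\<Phi>_midpoint_le W01pD(4) V)
    also have "\<dots> \<le> c + t m" using v by (simp add: C_def)
    finally show ?thesis unfolding C_def using a b W01p_linear_combination(1)[OF V] by blast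
  qed
  define d where "d m = Inf (E ` C m)" for m
  have bdd: "bdd_below (E ` C m)" for m by (rule bdd_belowI[of _ 0]) (auto simp: E_def energy_nonneg)
  have d_le: "d m \<le> E v" if "v \<in> C m" for m v unfolding d_def using bdd that by (intro cInf_lower) auto
  have d_mono: "incseq d" unfolding incseq_def d_def
    using C_ne C_mono bdd by (intro allI impI cInf_superset_mono image_mono) auto
  have d_bound: "d m \<le> K" for m
  proof -
    obtain v where "v \<in> C m" using C_ne by blast
    then show ?thesis using d_le[of v m] by (auto simp: C_def)
  qed
  obtain d0 where d0: "d \<longlonglongrightarrow> d0" "\<And>m. d m \<le> d0"
    using incseq_convergent[OF d_mono, of K] d_bound by blast
  have "\<exists>v\<in>C m. E v < d m + t m" for m
  proof -
    have "Inf (E ` C m) < d m + t m" using t by (simp add: d_def)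
    then show ?thesis using cInf_lessD[of "E ` C m"] C_ne by auto
  qed
  then have "\<exists>v. \<forall>m. v m \<in> C m \<and> E (v m) < d m + t m" by (intro choice) blast
  then obtain v where v: "\<forall>m. v m \<in> C m \<and> E (v m) < d m + t m" ..
  have vC: "v m \<in> C m" and vE: "E (v m) < d m + t m" for m using v by auto
  note V = CD[OF vC]
  have K0: "0 \<le> K" using K[of 0] energy_nonneg[of M p "\<nabla> (w 0)"] by linarith
  have Cauchy: "\<exists>N. \<forall>m\<ge>N. \<forall>k\<ge>N. dist_en (\<nabla> (v m)) (\<nabla> (v k)) < e" if e: "0 < e" for e
  proof -
    \<comment> \<open>\<open>e1\<close> and \<open>e2\<close> are chosen so that the two terms of the uniform convexity estimate
      contribute at most \<open>e / 2\<close> each.\<close>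
    define e1 where "e1 = e / (4 * (K + 1))"
    have e1: "0 < e1" using e K0 by (simp add: e1_def)
    obtain D where D: "0 \<le> D" "\<And>\<xi> \<eta> :: 'a. norm (\<xi> - \<eta>) powr p \<le> e1 * (norm \<xi> powr p + norm \<eta> powr p) + D * convexity_defect p \<xi> \<eta>"
      using uniform_convexity_powr_norm[OF p e1] by blast
    define e2 where "e2 = e / (4 * (D + 1))"
    have e2: "0 < e2" using e D by (simp add: e2_def)
    have "\<forall>\<^sub>F m in sequentially. d0 - e2 < d m \<and> t m < e2"
      using order_tendstoD(1)[OF d0(1), of "d0 - e2"] order_tendstoD(2)[OF t_lim e2] e2 by (auto elim: eventually_elim2)
    then obtain N where N: "d0 - e2 < d m" "t m < e2" if "N \<le> m" for m
      unfolding eventually_sequentially by blast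
    have main: "dist_en (\<nabla> (v m)) (\<nabla> (v k)) < e" if mk: "N \<le> m" "m \<le> k" for m k
    proof -
      let ?G = "\<nabla> (v m)" and ?H = "\<nabla> (v k)"
      have G: "in_Lp ?G" and H: "in_Lp ?H" using W01pD(4)[OF V] by auto
      have k: "N \<le> k" using mk by simp
      \<comment> \<open>Both functions lie in the larger set \<open>C m\<close>.\<close>
      have "?mid (v m) (v k) \<in> C m" using C_mid[OF vC[of m]] C_mono[OF mk(2)] vC[of k] by blast
      then have "d m \<le> en (\<lambda>x. (1/2) *\<^sub>R ?G x + (1/2) *\<^sub>R ?H x)"
        using d_le mid_grad(1)[OF V V] by metis
      then have "(\<integral>x. convexity_defect p (?G x) (?H x) \<partial>M) \<le> (E (v m) + E (v k)) / 2 - d m"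
        using energy_defect(2)[OF G H] by (simp add: E_def)
      also have "\<dots> \<le> ((d m + t m) + (d k + t k)) / 2 - d m" using vE[of m] vE[of k] by simp
      also have "\<dots> \<le> 2 * e2" using N[OF mk(1)] N[OF k] d0(2)[of k] by (simp add: field_simps)
      finally have def: "(\<integral>x. convexity_defect p (?G x) (?H x) \<partial>M) \<le> 2 * e2" .
      have iG: "integrable M (\<lambda>x. norm (?G x) powr p)" "integrable M (\<lambda>x. norm (?H x) powr p)"
        using G H by (auto simp: p_integrable_def)
      have "dist_en ?G ?H \<le> (\<integral>x. e1 * (norm (?G x) powr p + norm (?H x) powr p) + D * convexity_defect p (?G x) (?H x) \<partial>M)"
        unfolding energy_def using p_integrable_diff[OF G H p0(1)] iG energy_defect(1)[OF G H] D(2)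
        by (intro integral_mono) (auto simp: p_integrable_def)
      also have "\<dots> = e1 * (E (v m) + E (v k)) + D * (\<integral>x. convexity_defect p (?G x) (?H x) \<partial>M)"
        using iG energy_defect(1)[OF G H] by (simp add: E_def energy_def)
      also have "\<dots> \<le> e1 * (K + K) + D * (2 * e2)"
        using vC[of m] vC[of k] e1 D(1) def by (intro add_mono mult_left_mono) (auto simp: C_def)
      also have "\<dots> < e1 * (2 * (K + 1)) + (D + 1) * (2 * e2)"
        using e1 e2 by (simp add: algebra_simps)
      also have "e1 * (2 * (K + 1)) = e / 2" using K0 by (simp add: e1_def field_simps)
      also have "(D + 1) * (2 * e2) = e / 2" using D(1) by (simp add: e2_def field_simps)
      finally show ?thesis by simp
    qed
    have "dist_en (\<nabla> (v m)) (\<nabla> (v k)) < e" if "N \<le> m" "N \<le> k" for m k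
      using main[of m k] main[of k m] that energy_minus_commute[of M p "\<nabla> (v m)" "\<nabla> (v k)"]
      by (cases "m \<le> k") auto
    then show ?thesis by blast
  qed
  obtain r H g where r: "strict_mono (r :: nat \<Rightarrow> nat)" and H: "in_Lp H"
    and g: "in_Lp (g :: 'a \<Rightarrow> real)"
    and conv: "AE x in M. (\<lambda>n. \<nabla> (v (r n)) x) \<longlonglongrightarrow> H x"
    and dom: "AE x in M. \<forall>n. norm (\<nabla> (v (r n)) x) \<le> g x"
    and lim: "(\<lambda>n. dist_en (\<nabla> (v n)) H) \<longlonglongrightarrow> 0"
    using Lp_complete_dominated[OF p0(2) W01pD(4)[OF V] Cauchy] by blast
  have vu: "(\<lambda>n. dist_en (v n) u) \<longlonglongrightarrow> 0"
  proof (rule tendsto_sandwich[where f = "\<lambda>_. 0" and h = t])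
    show "\<forall>\<^sub>F n in sequentially. dist_en (v n) u \<le> t n"
      using vC by (auto simp: C_def intro!: always_eventually)
  qed (auto simp: energy_nonneg t_lim)
  note closed = W01p_closed[OF V u H vu lim]
  show uW: "u \<in> W0" by (rule closed(1))
  have "I\<Phi> (\<nabla> u) = I\<Phi> H" by (intro I\<Phi>_cong_AE W01pD(4)[OF uW] H closed(2))
  also have "I\<Phi> H \<le> c"
  proof (rule LIMSEQ_le)
    show "(\<lambda>n. I\<Phi> (\<nabla> (v (r n)))) \<longlonglongrightarrow> I\<Phi> H"
      unfolding I\<Phi>_def
    proof (rule integral_dominated_convergence)
      show "integrable M (\<lambda>x. norm (g x) powr p)" using g by (simp add: p_integrable_def)
      show "AE x in M. (\<lambda>n. \<Phi> p (\<nabla> (v (r n)) x)) \<longlonglongrightarrow> \<Phi> p (H x)"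
        using conv by eventually_elim
          (use continuous_\<Phi>[OF p0(2)] in \<open>auto simp: continuous_on_eq_continuous_at intro: isCont_tendsto_compose\<close>)
      show "AE x in M. norm (\<Phi> p (\<nabla> (v (r n)) x)) \<le> norm (g x) powr p" for n
        using dom
      proof eventually_elim
        case (elim x)
        have "\<Phi> p (\<nabla> (v (r n)) x) \<le> norm (\<nabla> (v (r n)) x) powr p" by (rule \<Phi>_le[OF p0(1)])
        also have "\<dots> \<le> norm (g x) powr p" using elim[rule_format, of n] p0 by (intro powr_mono2) auto
        finally show ?case by (simp add: \<Phi>_nonneg)
      qed
    qed (use H W01pD(4)[OF V] in \<open>auto simp: p_integrable_def intro!: \<Phi>_measurable\<close>)
    show "(\<lambda>n. c + t (r n)) \<longlonglongrightarrow> c"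
      using tendsto_add[OF tendsto_const LIMSEQ_subseq_LIMSEQ[OF t_lim r], of c] by (simp add: o_def)
    show "\<exists>N. \<forall>n\<ge>N. I\<Phi> (\<nabla> (v (r n))) \<le> c + t (r n)" using vC by (auto simp: C_def)
  qed
  finally show "I\<Phi> (\<nabla> u) \<le> c" .
qed

lemma I\<Phi>_le_energy:
  assumes "in_Lp G"
  shows "I\<Phi> G \<le> en G"
  unfolding I\<Phi>_def energy_def using assms integrable_\<Phi>[OF assms] p
  by (intro integral_mono \<Phi>_le) (auto simp: p_integrable_def)

text \<open>\<open>\<Phi>(\<xi>)\<close> is much smaller than \<open>|\<xi>|\<^sup>p\<close> near \<open>0\<close> and controls it only up to an additive
  constant, which contributes the measure of \<open>\<Omega>\<close>.\<close>

lemma energy_le_I\<Phi>: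
  assumes "in_Lp G"
  shows "en G \<le> 2 powr p * (I\<Phi> G + measure M (space M))"
proof -
  interpret finite_measure M by (rule finite_M)
  have "en G \<le> (\<integral>x. 2 powr p * (\<Phi> p (G x) + 1) \<partial>M)"
    unfolding energy_def using assms integrable_\<Phi>[OF assms] p
    by (intro integral_mono norm_powr_le_\<Phi>) (auto simp: p_integrable_def)
  also have "\<dots> = 2 powr p * (I\<Phi> G + measure M (space M))"
    using integrable_\<Phi>[OF assms] by (simp add: I\<Phi>_def)
  finally show ?thesis .
qed

text \<open>Three successive subsequences: one along which the values of \<open>\<integral>\<Phi>\<close> converge, one that is
  Cauchy in \<open>L\<^sup>p\<close> by Rellich's theorem, and one with pointwise convergence and a majorant.\<close>

theorem W01p_compactness:
  assumes w: "\<And>n. w n \<in> W0" and K: "\<And>n. en (w n) \<le> K" "\<And>n. en (\<nabla> (w n)) \<le> K"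
  shows "\<exists>r u g c. strict_mono (r :: nat \<Rightarrow> nat) \<and> u \<in> W0 \<and> in_Lp (g :: 'a \<Rightarrow> real) \<and>
    (AE x in M. (\<lambda>n. w (r n) x) \<longlonglongrightarrow> u x) \<and> (AE x in M. \<forall>n. norm (w (r n) x) \<le> g x) \<and>
    (\<lambda>n. I\<Phi> (\<nabla> (w (r n)))) \<longlonglongrightarrow> c \<and> I\<Phi> (\<nabla> u) \<le> c"
proof -
  have p0: "0 < p" using p by simp
  have "bounded (range (\<lambda>n. I\<Phi> (\<nabla> (w n))))"
  proof (rule boundedI)
    fix y assume "y \<in> range (\<lambda>n. I\<Phi> (\<nabla> (w n)))"
    then obtain n where y: "y = I\<Phi> (\<nabla> (w n))" by blast
    then show "norm y \<le> K" using I\<Phi>_le_energy[OF W01pD(4)[OF w[of n]]] K(2)[of n] I\<Phi>_nonneg[of "\<nabla> (w n)"] by simp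
  qed
  from bounded_imp_convergent_subsequence[OF this]
  obtain c r0 where r0: "strict_mono r0" and c: "((\<lambda>n. I\<Phi> (\<nabla> (w n))) \<circ> r0) \<longlonglongrightarrow> c" by blast
  obtain r1 where r1: "strict_mono (r1 :: nat \<Rightarrow> nat) \<and>
    (\<forall>e>0. \<exists>N. \<forall>m\<ge>N. \<forall>n\<ge>N. en (\<lambda>x. w (r0 (r1 m)) x - w (r0 (r1 n)) x) < e)"
    using Rellich_W01p[of "\<lambda>n. w (r0 n)" K, OF w K] ..
  note W = W01pD(2)[OF w]
  obtain r2 u g where r2: "strict_mono (r2 :: nat \<Rightarrow> nat)" and u: "in_Lp u"
    and g: "in_Lp (g :: 'a \<Rightarrow> real)"
    and conv: "AE x in M. (\<lambda>n. w (r0 (r1 (r2 n))) x) \<longlonglongrightarrow> u x"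
    and dom: "AE x in M. \<forall>n. norm (w (r0 (r1 (r2 n))) x) \<le> g x"
    and lim: "(\<lambda>n. en (\<lambda>x. w (r0 (r1 n)) x - u x)) \<longlonglongrightarrow> 0"
    using Lp_complete_dominated[OF p0, of M "\<lambda>n. w (r0 (r1 n))", OF W conjunct2[OF r1, rule_format]] by blast
  let ?r = "\<lambda>n. r0 (r1 (r2 n))"
  have r: "strict_mono ?r" using r0 r1 r2 by (simp add: strict_mono_def)
  have c': "(\<lambda>n. I\<Phi> (\<nabla> (w (r0 (r1 n))))) \<longlonglongrightarrow> c"
    using LIMSEQ_subseq_LIMSEQ[OF c, of r1] r1 by (simp add: o_def)
  have c'': "(\<lambda>n. I\<Phi> (\<nabla> (w (?r n)))) \<longlonglongrightarrow> c"
    using LIMSEQ_subseq_LIMSEQ[OF c' r2] by (simp add: o_def)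
  note lsc = W01p_lower_semicontinuous[of "\<lambda>n. w (r0 (r1 n))", OF w u lim K(2) c']
  show ?thesis
    using r lsc g conv dom c'' by (intro exI[of _ ?r] exI[of _ u] exI[of _ g] exI[of _ c] conjI)
qed

end

section \<open>Nemytskii operators and coercivity\<close>

lemma floor_quotient_tendsto: "(\<lambda>n. of_int \<lfloor>real (Suc n) * t\<rfloor> / real (Suc n)) \<longlonglongrightarrow> t"
proof (rule Lim_null_comparison[THEN LIM_zero_cancel])
  show "(\<lambda>n. 1 / real (Suc n)) \<longlonglongrightarrow> 0" using LIMSEQ_inverse_real_of_nat by (simp add: inverse_eq_divide)
  have "norm (of_int \<lfloor>real (Suc n) * t\<rfloor> / real (Suc n) - t) \<le> 1 / real (Suc n)" for n
  proof -
    have eq: "of_int \<lfloor>real (Suc n) * t\<rfloor> / real (Suc n) - t = (of_int \<lfloor>real (Suc n) * t\<rfloor> - real (Suc n) * t) / real (Suc n)"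
      by (simp add: field_simps del: of_nat_Suc)
    have "\<bar>of_int \<lfloor>real (Suc n) * t\<rfloor> - real (Suc n) * t\<bar> \<le> 1" by linarith
    then show ?thesis unfolding eq real_norm_def abs_divide by (simp add: divide_right_mono del: of_nat_Suc)
  qed
  then show "\<forall>\<^sub>F n in sequentially. norm (of_int \<lfloor>real (Suc n) * t\<rfloor> / real (Suc n) - t) \<le> 1 / real (Suc n)"
    by (intro always_eventually allI)
qed

text \<open>Approximate \<open>u\<close> by functions \<open>u\<^sub>n\<close> with countably many values. The compositions
  \<open>g(x, u\<^sub>n(x))\<close> are measurable piece by piece and converge to \<open>g(x, u(x))\<close> wherever \<open>g(x, \<cdot>)\<close>
  is continuous. Their limit operator is measurable everywhere, and completeness of the measure
  carries this over.\<close>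

lemma measurable_Caratheodory_compose:
  fixes g :: "'a::euclidean_space \<Rightarrow> real \<Rightarrow> real"
  assumes \<Omega>: "\<Omega> \<in> sets lebesgue" and g: "\<And>s. (\<lambda>x. g x s) \<in> borel_measurable (lebesgue_on \<Omega>)"
    and cont: "AE x in lebesgue_on \<Omega>. continuous_on UNIV (g x)" and u [measurable]: "u \<in> borel_measurable (lebesgue_on \<Omega>)"
  shows "(\<lambda>x. g x (u x)) \<in> borel_measurable (lebesgue_on \<Omega>)"
proof -
  define k where "k n x = \<lfloor>real (Suc n) * u x\<rfloor>" for n x
  define un where "un n x = of_int (k n x) / real (Suc n)" for n x
  have un_lim: "(\<lambda>n. un n x) \<longlonglongrightarrow> u x" for x
    unfolding un_def k_def by (rule floor_quotient_tendsto)
  have gn: "(\<lambda>x. g x (un n x)) \<in> borel_measurable (lebesgue_on \<Omega>)" for n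
    unfolding un_def
  proof (rule measurable_compose_countable[where f = "\<lambda>i x. g x (of_int i / real (Suc n))"])
    show "k n \<in> lebesgue_on \<Omega> \<rightarrow>\<^sub>M count_space UNIV" unfolding k_def by measurable
  qed (rule g)
  have "(\<lambda>x. lim (\<lambda>n. g x (un n x))) \<in> borel_measurable (lebesgue_on \<Omega>)"
    by (rule borel_measurable_lim_metric[OF gn])
  moreover have "AE x in lebesgue_on \<Omega>. lim (\<lambda>n. g x (un n x)) = g x (u x)"
    using cont
  proof eventually_elim
    case (elim x)
    then have "isCont (g x) (u x)" by (simp add: continuous_on_eq_continuous_at)
    then have "(\<lambda>n. g x (un n x)) \<longlonglongrightarrow> g x (u x)" by (rule isCont_tendsto_compose[OF _ un_lim])
    then show ?case by (rule limI)
  qed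
  ultimately show ?thesis by (rule borel_measurable_lebesgue_on_AE_cong[OF \<Omega>])
qed

lemma primitive_has_derivative:
  assumes "continuous_on UNIV (f x)"
  shows "(primitive f x has_real_derivative f x t) (at t)"
proof -
  have "((\<lambda>u. LBINT y=ereal 0..ereal u. f x y) has_vector_derivative f x t) (at t within {- \<bar>t\<bar> - 1..\<bar>t\<bar> + 1})"
    by (rule interval_integral_FTC2) (use assms in \<open>auto intro: continuous_on_subset\<close>)
  moreover have "at t within {- \<bar>t\<bar> - 1..\<bar>t\<bar> + 1} = at t" by (rule at_within_Icc_at) linarith+
  moreover have "primitive f x = (\<lambda>u. LBINT y=ereal 0..ereal u. f x y)"
    by (simp add: primitive_def fun_eq_iff zero_ereal_def)
  ultimately show ?thesis by (simp add: has_real_derivative_iff_has_vector_derivative)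
qed

lemma primitive_0: "primitive f x 0 = 0"
  by (simp only: primitive_def zero_ereal_def interval_integral_endpoints_same)

lemma primitive_continuous: "continuous_on UNIV (f x) \<Longrightarrow> continuous_on UNIV (primitive f x)"
  using primitive_has_derivative[of f x] DERIV_isCont by (metis continuous_at_imp_continuous_on)

text \<open>Rounding the second argument of \<open>f\<close> as before produces jointly measurable functions, whose
  limit \<open>fl\<close> agrees with \<open>f\<close> for almost every \<open>x\<close>. A parameter integral of a jointly measurable
  function is measurable.\<close>

lemma primitive_measurable:
  fixes f :: "'a::euclidean_space \<Rightarrow> real \<Rightarrow> real"
  assumes \<Omega>: "\<Omega> \<in> sets lebesgue" and f: "caratheodory \<Omega> f"
  shows "(\<lambda>x. primitive f x s) \<in> borel_measurable (lebesgue_on \<Omega>)"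
proof -
  have f1: "(\<lambda>x. f x s) \<in> borel_measurable (lebesgue_on \<Omega>)" for s using f by (simp add: caratheodory_def)
  have f2: "AE x in lebesgue_on \<Omega>. continuous_on UNIV (f x)" using f by (simp add: caratheodory_def)
  define fn where "fn n z = f (fst z) (of_int \<lfloor>real (Suc n) * snd z\<rfloor> / real (Suc n))" for n z
  have fn: "fn n \<in> borel_measurable (lebesgue_on \<Omega> \<Otimes>\<^sub>M lborel)" for n
    unfolding fn_def
  proof (rule measurable_compose_countable[where f = "\<lambda>i z. f (fst z) (of_int i / real (Suc n))"])
    show "(\<lambda>z. \<lfloor>real (Suc n) * snd z\<rfloor>) \<in> lebesgue_on \<Omega> \<Otimes>\<^sub>M lborel \<rightarrow>\<^sub>M count_space UNIV" by measurable
    show "(\<lambda>z. f (fst z) (of_int i / real (Suc n))) \<in> borel_measurable (lebesgue_on \<Omega> \<Otimes>\<^sub>M lborel)" for i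
      by (rule measurable_compose[OF measurable_fst f1])
  qed
  define fl where "fl z = lim (\<lambda>n. fn n z)" for z
  have fl [measurable]: "fl \<in> borel_measurable (lebesgue_on \<Omega> \<Otimes>\<^sub>M lborel)"
    unfolding fl_def by (rule borel_measurable_lim_metric[OF fn])
  have fl_eq: "fl (x, t) = f x t" if c: "continuous_on UNIV (f x)" for x t
  proof -
    note floor_quotient_tendsto[of t]
    moreover have "isCont (f x) t" using c by (simp add: continuous_on_eq_continuous_at)
    ultimately have "(\<lambda>n. fn n (x, t)) \<longlonglongrightarrow> f x t"
      unfolding fn_def fst_conv snd_conv by (rule isCont_tendsto_compose[rotated])
    then show ?thesis unfolding fl_def by (rule limI)
  qed
  have m: "(\<lambda>x. \<integral>t. indicator S t *\<^sub>R fl (x, t) \<partial>lborel) \<in> borel_measurable (lebesgue_on \<Omega>)"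
    if [measurable]: "S \<in> sets borel" for S :: "real set"
    by (rule lborel.borel_measurable_lebesgue_integral) (simp add: case_prod_beta')
  have "(\<lambda>x. LBINT t=0..s. fl (x, t)) \<in> borel_measurable (lebesgue_on \<Omega>)"
    unfolding interval_lebesgue_integral_def set_lebesgue_integral_def
    by (cases "(0::ereal) \<le> ereal s") (auto intro!: m borel_measurable_uminus)
  moreover have "AE x in lebesgue_on \<Omega>. (LBINT t=0..s. fl (x, t)) = primitive f x s"
    using f2 by eventually_elim (simp add: primitive_def fl_eq)
  ultimately show ?thesis by (rule borel_measurable_lebesgue_on_AE_cong[OF \<Omega>])
qed

lemma primitive_diff_le:
  assumes c: "continuous_on UNIV (f x)" and g: "\<And>s. \<bar>f x s\<bar> \<le> a * \<bar>s\<bar> powr q + b" and a: "0 \<le> a" and q: "0 \<le> q"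
  shows "\<bar>primitive f x (s + t) - primitive f x s\<bar> \<le> \<bar>t\<bar> * (a * (\<bar>s\<bar> + \<bar>t\<bar>) powr q + b)"
proof -
  have "norm (primitive f x (s + t) - primitive f x s) \<le> (a * (\<bar>s\<bar> + \<bar>t\<bar>) powr q + b) * norm ((s + t) - s)"
  proof (rule field_differentiable_bound[where S = "cball s \<bar>t\<bar>" and f' = "f x"])
    show "(primitive f x has_field_derivative f x z) (at z within cball s \<bar>t\<bar>)" for z
      using primitive_has_derivative[where f = f and x = x, OF c] by (rule has_field_derivative_at_within)
    show "norm (f x z) \<le> a * (\<bar>s\<bar> + \<bar>t\<bar>) powr q + b" if "z \<in> cball s \<bar>t\<bar>" for z
    proof -
      have "\<bar>z\<bar> \<le> \<bar>s\<bar> + \<bar>t\<bar>" using that by (auto simp: dist_real_def)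
      then have "a * \<bar>z\<bar> powr q \<le> a * (\<bar>s\<bar> + \<bar>t\<bar>) powr q" using a q by (intro mult_left_mono powr_mono2) auto
      then show ?thesis using g[of z] by simp
    qed
  qed (auto simp: dist_real_def)
  then show ?thesis by (simp add: mult.commute)
qed

lemma filterlim_powr_at_top:
  fixes a :: real
  assumes "0 < a"
  shows "filterlim (\<lambda>x. x powr a) at_top at_top"
proof -
  have "filterlim (\<lambda>x::real. exp (a * ln x)) at_top at_top"
    by (intro filterlim_compose[OF exp_at_top] filterlim_tendsto_pos_mult_at_top[OF tendsto_const assms] ln_at_top)
  then show ?thesis
    by (rule filterlim_mono_eventually)
      (auto simp: powr_def intro: eventually_mono[OF eventually_gt_at_top[of 0]])
qed

text \<open>Comparison with an integrable minorant \<open>g\<close>, for a function \<open>W\<close> whose integral is only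
  defined as a difference of extended numbers: the negative part of \<open>W\<close> has a finite integral,
  so the difference is meaningful.\<close>

lemma ereal_integral_ge:
  assumes g: "integrable M g" and le: "AE x in M. ereal (g x) \<le> W x"
  shows "ereal (\<integral>x. g x \<partial>M) \<le> ereal_integral M W"
proof -
  have [measurable]: "g \<in> borel_measurable M" using g by auto
  let ?P = "\<integral>\<^sup>+x. ennreal (g x) \<partial>M" and ?N = "\<integral>\<^sup>+x. ennreal (- g x) \<partial>M"
  have e: "e2ennreal (ereal r) = ennreal r" for r by (simp add: ennreal.abs_eq e2ennreal_def)
  have P: "?P \<le> (\<integral>\<^sup>+x. e2ennreal (W x) \<partial>M)"
    using le by (intro nn_integral_mono_AE, eventually_elim) (metis e e2ennreal_mono)
  have N: "(\<integral>\<^sup>+x. e2ennreal (- W x) \<partial>M) \<le> ?N"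
    using le by (intro nn_integral_mono_AE, eventually_elim) (metis e e2ennreal_mono ereal_uminus_le_reorder uminus_ereal.simps(1) ereal_minus_le_minus)
  have fin: "?P < \<infinity>" "?N < \<infinity>"
  proof -
    have "?P \<le> (\<integral>\<^sup>+x. ennreal (norm (g x)) \<partial>M)" "?N \<le> (\<integral>\<^sup>+x. ennreal (norm (g x)) \<partial>M)"
      by (intro nn_integral_mono ennreal_leI; simp)+
    moreover have "(\<integral>\<^sup>+x. ennreal (norm (g x)) \<partial>M) < \<infinity>" using g by (simp add: integrable_iff_bounded)
    ultimately show "?P < \<infinity>" "?N < \<infinity>" by (auto intro: le_less_trans)
  qed
  have "ereal (\<integral>x. g x \<partial>M) = ereal (enn2real ?P - enn2real ?N)"
    using real_lebesgue_integral_def[OF g] by simp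
  also have "\<dots> = enn2ereal ?P - enn2ereal ?N"
    using fin by (metis enn2ereal_ennreal ennreal_enn2real enn2real_nonneg infinity_ennreal_def ereal_minus(1))
  also have "\<dots> \<le> ereal_integral M W"
    unfolding ereal_integral_def using P N by (intro ereal_minus_mono) (auto simp: less_eq_ennreal.rep_eq)
  finally show ?thesis .
qed

text \<open>Fatou's lemma for the functions \<open>D - G\<^sub>n\<close>, whose lower limit is \<open>D - H\<close>, where \<open>H\<close> is the
  upper limit of \<open>G\<^sub>n\<close>. The lower bound \<open>s\<^sub>n\<close> for the integrals makes \<open>H\<close> finite almost
  everywhere, and even integrable.\<close>

lemma Fatou_upper:
  fixes G :: "nat \<Rightarrow> 'a \<Rightarrow> real"
  assumes G: "\<And>n. integrable M (G n)" and D: "integrable M D" and le: "\<And>n. AE x in M. G n x \<le> D x"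
    and s: "\<And>n. s n \<le> (\<integral>x. G n x \<partial>M)" "s \<longlonglongrightarrow> s0"
  shows "\<exists>H. integrable M H \<and> s0 \<le> (\<integral>x. H x \<partial>M) \<and>
    (AE x in M. H x \<le> D x \<and> ennreal (D x - H x) = liminf (\<lambda>n. ennreal (D x - G n x)))"
proof -
  have [measurable]: "G n \<in> borel_measurable M" for n using G by auto
  have [measurable]: "D \<in> borel_measurable M" using D by auto
  define P where "P x = liminf (\<lambda>n. ennreal (D x - G n x))" for x
  have [measurable]: "P \<in> borel_measurable M" unfolding P_def by measurable
  define d where "d = (\<integral>x. D x \<partial>M)"
  have i: "(\<integral>\<^sup>+x. ennreal (D x - G n x) \<partial>M) = ennreal (d - (\<integral>x. G n x \<partial>M))" for n
    unfolding d_def using G D le[of n] by (subst nn_integral_eq_integral) (auto elim: eventually_mono)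
  have Gd: "(\<integral>x. G n x \<partial>M) \<le> d" for n unfolding d_def using G D le by (intro integral_mono_AE)
  have s0d: "s0 \<le> d" by (rule LIMSEQ_le_const2[OF s(2)]) (use s(1) Gd order_trans in blast)
  have "(\<integral>\<^sup>+x. P x \<partial>M) \<le> liminf (\<lambda>n. \<integral>\<^sup>+x. ennreal (D x - G n x) \<partial>M)"
    unfolding P_def by (rule nn_integral_liminf) measurable
  also have "\<dots> \<le> liminf (\<lambda>n. ennreal (d - s n))"
    unfolding i using s(1) by (intro Liminf_mono always_eventually allI ennreal_leI) simp
  also have "\<dots> = ennreal (d - s0)"
    by (intro lim_imp_Liminf tendsto_ennrealI tendsto_diff tendsto_const s(2)) auto
  finally have Ple: "(\<integral>\<^sup>+x. P x \<partial>M) \<le> ennreal (d - s0)" .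
  then have fin: "(\<integral>\<^sup>+x. P x \<partial>M) < \<infinity>" by (simp add: le_less_trans)
  have P_fin: "AE x in M. P x \<noteq> \<infinity>" by (rule nn_integral_noteq_infinite) (use fin in auto)
  define R where "R x = enn2real (P x)" for x
  have [measurable]: "R \<in> borel_measurable M" unfolding R_def by measurable
  have R0: "0 \<le> R x" for x by (simp add: R_def)
  have PR: "AE x in M. ennreal (R x) = P x" using P_fin by eventually_elim (simp add: R_def less_top[symmetric])
  have Rnn: "(\<integral>\<^sup>+x. ennreal (R x) \<partial>M) = (\<integral>\<^sup>+x. P x \<partial>M)" using PR by (rule nn_integral_cong_AE)
  have R: "integrable M R"
    using fin by (intro integrableI_nonneg) (auto simp: Rnn, simp add: R_def)
  have "ennreal (\<integral>x. R x \<partial>M) \<le> ennreal (d - s0)"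
    using Ple nn_integral_eq_integral[OF R AE_I2[OF R0]] unfolding Rnn[symmetric] by simp
  then have "(\<integral>x. R x \<partial>M) \<le> d - s0" using s0d by simp
  then have "s0 \<le> (\<integral>x. D x - R x \<partial>M)" using D R by (simp add: d_def)
  moreover have "AE x in M. D x - R x \<le> D x \<and> ennreal (D x - (D x - R x)) = liminf (\<lambda>n. ennreal (D x - G n x))"
    using PR by eventually_elim (simp add: P_def R_def)
  ultimately show ?thesis using D R by (intro exI[of _ "\<lambda>x. D x - R x"]) auto
qed

text \<open>The data of the problem under the hypotheses (i), (ii) and (iii), with \<open>p\<close> for \<open>\<gamma>\<close>.\<close>

locale dirichlet_problem = sobolev_domain \<Omega> p for \<Omega> :: "'a::euclidean_space set" and p :: real +
  fixes f :: "'a \<Rightarrow> real \<Rightarrow> real" and a A :: real and b B h :: "'a \<Rightarrow> real" and q :: real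
  assumes dim: "p < real DIM('a)"
    and q: "q = real DIM('a) * p / (real DIM('a) - p)"
    and f: "caratheodory \<Omega> f"
    and a: "0 \<le> a" and b: "integrable M b"
    and growth: "AE x in M. \<forall>s. \<bar>f x s\<bar> \<le> a * \<bar>s\<bar> powr q + b x"
    and A: "0 \<le> A" and B: "integrable M B" "AE x in M. 0 \<le> B x"
    and upper: "AE x in M. \<forall>s. primitive f x s \<le> A * \<bar>s\<bar> powr p + B x"
    and asymptotic: "\<And>v. v \<in> W0 \<Longrightarrow> Lp_norm \<Omega> p v = 1 \<Longrightarrow> 0 < asymptotic_functional \<Omega> p f v"
    and h: "p_integrable M (p / (p - 1)) h"
begin

abbreviation "F \<equiv> primitive f"

lemma f_cont: "AE x in M. continuous_on UNIV (f x)"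
  using f by (simp add: caratheodory_def)

lemma F_cont: "AE x in M. continuous_on UNIV (F x)"
  using f_cont
proof eventually_elim
  case (elim x)
  show ?case by (rule primitive_continuous[where f = f and x = x, OF elim])
qed

lemma f_measurable: "(\<lambda>x. f x s) \<in> borel_measurable M"
  using f by (simp add: caratheodory_def)

lemma f_compose_measurable: "u \<in> borel_measurable M \<Longrightarrow> (\<lambda>x. f x (u x)) \<in> borel_measurable M"
  by (rule measurable_Caratheodory_compose[where g = f, OF \<Omega>_sets f_measurable f_cont])

lemma F_compose_measurable: "u \<in> borel_measurable M \<Longrightarrow> (\<lambda>x. F x (u x)) \<in> borel_measurable M"
  by (rule measurable_Caratheodory_compose[where g = F, OF \<Omega>_sets primitive_measurable[OF \<Omega>_sets f] F_cont])

lemma F_le_integral: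
  assumes u: "in_Lp u" and i: "integrable M (\<lambda>x. F x (u x))"
  shows "(\<integral>x. F x (u x) \<partial>M) \<le> A * en u + (\<integral>x. B x \<partial>M)"
proof -
  have iu: "integrable M (\<lambda>x. \<bar>u x\<bar> powr p)" using u by (simp add: p_integrable_def)
  have "(\<integral>x. F x (u x) \<partial>M) \<le> (\<integral>x. A * \<bar>u x\<bar> powr p + B x \<partial>M)"
  proof (rule integral_mono_AE[OF i])
    show "integrable M (\<lambda>x. A * \<bar>u x\<bar> powr p + B x)" using iu B(1) by auto
    show "AE x in M. F x (u x) \<le> A * \<bar>u x\<bar> powr p + B x" using upper by eventually_elim blast
  qed
  also have "\<dots> = A * en u + (\<integral>x. B x \<partial>M)" using iu B(1) by (simp add: energy_def)
  finally show ?thesis .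
qed

text \<open>The constant in Young's inequality for \<open>\<integral> h u\<close>.\<close>

definition H0 :: real where "H0 = (\<integral>x. \<bar>h x\<bar> powr (p / (p - 1)) \<partial>M)"

lemma h_mult_le: "\<bar>h x * s\<bar> \<le> \<bar>h x\<bar> powr (p / (p - 1)) + \<bar>s\<bar> powr p"
proof -
  let ?p' = "p / (p - 1)"
  have p': "1 < ?p'" "1 / ?p' + 1 / p = 1" using p by (auto simp: field_simps)
  have "\<bar>h x\<bar> * \<bar>s\<bar> \<le> \<bar>h x\<bar> powr ?p' / ?p' + \<bar>s\<bar> powr p / p"
    using p p' by (intro Youngs_inequality) auto
  also have "\<dots> \<le> \<bar>h x\<bar> powr ?p' / 1 + \<bar>s\<bar> powr p / 1"
    using p p' by (intro add_mono divide_left_mono) auto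
  finally show ?thesis by (simp add: abs_mult)
qed

lemma h_mult_integrable:
  assumes u: "in_Lp u"
  shows "integrable M (\<lambda>x. h x * u x)" "\<bar>\<integral>x. h x * u x \<partial>M\<bar> \<le> H0 + en u"
proof -
  have i: "integrable M (\<lambda>x. \<bar>h x\<bar> powr (p / (p - 1)) + \<bar>u x\<bar> powr p)"
    using h u by (simp add: p_integrable_def)
  show iu: "integrable M (\<lambda>x. h x * u x)"
  proof (rule Bochner_Integration.integrable_bound[OF i])
    show "(\<lambda>x. h x * u x) \<in> borel_measurable M"
      using h u by (intro borel_measurable_times) (simp_all add: p_integrable_def)
  qed (use h_mult_le in auto)
  have "\<bar>\<integral>x. h x * u x \<partial>M\<bar> \<le> (\<integral>x. \<bar>h x * u x\<bar> \<partial>M)" by (rule integral_abs_bound)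
  also have "\<dots> \<le> (\<integral>x. \<bar>h x\<bar> powr (p / (p - 1)) + \<bar>u x\<bar> powr p \<partial>M)"
    using iu i h_mult_le by (intro integral_mono) auto
  also have "\<dots> = H0 + en u" using h u by (simp add: p_integrable_def H0_def energy_def)
  finally show "\<bar>\<integral>x. h x * u x \<partial>M\<bar> \<le> H0 + en u" .
qed

text \<open>The domain on which \<open>J\<close> is finite. Outside of it the Bochner integral of \<open>F(x, u)\<close> is \<open>0\<close>
  by convention and \<open>J\<close> would be meaningless.\<close>

definition admissible :: "('a \<Rightarrow> real) set" where
  "admissible = {u \<in> W0. integrable M (\<lambda>x. F x (u x))}"

definition J :: "('a \<Rightarrow> real) \<Rightarrow> real" where
  "J u = I\<Phi> (\<nabla> u) - (\<integral>x. F x (u x) \<partial>M) - (\<integral>x. h x * u x \<partial>M)"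

text \<open>Hypothesis (iii) is applied to \<open>v\<close> through an integrable minorant \<open>g\<close> of \<open>A\<^sub>\<infinity> |v|\<^sup>p\<close>.
  Where \<open>v\<close> vanishes only \<open>g \<le> 0\<close> is asked, since that part of \<open>\<Omega>\<close> is left out of the integral
  in (iii).\<close>

lemma asymptotic_contradiction:
  assumes v: "v \<in> W0" "en v = 1" and g: "integrable M g" and c: "I\<Phi> (\<nabla> v) \<le> (\<integral>x. g x \<partial>M)"
    and ne: "AE x in M. v x \<noteq> 0 \<longrightarrow> ereal (g x) \<le> A_infinity f p x * ereal (\<bar>v x\<bar> powr p)"
    and eq: "AE x in M. v x = 0 \<longrightarrow> g x \<le> 0"
  shows False
proof -
  have "Lp_norm \<Omega> p v = 1" using v(2) unfolding Lp_norm_def energy_def by simp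
  then have pos: "0 < asymptotic_functional \<Omega> p f v" by (rule asymptotic[OF v(1)])
  have vm [measurable]: "v \<in> borel_measurable M" using W01pD(2)[OF v(1)] by (simp add: p_integrable_def)
  define S where "S = {x \<in> \<Omega>. v x \<noteq> 0}"
  have SM: "S \<in> sets M"
  proof -
    have "{x \<in> space M. v x \<noteq> 0} \<in> sets M" by measurable
    then show ?thesis by (simp add: S_def)
  qed
  have S: "S \<in> sets lebesgue" "S \<subseteq> \<Omega>" using SM \<Omega>_sets by (auto simp: S_def sets_restrict_space_iff)
  have gS: "integrable (lebesgue_on S) g" by (rule integrable_lebesgue_on_subset[OF g S(2,1) \<Omega>_sets])
  have "(\<integral>x. g x \<partial>M) \<le> (\<integral>x. indicator S x * g x \<partial>M)"
  proof (rule integral_mono_AE[OF g])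
    show "integrable M (\<lambda>x. indicator S x * g x)" using integrable_mult_indicator[OF SM g] by simp
    show "AE x in M. g x \<le> indicator S x * g x"
      using eq AE_space[of M] by eventually_elim (auto simp: S_def indicator_def)
  qed
  also have "(\<integral>x. indicator S x * g x \<partial>M) = (\<integral>x. g x \<partial>lebesgue_on S)"
  proof -
    have "(\<integral>x. indicator S x * g x \<partial>M) = (\<integral>x. (if x \<in> \<Omega> then indicator S x * g x else 0) \<partial>lebesgue)"
      by (rule Lebesgue_Measure.integral_restrict_UNIV[OF \<Omega>_sets, symmetric])
    also have "\<dots> = (\<integral>x. (if x \<in> S then g x else 0) \<partial>lebesgue)"
      using S(2) by (intro Bochner_Integration.integral_cong) (auto simp: indicator_def)
    also have "\<dots> = (\<integral>x. g x \<partial>lebesgue_on S)"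
      by (rule Lebesgue_Measure.integral_restrict_UNIV[OF S(1)])
    finally show ?thesis .
  qed
  finally have "ereal (I\<Phi> (\<nabla> v)) \<le> ereal (\<integral>x. g x \<partial>lebesgue_on S)" using c by simp
  also have "\<dots> \<le> ereal_integral (lebesgue_on S) (\<lambda>x. A_infinity f p x * ereal (\<bar>v x\<bar> powr p))"
  proof (rule ereal_integral_ge[OF gS])
    have "AE x in lebesgue. x \<in> \<Omega> \<longrightarrow> v x \<noteq> 0 \<longrightarrow> ereal (g x) \<le> A_infinity f p x * ereal (\<bar>v x\<bar> powr p)"
      using ne \<Omega>_sets by (simp add: AE_restrict_space_iff)
    then have "AE x in lebesgue. x \<in> S \<longrightarrow> ereal (g x) \<le> A_infinity f p x * ereal (\<bar>v x\<bar> powr p)"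
      by eventually_elim (simp add: S_def)
    then show "AE x in lebesgue_on S. ereal (g x) \<le> A_infinity f p x * ereal (\<bar>v x\<bar> powr p)"
      using S(1) by (simp add: AE_restrict_space_iff)
  qed
  finally have le: "ereal (I\<Phi> (\<nabla> v)) \<le> ereal_integral (lebesgue_on S) (\<lambda>x. A_infinity f p x * ereal (\<bar>v x\<bar> powr p))" .
  \<comment> \<open>\<open>W\<close> need not be finite.\<close>
  have sub: "ereal i - W \<le> 0" if "ereal i \<le> W" for i W
    using that by (cases W) auto
  from sub[OF le] have "asymptotic_functional \<Omega> p f v \<le> 0"
    unfolding asymptotic_functional_def S_def I\<Phi>_def \<Phi>_def .
  with pos show False by simp
qed

text \<open>For \<open>v \<noteq> 0\<close> the arguments \<open>t\<^sub>n v\<^sub>n\<close> tend to infinity in absolute value, so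
  \<open>F(x, t\<^sub>n v\<^sub>n) / t\<^sub>n\<^sup>p\<close> is eventually at most \<open>\<alpha> |v\<^sub>n|\<^sup>p\<close> for every real \<open>\<alpha>\<close> above the upper
  limit \<open>A\<^sub>\<infinity>(x)\<close>. The number \<open>g\<close> is the upper limit of these quotients, written as in
  \<open>Fatou_upper\<close>.\<close>

lemma A_infinity_bound:
  assumes v: "v \<noteq> 0" and vn: "(\<lambda>n. vn n) \<longlonglongrightarrow> v" and t: "filterlim t at_top sequentially" "\<And>n. 1 \<le> t n"
    and D: "g \<le> D" "ennreal (D - g) = liminf (\<lambda>n. ennreal (D - F x (t n * vn n) / t n powr p))"
  shows "ereal g \<le> A_infinity f p x * ereal (\<bar>v\<bar> powr p)"
proof -
  have vp: "0 < \<bar>v\<bar> powr p" using v by simp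
  have key: "g \<le> \<alpha> * \<bar>v\<bar> powr p" if \<alpha>: "A_infinity f p x < ereal \<alpha>" for \<alpha>
  proof -
    have "\<forall>\<^sub>F s in at_infinity. ereal (F x s / \<bar>s\<bar> powr p) < ereal \<alpha>"
      using \<alpha> unfolding A_infinity_def by (rule Limsup_lessD)
    then have ev: "\<forall>\<^sub>F s in at_infinity. F x s / \<bar>s\<bar> powr p < \<alpha>" by simp
    have lim: "filterlim (\<lambda>n. t n * vn n) at_infinity sequentially"
    proof (rule filterlim_at_infinity_conv_norm_at_top[THEN iffD2])
      have "filterlim (\<lambda>n. norm (vn n) * t n) at_top sequentially"
        by (rule filterlim_tendsto_pos_mult_at_top[OF tendsto_norm[OF vn] _ t(1)]) (use v in simp)
      moreover have "(\<lambda>n. norm (vn n) * t n) = (\<lambda>n. norm (t n * vn n))"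
        using t(2) by (auto simp: fun_eq_iff abs_mult) (metis abs_of_nonneg mult.commute order_trans zero_le_one)
      ultimately show "filterlim (\<lambda>n. norm (t n * vn n)) at_top sequentially" by simp
    qed
    have ev1: "\<forall>\<^sub>F n in sequentially. F x (t n * vn n) / \<bar>t n * vn n\<bar> powr p < \<alpha>"
      by (rule eventually_compose_filterlim[OF ev lim])
    have ev2: "\<forall>\<^sub>F n in sequentially. vn n \<noteq> 0" using vn v by (rule tendsto_imp_eventually_ne)
    have ev3: "\<forall>\<^sub>F n in sequentially. ennreal (D - \<alpha> * \<bar>vn n\<bar> powr p) \<le> ennreal (D - F x (t n * vn n) / t n powr p)"
      using ev1 ev2
    proof eventually_elim
      case (elim n)
      have tn: "0 < t n" using t(2)[of n] by simp
      have "\<bar>t n * vn n\<bar> powr p = t n powr p * \<bar>vn n\<bar> powr p" using tn by (simp add: abs_mult powr_mult)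
      moreover have "0 < t n powr p" "0 < \<bar>vn n\<bar> powr p" using tn elim by auto
      ultimately have "F x (t n * vn n) / t n powr p < \<alpha> * \<bar>vn n\<bar> powr p"
        using elim(1) by (simp add: field_simps)
      then show ?case by (intro ennreal_leI) simp
    qed
    have "(\<lambda>n. ennreal (D - \<alpha> * \<bar>vn n\<bar> powr p)) \<longlonglongrightarrow> ennreal (D - \<alpha> * \<bar>v\<bar> powr p)"
      using p by (intro tendsto_ennrealI tendsto_diff tendsto_mult tendsto_const tendsto_powr' tendsto_rabs vn) auto
    then have "ennreal (D - \<alpha> * \<bar>v\<bar> powr p) = liminf (\<lambda>n. ennreal (D - \<alpha> * \<bar>vn n\<bar> powr p))"
      by (intro lim_imp_Liminf[symmetric]) auto
    also have "\<dots> \<le> ennreal (D - g)" unfolding D(2) by (rule Liminf_mono[OF ev3])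
    finally show ?thesis using D(1) by (simp add: ennreal_le_iff2) linarith
  qed
  show ?thesis
  proof (cases "A_infinity f p x")
    case (real r)
    have "g \<le> r * \<bar>v\<bar> powr p"
    proof (rule field_le_epsilon)
      fix e :: real assume e: "0 < e"
      have "g \<le> (r + e / \<bar>v\<bar> powr p) * \<bar>v\<bar> powr p" using e vp real by (intro key) auto
      then show "g \<le> r * \<bar>v\<bar> powr p + e" using vp by (simp add: distrib_right)
    qed
    then show ?thesis using real by simp
  next
    case PInf
    then show ?thesis using vp by simp
  next
    case MInf
    then have "g \<le> ((g - 1) / \<bar>v\<bar> powr p) * \<bar>v\<bar> powr p" by (intro key) auto
    then show ?thesis using vp v by simp
  qed
qed

text \<open>If not, there are \<open>u\<^sub>n\<close> with \<open>J(u\<^sub>n) \<le> C\<close> and \<open>t\<^sub>n\<^sup>p = \<integral>|u\<^sub>n|\<^sup>p \<rightarrow> \<infinity>\<close>. For the normalised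
  functions \<open>v\<^sub>n = u\<^sub>n / t\<^sub>n\<close> and \<open>G\<^sub>n = F(x, t\<^sub>n v\<^sub>n) / t\<^sub>n\<^sup>p\<close> one gets
  \<open>\<integral>\<Phi>(\<nabla> v\<^sub>n) - \<epsilon>\<^sub>n \<le> \<integral> G\<^sub>n\<close>, where \<open>\<epsilon>\<^sub>n \<rightarrow> 0\<close> collects the bound for \<open>J\<close> and the term with \<open>h\<close>,
  which is of lower order \<open>t\<^sub>n\<close>. Since \<open>G\<^sub>n \<le> A |v\<^sub>n|\<^sup>p + B / t\<^sub>n\<^sup>p\<close>, the sequence \<open>v\<^sub>n\<close> is
  bounded in the Sobolev space, and passing to the limit contradicts (iii). On the set where the
  limit \<open>w\<close> vanishes the same bound shows that the upper limit \<open>H\<close> of \<open>G\<^sub>n\<close> is at most \<open>0\<close>.\<close>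

theorem coercive:
  shows "\<exists>R. \<forall>u\<in>admissible. J u \<le> C \<longrightarrow> en u \<le> R"
proof (rule ccontr)
  assume "\<not> ?thesis"
  then have "\<forall>n::nat. \<exists>u. u \<in> admissible \<and> J u \<le> C \<and> real (Suc n) < en u"
    by (metis not_le)
  then have "\<exists>u. \<forall>n::nat. u n \<in> admissible \<and> J (u n) \<le> C \<and> real (Suc n) < en (u n)"
    by (rule choice)
  then obtain u where u': "\<forall>n::nat. u n \<in> admissible \<and> J (u n) \<le> C \<and> real (Suc n) < en (u n)" ..
  have u: "u n \<in> W0" "integrable M (\<lambda>x. F x (u n x))" "J (u n) \<le> C" "real (Suc n) < en (u n)" for n
    using u' by (auto simp: admissible_def)
  note uD = W01pD[OF u(1)]
  have p0: "0 \<le> p" "0 < p" using p by auto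
  define t where "t n = en (u n) powr (1 / p)" for n
  have tp: "t n powr p = en (u n)" for n
    using p0 energy_nonneg[of M p "u n"] by (simp add: t_def powr_powr)
  have t1: "1 \<le> t n" for n
  proof -
    have "1 powr (1 / p) \<le> en (u n) powr (1 / p)" using u(4)[of n] p0 by (intro powr_mono2) auto
    then show ?thesis by (simp add: t_def)
  qed
  have tp1: "1 \<le> t n powr p" for n using t1 p0 by (simp add: ge_one_powr_ge_zero)
  have tp_lim: "filterlim (\<lambda>n. t n powr p) at_top sequentially"
  proof (rule filterlim_at_top_mono)
    show "filterlim (\<lambda>n. real (Suc n)) at_top sequentially"
      by (rule filterlim_compose[OF filterlim_real_sequentially filterlim_Suc])
    show "\<forall>\<^sub>F n in sequentially. real (Suc n) \<le> t n powr p"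
      unfolding tp using u(4) by (intro always_eventually allI less_imp_le)
  qed
  have t_lim: "filterlim t at_top sequentially"
  proof -
    have "filterlim (\<lambda>n. (t n powr p) powr (1 / p)) at_top sequentially"
      using p0 by (intro filterlim_compose[OF filterlim_powr_at_top tp_lim]) auto
    moreover have "(t n powr p) powr (1 / p) = t n" for n using t1[of n] p0 by (simp add: powr_powr)
    ultimately show ?thesis by simp
  qed
  \<comment> \<open>The second term is \<open>0\<close>; it puts \<open>v n\<close> into the form of \<open>W01p_linear_combination\<close>.\<close>
  define v where "v n x = (1 / t n) * u n x + 0 * u n x" for n x
  have v: "v n \<in> W0" and v_grad: "AE x in M. \<nabla> (v n) x = (1 / t n) *\<^sub>R \<nabla> (u n) x" for n
    using W01p_linear_combination[OF u(1) u(1), of "1 / t n" n 0 n] unfolding v_def by auto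
  note vD = W01pD[OF v]
  have uv: "u n x = t n * v n x" for n x using t1[of n] by (simp add: v_def)
  have v_en: "en (v n) = 1" for n
  proof -
    have "en (v n) = \<bar>1 / t n\<bar> powr p * en (u n)"
      using energy_scaleR[of M p "1 / t n" "u n"] by (simp add: v_def[abs_def])
    also have "\<dots> = 1" using t1[of n] tp1[of n] by (simp add: tp[symmetric] powr_divide)
    finally show ?thesis .
  qed
  define G where "G n x = F x (t n * v n x) / t n powr p" for n x
  have G_int: "integrable M (G n)" for n unfolding G_def using u(2)[of n] by (simp add: uv)
  have G_eq: "(\<integral>x. G n x \<partial>M) = (\<integral>x. F x (u n x) \<partial>M) / t n powr p" for n unfolding G_def by (simp add: uv)
  define \<epsilon> where "\<epsilon> n = (C + (\<integral>x. h x * u n x \<partial>M)) / t n powr p" for n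
  have \<epsilon>_lim: "\<epsilon> \<longlonglongrightarrow> 0"
  proof -
    have a1: "(\<lambda>n. C / t n powr p) \<longlonglongrightarrow> 0" by (rule tendsto_divide_0[OF tendsto_const filterlim_at_top_imp_at_infinity[OF tp_lim]])
    \<comment> \<open>The integral of \<open>h u\<^sub>n\<close> is \<open>t\<^sub>n\<close> times a bounded number.\<close>
    have a2: "(\<lambda>n. (\<integral>x. h x * u n x \<partial>M) / t n powr p) \<longlonglongrightarrow> 0"
    proof (rule Lim_null_comparison)
      have "filterlim (\<lambda>n. t n powr (p - 1)) at_top sequentially"
        using p by (intro filterlim_compose[OF filterlim_powr_at_top t_lim]) auto
      then show "(\<lambda>n. (H0 + 1) / t n powr (p - 1)) \<longlonglongrightarrow> 0"
        by (intro tendsto_divide_0[OF tendsto_const] filterlim_at_top_imp_at_infinity)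
      show "\<forall>\<^sub>F n in sequentially. norm ((\<integral>x. h x * u n x \<partial>M) / t n powr p) \<le> (H0 + 1) / t n powr (p - 1)"
      proof (intro always_eventually allI)
        fix n
        have "(\<integral>x. h x * u n x \<partial>M) = (\<integral>x. t n * (h x * v n x) \<partial>M)"
          by (intro Bochner_Integration.integral_cong) (auto simp: uv)
        also have "\<dots> = t n * (\<integral>x. h x * v n x \<partial>M)" by simp
        finally have "\<bar>\<integral>x. h x * u n x \<partial>M\<bar> = t n * \<bar>\<integral>x. h x * v n x \<partial>M\<bar>"
          using t1[of n] by (simp add: abs_mult)
        also have "\<dots> \<le> t n * (H0 + 1)"
          using h_mult_integrable(2)[OF vD(2)[of n]] v_en[of n] t1[of n] by (intro mult_left_mono) auto
        finally have "\<bar>\<integral>x. h x * u n x \<partial>M\<bar> / t n powr p \<le> t n * (H0 + 1) / t n powr p"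
          by (intro divide_right_mono) auto
        also have "\<dots> = (H0 + 1) / t n powr (p - 1)"
          using t1[of n] by (simp add: powr_diff)
        finally show "norm ((\<integral>x. h x * u n x \<partial>M) / t n powr p) \<le> (H0 + 1) / t n powr (p - 1)"
          by (simp add: abs_divide)
      qed
    qed
    show ?thesis unfolding \<epsilon>_def add_divide_distrib using tendsto_add[OF a1 a2] by simp
  qed
  have main: "I\<Phi> (\<nabla> (v n)) - \<epsilon> n \<le> (\<integral>x. G n x \<partial>M)" for n
  proof -
    \<comment> \<open>Superhomogeneity of \<open>\<Phi>\<close> for factors at least 1.\<close>
    have sc: "I\<Phi> (\<nabla> (v n)) \<le> I\<Phi> (\<nabla> (u n)) / t n powr p"
    proof -
      have "I\<Phi> (\<nabla> (v n)) \<le> (\<integral>x. \<Phi> p (\<nabla> (u n) x) / t n powr p \<partial>M)"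
        unfolding I\<Phi>_def
      proof (rule integral_mono_AE)
        show "integrable M (\<lambda>x. \<Phi> p (\<nabla> (v n) x))" by (rule integrable_\<Phi>[OF vD(4)])
        show "integrable M (\<lambda>x. \<Phi> p (\<nabla> (u n) x) / t n powr p)" using integrable_\<Phi>[OF uD(4)] by auto
        show "AE x in M. \<Phi> p (\<nabla> (v n) x) \<le> \<Phi> p (\<nabla> (u n) x) / t n powr p"
          using v_grad[of n]
        proof eventually_elim
          case (elim x)
          have "t n powr p * \<Phi> p (\<nabla> (v n) x) \<le> \<Phi> p (t n *\<^sub>R \<nabla> (v n) x)"
            by (rule \<Phi>_scale_le[OF t1 p0(1)])
          also have "t n *\<^sub>R \<nabla> (v n) x = \<nabla> (u n) x" using elim t1[of n] by simp
          finally have "\<Phi> p (\<nabla> (v n) x) * t n powr p \<le> \<Phi> p (\<nabla> (u n) x)" by (simp only: mult.commute)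
          moreover have "0 < t n powr p" using tp1[of n] by linarith
          ultimately show ?case by (simp only: pos_le_divide_eq)
        qed
      qed
      then show ?thesis by (simp add: I\<Phi>_def)
    qed
    have "I\<Phi> (\<nabla> (u n)) \<le> (C + (\<integral>x. h x * u n x \<partial>M)) + (\<integral>x. F x (u n x) \<partial>M)"
      using u(3)[of n] by (simp add: J_def)
    then have "I\<Phi> (\<nabla> (u n)) / t n powr p \<le> ((C + (\<integral>x. h x * u n x \<partial>M)) + (\<integral>x. F x (u n x) \<partial>M)) / t n powr p"
      by (intro divide_right_mono) auto
    also have "\<dots> = \<epsilon> n + (\<integral>x. G n x \<partial>M)" unfolding \<epsilon>_def G_eq by (simp add: add_divide_distrib)
    finally show ?thesis using sc by linarith
  qed
  have G_le: "AE x in M. \<forall>n. G n x \<le> A * \<bar>v n x\<bar> powr p + B x / t n powr p"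
    using upper
  proof eventually_elim
    case (elim x)
    show ?case
    proof
      fix n
      have "F x (t n * v n x) \<le> A * \<bar>t n * v n x\<bar> powr p + B x" using elim by blast
      also have "\<bar>t n * v n x\<bar> powr p = t n powr p * \<bar>v n x\<bar> powr p" using t1[of n] by (simp add: abs_mult powr_mult)
      finally have "F x (t n * v n x) / t n powr p \<le> (A * (t n powr p * \<bar>v n x\<bar> powr p) + B x) / t n powr p"
        by (intro divide_right_mono) auto
      also have "\<dots> = A * \<bar>v n x\<bar> powr p + B x / t n powr p" using tp1[of n] t1[of n] by (simp add: add_divide_distrib)
      finally show "G n x \<le> A * \<bar>v n x\<bar> powr p + B x / t n powr p" by (simp add: G_def)
    qed
  qed
  obtain e0 where e0: "\<And>n. \<bar>\<epsilon> n\<bar> \<le> e0"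
    using Bseq_eq_bounded convergent_imp_Bseq[OF convergentI[OF \<epsilon>_lim]] by (auto simp: Bseq_def)
  have G_bound: "(\<integral>x. G n x \<partial>M) \<le> A + (\<integral>x. B x \<partial>M)" for n
  proof -
    have iv: "integrable M (\<lambda>x. \<bar>v n x\<bar> powr p)" using vD(2)[of n] by (simp add: p_integrable_def)
    have "(\<integral>x. G n x \<partial>M) \<le> (\<integral>x. A * \<bar>v n x\<bar> powr p + B x \<partial>M)"
    proof (rule integral_mono_AE[OF G_int])
      show "integrable M (\<lambda>x. A * \<bar>v n x\<bar> powr p + B x)" using iv B(1) by auto
      show "AE x in M. G n x \<le> A * \<bar>v n x\<bar> powr p + B x" using G_le B(2)
      proof eventually_elim
        case (elim x)
        have "B x / t n powr p \<le> B x / 1" using elim(2) tp1[of n] by (intro divide_left_mono) auto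
        then show ?case using elim(1)[rule_format, of n] by simp
      qed
    qed
    also have "\<dots> = A * en (v n) + (\<integral>x. B x \<partial>M)" using iv B(1) by (simp add: energy_def)
    finally show ?thesis by (simp add: v_en)
  qed
  define K where "K = max 1 (2 powr p * (e0 + A + (\<integral>x. B x \<partial>M) + measure M (space M)))"
  have K1: "en (v n) \<le> K" for n by (simp add: v_en K_def)
  have K2: "en (\<nabla> (v n)) \<le> K" for n
  proof -
    have "I\<Phi> (\<nabla> (v n)) \<le> e0 + A + (\<integral>x. B x \<partial>M)"
      using main[of n] G_bound[of n] e0[of n] by linarith
    then have "2 powr p * (I\<Phi> (\<nabla> (v n)) + measure M (space M)) \<le> 2 powr p * (e0 + A + (\<integral>x. B x \<partial>M) + measure M (space M))"
      by (intro mult_left_mono) auto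
    with energy_le_I\<Phi>[OF vD(4)[of n]]
    have "en (\<nabla> (v n)) \<le> 2 powr p * (e0 + A + (\<integral>x. B x \<partial>M) + measure M (space M))"
      by (rule order_trans)
    then show ?thesis unfolding K_def by (rule max.coboundedI2)
  qed
  obtain r w g c where r: "strict_mono (r :: nat \<Rightarrow> nat)" and w: "w \<in> W0" and g: "in_Lp (g :: 'a \<Rightarrow> real)"
    and conv: "AE x in M. (\<lambda>n. v (r n) x) \<longlonglongrightarrow> w x" and dom: "AE x in M. \<forall>n. norm (v (r n) x) \<le> g x"
    and c: "(\<lambda>n. I\<Phi> (\<nabla> (v (r n)))) \<longlonglongrightarrow> c" "I\<Phi> (\<nabla> w) \<le> c"
    using W01p_compactness[of v K, OF v K1 K2] by blast
  \<comment> \<open>The limit is still normalised, by the strong convergence in \<open>L\<^sup>p\<close>.\<close>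
  have "(\<lambda>n. en (v (r n))) \<longlonglongrightarrow> en w"
  proof (rule energy_tendsto_dominated[OF _ g p0(2) conv])
    show "AE x in M. norm (v (r n) x) \<le> g x" for n using dom by eventually_elim blast
  qed (use vD(2) W01pD(2)[OF w] in \<open>auto simp: p_integrable_def\<close>)
  then have w1: "en w = 1" by (simp add: v_en LIMSEQ_const_iff)
  have t_r: "filterlim (\<lambda>n. t (r n)) at_top sequentially" "filterlim (\<lambda>n. t (r n) powr p) at_top sequentially"
    using filterlim_compose[OF t_lim filterlim_subseq[OF r]] filterlim_compose[OF tp_lim filterlim_subseq[OF r]] by auto
  define D where "D x = A * \<bar>g x\<bar> powr p + B x" for x
  have D_int: "integrable M D" unfolding D_def using g B(1) by (auto simp: p_integrable_def)
  have GD: "AE x in M. G (r n) x \<le> D x" for n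
    using G_le dom B(2)
  proof eventually_elim
    case (elim x)
    have "\<bar>v (r n) x\<bar> powr p \<le> \<bar>g x\<bar> powr p" using elim(2)[rule_format, of n] p0 by (intro powr_mono2) auto
    then have "A * \<bar>v (r n) x\<bar> powr p \<le> A * \<bar>g x\<bar> powr p" using A by (intro mult_left_mono)
    moreover have "B x / t (r n) powr p \<le> B x / 1" using elim(3) tp1[of "r n"] by (intro divide_left_mono) auto
    ultimately show ?case using elim(1)[rule_format, of "r n"] by (simp add: D_def)
  qed
  have s_lim: "(\<lambda>n. I\<Phi> (\<nabla> (v (r n))) - \<epsilon> (r n)) \<longlonglongrightarrow> c"
    using tendsto_diff[OF c(1) LIMSEQ_subseq_LIMSEQ[OF \<epsilon>_lim r]] by (simp add: o_def)
  obtain H where H: "integrable M H" "c \<le> (\<integral>x. H x \<partial>M)"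
    and HP: "AE x in M. H x \<le> D x \<and> ennreal (D x - H x) = liminf (\<lambda>n. ennreal (D x - G (r n) x))"
    using Fatou_upper[of M "\<lambda>n. G (r n)" D, OF G_int D_int GD main s_lim] by blast
  show False
  proof (rule asymptotic_contradiction[OF w w1 H(1)])
    show "I\<Phi> (\<nabla> w) \<le> (\<integral>x. H x \<partial>M)" using c(2) H(2) by simp
    show "AE x in M. w x \<noteq> 0 \<longrightarrow> ereal (H x) \<le> A_infinity f p x * ereal (\<bar>w x\<bar> powr p)"
      using HP conv
    proof eventually_elim
      case (elim x)
      show ?case
      proof
        assume wx: "w x \<noteq> 0"
        show "ereal (H x) \<le> A_infinity f p x * ereal (\<bar>w x\<bar> powr p)"
          by (rule A_infinity_bound[OF wx elim(2) t_r(1)]) (use elim(1) t1 in \<open>auto simp: G_def\<close>)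
      qed
    qed
    show "AE x in M. w x = 0 \<longrightarrow> H x \<le> 0"
      using HP conv G_le
    proof eventually_elim
      case (elim x)
      show ?case
      proof
        assume wx: "w x = 0"
        have "(\<lambda>n. D x - (A * \<bar>v (r n) x\<bar> powr p + B x / t (r n) powr p)) \<longlonglongrightarrow> D x - (A * \<bar>w x\<bar> powr p + 0)"
          using elim(2) p0 by (intro tendsto_diff tendsto_add tendsto_mult tendsto_const tendsto_powr' tendsto_rabs
              tendsto_divide_0[OF tendsto_const filterlim_at_top_imp_at_infinity[OF t_r(2)]]) auto
        then have "(\<lambda>n. ennreal (D x - (A * \<bar>v (r n) x\<bar> powr p + B x / t (r n) powr p))) \<longlonglongrightarrow> ennreal (D x)"
          using wx by (auto dest: tendsto_ennrealI)
        then have "ennreal (D x) = liminf (\<lambda>n. ennreal (D x - (A * \<bar>v (r n) x\<bar> powr p + B x / t (r n) powr p)))"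
          by (intro lim_imp_Liminf[symmetric]) auto
        also have "\<dots> \<le> liminf (\<lambda>n. ennreal (D x - G (r n) x))"
          using elim(3) by (intro Liminf_mono always_eventually allI ennreal_leI diff_left_mono) blast
        also have "\<dots> = ennreal (D x - H x)" using elim(1) by simp
        finally have "ennreal (D x) \<le> ennreal (D x - H x)" .
        then show "H x \<le> 0" using elim(1) unfolding ennreal_le_iff2 by linarith
      qed
    qed
  qed
qed

end

section \<open>Minimisers and their Euler equation\<close>

text \<open>The gradient of \<open>\<Phi> p\<close>.\<close>

definition d\<Phi> :: "real \<Rightarrow> 'a::euclidean_space \<Rightarrow> 'a" where
  "d\<Phi> p \<xi> = (p * ((sqrt (1 + (norm \<xi>)\<^sup>2) - 1) powr (p - 1) / sqrt (1 + (norm \<xi>)\<^sup>2))) *\<^sub>R \<xi>"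

text \<open>\<open>\<Phi>\<close> is differentiable also at \<open>0\<close>, because the power of \<open>q(t) \<ge> 0\<close> is differentiable as
  \<open>|q|\<^sup>p\<close> with \<open>p > 1\<close>.\<close>

lemma \<Phi>_line_has_derivative:
  fixes \<xi> \<eta> :: "'a::euclidean_space"
  assumes p: "1 < p"
  shows "((\<lambda>t. \<Phi> p (\<xi> + t *\<^sub>R \<eta>)) has_real_derivative d\<Phi> p (\<xi> + t *\<^sub>R \<eta>) \<bullet> \<eta>) (at t)"
proof -
  let ?\<zeta> = "\<lambda>t. \<xi> + t *\<^sub>R \<eta>"
  define q where "q t = sqrt (1 + ?\<zeta> t \<bullet> ?\<zeta> t) - 1" for t
  have q0: "0 \<le> q t" for t by (simp add: q_def)
  have pos: "0 < 1 + ?\<zeta> t \<bullet> ?\<zeta> t" for t by (simp add: add_pos_nonneg)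
  have d1: "((\<lambda>t. 1 + ?\<zeta> t \<bullet> ?\<zeta> t) has_real_derivative 2 * (?\<zeta> t \<bullet> \<eta>)) (at t)"
  proof -
    have eq: "(\<lambda>t. 1 + ?\<zeta> t \<bullet> ?\<zeta> t) = (\<lambda>t. 1 + \<xi> \<bullet> \<xi> + 2 * t * (\<xi> \<bullet> \<eta>) + t * t * (\<eta> \<bullet> \<eta>))"
      by (simp add: fun_eq_iff inner_add_left inner_add_right inner_commute[of \<eta> \<xi>] algebra_simps)
    have "((\<lambda>t. 1 + \<xi> \<bullet> \<xi> + 2 * t * (\<xi> \<bullet> \<eta>) + t * t * (\<eta> \<bullet> \<eta>)) has_real_derivative 2 * (\<xi> \<bullet> \<eta>) + 2 * t * (\<eta> \<bullet> \<eta>)) (at t)"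
      by (auto intro!: derivative_eq_intros)
    moreover have "2 * (\<xi> \<bullet> \<eta>) + 2 * t * (\<eta> \<bullet> \<eta>) = 2 * (?\<zeta> t \<bullet> \<eta>)"
      by (simp add: inner_add_left algebra_simps)
    ultimately show ?thesis unfolding eq by (simp only:)
  qed
  have d2: "(q has_real_derivative (?\<zeta> t \<bullet> \<eta>) / sqrt (1 + ?\<zeta> t \<bullet> ?\<zeta> t)) (at t)"
  proof -
    have "((\<lambda>t. sqrt (1 + ?\<zeta> t \<bullet> ?\<zeta> t)) has_real_derivative
        (inverse (sqrt (1 + ?\<zeta> t \<bullet> ?\<zeta> t)) / 2) * (2 * (?\<zeta> t \<bullet> \<eta>))) (at t)"
      by (rule DERIV_chain2[OF DERIV_real_sqrt[OF pos] d1])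
    then have D: "((\<lambda>t. sqrt (1 + ?\<zeta> t \<bullet> ?\<zeta> t) - 1) has_real_derivative
        (inverse (sqrt (1 + ?\<zeta> t \<bullet> ?\<zeta> t)) / 2) * (2 * (?\<zeta> t \<bullet> \<eta>)) - 0) (at t)"
      by (rule DERIV_diff[OF _ DERIV_const])
    have eq: "(inverse s / 2) * (2 * y) - 0 = y / s" for s y :: real by (simp add: field_simps)
    show ?thesis using D unfolding q_def[abs_def] eq .
  qed
  have "((\<lambda>t. \<bar>q t\<bar> powr p) has_real_derivative (p * \<bar>q t\<bar> powr (p - 1) * sgn (q t)) * ((?\<zeta> t \<bullet> \<eta>) / sqrt (1 + ?\<zeta> t \<bullet> ?\<zeta> t))) (at t)"
    by (rule DERIV_chain2[OF abs_powr_has_derivative[OF p] d2])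
  moreover have "(\<lambda>t. \<bar>q t\<bar> powr p) = (\<lambda>t. \<Phi> p (?\<zeta> t))"
    using q0 by (simp add: \<Phi>_def q_def power2_norm_eq_inner)
  moreover have "(p * \<bar>q t\<bar> powr (p - 1) * sgn (q t)) * ((?\<zeta> t \<bullet> \<eta>) / sqrt (1 + ?\<zeta> t \<bullet> ?\<zeta> t)) = d\<Phi> p (?\<zeta> t) \<bullet> \<eta>"
  proof -
    have "\<bar>q t\<bar> powr (p - 1) * sgn (q t) = q t powr (p - 1)"
      using q0[of t] by (cases "q t = 0") auto
    then have "(p * \<bar>q t\<bar> powr (p - 1) * sgn (q t)) * ((?\<zeta> t \<bullet> \<eta>) / sqrt (1 + ?\<zeta> t \<bullet> ?\<zeta> t))
      = (p * q t powr (p - 1)) * ((?\<zeta> t \<bullet> \<eta>) / sqrt (1 + ?\<zeta> t \<bullet> ?\<zeta> t))" by (simp only: mult.assoc)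
    then show ?thesis unfolding d\<Phi>_def q_def by (simp add: power2_norm_eq_inner)
  qed
  ultimately show ?thesis by simp
qed

lemma d\<Phi>_inner_le:
  assumes p: "1 < p"
  shows "\<bar>d\<Phi> p \<xi> \<bullet> \<eta>\<bar> \<le> p * norm \<xi> powr (p - 1) * norm \<eta>"
proof -
  let ?r = "sqrt (1 + (norm \<xi>)\<^sup>2)"
  have r: "0 < ?r" by (simp add: add_pos_nonneg)
  have nr: "norm \<xi> \<le> ?r" by (intro real_le_rsqrt) simp
  have "(?r - 1) powr (p - 1) \<le> norm \<xi> powr (p - 1)"
    using sqrt_one_plus_bounds[of "norm \<xi>"] p by (intro powr_mono2) auto
  moreover have "norm \<xi> / ?r \<le> 1" using nr r by (simp add: pos_divide_le_eq)
  ultimately have "(?r - 1) powr (p - 1) * (norm \<xi> / ?r) \<le> norm \<xi> powr (p - 1) * 1"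
    using r by (intro mult_mono) auto
  then have "p * ((?r - 1) powr (p - 1) * (norm \<xi> / ?r)) * norm \<eta> \<le> p * norm \<xi> powr (p - 1) * norm \<eta>"
    using p by (intro mult_right_mono mult_left_mono) auto
  moreover have "norm (d\<Phi> p \<xi>) = p * ((?r - 1) powr (p - 1) * (norm \<xi> / ?r))"
    using p r by (simp add: d\<Phi>_def abs_mult)
  ultimately show ?thesis using Cauchy_Schwarz_ineq2[of "d\<Phi> p \<xi>" \<eta>] by simp
qed

lemma \<Phi>_diff_le:
  assumes p: "1 < p" and t: "\<bar>t\<bar> \<le> 1"
  shows "\<bar>\<Phi> p (\<xi> + t *\<^sub>R \<eta>) - \<Phi> p \<xi>\<bar> \<le> \<bar>t\<bar> * (p * (norm \<xi> + norm \<eta>) powr (p - 1) * norm \<eta>)"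
proof -
  have "norm (\<Phi> p (\<xi> + t *\<^sub>R \<eta>) - \<Phi> p (\<xi> + 0 *\<^sub>R \<eta>)) \<le> (p * (norm \<xi> + norm \<eta>) powr (p - 1) * norm \<eta>) * norm (t - 0)"
  proof (rule field_differentiable_bound[where S = "cball 0 \<bar>t\<bar>" and f = "\<lambda>t. \<Phi> p (\<xi> + t *\<^sub>R \<eta>)" and f' = "\<lambda>z. d\<Phi> p (\<xi> + z *\<^sub>R \<eta>) \<bullet> \<eta>"])
    show "((\<lambda>t. \<Phi> p (\<xi> + t *\<^sub>R \<eta>)) has_field_derivative d\<Phi> p (\<xi> + z *\<^sub>R \<eta>) \<bullet> \<eta>) (at z within cball 0 \<bar>t\<bar>)" for z
      using \<Phi>_line_has_derivative[OF p] by (rule has_field_derivative_at_within)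
    show "norm (d\<Phi> p (\<xi> + z *\<^sub>R \<eta>) \<bullet> \<eta>) \<le> p * (norm \<xi> + norm \<eta>) powr (p - 1) * norm \<eta>" if "z \<in> cball 0 \<bar>t\<bar>" for z
    proof -
      have "\<bar>z\<bar> \<le> 1" using that t by simp
      then have "\<bar>z\<bar> * norm \<eta> \<le> 1 * norm \<eta>" by (intro mult_right_mono) auto
      then have "norm (\<xi> + z *\<^sub>R \<eta>) \<le> norm \<xi> + norm \<eta>" using norm_triangle_ineq[of \<xi> "z *\<^sub>R \<eta>"] by simp
      then have "p * norm (\<xi> + z *\<^sub>R \<eta>) powr (p - 1) * norm \<eta> \<le> p * (norm \<xi> + norm \<eta>) powr (p - 1) * norm \<eta>"
        using p by (intro mult_right_mono mult_left_mono powr_mono2) auto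
      then show ?thesis using d\<Phi>_inner_le[OF p, of "\<xi> + z *\<^sub>R \<eta>" \<eta>] by simp
    qed
  qed auto
  then show ?thesis by (simp add: mult.commute)
qed

context dirichlet_problem begin

lemma admissible_zero: "(\<lambda>x. 0) \<in> admissible"
  unfolding admissible_def using test_function_W01p[OF test_functions_zero] by (simp add: primitive_0)

text \<open>On the sublevel set of \<open>J\<close> at height \<open>J(0) + 1\<close> coercivity bounds \<open>u\<close> in \<open>L\<^sup>p\<close>, so (ii)
  bounds \<open>\<integral> F(x, u)\<close> and \<open>\<integral> h u\<close> from above by \<open>K0\<close> in total. This bounds \<open>J\<close> from below, and
  the gradients of a minimising sequence. For a limit \<open>w\<close> of that sequence, \<open>Fatou_upper\<close> is
  applied to \<open>F(x, u\<^sub>n)\<close>; by continuity the upper limit is \<open>F(x, w)\<close>, so this is integrable and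
  \<open>J(w)\<close> is at most the infimum.\<close>

theorem minimiser_exists: "\<exists>u\<in>admissible. \<forall>w\<in>admissible. J u \<le> J w"
proof -
  have p0: "0 \<le> p" "0 < p" using p by auto
  obtain R where R: "\<And>u. u \<in> admissible \<Longrightarrow> J u \<le> J (\<lambda>x. 0) + 1 \<Longrightarrow> en u \<le> R"
    using coercive[of "J (\<lambda>x. 0) + 1"] by blast
  have adm: "u \<in> W0" "integrable M (\<lambda>x. F x (u x))" if "u \<in> admissible" for u
    using that by (auto simp: admissible_def)
  define K0 where "K0 = A * R + (\<integral>x. B x \<partial>M) + (H0 + R)"
  have I\<Phi>_le: "I\<Phi> (\<nabla> u) \<le> J u + K0" if u: "u \<in> admissible" "J u \<le> J (\<lambda>x. 0) + 1" for u
  proof -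
    note uD = W01pD[OF adm(1)[OF u(1)]]
    have "(\<integral>x. F x (u x) \<partial>M) \<le> A * en u + (\<integral>x. B x \<partial>M)"
      by (rule F_le_integral[OF uD(2) adm(2)[OF u(1)]])
    moreover have "A * en u \<le> A * R" using A R[OF u] by (intro mult_left_mono)
    moreover have "(\<integral>x. h x * u x \<partial>M) \<le> H0 + en u" using h_mult_integrable(2)[OF uD(2)] by linarith
    ultimately show ?thesis using R[OF u] by (simp add: J_def K0_def)
  qed
  have bdd: "bdd_below (J ` admissible)"
  proof (rule bdd_belowI)
    fix y assume "y \<in> J ` admissible"
    then obtain u where u: "u \<in> admissible" "y = J u" by blast
    show "min (J (\<lambda>x. 0)) (- K0) \<le> y"
    proof (cases "J u \<le> J (\<lambda>x. 0) + 1")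
      case True
      then show ?thesis using I\<Phi>_le[OF u(1) True] I\<Phi>_nonneg[of "\<nabla> u"] u(2) by linarith
    next
      case False
      then show ?thesis using u(2) by linarith
    qed
  qed
  define m where "m = Inf (J ` admissible)"
  have m_le: "m \<le> J w" if "w \<in> admissible" for w unfolding m_def using bdd that by (intro cInf_lower) auto
  have "\<forall>n::nat. \<exists>u. u \<in> admissible \<and> J u < m + 1 / real (Suc n)"
  proof
    fix n :: nat
    have "Inf (J ` admissible) < m + 1 / real (Suc n)" by (simp add: m_def)
    then show "\<exists>u. u \<in> admissible \<and> J u < m + 1 / real (Suc n)"
      using cInf_lessD[of "J ` admissible" "m + 1 / real (Suc n)"] admissible_zero by auto
  qed
  then have "\<exists>u. \<forall>n::nat. u n \<in> admissible \<and> J (u n) < m + 1 / real (Suc n)" by (rule choice)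
  then obtain u where u': "\<forall>n::nat. u n \<in> admissible \<and> J (u n) < m + 1 / real (Suc n)" ..
  have u: "u n \<in> admissible" "J (u n) < m + 1 / real (Suc n)" for n using u' by auto
  have inv1: "1 / real (Suc n) \<le> 1" for n by simp
  have uC: "J (u n) \<le> J (\<lambda>x. 0) + 1" "J (u n) \<le> m + 1" for n
    using u(2)[of n] m_le[OF admissible_zero] inv1[of n] by linarith+
  note uW = adm(1)[OF u(1)] and uF = adm(2)[OF u(1)]
  note uD = W01pD[OF uW]
  define K where "K = max R (2 powr p * (m + 1 + K0 + measure M (space M)))"
  have K1: "en (u n) \<le> K" for n unfolding K_def by (intro max.coboundedI1 R[OF u(1) uC(1)])
  have K2: "en (\<nabla> (u n)) \<le> K" for n
  proof -
    have "I\<Phi> (\<nabla> (u n)) \<le> m + 1 + K0" using I\<Phi>_le[OF u(1) uC(1), of n] uC(2)[of n] by linarith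
    then have "2 powr p * (I\<Phi> (\<nabla> (u n)) + measure M (space M)) \<le> 2 powr p * (m + 1 + K0 + measure M (space M))"
      by (intro mult_left_mono) auto
    with energy_le_I\<Phi>[OF uD(4)[of n]]
    have "en (\<nabla> (u n)) \<le> 2 powr p * (m + 1 + K0 + measure M (space M))" by (rule order_trans)
    then show ?thesis unfolding K_def by (rule max.coboundedI2)
  qed
  obtain r w g c where r: "strict_mono (r :: nat \<Rightarrow> nat)" and w: "w \<in> W0" and g: "in_Lp (g :: 'a \<Rightarrow> real)"
    and conv: "AE x in M. (\<lambda>n. u (r n) x) \<longlonglongrightarrow> w x" and dom: "AE x in M. \<forall>n. norm (u (r n) x) \<le> g x"
    and c: "(\<lambda>n. I\<Phi> (\<nabla> (u (r n)))) \<longlonglongrightarrow> c" "I\<Phi> (\<nabla> w) \<le> c"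
    using W01p_compactness[of u K, OF uW K1 K2] by blast
  note wD = W01pD[OF w]
  have h_lim: "(\<lambda>n. \<integral>x. h x * u (r n) x \<partial>M) \<longlonglongrightarrow> (\<integral>x. h x * w x \<partial>M)"
  proof (rule integral_dominated_convergence)
    show "integrable M (\<lambda>x. \<bar>h x\<bar> powr (p / (p - 1)) + \<bar>g x\<bar> powr p)"
      using h g by (simp add: p_integrable_def)
    show "AE x in M. (\<lambda>n. h x * u (r n) x) \<longlonglongrightarrow> h x * w x"
      using conv by eventually_elim (intro tendsto_mult tendsto_const)
    show "AE x in M. norm (h x * u (r n) x) \<le> \<bar>h x\<bar> powr (p / (p - 1)) + \<bar>g x\<bar> powr p" for n
      using dom
    proof eventually_elim
      case (elim x)
      have "\<bar>u (r n) x\<bar> powr p \<le> \<bar>g x\<bar> powr p" using elim[rule_format, of n] p0 by (intro powr_mono2) auto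
      then show ?case using h_mult_le[of x "u (r n) x"] by simp
    qed
  qed (use h_mult_integrable(1)[OF uD(2)] h_mult_integrable(1)[OF wD(2)] in auto)
  have J_lim: "(\<lambda>n. J (u (r n))) \<longlonglongrightarrow> m"
  proof (rule tendsto_sandwich[where f = "\<lambda>_. m" and h = "\<lambda>n. m + 1 / real (Suc (r n))"])
    show "\<forall>\<^sub>F n in sequentially. m \<le> J (u (r n))" using m_le[OF u(1)] by (intro always_eventually allI)
    show "\<forall>\<^sub>F n in sequentially. J (u (r n)) \<le> m + 1 / real (Suc (r n))"
      using u(2) by (intro always_eventually allI less_imp_le)
    have "(\<lambda>n. 1 / real (Suc n)) \<longlonglongrightarrow> 0" using LIMSEQ_inverse_real_of_nat by (simp add: inverse_eq_divide)
    from tendsto_add[OF tendsto_const LIMSEQ_subseq_LIMSEQ[OF this r], of m]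
    show "(\<lambda>n. m + 1 / real (Suc (r n))) \<longlonglongrightarrow> m" by (simp add: o_def)
  qed auto
  define D where "D x = A * \<bar>g x\<bar> powr p + B x" for x
  have D_int: "integrable M D" unfolding D_def using g B(1) by (auto simp: p_integrable_def)
  have GD: "AE x in M. F x (u (r n) x) \<le> D x" for n
    using upper dom
  proof eventually_elim
    case (elim x)
    have "\<bar>u (r n) x\<bar> powr p \<le> \<bar>g x\<bar> powr p" using elim(2)[rule_format, of n] p0 by (intro powr_mono2) auto
    then have "A * \<bar>u (r n) x\<bar> powr p \<le> A * \<bar>g x\<bar> powr p" using A by (intro mult_left_mono)
    then show ?case using elim(1)[rule_format, of "u (r n) x"] by (simp add: D_def)
  qed
  let ?s = "\<lambda>n. I\<Phi> (\<nabla> (u (r n))) - (\<integral>x. h x * u (r n) x \<partial>M) - J (u (r n))"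
  have s_le: "?s n \<le> (\<integral>x. F x (u (r n) x) \<partial>M)" for n by (simp add: J_def)
  have s_lim: "?s \<longlonglongrightarrow> c - (\<integral>x. h x * w x \<partial>M) - m" by (intro tendsto_diff c(1) h_lim J_lim)
  obtain H where H: "integrable M H" "c - (\<integral>x. h x * w x \<partial>M) - m \<le> (\<integral>x. H x \<partial>M)"
    and HP: "AE x in M. H x \<le> D x \<and> ennreal (D x - H x) = liminf (\<lambda>n. ennreal (D x - F x (u (r n) x)))"
    using Fatou_upper[of M "\<lambda>n x. F x (u (r n) x)" D, OF uF D_int GD s_le s_lim] by blast
  have AE_GD: "AE x in M. \<forall>n. F x (u (r n) x) \<le> D x" using GD by (simp add: AE_all_countable)
  \<comment> \<open>At points of convergence the upper limit is a limit, by continuity of \<open>F\<close>.\<close>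
  have HF: "AE x in M. H x = F x (w x)"
    using HP conv F_cont AE_GD
  proof eventually_elim
    case (elim x)
    have "isCont (F x) (w x)" using elim(3) by (simp add: continuous_on_eq_continuous_at)
    then have lim: "(\<lambda>n. F x (u (r n) x)) \<longlonglongrightarrow> F x (w x)" by (rule isCont_tendsto_compose[OF _ elim(2)])
    have "F x (w x) \<le> D x" by (rule LIMSEQ_le_const2[OF lim]) (use elim(4) in auto)
    moreover have "liminf (\<lambda>n. ennreal (D x - F x (u (r n) x))) = ennreal (D x - F x (w x))"
      by (intro lim_imp_Liminf tendsto_ennrealI tendsto_diff tendsto_const lim) auto
    ultimately show ?case using elim(1) ennreal_inj[of "D x - H x" "D x - F x (w x)"] by auto
  qed
  have wm: "(\<lambda>x. F x (w x)) \<in> borel_measurable M"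
    using wD(2) by (intro F_compose_measurable) (simp add: p_integrable_def)
  have Hm: "H \<in> borel_measurable M" using H(1) by auto
  have Fw: "integrable M (\<lambda>x. F x (w x))" using H(1) integrable_cong_AE[OF Hm wm HF] by simp
  have "(\<integral>x. H x \<partial>M) = (\<integral>x. F x (w x) \<partial>M)" by (rule integral_cong_AE[OF Hm wm HF])
  then have "J w \<le> m" using H(2) c(2) by (simp add: J_def)
  moreover have "w \<in> admissible" using w Fw by (simp add: admissible_def)
  ultimately show ?thesis using m_le order_trans by blast
qed

lemma q_nonneg: "0 \<le> q"
  using p dim by (simp add: q)

text \<open>The reason why the critical exponent is allowed in (i): \<open>u\<close> lies in \<open>L\<^sup>q\<close> by the Sobolev
  inequality, and adding a constant does not matter on a bounded set.\<close>

lemma growth_majorant_integrable: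
  assumes u: "u \<in> W0" and C: "0 \<le> C"
  shows "integrable M (\<lambda>x. C * (a * (\<bar>u x\<bar> + C) powr q + b x))"
proof -
  note q0 = q_nonneg
  interpret finite_measure M by (rule finite_M)
  have um [measurable]: "u \<in> borel_measurable M" using W01pD(2)[OF u] by (simp add: p_integrable_def)
  have "integrable M (\<lambda>x. (\<bar>u x\<bar> + C) powr q)"
  proof (rule Bochner_Integration.integrable_bound)
    show "integrable M (\<lambda>x. 2 powr q * (\<bar>u x\<bar> powr q + C powr q))"
      using Sobolev_integrable[OF u dim] unfolding q[symmetric] by auto
    show "(\<lambda>x. (\<bar>u x\<bar> + C) powr q) \<in> borel_measurable M" by measurable
    show "AE x in M. norm ((\<bar>u x\<bar> + C) powr q) \<le> norm (2 powr q * (\<bar>u x\<bar> powr q + C powr q))"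
    proof (rule AE_I2)
      fix x
      show "norm ((\<bar>u x\<bar> + C) powr q) \<le> norm (2 powr q * (\<bar>u x\<bar> powr q + C powr q))"
        using powr_add_le[of "\<bar>u x\<bar>" C q] C q0 by simp
    qed
  qed
  then show ?thesis using b by auto
qed

lemma f_test_integrable:
  assumes u: "u \<in> W0" and v: "v \<in> tests"
  shows "integrable M (\<lambda>x. f x (u x) * v x)"
proof -
  note q0 = q_nonneg
  obtain C where C: "0 < C" "\<And>x. \<bar>v x\<bar> \<le> C" using test_function_bounded[OF v] by auto
  have um: "u \<in> borel_measurable M" using W01pD(2)[OF u] by (simp add: p_integrable_def)
  have vm: "v \<in> borel_measurable M" using test_function_p_integrable(1)[OF v] by (simp add: p_integrable_def)
  show ?thesis
  proof (rule Bochner_Integration.integrable_bound[OF growth_majorant_integrable[OF u less_imp_le[OF C(1)]]])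
    show "(\<lambda>x. f x (u x) * v x) \<in> borel_measurable M"
      by (intro borel_measurable_times f_compose_measurable um vm)
    show "AE x in M. norm (f x (u x) * v x) \<le> norm (C * (a * (\<bar>u x\<bar> + C) powr q + b x))"
      using growth
    proof eventually_elim
      case (elim x)
      have "\<bar>f x (u x)\<bar> \<le> a * \<bar>u x\<bar> powr q + b x" using elim by blast
      also have "\<dots> \<le> a * (\<bar>u x\<bar> + C) powr q + b x" using C a q0 by (intro add_right_mono mult_left_mono powr_mono2) auto
      finally have "\<bar>f x (u x)\<bar> * \<bar>v x\<bar> \<le> (a * (\<bar>u x\<bar> + C) powr q + b x) * C"
        using C by (intro mult_mono) auto
      then have "norm (f x (u x) * v x) \<le> C * (a * (\<bar>u x\<bar> + C) powr q + b x)" by (simp add: abs_mult mult.commute)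
      also have "\<dots> \<le> norm (C * (a * (\<bar>u x\<bar> + C) powr q + b x))" by simp
      finally show ?case .
    qed
  qed
qed

text \<open>The mean value theorem with the bound (i) for the derivative. A bounded perturbation keeps
  the power \<open>q\<close> of \<open>u\<close>, although \<open>F\<close> itself may grow with the power \<open>q + 1\<close>.\<close>

lemma F_perturbation_le:
  assumes v: "\<And>x. \<bar>v x\<bar> \<le> C" and t: "\<bar>t\<bar> \<le> 1"
  shows "AE x in M. \<bar>F x (u x + t * v x) - F x (u x)\<bar> \<le> \<bar>t\<bar> * (C * (a * (\<bar>u x\<bar> + C) powr q + b x))"
  using growth f_cont
proof eventually_elim
  case (elim x)
  note q0 = q_nonneg
  have tv: "\<bar>t * v x\<bar> \<le> \<bar>t\<bar> * C" using v[of x] by (simp add: abs_mult mult_left_mono)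
  have C0: "0 \<le> C" using v[of x] by linarith
  have tC: "\<bar>t\<bar> * C \<le> 1 * C" using t C0 by (intro mult_right_mono)
  have "\<bar>F x (u x + t * v x) - F x (u x)\<bar> \<le> \<bar>t * v x\<bar> * (a * (\<bar>u x\<bar> + \<bar>t * v x\<bar>) powr q + b x)"
    by (rule primitive_diff_le[where f = f and x = x, OF elim(2)]) (use elim(1) a q0 in auto)
  also have "\<dots> \<le> (\<bar>t\<bar> * C) * (a * (\<bar>u x\<bar> + C) powr q + b x)"
  proof (rule mult_mono[OF tv])
    show "a * (\<bar>u x\<bar> + \<bar>t * v x\<bar>) powr q + b x \<le> a * (\<bar>u x\<bar> + C) powr q + b x"
      using tv tC a q0 by (intro add_right_mono mult_left_mono powr_mono2) auto
    have "\<bar>f x (\<bar>u x\<bar> + \<bar>t * v x\<bar>)\<bar> \<le> a * \<bar>\<bar>u x\<bar> + \<bar>t * v x\<bar>\<bar> powr q + b x" using elim(1) by blast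
    then show "0 \<le> a * (\<bar>u x\<bar> + \<bar>t * v x\<bar>) powr q + b x" by simp
    show "0 \<le> \<bar>t\<bar> * C" using C0 by simp
  qed
  finally show ?case by (simp only: mult.assoc)
qed

lemma admissible_perturbation:
  assumes u: "u \<in> admissible" and v: "v \<in> tests" and t: "\<bar>t\<bar> \<le> 1"
  shows "(\<lambda>x. 1 * u x + t * v x) \<in> admissible"
proof -
  have uW: "u \<in> W0" and uF: "integrable M (\<lambda>x. F x (u x))" using u by (auto simp: admissible_def)
  obtain C where C: "0 < C" "\<And>x. \<bar>v x\<bar> \<le> C" using test_function_bounded[OF v] by auto
  have w: "(\<lambda>x. 1 * u x + t * v x) \<in> W0" by (rule W01p_linear_combination(1)[OF uW test_function_W01p[OF v]])
  have wm: "(\<lambda>x. u x + t * v x) \<in> borel_measurable M" using W01pD(2)[OF w] by (simp add: p_integrable_def)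
  have um: "u \<in> borel_measurable M" using W01pD(2)[OF uW] by (simp add: p_integrable_def)
  have "integrable M (\<lambda>x. F x (u x + t * v x) - F x (u x))"
  proof (rule Bochner_Integration.integrable_bound[OF integrable_mult_right[OF growth_majorant_integrable[OF uW less_imp_le[OF C(1)]], of "\<bar>t\<bar>"]])
    show "(\<lambda>x. F x (u x + t * v x) - F x (u x)) \<in> borel_measurable M"
      by (intro borel_measurable_diff F_compose_measurable um wm)
    show "AE x in M. norm (F x (u x + t * v x) - F x (u x)) \<le> norm (\<bar>t\<bar> * (C * (a * (\<bar>u x\<bar> + C) powr q + b x)))"
      using F_perturbation_le[of v C t u, OF C(2) t] by eventually_elim simp
  qed
  from Bochner_Integration.integrable_add[OF this uF]
  have "integrable M (\<lambda>x. F x (1 * u x + t * v x))" by simp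
  with w show ?thesis by (simp add: admissible_def)
qed

text \<open>Dominated convergence for the difference quotients of the two nonlinear terms. The
  majorants are \<open>|\<nabla> u|\<^sup>p\<close> plus constants for the first one and \<open>growth_majorant_integrable\<close> for
  the second one. The perturbed function is written with the factor 1 to match
  \<open>W01p_linear_combination\<close>.\<close>

lemma J_directional_derivative:
  assumes u: "u \<in> admissible" and v: "v \<in> tests"
    and t: "t \<longlonglongrightarrow> 0" "\<And>n. t n \<noteq> 0" "\<And>n. \<bar>t n\<bar> \<le> 1"
  shows "(\<lambda>n. (J (\<lambda>x. 1 * u x + t n * v x) - J u) / t n) \<longlonglongrightarrow>
    (\<integral>x. d\<Phi> p (\<nabla> u x) \<bullet> grad v x \<partial>M) - (\<integral>x. f x (u x) * v x \<partial>M) - (\<integral>x. h x * v x \<partial>M)"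
proof -
  have uW: "u \<in> W0" and uF: "integrable M (\<lambda>x. F x (u x))" using u by (auto simp: admissible_def)
  note uD = W01pD[OF uW] and vW = test_function_W01p[OF v] and vi = test_function_p_integrable[OF v]
  have p0: "0 \<le> p" "0 < p" using p by auto
  obtain C where C: "0 < C" "\<And>x. \<bar>v x\<bar> \<le> C" "\<And>x. norm (grad v x) \<le> C" using test_function_bounded[OF v] by auto
  let ?w = "\<lambda>n x. 1 * u x + t n * v x"
  let ?G = "\<nabla> u" and ?\<eta> = "grad v"
  note w = admissible_perturbation[OF u v t(3)]
  have wW: "?w n \<in> W0" and wF: "integrable M (\<lambda>x. F x (?w n x))" for n using w[of n] by (auto simp: admissible_def)
  have um: "u \<in> borel_measurable M" and vm: "v \<in> borel_measurable M"
    and Gm: "?G \<in> borel_measurable M" and \<eta>m: "?\<eta> \<in> borel_measurable M"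
    using uD vi by (auto simp: p_integrable_def)
  have wm: "(\<lambda>x. u x + t n * v x) \<in> borel_measurable M" for n
    using um vm by (intro borel_measurable_add borel_measurable_times) auto
  have gi: "in_Lp (\<lambda>x. ?G x + t n *\<^sub>R ?\<eta> x)" for n
    using p0 by (intro p_integrable_add p_integrable_scaleR uD vi)
  have I\<Phi>_w: "I\<Phi> (\<nabla> (?w n)) = I\<Phi> (\<lambda>x. ?G x + t n *\<^sub>R ?\<eta> x)" for n
  proof (rule I\<Phi>_cong_AE[OF W01pD(4)[OF wW] gi])
    show "AE x in M. \<nabla> (?w n) x = ?G x + t n *\<^sub>R ?\<eta> x"
      using W01p_linear_combination(2)[OF uW vW, of 1 "t n"] test_function_W1p(2)[OF v] by eventually_elim simp
  qed
  have quot: "(J (?w n) - J u) / t n = (\<integral>x. (\<Phi> p (?G x + t n *\<^sub>R ?\<eta> x) - \<Phi> p (?G x)) / t n \<partial>M)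
      - (\<integral>x. (F x (u x + t n * v x) - F x (u x)) / t n \<partial>M) - (\<integral>x. h x * v x \<partial>M)" for n
  proof -
    have i1: "(\<integral>x. (\<Phi> p (?G x + t n *\<^sub>R ?\<eta> x) - \<Phi> p (?G x)) / t n \<partial>M) = (I\<Phi> (\<lambda>x. ?G x + t n *\<^sub>R ?\<eta> x) - I\<Phi> ?G) / t n"
      unfolding I\<Phi>_def using integrable_\<Phi>[OF gi] integrable_\<Phi>[OF uD(4)] by simp
    have i2: "(\<integral>x. (F x (u x + t n * v x) - F x (u x)) / t n \<partial>M) = ((\<integral>x. F x (?w n x) \<partial>M) - (\<integral>x. F x (u x) \<partial>M)) / t n"
      using wF[of n] uF by simp
    have i3: "(\<integral>x. h x * ?w n x \<partial>M) = (\<integral>x. h x * u x \<partial>M) + t n * (\<integral>x. h x * v x \<partial>M)"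
    proof -
      have "(\<integral>x. h x * ?w n x \<partial>M) = (\<integral>x. h x * u x + t n * (h x * v x) \<partial>M)"
        by (intro Bochner_Integration.integral_cong) (auto simp: algebra_simps)
      then show ?thesis using h_mult_integrable(1)[OF uD(2)] h_mult_integrable(1)[OF vi(1)] by simp
    qed
    have "J (?w n) - J u = (I\<Phi> (\<lambda>x. ?G x + t n *\<^sub>R ?\<eta> x) - I\<Phi> ?G) - ((\<integral>x. F x (?w n x) \<partial>M) - (\<integral>x. F x (u x) \<partial>M)) - t n * (\<integral>x. h x * v x \<partial>M)"
      unfolding J_def I\<Phi>_w i3 by simp
    then show ?thesis unfolding i1 i2 using t(2)[of n] by (simp add: diff_divide_distrib)
  qed
  have l1: "(\<lambda>n. \<integral>x. (\<Phi> p (?G x + t n *\<^sub>R ?\<eta> x) - \<Phi> p (?G x)) / t n \<partial>M) \<longlonglongrightarrow> (\<integral>x. d\<Phi> p (?G x) \<bullet> ?\<eta> x \<partial>M)"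
  proof (rule integral_dominated_convergence)
    let ?D = "\<lambda>x. p * C * (1 + 2 powr p * (norm (?G x) powr p + C powr p))"
    interpret finite_measure M by (rule finite_M)
    show "integrable M ?D" using uD(4) by (auto simp: p_integrable_def)
    show "AE x in M. (\<lambda>n. (\<Phi> p (?G x + t n *\<^sub>R ?\<eta> x) - \<Phi> p (?G x)) / t n) \<longlonglongrightarrow> d\<Phi> p (?G x) \<bullet> ?\<eta> x"
    proof (rule AE_I2)
      fix x
      have "((\<lambda>s. (\<Phi> p (?G x + s *\<^sub>R ?\<eta> x) - \<Phi> p (?G x)) / s) \<longlongrightarrow> d\<Phi> p (?G x) \<bullet> ?\<eta> x) (at 0)"
        using \<Phi>_line_has_derivative[OF p, of "?G x" "?\<eta> x" 0] by (simp add: has_field_derivative_iff)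
      moreover have "filterlim t (at 0) sequentially" using t(1,2) by (simp add: filterlim_at)
      ultimately show "(\<lambda>n. (\<Phi> p (?G x + t n *\<^sub>R ?\<eta> x) - \<Phi> p (?G x)) / t n) \<longlonglongrightarrow> d\<Phi> p (?G x) \<bullet> ?\<eta> x"
        by (rule filterlim_compose)
    qed
    show "AE x in M. norm ((\<Phi> p (?G x + t n *\<^sub>R ?\<eta> x) - \<Phi> p (?G x)) / t n) \<le> ?D x" for n
    proof (rule AE_I2)
      fix x
      let ?y = "norm (?G x) + norm (?\<eta> x)"
      have "\<bar>\<Phi> p (?G x + t n *\<^sub>R ?\<eta> x) - \<Phi> p (?G x)\<bar> \<le> \<bar>t n\<bar> * (p * ?y powr (p - 1) * norm (?\<eta> x))"
        by (rule \<Phi>_diff_le[OF p t(3)])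
      then have "\<bar>\<Phi> p (?G x + t n *\<^sub>R ?\<eta> x) - \<Phi> p (?G x)\<bar> / \<bar>t n\<bar> \<le> p * ?y powr (p - 1) * norm (?\<eta> x)"
        using t(2)[of n] by (simp add: pos_divide_le_eq mult.commute)
      also have "\<dots> \<le> p * (1 + 2 powr p * (norm (?G x) powr p + C powr p)) * C"
      proof (intro mult_mono mult_left_mono)
        have "?y powr (p - 1) \<le> 1 + ?y powr p"
        proof (cases "?y \<le> 1")
          case True
          then have "?y powr (p - 1) \<le> 1 powr (p - 1)" using p by (intro powr_mono2) auto
          then show ?thesis by (simp add: add_increasing2)
        next
          case False
          then have "?y powr (p - 1) \<le> ?y powr p" by (intro powr_mono) auto
          then show ?thesis by simp
        qed
        also have "?y powr p \<le> (norm (?G x) + C) powr p" using C(3)[of x] p by (intro powr_mono2) auto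
        also have "\<dots> \<le> 2 powr p * (norm (?G x) powr p + C powr p)" using C(1) p by (intro powr_add_le) auto
        finally show "?y powr (p - 1) \<le> 1 + 2 powr p * (norm (?G x) powr p + C powr p)" by simp
      qed (use C(3)[of x] C(1) p in auto)
      finally show "norm ((\<Phi> p (?G x + t n *\<^sub>R ?\<eta> x) - \<Phi> p (?G x)) / t n) \<le> ?D x"
        by (simp add: abs_divide mult_ac)
    qed
    show "(\<lambda>x. (\<Phi> p (?G x + t n *\<^sub>R ?\<eta> x) - \<Phi> p (?G x)) / t n) \<in> borel_measurable M" for n
      using integrable_\<Phi>[OF gi] integrable_\<Phi>[OF uD(4)] by (intro borel_measurable_divide borel_measurable_diff) auto
    note [measurable] = Gm \<eta>m
    show "(\<lambda>x. d\<Phi> p (?G x) \<bullet> ?\<eta> x) \<in> borel_measurable M" unfolding d\<Phi>_def by measurable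
  qed
  have l2: "(\<lambda>n. \<integral>x. (F x (u x + t n * v x) - F x (u x)) / t n \<partial>M) \<longlonglongrightarrow> (\<integral>x. f x (u x) * v x \<partial>M)"
  proof (rule integral_dominated_convergence[OF _ _ growth_majorant_integrable[OF uW less_imp_le[OF C(1)]]])
    show "AE x in M. (\<lambda>n. (F x (u x + t n * v x) - F x (u x)) / t n) \<longlonglongrightarrow> f x (u x) * v x"
      using f_cont
    proof eventually_elim
      case (elim x)
      have "((\<lambda>s. F x (u x + s * v x)) has_real_derivative f x (u x + 0 * v x) * v x) (at 0)"
        by (rule DERIV_chain2[OF primitive_has_derivative[where f = f and x = x, OF elim]]) (auto intro!: derivative_eq_intros)
      then have "((\<lambda>s. (F x (u x + s * v x) - F x (u x)) / s) \<longlongrightarrow> f x (u x) * v x) (at 0)"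
        by (simp add: has_field_derivative_iff)
      moreover have "filterlim t (at 0) sequentially" using t(1,2) by (simp add: filterlim_at)
      ultimately show ?case by (rule filterlim_compose)
    qed
    show "AE x in M. norm ((F x (u x + t n * v x) - F x (u x)) / t n) \<le> C * (a * (\<bar>u x\<bar> + C) powr q + b x)" for n
      using F_perturbation_le[of v C "t n" u, OF C(2) t(3)]
    proof eventually_elim
      case (elim x)
      then show ?case using t(2)[of n] by (simp add: abs_divide pos_divide_le_eq mult.commute)
    qed
    show "(\<lambda>x. (F x (u x + t n * v x) - F x (u x)) / t n) \<in> borel_measurable M" for n
      by (intro borel_measurable_divide borel_measurable_diff F_compose_measurable um wm borel_measurable_const)
    show "(\<lambda>x. f x (u x) * v x) \<in> borel_measurable M"
      by (intro borel_measurable_times f_compose_measurable um vm)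
  qed
  show ?thesis unfolding quot by (intro tendsto_diff l1 l2 tendsto_const)
qed

text \<open>At a minimum the difference quotients are nonnegative for positive steps and nonpositive
  for negative steps.\<close>

theorem Euler_equation:
  assumes u: "u \<in> admissible" and min: "\<And>w. w \<in> admissible \<Longrightarrow> J u \<le> J w" and v: "v \<in> tests"
  shows "(\<integral>x. d\<Phi> p (\<nabla> u x) \<bullet> grad v x \<partial>M) = (\<integral>x. f x (u x) * v x \<partial>M) + (\<integral>x. h x * v x \<partial>M)"
proof -
  let ?L = "(\<integral>x. d\<Phi> p (\<nabla> u x) \<bullet> grad v x \<partial>M) - (\<integral>x. f x (u x) * v x \<partial>M) - (\<integral>x. h x * v x \<partial>M)"
  define t where "t n = 1 / real (Suc n)" for n
  have t: "t \<longlonglongrightarrow> 0" "0 < t n" "t n \<le> 1" for n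
    using LIMSEQ_inverse_real_of_nat by (auto simp: t_def[abs_def] inverse_eq_divide)
  have ge: "J u \<le> J (\<lambda>x. 1 * u x + s * v x)" if "\<bar>s\<bar> \<le> 1" for s
    by (intro min admissible_perturbation[OF u v that])
  have "0 \<le> ?L"
  proof (rule LIMSEQ_le_const)
    show "(\<lambda>n. (J (\<lambda>x. 1 * u x + t n * v x) - J u) / t n) \<longlonglongrightarrow> ?L"
      by (rule J_directional_derivative[OF u v t(1)]) (use t(2,3) in \<open>auto simp: less_imp_neq[symmetric] abs_le_iff less_imp_le minus_le_iff intro: order_trans[of _ 0]\<close>)
    show "\<exists>N. \<forall>n\<ge>N. 0 \<le> (J (\<lambda>x. 1 * u x + t n * v x) - J u) / t n"
      using ge t(2,3) by (intro exI allI impI divide_nonneg_pos) (auto simp: abs_of_pos)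
  qed
  moreover have "?L \<le> 0"
  proof (rule LIMSEQ_le_const2)
    show "(\<lambda>n. (J (\<lambda>x. 1 * u x + (- t n) * v x) - J u) / (- t n)) \<longlonglongrightarrow> ?L"
    proof (rule J_directional_derivative[OF u v])
      show "(\<lambda>n. - t n) \<longlonglongrightarrow> 0" using tendsto_minus[OF t(1)] by simp
      show "- t n \<noteq> 0" "\<bar>- t n\<bar> \<le> 1" for n using t(2,3)[of n] by auto
    qed
    show "\<exists>N. \<forall>n\<ge>N. (J (\<lambda>x. 1 * u x + (- t n) * v x) - J u) / (- t n) \<le> 0"
    proof (intro exI allI impI)
      fix n
      have "0 \<le> J (\<lambda>x. 1 * u x + (- t n) * v x) - J u" using ge[of "- t n"] t(2,3)[of n] by auto
      then show "(J (\<lambda>x. 1 * u x + (- t n) * v x) - J u) / (- t n) \<le> 0"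
        using t(2)[of n] by (intro divide_nonneg_neg) auto
    qed
  qed
  ultimately show ?thesis by linarith
qed

theorem solution_exists: "\<exists>u. distributional_solution \<Omega> p f h u"
proof -
  obtain u where u: "u \<in> admissible" and min: "\<And>w. w \<in> admissible \<Longrightarrow> J u \<le> J w"
    using minimiser_exists by blast
  have uW: "u \<in> W0" using u by (simp add: admissible_def)
  have "distributional_solution \<Omega> p f h u"
    unfolding distributional_solution_def
  proof (intro conjI ballI uW f_test_integrable)
    fix v assume v: "v \<in> tests"
    show "(\<integral>x. p * ((sqrt (1 + (norm (\<nabla> u x))\<^sup>2) - 1) powr (p - 1)
                    / sqrt (1 + (norm (\<nabla> u x))\<^sup>2))
                * (\<nabla> u x \<bullet> grad v x) \<partial>M)
        = (\<integral>x. f x (u x) * v x \<partial>M) + (\<integral>x. h x * v x \<partial>M)"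
      using Euler_equation[OF u min v] by (simp only: d\<Phi>_def inner_scaleR_left)
  qed
  then show ?thesis by blast
qed

end

theorem theorem2p3:
  fixes \<Omega> :: "'a::euclidean_space set"
    and \<gamma> a A :: real
    and f :: "'a \<Rightarrow> real \<Rightarrow> real"
    and b B :: "'a \<Rightarrow> real"
  assumes "bounded_smooth_domain \<Omega>"
    and "1 < \<gamma>" and "\<gamma> < real DIM('a)"
    and "caratheodory \<Omega> f"
    and "0 \<le> a" and "b \<in> Lp \<Omega> 1" and "AE x in lebesgue_on \<Omega>. 0 \<le> b x"
    and "AE x in lebesgue_on \<Omega>. \<forall>s.
           \<bar>f x s\<bar> \<le> a * \<bar>s\<bar> powr (real DIM('a) * \<gamma> / (real DIM('a) - \<gamma>)) + b x"
    and "0 \<le> A" and "B \<in> Lp \<Omega> 1" and "AE x in lebesgue_on \<Omega>. 0 \<le> B x"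
    and "AE x in lebesgue_on \<Omega>. \<forall>s. primitive f x s \<le> A * \<bar>s\<bar> powr \<gamma> + B x"
    and "0 < (INF v\<in>{v \<in> W01p \<Omega> \<gamma>. Lp_norm \<Omega> \<gamma> v = 1}. asymptotic_functional \<Omega> \<gamma> f v)"
  shows "\<forall>h\<in>Lp \<Omega> (\<gamma> / (\<gamma> - 1)). \<exists>u. distributional_solution \<Omega> \<gamma> f h u"
proof
  fix h :: "'a \<Rightarrow> real" assume h: "h \<in> Lp \<Omega> (\<gamma> / (\<gamma> - 1))"
  have L1: "integrable (lebesgue_on \<Omega>) g" if "g \<in> Lp \<Omega> 1" for g :: "'a \<Rightarrow> real"
    using that integrable_norm_iff[of g "lebesgue_on \<Omega>"] by (simp add: Lp_def)
  interpret dirichlet_problem \<Omega> \<gamma> f a A b B h "real DIM('a) * \<gamma> / (real DIM('a) - \<gamma>)"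
  proof
    show "open \<Omega>" "bounded \<Omega>" using assms(1) by (auto simp: bounded_smooth_domain_def)
    show "integrable (lebesgue_on \<Omega>) b" "integrable (lebesgue_on \<Omega>) B" using L1 assms(6,10) by auto
    show "0 < asymptotic_functional \<Omega> \<gamma> f v" if "v \<in> W01p \<Omega> \<gamma>" "Lp_norm \<Omega> \<gamma> v = 1" for v
      using assms(13) that by (intro less_le_trans[OF assms(13)] INF_lower) auto
    show "p_integrable (lebesgue_on \<Omega>) (\<gamma> / (\<gamma> - 1)) h" using h by (simp add: Lp_iff_p_integrable)
  qed (use assms in auto)
  show "\<exists>u. distributional_solution \<Omega> \<gamma> f h u" by (rule solution_exists)
qed

end
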